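(* The rule $$W\longleftrightarrow\mathcal J\iff \mathcal J=\mathcal F(W^0)$$ defines a one-to-one correspondence between the set of all $D$-invariant subspaces $W\subset\mathcal U_a$ and the set of all (closed) submodules $\mathcal J\subset\mathcal P_a$. In addition, if $\mathcal J=\mathcal F(W^0)$ then $\Lambda_W=\mathcal Z_{\mathcal J}$.
   Context: Weight. $\omega:[0,\infty)\to[0,\infty)$ is a non-decreasing continuous function such that: $\varphi_\omega(t):=\omega(e^t)$ is convex on $[0,\infty)$; $\omega(x)=o(x)$ and $\ln x=o(\omega(x))$ as $x\to\infty$; for every $\sigma>1$ there is $C>0$ with $\omega(x+y)\le\sigma(\omega(x)+\omega(y))+C$ for all $x,y\ge0$; $\int_1^\infty \omega(x)x^{-2}\,dx<\infty$. Fix $0<a\le+\infty$ and sequences $0<c_k\nearrow a$ with $c_k<a$, and $0<r_k\nearrow1$ with $r_k<1$. Ultradifferentiable functions. Put $\varphi_\omega^*(s)=\sup_{t\ge0}(st-\varphi_\omega(t))$ and, for $f\in C^\infty(-a,a)$, $q\in(0,1)$, $k\in\mathbb N$, $\|f\|_{\omega,q,k}=\sup_{j\in\mathbb N_0}\sup_{|x|\le c_k}|f^{(j)}(x)|e^{-q\varphi_\omega^*(j/q)}$. $\mathcal U_a$ is the space of all $f\in C^\infty(-a,a)$ with $\|f\|_{\omega,q,k}<\infty$ for all $q\in(0,1)$, $k\in\mathbb N$, with the locally convex topology given by these semi-norms; $\mathcal U_a'$ is its strong dual. $D=d/dx$. A $D$-invariant subspace is a closed linear subspace $W\subset\mathcal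 U_a$ with $D(W)\subset W$. $W^0=\{S\in\mathcal U_a': S(f)=0\ \forall f\in W\}$. $\mathrm{Exp}(W)$ is the set of all exponential monomials $t^je^{-\mathrm i\lambda t}$ ($j\in\mathbb Z_+$, $\lambda\in\mathbb C$) contained in $W$; $\Lambda_W=\{(\lambda_k;m_k)\}$ denotes the collection of points with multiplicities such that $\mathrm{Exp}(W)=\{t^je^{-\mathrm i\lambda_kt}: 0\le j\le m_k-1\}_k$ (for $W=\mathcal U_a$ every $\lambda\in\mathbb C$ has infinite multiplicity). Module. $P_k$ is the Banach space of entire functions $\varphi$ with $\|\varphi\|_k=\sup_{z\in\mathbb C}|\varphi(z)|e^{-r_k\omega(|z|)-c_k|\mathrm{Im}\,z|}<\infty$, and $\mathcal P_a$ is the locally convex inductive limit of the $P_k$. The Fourier-Laplace transform $\mathcal F(S)(z)=S(e^{-\mathrm itz})$ is a linear topological isomorphism of $\mathcal U_a'$ onto $\mathcal P_a$. $\mathcal P_a$ is a topological module over $\mathbb C[z]$; "submodule" always means closed $\mathbb C[z]$-submodule. The zero set $\mathcal Z_{\mathcal J}$ of a submodule $\mathcal J$ is the collection of pairs $(\mu;n)$ such that every $\psi\in\mathcal J$ vanishes at $\mu$ with multiplicity at least $n\geq 1$ and some $\varphi\in\mathcal J$ vanishes at $\mu$ with multiplicity exactly $n$ (for $\mathcal J=\{0\}$ every point has infinite multiplicity). *)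

theory Defs
  imports
    "HOL-Analysis.Analysis"
    "HOL-Complex_Analysis.Complex_Analysis"
    "HOL-Library.Function_Algebras"
    "HOL-Library.Extended_Nat"
begin

section \<open>Complex function spaces and their locally convex topologies\<close>

interpretation cfun: vector_space "\<lambda>(c::complex) (f::'a \<Rightarrow> complex) x. c * f x"
  by unfold_locales (auto simp: algebra_simps fun_eq_iff)

definition seminorm_on :: "('a \<Rightarrow> complex) set \<Rightarrow> (('a \<Rightarrow> complex) \<Rightarrow> real) \<Rightarrow> bool" where
  "seminorm_on X p \<longleftrightarrow>
     (\<forall>f\<in>X. \<forall>g\<in>X. p (f + g) \<le> p f + p g) \<and>
     (\<forall>c. \<forall>f\<in>X. p (\<lambda>x. c * f x) = cmod c * p f)"

definition seminorm_topology ::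
    "('a \<Rightarrow> complex) set \<Rightarrow> (('a \<Rightarrow> complex) \<Rightarrow> real) set \<Rightarrow> ('a \<Rightarrow> complex) topology" where
  "seminorm_topology X Q =
     topology_generated_by {{g\<in>X. q (g - f) < e} | q f e. q \<in> Q \<and> f \<in> X \<and> 0 < e}"

text \<open>
  The locally convex inductive limit of the normed spaces \<open>(E k, N k)\<close>, where \<open>E\<close> is
  increasing: the finest locally convex topology on the union for which all inclusions of the
  steps are continuous.  It is the topology given by all those seminorms on the union whose
  restriction to each step is continuous; see \<open>inductive_limit_inclusion\<close> and
  \<open>inductive_limit_finest\<close> below.
\<close>

definition inductive_limit_topology ::
    "(nat \<Rightarrow> ('a \<Rightarrow> complex) set) \<Rightarrow> (nat \<Rightarrow> ('a \<Rightarrow> complex) \<Rightarrow> real) \<Rightarrow> ('a \<Rightarrow> complex) topology"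
  where
  "inductive_limit_topology E N =
     seminorm_topology (\<Union>k. E k)
       {q. seminorm_on (\<Union>k. E k) q \<and>
           (\<forall>k. continuous_map (seminorm_topology (E k) {N k}) euclideanreal q)}"

definition clinear_functional_on ::
    "('a \<Rightarrow> complex) set \<Rightarrow> (('a \<Rightarrow> complex) \<Rightarrow> complex) \<Rightarrow> bool" where
  "clinear_functional_on X S \<longleftrightarrow>
     (\<forall>f\<in>X. \<forall>g\<in>X. S (f + g) = S f + S g) \<and>
     (\<forall>c. \<forall>f\<in>X. S (\<lambda>x. c * f x) = c * S f)"

lemma seminorm_on_zero:
  fixes p :: "('a \<Rightarrow> complex) \<Rightarrow> real"
  shows "seminorm_on X p \<Longrightarrow> 0 \<in> X \<Longrightarrow> p 0 = 0"
proof -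
  assume "seminorm_on X p" "0 \<in> X"
  then have "p (\<lambda>x. 0 * (0 :: 'a \<Rightarrow> complex) x) = cmod 0 * p 0"
    unfolding seminorm_on_def by blast
  then show ?thesis by (simp add: zero_fun_def)
qed

lemma seminorm_on_minus_commute:
  assumes "seminorm_on X p" "cfun.subspace X" "f \<in> X" "g \<in> X"
  shows "p (f - g) = p (g - f)"
proof -
  have "f - g \<in> X" using assms cfun.subspace_diff by blast
  then have "p (\<lambda>x. (-1) * (f - g) x) = cmod (-1) * p (f - g)"
    using assms(1) unfolding seminorm_on_def by blast
  moreover have "(\<lambda>x. (-1) * (f - g) x) = g - f" by (auto simp: fun_eq_iff)
  ultimately show ?thesis by simp
qed

lemma topspace_seminorm_topology:
  assumes "seminorm_on X q" "q \<in> Q" "0 \<in> X"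
  shows "topspace (seminorm_topology X Q) = X"
proof -
  have "x \<in> \<Union>{{g\<in>X. q (g - f) < e} | q f e. q \<in> Q \<and> f \<in> X \<and> 0 < e}" if "x \<in> X" for x
  proof -
    have "x \<in> {g\<in>X. q (g - x) < 1}"
      using seminorm_on_zero[OF assms(1,3)] that by simp
    then show ?thesis using assms(2) that zero_less_one by blast
  qed
  then show ?thesis unfolding seminorm_topology_def topology_generated_by_topspace by blast
qed

lemma continuous_map_seminorm:
  assumes X: "cfun.subspace X" and p: "seminorm_on X p" "p \<in> Q"
  shows "continuous_map (seminorm_topology X Q) euclideanreal p"
proof -
  have ts: "topspace (seminorm_topology X Q) = X"
    using topspace_seminorm_topology[OF p] cfun.subspace_0[OF X] by simp
  have op: "openin (seminorm_topology X Q) {g\<in>X. p (g - f) < e}" if "f \<in> X" "0 < e" for f e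
    unfolding seminorm_topology_def
    by (rule topology_generated_by_Basis) (use that p in blast)
  have tri: "\<bar>p g - p f\<bar> \<le> p (g - f)" if "f \<in> X" "g \<in> X" for f g
  proof -
    have d: "g - f \<in> X" "f - g \<in> X" using X that cfun.subspace_diff by blast+
    have "p (f + (g - f)) \<le> p f + p (g - f)" "p (g + (f - g)) \<le> p g + p (f - g)"
      using p(1) d that unfolding seminorm_on_def by blast+
    then show ?thesis
      using seminorm_on_minus_commute[OF p(1) X that] by (simp add: algebra_simps)
  qed
  have "openin (seminorm_topology X Q) {x\<in>X. p x \<in> U}" if U: "open U" for U
  proof (subst openin_subopen, intro ballI)
    fix f assume f: "f \<in> {x\<in>X. p x \<in> U}"
    then obtain e where e: "0 < e" "ball (p f) e \<subseteq> U" using U openE by blast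
    have "{g\<in>X. p (g - f) < e} \<subseteq> {x\<in>X. p x \<in> U}"
      using tri f e(2) by (force simp: dist_real_def subset_iff)
    moreover have "f \<in> {g\<in>X. p (g - f) < e}"
      using f e(1) seminorm_on_zero[OF p(1) cfun.subspace_0[OF X]] by simp
    ultimately show "\<exists>T. openin (seminorm_topology X Q) T \<and> f \<in> T \<and> T \<subseteq> {x\<in>X. p x \<in> U}"
      using op[of f e] f e(1) by blast
  qed
  then show ?thesis unfolding continuous_map_def ts by simp
qed

lemma inductive_limit_inclusion:
  assumes E: "\<And>j. cfun.subspace (E j)" and X: "cfun.subspace (\<Union>j. E j)"
    and N: "seminorm_on (E k) (N k)"
  shows "continuous_map (seminorm_topology (E k) {N k}) (inductive_limit_topology E N) id"
proof -
  let ?T = "seminorm_topology (E k) {N k}" and ?X = "\<Union>j. E j"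
  have ts: "topspace ?T = E k"
    using topspace_seminorm_topology[OF N] cfun.subspace_0[OF E] by simp
  have null: "seminorm_on ?X (\<lambda>_. 0)" unfolding seminorm_on_def by auto
  have tsX: "topspace (inductive_limit_topology E N) = ?X"
    unfolding inductive_limit_topology_def
    by (rule topspace_seminorm_topology[OF null]) (use null cfun.subspace_0[OF X] in auto)
  have "openin ?T (id -` {g\<in>?X. q (g - f) < e} \<inter> topspace ?T)"
    if q: "seminorm_on ?X q" "continuous_map ?T euclideanreal q" and f: "f \<in> ?X" "0 < e" for q f e
  proof (subst openin_subopen, intro ballI)
    fix h assume "h \<in> id -` {g\<in>?X. q (g - f) < e} \<inter> topspace ?T"
    then have h: "h \<in> E k" "h \<in> ?X" "q (h - f) < e" using ts by auto
    define d where "d = e - q (h - f)"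
    have "openin ?T {x\<in>topspace ?T. q x \<in> {..<d}}"
      using q(2) by (rule openin_continuous_map_preimage) (simp add: open_openin[symmetric])
    then have "openin ?T {x\<in>E k. q x < d}" by (simp add: ts)
    then obtain r where r: "0 < r" "\<And>x. x \<in> E k \<Longrightarrow> N k x < r \<Longrightarrow> q x < d"
    proof -
      assume *: "openin ?T {x\<in>E k. q x < d}"
        and that: "\<And>r. 0 < r \<Longrightarrow> (\<And>x. x \<in> E k \<Longrightarrow> N k x < r \<Longrightarrow> q x < d) \<Longrightarrow> thesis"
      have "\<exists>r>0. \<forall>x\<in>E k. N k (x - y) < r \<longrightarrow> x \<in> U" if "openin ?T U" "y \<in> U" for U y
      proof -
        have "generate_topology_on {{g\<in>E k. q (g - f) < e} | q f e. q \<in> {N k} \<and> f \<in> E k \<and> 0 < e} U"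
          using that(1) unfolding seminorm_topology_def openin_topology_generated_by_iff .
        then show ?thesis using that(2)
        proof (induction arbitrary: y)
          case Empty then show ?case by simp
        next
          case (Int a b)
          obtain r1 where r1: "r1 > 0" "\<forall>x\<in>E k. N k (x - y) < r1 \<longrightarrow> x \<in> a"
            using Int.IH(1)[of y] Int.prems by blast
          obtain r2 where r2: "r2 > 0" "\<forall>x\<in>E k. N k (x - y) < r2 \<longrightarrow> x \<in> b"
            using Int.IH(2)[of y] Int.prems by blast
          have "\<forall>x\<in>E k. N k (x - y) < min r1 r2 \<longrightarrow> x \<in> a \<inter> b"
            using r1(2) r2(2) unfolding min_less_iff_conj by blast
          then show ?case using r1(1) r2(1) by (metis min_less_iff_conj)
        next
          case (UN K)
          then show ?case by (meson UnionE UnionI)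
        next
          case (Basis s)
          then obtain f e where s: "s = {g\<in>E k. N k (g - f) < e}" "f \<in> E k" "0 < e" by auto
          have y: "y \<in> E k" "N k (y - f) < e" using Basis.prems s by auto
          have "N k (x - f) < e" if x: "x \<in> E k" "N k (x - y) < e - N k (y - f)" for x
          proof -
            have "x - y \<in> E k" "y - f \<in> E k"
              using cfun.subspace_diff[OF E[of k]] x y s by auto
            then have "N k ((x - y) + (y - f)) \<le> N k (x - y) + N k (y - f)"
              using N unfolding seminorm_on_def by blast
            then show ?thesis using x by simp
          qed
          then have "\<forall>x\<in>E k. N k (x - y) < e - N k (y - f) \<longrightarrow> x \<in> s"
            unfolding s(1) by blast
          moreover have "0 < e - N k (y - f)" using y(2) by simp
          ultimately show ?case by blast
        qed
      qed
      moreover have "0 \<in> {x\<in>E k. q x < d}"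
        using h seminorm_on_zero[OF q(1) cfun.subspace_0[OF X]] cfun.subspace_0[OF E[of k]]
        by (simp add: d_def)
      ultimately have "\<exists>r>0. \<forall>x\<in>E k. N k (x - 0) < r \<longrightarrow> x \<in> {x\<in>E k. q x < d}"
        using * by blast
      then show thesis using that by auto
    qed
    let ?B = "{g\<in>E k. N k (g - h) < r}"
    have "openin ?T ?B" unfolding seminorm_topology_def
      using h(1) r(1) by (intro topology_generated_by_Basis CollectI exI[of _ "N k"] exI[of _ h] exI[of _ r]) simp
    moreover have "h \<in> ?B" using h r seminorm_on_zero[OF N cfun.subspace_0[OF E]] by simp
    moreover have "?B \<subseteq> id -` {g\<in>?X. q (g - f) < e} \<inter> topspace ?T"
    proof
      fix g assume g: "g \<in> ?B"
      then have g1: "g \<in> E k" "N k (g - h) < r" by blast+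
      have gh: "g - h \<in> E k" by (rule cfun.subspace_diff[OF E g1(1) h(1)])
      then have ghX: "g - h \<in> ?X" by blast
      have hfX: "h - f \<in> ?X" by (rule cfun.subspace_diff[OF X h(2) f(1)])
      have "q (g - f) = q ((g - h) + (h - f))" by simp
      also have "\<dots> \<le> q (g - h) + q (h - f)"
        using conjunct1[OF q(1)[unfolded seminorm_on_def]] ghX hfX by (meson bspec)
      also have "\<dots> < e" using r(2)[OF gh g1(2)] unfolding d_def by linarith
      finally have "q (g - f) < e" .
      moreover have "g \<in> ?X" using g1(1) by blast
      ultimately show "g \<in> id -` {g\<in>?X. q (g - f) < e} \<inter> topspace ?T"
        using g1(1) unfolding ts vimage_def id_apply by blast
    qed
    ultimately show "\<exists>T. openin ?T T \<and> h \<in> T \<and> T \<subseteq> id -` {g\<in>?X. q (g - f) < e} \<inter> topspace ?T"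
      by blast
  qed
  then show ?thesis
    unfolding inductive_limit_topology_def seminorm_topology_def[of ?X]
  proof (intro continuous_on_generated_topo)
    show "id ` topspace ?T \<subseteq> \<Union>{{g\<in>?X. q (g - f) < e} | q f e.
      q \<in> {q. seminorm_on ?X q \<and> (\<forall>k. continuous_map (seminorm_topology (E k) {N k}) euclideanreal q)}
      \<and> f \<in> ?X \<and> 0 < e}"
      using ts tsX
      unfolding inductive_limit_topology_def seminorm_topology_def[of ?X] topology_generated_by_topspace
      by auto
  qed blast
qed

lemma seminorm_topology_mono:
  assumes "Q \<subseteq> Q'" "openin (seminorm_topology X Q) U"
  shows "openin (seminorm_topology X Q') U"
proof -
  have sub: "{{g\<in>X. q (g - f) < e} | q f e. q \<in> Q \<and> f \<in> X \<and> 0 < e} \<subseteq>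
      {{g\<in>X. q (g - f) < e} | q f e. q \<in> Q' \<and> f \<in> X \<and> 0 < e}"
    using assms(1) by blast
  from assms(2) show ?thesis
    unfolding seminorm_topology_def openin_topology_generated_by_iff
  proof (induction)
    case (Basis s)
    then show ?case using subsetD[OF sub] by (intro generate_topology_on.Basis)
  qed (rule generate_topology_on.intros; assumption)+
qed

lemma inductive_limit_finest:
  assumes X: "cfun.subspace (\<Union>j. E j)" and Q: "\<And>q. q \<in> Q \<Longrightarrow> seminorm_on (\<Union>j. E j) q"
    and incl: "\<And>k. continuous_map (seminorm_topology (E k) {N k}) (seminorm_topology (\<Union>j. E j) Q) id"
    and U: "openin (seminorm_topology (\<Union>j. E j) Q) U"
  shows "openin (inductive_limit_topology E N) U"
proof -
  have "continuous_map (seminorm_topology (E k) {N k}) euclideanreal q" if "q \<in> Q" for q k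
    using continuous_map_compose[OF incl continuous_map_seminorm[OF X Q[OF that] that]]
    by (simp add: o_def)
  then have "Q \<subseteq> {q. seminorm_on (\<Union>k. E k) q \<and>
           (\<forall>k. continuous_map (seminorm_topology (E k) {N k}) euclideanreal q)}"
    using Q by blast
  from seminorm_topology_mono[OF this U] show ?thesis
    unfolding inductive_limit_topology_def .
qed


section \<open>Weights\<close>

definition weight :: "(real \<Rightarrow> real) \<Rightarrow> bool" where
  "weight \<omega> \<longleftrightarrow>
     (\<forall>x\<ge>0. 0 \<le> \<omega> x) \<and> mono_on {0..} \<omega> \<and> continuous_on {0..} \<omega> \<and>
     convex_on {0..} (\<lambda>t. \<omega> (exp t)) \<and>
     \<omega> \<in> o[at_top](\<lambda>x. x) \<and> ln \<in> o[at_top](\<omega>) \<and>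
     (\<forall>\<sigma>>1. \<exists>C>0. \<forall>x\<ge>0. \<forall>y\<ge>0. \<omega> (x + y) \<le> \<sigma> * (\<omega> x + \<omega> y) + C) \<and>
     set_integrable lborel {1..} (\<lambda>x. \<omega> x / x\<^sup>2)"

definition young_conj :: "(real \<Rightarrow> real) \<Rightarrow> real \<Rightarrow> real" where
  "young_conj \<omega> s = (SUP t\<in>{0..}. s * t - \<omega> (exp t))"


section \<open>Ultradifferentiable functions\<close>

text \<open>
  A function on \<open>(-a, a)\<close> is represented by its extension by zero to the real line, so that
  equality of functions on the interval is equality in HOL.
\<close>

definition Dop :: "ereal \<Rightarrow> (real \<Rightarrow> complex) \<Rightarrow> real \<Rightarrow> complex" where
  "Dop a f = (\<lambda>x. if ereal \<bar>x\<bar> < a then vector_derivative f (at x) else 0)"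

definition smooth_fun :: "ereal \<Rightarrow> (real \<Rightarrow> complex) set" where
  "smooth_fun a =
     {f. (\<forall>x. \<not> ereal \<bar>x\<bar> < a \<longrightarrow> f x = 0) \<and>
         (\<forall>j x. ereal \<bar>x\<bar> < a \<longrightarrow> ((Dop a ^^ j) f) differentiable (at x))}"

definition u_weighted ::
    "ereal \<Rightarrow> (real \<Rightarrow> real) \<Rightarrow> real \<Rightarrow> (real \<Rightarrow> complex) \<Rightarrow> nat \<times> real \<Rightarrow> real" where
  "u_weighted a \<omega> q f = (\<lambda>(j, x).
     cmod ((Dop a ^^ j) f x) * exp (- q * young_conj \<omega> (real j / q)))"

definition u_norm ::
    "ereal \<Rightarrow> (real \<Rightarrow> real) \<Rightarrow> (nat \<Rightarrow> real) \<Rightarrow> real \<Rightarrow> nat \<Rightarrow> (real \<Rightarrow> complex) \<Rightarrow> real" where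
  "u_norm a \<omega> c q k f = (SUP p\<in>UNIV \<times> {- c k..c k}. u_weighted a \<omega> q f p)"

text \<open>Since real suprema are total, finiteness of the norm is expressed by \<^const>\<open>bdd_above\<close>.\<close>

definition U_space :: "ereal \<Rightarrow> (real \<Rightarrow> real) \<Rightarrow> (nat \<Rightarrow> real) \<Rightarrow> (real \<Rightarrow> complex) set" where
  "U_space a \<omega> c =
     {f \<in> smooth_fun a. \<forall>q k. 0 < q \<and> q < 1 \<longrightarrow>
        bdd_above (u_weighted a \<omega> q f ` (UNIV \<times> {- c k..c k}))}"

definition U_topology ::
    "ereal \<Rightarrow> (real \<Rightarrow> real) \<Rightarrow> (nat \<Rightarrow> real) \<Rightarrow> (real \<Rightarrow> complex) topology" where
  "U_topology a \<omega> c =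
     seminorm_topology (U_space a \<omega> c) {u_norm a \<omega> c q k | q k. 0 < q \<and> q < 1}"

definition U_dual ::
    "ereal \<Rightarrow> (real \<Rightarrow> real) \<Rightarrow> (nat \<Rightarrow> real) \<Rightarrow> ((real \<Rightarrow> complex) \<Rightarrow> complex) set" where
  "U_dual a \<omega> c =
     {S \<in> extensional (U_space a \<omega> c).
        clinear_functional_on (U_space a \<omega> c) S \<and>
        continuous_map (U_topology a \<omega> c) euclidean S}"

definition D_invariant_subspace ::
    "ereal \<Rightarrow> (real \<Rightarrow> real) \<Rightarrow> (nat \<Rightarrow> real) \<Rightarrow> (real \<Rightarrow> complex) set \<Rightarrow> bool" where
  "D_invariant_subspace a \<omega> c W \<longleftrightarrow>
     W \<subseteq> U_space a \<omega> c \<and> cfun.subspace W \<and> closedin (U_topology a \<omega> c) W \<and> Dop a ` W \<subseteq> W"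

definition annihilator ::
    "ereal \<Rightarrow> (real \<Rightarrow> real) \<Rightarrow> (nat \<Rightarrow> real) \<Rightarrow> (real \<Rightarrow> complex) set \<Rightarrow>
     ((real \<Rightarrow> complex) \<Rightarrow> complex) set" where
  "annihilator a \<omega> c W = {S \<in> U_dual a \<omega> c. \<forall>f\<in>W. S f = 0}"

definition exp_monomial :: "ereal \<Rightarrow> nat \<Rightarrow> complex \<Rightarrow> real \<Rightarrow> complex" where
  "exp_monomial a j \<mu> = (\<lambda>t. if ereal \<bar>t\<bar> < a
     then of_real t ^ j * exp (- \<i> * \<mu> * of_real t) else 0)"

definition Exp_set :: "ereal \<Rightarrow> (real \<Rightarrow> complex) set \<Rightarrow> (real \<Rightarrow> complex) set" where
  "Exp_set a W = {exp_monomial a j \<mu> | j \<mu>. exp_monomial a j \<mu> \<in> W}"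

text \<open>
  Points with multiplicities are pairs in \<open>complex \<times> enat\<close>, so that infinite multiplicity is
  covered.  That \<open>spectrum\<close> does describe \<open>Exp_set\<close> is lemma \<open>Exp_set_spectrum\<close> below.
\<close>

definition spectrum :: "ereal \<Rightarrow> (real \<Rightarrow> complex) set \<Rightarrow> (complex \<times> enat) set" where
  "spectrum a W = {(\<mu>, m). 1 \<le> m \<and> (\<forall>j. exp_monomial a j \<mu> \<in> W \<longleftrightarrow> enat j < m)}"

lemma Dop_exp_monomial:
  "Dop a (exp_monomial a (Suc j) \<mu>) =
     (\<lambda>x. of_nat (Suc j) * exp_monomial a j \<mu> x + (- \<i> * \<mu>) * exp_monomial a (Suc j) \<mu> x)"
proof
  fix x
  show "Dop a (exp_monomial a (Suc j) \<mu>) x =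
     of_nat (Suc j) * exp_monomial a j \<mu> x + (- \<i> * \<mu>) * exp_monomial a (Suc j) \<mu> x"
  proof (cases "ereal \<bar>x\<bar> < a")
    case True
    have "open {t. ereal \<bar>t\<bar> < a}" by (intro open_Collect_less continuous_intros)
    have "((\<lambda>z::complex. z ^ Suc j) has_field_derivative of_nat (Suc j) * of_real x ^ j)
        (at (of_real x))"
      using DERIV_power[OF DERIV_ident, of "Suc j" "of_real x :: complex" UNIV] by simp
    moreover have "((\<lambda>z::complex. exp (- \<i> * \<mu> * z)) has_field_derivative
        exp (- \<i> * \<mu> * of_real x) * (- \<i> * \<mu>)) (at (of_real x))"
      by (auto intro!: derivative_eq_intros)
    ultimately have "((\<lambda>z::complex. z ^ Suc j * exp (- \<i> * \<mu> * z)) has_field_derivative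
        (of_nat (Suc j) * of_real x ^ j * exp (- \<i> * \<mu> * of_real x)
          + of_real x ^ Suc j * (exp (- \<i> * \<mu> * of_real x) * (- \<i> * \<mu>)))) (at (of_real x))"
      by (rule DERIV_cong[OF DERIV_mult]) (simp add: algebra_simps)
    from has_vector_derivative_real_field[OF this]
    have "((\<lambda>t. of_real t ^ Suc j * exp (- \<i> * \<mu> * of_real t)) has_vector_derivative
        (of_nat (Suc j) * of_real x ^ j * exp (- \<i> * \<mu> * of_real x)
          + of_real x ^ Suc j * (exp (- \<i> * \<mu> * of_real x) * (- \<i> * \<mu>)))) (at x)"
      by simp
    then have "(exp_monomial a (Suc j) \<mu> has_vector_derivative
        (of_nat (Suc j) * of_real x ^ j * exp (- \<i> * \<mu> * of_real x)
          + of_real x ^ Suc j * (exp (- \<i> * \<mu> * of_real x) * (- \<i> * \<mu>)))) (at x)"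
      by (rule has_vector_derivative_transform_within_open[OF _ \<open>open {t. ereal \<bar>t\<bar> < a}\<close>])
         (use True in \<open>auto simp: exp_monomial_def\<close>)
    then show ?thesis using True
      by (auto simp: Dop_def exp_monomial_def algebra_simps dest!: vector_derivative_at)
  qed (simp add: Dop_def exp_monomial_def)
qed

lemma Exp_set_spectrum:
  assumes "D_invariant_subspace a \<omega> c W"
  shows "Exp_set a W = {exp_monomial a j \<mu> | j \<mu> m. (\<mu>, m) \<in> spectrum a W \<and> enat j < m}"
proof -
  have sub: "cfun.subspace W" and D: "\<And>f. f \<in> W \<Longrightarrow> Dop a f \<in> W"
    using assms unfolding D_invariant_subspace_def by auto
  have step: "exp_monomial a j \<mu> \<in> W" if "exp_monomial a (Suc j) \<mu> \<in> W" for j \<mu>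
  proof -
    have "Dop a (exp_monomial a (Suc j) \<mu>) - (\<lambda>x. (- \<i> * \<mu>) * exp_monomial a (Suc j) \<mu> x) \<in> W"
      using that D cfun.subspace_diff[OF sub] cfun.subspace_scale[OF sub] by blast
    then have "(\<lambda>x. (1 / of_nat (Suc j)) * (Dop a (exp_monomial a (Suc j) \<mu>)
        - (\<lambda>x. (- \<i> * \<mu>) * exp_monomial a (Suc j) \<mu> x)) x) \<in> W"
      using cfun.subspace_scale[OF sub] by blast
    moreover have "(\<lambda>x. (1 / of_nat (Suc j)) * (Dop a (exp_monomial a (Suc j) \<mu>)
        - (\<lambda>x. (- \<i> * \<mu>) * exp_monomial a (Suc j) \<mu> x)) x) = exp_monomial a j \<mu>"
      unfolding Dop_exp_monomial by (auto simp: fun_eq_iff simp del: of_nat_Suc)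
    ultimately show ?thesis by simp
  qed
  have down: "exp_monomial a i \<mu> \<in> W" if "exp_monomial a j \<mu> \<in> W" "i \<le> j" for i j \<mu>
    using that(2,1) by (induction rule: inc_induct) (auto intro: step)
  have "\<exists>m. (\<mu>, m) \<in> spectrum a W \<and> enat j < m" if j: "exp_monomial a j \<mu> \<in> W" for j \<mu>
  proof (cases "\<forall>i. exp_monomial a i \<mu> \<in> W")
    case True
    then show ?thesis by (intro exI[of _ \<infinity>]) (auto simp: spectrum_def)
  next
    case False
    define n where "n = (LEAST i. exp_monomial a i \<mu> \<notin> W)"
    have n: "exp_monomial a n \<mu> \<notin> W" using False LeastI_ex unfolding n_def by (metis (mono_tags))
    have n': "exp_monomial a i \<mu> \<in> W" if "i < n" for i
      using not_less_Least that unfolding n_def by blast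
    have iff: "exp_monomial a i \<mu> \<in> W \<longleftrightarrow> i < n" for i using n n' down not_less by blast
    then have "j < n" using j by simp
    then show ?thesis using iff
      by (intro exI[of _ "enat n"]) (auto simp: spectrum_def one_enat_def)
  qed
  moreover have "exp_monomial a j \<mu> \<in> W" if "(\<mu>, m) \<in> spectrum a W" "enat j < m" for j \<mu> m
    using that unfolding spectrum_def by blast
  ultimately show ?thesis unfolding Exp_set_def by blast
qed


section \<open>The module of entire functions\<close>

definition p_weighted ::
    "(real \<Rightarrow> real) \<Rightarrow> (nat \<Rightarrow> real) \<Rightarrow> (nat \<Rightarrow> real) \<Rightarrow> nat \<Rightarrow> (complex \<Rightarrow> complex) \<Rightarrow> complex \<Rightarrow> real"
  where
  "p_weighted \<omega> c r k \<phi> z = cmod (\<phi> z) * exp (- r k * \<omega> (cmod z) - c k * \<bar>Im z\<bar>)"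

definition p_norm ::
    "(real \<Rightarrow> real) \<Rightarrow> (nat \<Rightarrow> real) \<Rightarrow> (nat \<Rightarrow> real) \<Rightarrow> nat \<Rightarrow> (complex \<Rightarrow> complex) \<Rightarrow> real" where
  "p_norm \<omega> c r k \<phi> = (SUP z. p_weighted \<omega> c r k \<phi> z)"

definition P_step ::
    "(real \<Rightarrow> real) \<Rightarrow> (nat \<Rightarrow> real) \<Rightarrow> (nat \<Rightarrow> real) \<Rightarrow> nat \<Rightarrow> (complex \<Rightarrow> complex) set" where
  "P_step \<omega> c r k = {\<phi>. \<phi> holomorphic_on UNIV \<and> bdd_above (range (p_weighted \<omega> c r k \<phi>))}"

definition P_space ::
    "(real \<Rightarrow> real) \<Rightarrow> (nat \<Rightarrow> real) \<Rightarrow> (nat \<Rightarrow> real) \<Rightarrow> (complex \<Rightarrow> complex) set" where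
  "P_space \<omega> c r = (\<Union>k. P_step \<omega> c r k)"

definition P_topology ::
    "(real \<Rightarrow> real) \<Rightarrow> (nat \<Rightarrow> real) \<Rightarrow> (nat \<Rightarrow> real) \<Rightarrow> (complex \<Rightarrow> complex) topology" where
  "P_topology \<omega> c r = inductive_limit_topology (P_step \<omega> c r) (p_norm \<omega> c r)"

definition closed_submodule ::
    "(real \<Rightarrow> real) \<Rightarrow> (nat \<Rightarrow> real) \<Rightarrow> (nat \<Rightarrow> real) \<Rightarrow> (complex \<Rightarrow> complex) set \<Rightarrow> bool" where
  "closed_submodule \<omega> c r J \<longleftrightarrow>
     J \<subseteq> P_space \<omega> c r \<and> cfun.subspace J \<and> closedin (P_topology \<omega> c r) J \<and>
     (\<forall>p. \<forall>\<phi>\<in>J. (\<lambda>z. poly p z * \<phi> z) \<in> J)"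

text \<open>The infimum over the empty set is \<open>\<infinity>\<close>, the multiplicity of a zero of the zero function.\<close>

definition zero_mult :: "(complex \<Rightarrow> complex) \<Rightarrow> complex \<Rightarrow> enat" where
  "zero_mult \<phi> \<mu> = (INF j\<in>{j. (deriv ^^ j) \<phi> \<mu> \<noteq> 0}. enat j)"

definition zero_set :: "(complex \<Rightarrow> complex) set \<Rightarrow> (complex \<times> enat) set" where
  "zero_set J = {(\<mu>, n). 1 \<le> n \<and> (\<forall>\<psi>\<in>J. n \<le> zero_mult \<psi> \<mu>) \<and> (\<exists>\<phi>\<in>J. zero_mult \<phi> \<mu> = n)}"

definition fourier_laplace ::
    "ereal \<Rightarrow> ((real \<Rightarrow> complex) \<Rightarrow> complex) \<Rightarrow> complex \<Rightarrow> complex" where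
  "fourier_laplace a S = (\<lambda>z. S (exp_monomial a 0 z))"

end

theory Submission
  imports Defs
begin

text \<open>
  Both directions of the correspondence are bipolar theorems, once the Fourier-Laplace transform
  is known to be an isomorphism of the dual of \<open>\<U>\<^sub>a\<close> onto \<open>\<P>\<^sub>a\<close> and every continuous functional on
  \<open>\<P>\<^sub>a\<close> is known to be evaluation at an element of \<open>\<U>\<^sub>a\<close>. These facts rest on one expansion: as the
  weight is non-quasianalytic, there are smooth cut-off functions of the class, and cutting off
  \<open>f\<close> and taking its Fourier series yields \<open>f = \<Sum> coef f n exp (-\<i> w\<^sub>n t)\<close> on a prescribed
  compact interval, where \<open>coef f n\<close> decays like \<open>exp (- q \<omega> |w\<^sub>n|)\<close> for any prescribed \<open>q < 1\<close>.
  A functional \<open>S\<close> with transform \<open>\<phi>\<close> is then \<open>S f = \<Sum> coef f n \<phi> w\<^sub>n\<close>, which gives injectivity;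
  for an arbitrary \<open>\<phi>\<close> in \<open>\<P>\<^sub>a\<close> the same formula defines a preimage, because finite sums of
  exponentials \<open>exp (-\<i> t z)\<close> are dense in \<open>\<P>\<^sub>a\<close> and for those the formula is evident.
  Density follows from the sampling theorem after multiplication by an entire function of small
  exponential type that decays faster than \<open>exp (- \<omega> |z|)\<close> on the real axis.

  The derivatives of the transform of \<open>S\<close> at \<open>\<mu>\<close> are the values of \<open>S\<close> on exponential monomials
  with exponent \<open>\<mu>\<close>, and the transform turns the derivation into multiplication by \<open>z\<close>; this
  identifies invariant subspaces with submodules and spectra with zero sets.
\<close>

section \<open>Separation in seminormed function spaces\<close>

text \<open>Every estimate loses something: a polynomial factor, a product or a differentiation
  changes \<open>q\<close> slightly. This is affordable because all \<open>q < 1\<close> and all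
  \<open>r k < 1\<close> occur in the spaces, while \<open>ln\<close> is of smaller order than
  \<omega> and \<omega> is nearly subadditive with every factor above 1. What cannot be lost is
  uniformity in the order of differentiation: multiplication by a cut-off produces Leibniz sums of
  \<open>j + 1\<close> terms. Hence the cut-off is made better than the class, its i-th derivative
  gaining a factor \<open>2 ^ i\<close>, which turns these sums into geometric series. This explains
  the decay \<open>exp (- 2 * \<omega> (2 * cmod z))\<close> demanded of the entire function: the
  dilation by 2 yields the gain, and the doubled weight leaves one copy for summability. On the side
  of \<open>P\<close> the obstacle is that a functional is known only through bounds on the steps,
  with constants depending on the step. Density is therefore stated with one step \<open>m\<close>
  that serves all elements of the step \<open>k\<close> and all accuracies.\<close>

lemma seminorm_on_nonneg:
  assumes "seminorm_on X p" "cfun.subspace X" "f \<in> X"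
  shows "0 \<le> p f"
proof -
  have z: "0 \<in> X" using assms(2) cfun.subspace_0 by blast
  have "p (f - f) \<le> p f + p (0 - f)"
    using assms(1) seminorm_on_def[of X p] cfun.subspace_diff[OF assms(2) z assms(3)] assms(3)
    by (metis add_uminus_conv_diff diff_0)
  moreover have "p (0 - f) = p (f - 0)"
    using seminorm_on_minus_commute[OF assms(1,2) z assms(3)] .
  moreover have "p (f - f) = 0" using seminorm_on_zero[OF assms(1) z] by simp
  ultimately show ?thesis by simp
qed

lemma seminorm_on_sum:
  assumes "finite F" "\<And>q. q \<in> F \<Longrightarrow> seminorm_on X q"
  shows "seminorm_on X (\<lambda>f. \<Sum>q\<in>F. q f)"
  using assms unfolding seminorm_on_def
  by (simp add: sum.distrib[symmetric] sum_mono sum_distrib_left)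

lemma seminorm_on_tri_diff:
  assumes "seminorm_on X p" "cfun.subspace X" "f \<in> X" "g \<in> X" "h \<in> X"
  shows "p (f - h) \<le> p (f - g) + p (g - h)"
proof -
  have "f - g \<in> X" "g - h \<in> X" using assms cfun.subspace_diff by blast+
  then have "p ((f - g) + (g - h)) \<le> p (f - g) + p (g - h)"
    using assms(1) unfolding seminorm_on_def by blast
  then show ?thesis by simp
qed

text \<open>Recovers the usual base of neighbourhoods from the subbase, by induction on the
  generation of the open set: an intersection merges two finite families and takes the smaller
  radius, and a subbasic ball around \<open>h\<close> contains the ball around \<open>f\<close> of
  radius \<open>e - q (f - h)\<close>.\<close>

lemma seminorm_topology_nhds:
  assumes Q: "\<And>q. q \<in> Q \<Longrightarrow> seminorm_on X q" and X: "cfun.subspace X"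
    and U: "openin (seminorm_topology X Q) U" and f: "f \<in> U"
  shows "\<exists>F e. finite F \<and> F \<subseteq> Q \<and> 0 < e \<and> (\<forall>g\<in>X. (\<forall>q\<in>F. q (g - f) < e) \<longrightarrow> g \<in> U)"
proof -
  have "generate_topology_on {{g\<in>X. q (g - f) < e} | q f e. q \<in> Q \<and> f \<in> X \<and> 0 < e} U"
    using U unfolding seminorm_topology_def openin_topology_generated_by_iff .
  then show ?thesis using f
  proof (induction arbitrary: f)
    case Empty then show ?case by simp
  next
    case (Int a b)
    obtain F e where F: "finite F" "F \<subseteq> Q" "0 < e" "\<forall>g\<in>X. (\<forall>q\<in>F. q (g - f) < e) \<longrightarrow> g \<in> a"
      using Int.IH(1)[of f] Int.prems by blast
    obtain F' e' where F': "finite F'" "F' \<subseteq> Q" "0 < e'"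
        "\<forall>g\<in>X. (\<forall>q\<in>F'. q (g - f) < e') \<longrightarrow> g \<in> b"
      using Int.IH(2)[of f] Int.prems by blast
    have "\<forall>g\<in>X. (\<forall>q\<in>F \<union> F'. q (g - f) < min e e') \<longrightarrow> g \<in> a \<inter> b"
      using F(4) F'(4) by (metis IntI UnCI min_less_iff_conj)
    moreover have "0 < min e e'" "finite (F \<union> F')" "F \<union> F' \<subseteq> Q" using F F' by auto
    ultimately show ?case by blast
  next
    case (UN K)
    then obtain k where k: "k \<in> K" "f \<in> k" by blast
    obtain F e where "finite F" "F \<subseteq> Q" "0 < e" "\<forall>g\<in>X. (\<forall>q\<in>F. q (g - f) < e) \<longrightarrow> g \<in> k"
      using UN.IH[OF k] by blast
    then show ?case using k(1) by blast
  next
    case (Basis s)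
    then obtain q h e where s: "s = {g\<in>X. q (g - h) < e}" "q \<in> Q" "h \<in> X" by auto
    have f: "f \<in> X" "q (f - h) < e" using Basis.prems s by auto
    have "q (g - h) < e" if "g \<in> X" "q (g - f) < e - q (f - h)" for g
      using seminorm_on_tri_diff[OF Q[OF s(2)] X that(1) f(1) s(3)] that(2) by simp
    then have "\<forall>g\<in>X. (\<forall>q'\<in>{q}. q' (g - f) < e - q (f - h)) \<longrightarrow> g \<in> s"
      unfolding s(1) by blast
    moreover have "finite {q}" "{q} \<subseteq> Q" "0 < e - q (f - h)" using s f by auto
    ultimately show ?case by blast
  qed
qed

lemma clinear_functional_onD:
  assumes "clinear_functional_on X T"
  shows "\<And>f g. f \<in> X \<Longrightarrow> g \<in> X \<Longrightarrow> T (f + g) = T f + T g"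
    and "\<And>c f. f \<in> X \<Longrightarrow> T (\<lambda>x. c * f x) = c * T f"
  using assms unfolding clinear_functional_on_def by blast+

lemma clinear_functional_on_zero:
  assumes "clinear_functional_on X T" "cfun.subspace X"
  shows "T 0 = 0"
proof -
  have "T (\<lambda>x. 0 * (0 :: _ \<Rightarrow> complex) x) = 0 * T 0"
    by (rule clinear_functional_onD(2)[OF assms(1)]) (rule cfun.subspace_0[OF assms(2)])
  then show ?thesis by (simp add: zero_fun_def)
qed

lemma clinear_functional_on_diff:
  assumes "clinear_functional_on X T" "cfun.subspace X" "f \<in> X" "g \<in> X"
  shows "T (f - g) = T f - T g"
proof -
  have "f - g \<in> X" using assms cfun.subspace_diff by blast
  then have "T ((f - g) + g) = T (f - g) + T g"
    using clinear_functional_onD(1)[OF assms(1)] assms(4) by blast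
  then show ?thesis by simp
qed

lemma clinear_functional_on_sum:
  assumes "clinear_functional_on X T" "cfun.subspace X" "\<And>i. i \<in> I \<Longrightarrow> f i \<in> X"
  shows "T (\<lambda>x. \<Sum>i\<in>I. b i * f i x) = (\<Sum>i\<in>I. b i * T (f i))"
    and "(\<lambda>x. \<Sum>i\<in>I. b i * f i x) \<in> X"
proof -
  have "T (\<lambda>x. \<Sum>i\<in>I. b i * f i x) = (\<Sum>i\<in>I. b i * T (f i)) \<and> (\<lambda>x. \<Sum>i\<in>I. b i * f i x) \<in> X"
    using assms(3)
  proof (induction I rule: infinite_finite_induct)
    case (insert i I)
    have 1: "(\<lambda>x. b i * f i x) \<in> X" using cfun.subspace_scale[OF assms(2)] insert.prems by blast
    have eq: "(\<lambda>x. \<Sum>i\<in>insert i I. b i * f i x) = (\<lambda>x. b i * f i x) + (\<lambda>x. \<Sum>i\<in>I. b i * f i x)"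
      using insert by (auto simp: fun_eq_iff)
    have 2: "T (\<lambda>x. \<Sum>i\<in>I. b i * f i x) = (\<Sum>i\<in>I. b i * T (f i))" "(\<lambda>x. \<Sum>i\<in>I. b i * f i x) \<in> X"
      using insert by auto
    show ?case unfolding eq
      using clinear_functional_onD(1)[OF assms(1) 1 2(2)] clinear_functional_onD(2)[OF assms(1)]
        cfun.subspace_add[OF assms(2) 1 2(2)] 2 insert by simp
  qed (use clinear_functional_on_zero[OF assms(1,2)] cfun.subspace_0[OF assms(2)]
      in \<open>auto simp: zero_fun_def\<close>)
  then show "T (\<lambda>x. \<Sum>i\<in>I. b i * f i x) = (\<Sum>i\<in>I. b i * T (f i))"
    "(\<lambda>x. \<Sum>i\<in>I. b i * f i x) \<in> X" by auto
qed

text \<open>The functional is below 1 in modulus on a basic neighbourhood of 0; homogeneity turns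
  this into a bound by the finitely many seminorms that describe the neighbourhood.\<close>

lemma continuous_functional_imp_bound:
  assumes Q: "\<And>q. q \<in> Q \<Longrightarrow> seminorm_on X q" and X: "cfun.subspace X" and ne: "Q \<noteq> {}"
    and T: "clinear_functional_on X T"
    and cont: "continuous_map (seminorm_topology X Q) euclidean T"
  shows "\<exists>F C. finite F \<and> F \<subseteq> Q \<and> 0 \<le> C \<and> (\<forall>f\<in>X. cmod (T f) \<le> C * (\<Sum>q\<in>F. q f))"
proof -
  have ts: "topspace (seminorm_topology X Q) = X"
    using topspace_seminorm_topology[of X _ Q] Q ne cfun.subspace_0[OF X] by blast
  have op: "openin (seminorm_topology X Q) {f\<in>X. T f \<in> ball 0 1}"
    using openin_continuous_map_preimage[OF cont, of "ball 0 1"] ts by simp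
  have 0: "0 \<in> {f\<in>X. T f \<in> ball 0 1}"
    using clinear_functional_on_zero[OF T X] cfun.subspace_0[OF X] by simp
  have "\<exists>F e. finite F \<and> F \<subseteq> Q \<and> 0 < e \<and>
      (\<forall>g\<in>X. (\<forall>q\<in>F. q (g - 0) < e) \<longrightarrow> g \<in> {f\<in>X. T f \<in> ball 0 1})"
    by (rule seminorm_topology_nhds[OF _ X op 0]) (rule Q)
  then obtain F e where F: "finite F" "F \<subseteq> Q" "0 < e"
    "\<forall>g\<in>X. (\<forall>q\<in>F. q (g - 0) < e) \<longrightarrow> g \<in> {f\<in>X. T f \<in> ball 0 1}"
    by (elim exE conjE)
  let ?p = "\<lambda>f. \<Sum>q\<in>F. q f"
  have Fq: "\<And>q. q \<in> F \<Longrightarrow> seminorm_on X q" using F(2) Q by blast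
  have p: "seminorm_on X ?p" by (rule seminorm_on_sum[OF F(1) Fq])
  have small: "cmod (T g) < 1" if "g \<in> X" "?p g < e" for g
  proof -
    have "q (g - 0) < e" if "q \<in> F" for q
      using member_le_sum[OF that, of "\<lambda>q. q g"] seminorm_on_nonneg[OF Fq X \<open>g \<in> X\<close>] F(1)
        \<open>?p g < e\<close> by fastforce
    then show ?thesis using F(4) that(1) by auto
  qed
  have "cmod (T f) \<le> (2 / e) * ?p f" if f: "f \<in> X" for f
  proof (cases "?p f = 0")
    case True
    \<comment> \<open>All multiples of \<open>f\<close> stay in the neighbourhood, so
      \<open>T f\<close> is smaller than any positive number; the choice
      \<open>n = 2 / cmod (T f)\<close> excludes a nonzero value.\<close>
    have "cmod (T f) \<le> 1 / n" if "n > 0" for n :: real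
    proof -
      have fX: "(\<lambda>x. of_real n * f x) \<in> X" using f cfun.subspace_scale[OF X] by blast
      have "?p (\<lambda>x. of_real n * f x) = n * ?p f"
        using conjunct2[OF p[unfolded seminorm_on_def], rule_format, OF f, of "of_real n"] \<open>n > 0\<close>
        by simp
      then have "cmod (T (\<lambda>x. of_real n * f x)) < 1" using small[OF fX] True F(3) by simp
      then show ?thesis using clinear_functional_onD(2)[OF T f, of "of_real n"] \<open>n > 0\<close>
        by (simp add: norm_mult field_simps)
    qed
    from this[of "2 / cmod (T f)"] have "cmod (T f) = 0"
      by (cases "cmod (T f) = 0") auto
    then show ?thesis using True by simp
  next
    case False
    then have pos: "?p f > 0" using seminorm_on_nonneg[OF p X f] by simp
    \<comment> \<open>Scaling to \<open>e / 2\<close> instead of \<open>e\<close> keeps the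
      neighbourhood condition strict; this is the 2 in \<open>2 / e\<close>.\<close>
    define n where "n = e / (2 * ?p f)"
    have n: "n > 0" using pos F(3) by (simp add: n_def)
    have fX: "(\<lambda>x. of_real n * f x) \<in> X" using f cfun.subspace_scale[OF X] by blast
    have "?p (\<lambda>x. of_real n * f x) = n * ?p f"
      using conjunct2[OF p[unfolded seminorm_on_def], rule_format, OF f, of "of_real n"] n by simp
    also have "\<dots> < e" using pos F(3) by (simp add: n_def)
    finally have "cmod (T (\<lambda>x. of_real n * f x)) < 1" using small[OF fX] by simp
    then have "n * cmod (T f) < 1" using clinear_functional_onD(2)[OF T f, of "of_real n"] n
      by (simp add: norm_mult)
    then show ?thesis using pos F(3) by (simp add: n_def field_simps)
  qed
  then show ?thesis using F by (intro exI[of _ F] exI[of _ "2/e"]) auto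
qed

lemma bound_imp_continuous_functional:
  assumes Q: "\<And>q. q \<in> Q \<Longrightarrow> seminorm_on X q" and X: "cfun.subspace X" and ne: "Q \<noteq> {}"
    and T: "clinear_functional_on X T"
    and F: "finite F" "F \<subseteq> Q" "\<And>f. f \<in> X \<Longrightarrow> cmod (T f) \<le> C * (\<Sum>q\<in>F. q f)"
  shows "continuous_map (seminorm_topology X Q) euclidean T"
proof -
  have ts: "topspace (seminorm_topology X Q) = X"
    using topspace_seminorm_topology[of X _ Q] Q ne cfun.subspace_0[OF X] by blast
  have "openin (seminorm_topology X Q) {f\<in>X. T f \<in> U}" if U: "open U" for U
  proof (subst openin_subopen, intro ballI)
    fix f assume f: "f \<in> {f\<in>X. T f \<in> U}"
    then obtain e where e: "0 < e" "ball (T f) e \<subseteq> U" using U openE by blast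
    \<comment> \<open>Chosen so that \<open>\<bar>C\<bar> * card F * d < e\<close>; the summands 1
      keep the denominator positive and the inequality strict when \<open>C = 0\<close> or
      \<open>F\<close> is empty.\<close>
    define d where "d = e / ((\<bar>C\<bar> + 1) * (real (card F) + 1))"
    have d: "d > 0" using e unfolding d_def by (intro divide_pos_pos mult_pos_pos) auto
    \<comment> \<open>For empty \<open>F\<close> the intersection would be the whole type instead of
      \<open>X\<close>.\<close>
    define V where "V = (if F = {} then X else (\<Inter>q\<in>F. {g\<in>X. q (g - f) < d}))"
    have "openin (seminorm_topology X Q) V"
    proof (cases "F = {}")
      case True
      then show ?thesis using openin_topspace[of "seminorm_topology X Q"] ts by (simp add: V_def)
    next
      case False
      have "openin (seminorm_topology X Q) {g\<in>X. q (g - f) < d}" if "q \<in> F" for q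
        unfolding seminorm_topology_def
        by (rule topology_generated_by_Basis) (use that F f d in blast)
      then have "openin (seminorm_topology X Q) (\<Inter>q\<in>F. {g\<in>X. q (g - f) < d})"
        using False F(1) by (intro openin_Inter) auto
      then show ?thesis using False by (simp add: V_def)
    qed
    moreover have "f \<in> V"
    proof -
      have "q (f - f) < d" if "q \<in> F" for q
        using seminorm_on_zero[OF Q[of q] cfun.subspace_0[OF X]] that F(2) d by auto
      then show ?thesis using f by (auto simp: V_def)
    qed
    moreover have "g \<in> {f\<in>X. T f \<in> U}" if g: "g \<in> V" for g
    proof -
      have gX: "g \<in> X" and gq: "\<And>q. q \<in> F \<Longrightarrow> q (g - f) < d"
        using g by (auto simp: V_def split: if_splits)
      have gf: "g - f \<in> X" using cfun.subspace_diff[OF X gX] f by blast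
      have s0: "0 \<le> (\<Sum>q\<in>F. q (g - f))"
        using seminorm_on_nonneg[OF Q X gf] F(2) by (intro sum_nonneg) blast
      have "cmod (T g - T f) = cmod (T (g - f))"
        using clinear_functional_on_diff[OF T X gX] f by simp
      also have "\<dots> \<le> C * (\<Sum>q\<in>F. q (g - f))" by (rule F(3)[OF gf])
      also have "\<dots> \<le> \<bar>C\<bar> * (\<Sum>q\<in>F. q (g - f))" using s0 by (intro mult_right_mono) auto
      also have "\<dots> \<le> \<bar>C\<bar> * (\<Sum>q\<in>F. d)" using gq by (intro mult_left_mono sum_mono) (auto intro: less_imp_le)
      also have "\<dots> = \<bar>C\<bar> * real (card F) * d" by simp
      also have "\<dots> < ((\<bar>C\<bar> + 1) * (real (card F) + 1)) * d"
        using d by (intro mult_strict_right_mono) (auto simp: algebra_simps add_pos_nonneg)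
      also have "\<dots> = e" unfolding d_def by (simp add: add_nonneg_eq_0_iff)
      finally show ?thesis using e(2) gX by (auto simp: dist_norm norm_minus_commute)
    qed
    ultimately show "\<exists>S. openin (seminorm_topology X Q) S \<and> f \<in> S \<and> S \<subseteq> {f\<in>X. T f \<in> U}"
      by blast
  qed
  then show ?thesis unfolding continuous_map_def ts by simp
qed

lemma closedin_kernel:
  assumes "continuous_map \<T> euclidean T"
  shows "closedin \<T> {f \<in> topspace \<T>. T f = (0::complex)}"
  using closedin_continuous_map_preimage[OF assms, of "{0}"] by simp

section \<open>Hahn-Banach separation of a point from a closed subspace\<close>

text \<open>The real-linear separation is obtained from a subspace that is maximal among those at
  distance at least one from the given vector: such a subspace is a hyperplane.\<close>

lemma real_separation:
  fixes x0 :: "'a \<Rightarrow> complex"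
  defines "rsub \<equiv> \<lambda>M :: ('a \<Rightarrow> complex) set. 0 \<in> M \<and> (\<forall>f\<in>M. \<forall>g\<in>M. f + g \<in> M) \<and>
             (\<forall>c::real. \<forall>f\<in>M. (\<lambda>x. of_real c * f x) \<in> M)"
  assumes p: "seminorm_on X p" and X: "cfun.subspace X" and J: "cfun.subspace J" "J \<subseteq> X"
    and x0: "x0 \<in> X" "\<And>g. g \<in> J \<Longrightarrow> 1 \<le> p (x0 - g)"
  shows "\<exists>u::('a \<Rightarrow> complex) \<Rightarrow> real.
     (\<forall>f\<in>X. \<forall>g\<in>X. u (f + g) = u f + u g) \<and>
     (\<forall>c::real. \<forall>f\<in>X. u (\<lambda>x. of_real c * f x) = c * u f) \<and>
     (\<forall>f\<in>X. \<bar>u f\<bar> \<le> p f) \<and> (\<forall>f\<in>J. u f = 0) \<and> u x0 = 1"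
proof -
  define sc where "sc = (\<lambda>(c::real) (f::'a \<Rightarrow> complex) x. of_real c * f x)"
  define \<A> where "\<A> = {M. rsub M \<and> J \<subseteq> M \<and> M \<subseteq> X \<and> (\<forall>m\<in>M. 1 \<le> p (x0 - m))}"
  have scX: "sc c f \<in> X" if "f \<in> X" for c f
    using cfun.subspace_scale[OF X that, of "of_real c"] by (simp add: sc_def)
  have psc: "p (sc c f) = \<bar>c\<bar> * p f" if "f \<in> X" for c f
    using conjunct2[OF p[unfolded seminorm_on_def], rule_format, OF that, of "of_real c"]
    by (simp add: sc_def)
  have padd: "p (f + g) \<le> p f + p g" if "f \<in> X" "g \<in> X" for f g
    using p that unfolding seminorm_on_def by blast
  have sc_eqs: "sc c (f + g) = sc c f + sc c g" "sc c (f - g) = sc c f - sc c g"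
    "sc c (sc d f) = sc (c * d) f" "sc (c + d) f = sc c f + sc d f"
    "sc (c - d) f = sc c f - sc d f" "sc 1 f = f" "sc 0 f = 0" "sc (-1) f = - f"
    for c d f g
    by ((rule ext, simp add: sc_def distrib_left distrib_right right_diff_distrib left_diff_distrib)+)
  have XD: "f + g \<in> X" "f - g \<in> X" if "f \<in> X" "g \<in> X" for f g
    using that cfun.subspace_add[OF X] cfun.subspace_diff[OF X] by blast+
  have JA: "J \<in> \<A>"
    using J x0 cfun.subspace_0[OF J(1)] cfun.subspace_add[OF J(1)] cfun.subspace_scale[OF J(1)]
    by (auto simp: \<A>_def rsub_def)
  have "\<exists>M\<in>\<A>. \<forall>N\<in>\<A>. M \<subseteq> N \<longrightarrow> N = M"
  proof (rule subset_Zorn_nonempty)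
    show "\<A> \<noteq> {}" using JA by blast
  next
    fix \<C> assume ne: "\<C> \<noteq> {}" and ch: "subset.chain \<A> \<C>"
    have A: "\<And>M. M \<in> \<C> \<Longrightarrow> M \<in> \<A>" using ch by (auto simp: subset.chain_def)
    have "f + g \<in> \<Union>\<C>" if fg: "f \<in> \<Union>\<C>" "g \<in> \<Union>\<C>" for f g
    proof -
      obtain M N where MN: "M \<in> \<C>" "f \<in> M" "N \<in> \<C>" "g \<in> N" using fg by blast
      have "M \<subseteq> N \<or> N \<subseteq> M" using ch MN by (auto simp: subset.chain_def)
      then obtain L where L: "L \<in> \<C>" "f \<in> L" "g \<in> L" using MN by blast
      then have "f + g \<in> L" using A[OF L(1)] by (auto simp: \<A>_def rsub_def)
      then show ?thesis using L(1) by blast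
    qed
    moreover have "\<And>c f. f \<in> \<Union>\<C> \<Longrightarrow> (\<lambda>x. of_real c * f x) \<in> \<Union>\<C>"
      using A by (fastforce simp: \<A>_def rsub_def)
    moreover have "0 \<in> \<Union>\<C>" using ne A by (fastforce simp: \<A>_def rsub_def)
    ultimately have "rsub (\<Union>\<C>)" unfolding rsub_def by blast
    moreover have "J \<subseteq> \<Union>\<C>" "\<Union>\<C> \<subseteq> X" "\<forall>m\<in>\<Union>\<C>. 1 \<le> p (x0 - m)"
      using ne A by (fastforce simp: \<A>_def)+
    ultimately show "\<Union>\<C> \<in> \<A>" unfolding \<A>_def by blast
  qed
  then obtain M where M: "M \<in> \<A>" and max: "\<And>N. N \<in> \<A> \<Longrightarrow> M \<subseteq> N \<Longrightarrow> N = M" by blast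
  have MX: "M \<subseteq> X" "J \<subseteq> M" and M0: "0 \<in> M" and Madd: "\<And>f g. f \<in> M \<Longrightarrow> g \<in> M \<Longrightarrow> f + g \<in> M"
    and Msc: "\<And>c f. f \<in> M \<Longrightarrow> sc c f \<in> M" and Mp: "\<And>m. m \<in> M \<Longrightarrow> 1 \<le> p (x0 - m)"
    using M by (auto simp: \<A>_def rsub_def sc_def)
  have Mneg: "- f \<in> M" if "f \<in> M" for f using Msc[OF that, of "-1"] by (simp add: sc_eqs)
  have Mdiff: "f - g \<in> M" if "f \<in> M" "g \<in> M" for f g
    using Madd[OF that(1) Mneg[OF that(2)]] by simp
  \<comment> \<open>Homogeneity: for \<open>c \<noteq> 0\<close> divide by \<open>c\<close> and use
    that \<open>- m / c\<close> belongs to \<open>M\<close> and hence has distance at least 1 from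
    \<open>x0\<close>.\<close>
  have pM: "\<bar>c\<bar> \<le> p (m + sc c x0)" if "m \<in> M" for c m
  proof (cases "c = 0")
    case True
    have "m + sc c x0 \<in> X" using that MX scX[OF x0(1)] XD by blast
    then show ?thesis using True seminorm_on_nonneg[OF p X] by simp
  next
    case False
    have m': "- sc (1/c) m \<in> M" using Mneg Msc that by blast
    have "m + sc c x0 = sc c (x0 - (- sc (1/c) m))"
      using False by (auto simp: sc_def fun_eq_iff algebra_simps)
    moreover have "x0 - (- sc (1/c) m) \<in> X" using m' MX x0 XD by blast
    ultimately have "p (m + sc c x0) = \<bar>c\<bar> * p (x0 - (- sc (1/c) m))" using psc by simp
    then show ?thesis using Mp[OF m'] by (metis abs_ge_zero mult.right_neutral mult_left_mono)
  qed
  \<comment> \<open>Otherwise \<open>M\<close> could be enlarged by the line through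
    \<open>y - L * x0\<close>, with a real \<open>L\<close> that keeps the distance from
    \<open>x0\<close> at least 1, against maximality.\<close>
  have hyper: "\<exists>m\<in>M. \<exists>c. y = m + sc c x0" if y: "y \<in> X" for y
  proof (rule ccontr)
    assume no: "\<not> ?thesis"
    define L where "L = (SUP (m,c)\<in>M \<times> UNIV. c - p (m + sc c x0 - y))"
    \<comment> \<open>As in the one-step Hahn-Banach extension, this leaves room for
      \<open>L\<close> between two families of numbers: in the sum of the two vectors
      \<open>y\<close> cancels, and \<open>pM\<close> applies.\<close>
    have le: "c - p (m + sc c x0 - y) \<le> p (m' + sc c' x0 + y) - c'"
      if "m \<in> M" "m' \<in> M" for m m' c c'
    proof -
      have "m + sc c x0 - y \<in> X" "m' + sc c' x0 + y \<in> X"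
        using that MX y scX[OF x0(1)] by (meson XD subsetD)+
      then have "p ((m + sc c x0 - y) + (m' + sc c' x0 + y)) \<le>
          p (m + sc c x0 - y) + p (m' + sc c' x0 + y)" by (rule padd)
      moreover have "(m + sc c x0 - y) + (m' + sc c' x0 + y) = (m + m') + sc (c + c') x0"
        by (simp add: sc_eqs)
      moreover have "\<bar>c + c'\<bar> \<le> p ((m + m') + sc (c + c') x0)" using pM Madd that by blast
      ultimately show ?thesis by auto
    qed
    have bdd: "bdd_above ((\<lambda>(m,c). c - p (m + sc c x0 - y)) ` (M \<times> UNIV))"
    proof (rule bdd_aboveI2[where M="p (0 + sc 0 x0 + y) - 0"])
      fix mc :: "('a \<Rightarrow> complex) \<times> real" assume "mc \<in> M \<times> UNIV"
      then show "(case mc of (m, c) \<Rightarrow> c - p (m + sc c x0 - y)) \<le> p (0 + sc 0 x0 + y) - 0"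
        using le[OF _ M0] by (cases mc) (simp only: split_conv mem_Times_iff fst_conv)
    qed
    have L1: "c - p (m + sc c x0 - y) \<le> L" if "m \<in> M" for m c
      unfolding L_def using cSUP_upper[OF _ bdd, of "(m,c)"] that by (simp only: split_conv mem_Times_iff fst_conv snd_conv UNIV_I simp_thms)
    have L2: "L \<le> p (m' + sc c' x0 + y) - c'" if "m' \<in> M" for m' c'
      unfolding L_def
    proof (rule cSUP_least)
      show "M \<times> UNIV \<noteq> {}" using M0 by blast
      fix mc :: "('a \<Rightarrow> complex) \<times> real" assume "mc \<in> M \<times> UNIV"
      then show "(case mc of (m, c) \<Rightarrow> c - p (m + sc c x0 - y)) \<le> p (m' + sc c' x0 + y) - c'"
        using le[OF _ that] by (cases mc) (simp only: split_conv mem_Times_iff fst_conv)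
    qed
    define z where "z = y - sc L x0"
    have zX: "z \<in> X" using y scX[OF x0(1)] XD by (simp add: z_def)
    define N where "N = {m + sc \<mu> z | m \<mu>. m \<in> M}"
    have "N \<in> \<A>"
    proof -
      have "0 \<in> N" unfolding N_def using M0 sc_eqs(7) by (intro CollectI exI[of _ 0]) auto
      moreover have "f + g \<in> N" if "f \<in> N" "g \<in> N" for f g
      proof -
        obtain m \<mu> m' \<mu>' where "m \<in> M" "m' \<in> M" "f = m + sc \<mu> z" "g = m' + sc \<mu>' z"
          using \<open>f \<in> N\<close> \<open>g \<in> N\<close> unfolding N_def by blast
        then have "f + g = (m + m') + sc (\<mu> + \<mu>') z" "m + m' \<in> M"
          using Madd by (auto simp: sc_eqs)
        then show ?thesis unfolding N_def by blast
      qed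
      moreover have "sc c f \<in> N" if "f \<in> N" for c f
      proof -
        obtain m \<mu> where "m \<in> M" "f = m + sc \<mu> z" using \<open>f \<in> N\<close> unfolding N_def by blast
        then have "sc c f = sc c m + sc (c * \<mu>) z" "sc c m \<in> M" using Msc by (auto simp: sc_eqs)
        then show ?thesis unfolding N_def by blast
      qed
      ultimately have "rsub N" by (auto simp: rsub_def sc_def)
      moreover have MN: "M \<subseteq> N"
        unfolding N_def by (auto intro!: exI[of _ "0::real"] simp: sc_eqs)
      moreover have "N \<subseteq> X" using MX zX scX XD unfolding N_def by blast
      moreover have "1 \<le> p (x0 - f)" if f: "f \<in> N" for f
      proof -
        obtain m \<mu> where m: "m \<in> M" "f = m + sc \<mu> z" using f unfolding N_def by blast
        \<comment> \<open>After division by \<open>\<bar>\<mu>\<bar>\<close>, positive \<mu> is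
          settled by \<open>L1\<close> and negative \<mu> by \<open>L2\<close>.\<close>
        consider "\<mu> = 0" | "\<mu> > 0" | "\<mu> < 0" by linarith
        then show ?thesis
        proof cases
          case 1 then show ?thesis using m Mp by (simp add: sc_eqs)
        next
          case 2
          define c m' where "c = (1 + \<mu> * L) / \<mu>" and "m' = sc (- (1/\<mu>)) m"
          have "m' \<in> M" using m Msc by (simp add: m'_def)
          have eq: "x0 - f = sc \<mu> (m' + sc c x0 - y)"
            using 2 unfolding m c_def m'_def z_def by (auto simp: sc_def fun_eq_iff field_simps)
          have "m' + sc c x0 - y \<in> X" using \<open>m' \<in> M\<close> MX y scX[OF x0(1)] by (meson XD subsetD)
          then have "p (x0 - f) = \<mu> * p (m' + sc c x0 - y)" using psc 2 eq by simp
          moreover have "c - L \<le> p (m' + sc c x0 - y)" using L1[OF \<open>m' \<in> M\<close>, of c] by simp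
          moreover have "\<mu> * (c - L) = 1" using 2 by (simp add: c_def field_simps)
          ultimately show ?thesis using 2 by (metis mult_le_cancel_left_pos)
        next
          case 3
          define c m' where "c = (1 + \<mu> * L) / (-\<mu>)" and "m' = sc (1/\<mu>) m"
          have "m' \<in> M" using m Msc by (simp add: m'_def)
          have eq: "x0 - f = sc (-\<mu>) (m' + sc c x0 + y)"
            using 3 unfolding m c_def m'_def z_def by (auto simp: sc_def fun_eq_iff field_simps)
          have "m' + sc c x0 + y \<in> X" using \<open>m' \<in> M\<close> MX y scX[OF x0(1)] by (meson XD subsetD)
          then have "p (x0 - f) = (-\<mu>) * p (m' + sc c x0 + y)" using psc 3 eq by simp
          moreover have "c + L \<le> p (m' + sc c x0 + y)" using L2[OF \<open>m' \<in> M\<close>, of c] by simp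
          moreover have "(-\<mu>) * (c + L) = 1" using 3 by (simp add: c_def field_simps)
          ultimately show ?thesis using 3 by (metis mult_le_cancel_left_pos neg_0_less_iff_less)
        qed
      qed
      ultimately show ?thesis using MX unfolding \<A>_def by blast
    qed
    moreover have "M \<subseteq> N"
      unfolding N_def by (auto intro!: exI[of _ "0::real"] simp: sc_eqs)
    ultimately have "N = M" using max by blast
    moreover have "z \<in> N" unfolding N_def using M0 sc_eqs(6)[of z]
      by (intro CollectI exI[of _ 0] exI[of _ 1]) simp
    ultimately have "z \<in> M" by simp
    moreover have "y = z + sc L x0" by (simp add: z_def)
    ultimately show False using no by blast
  qed
  \<comment> \<open>The coordinate along \<open>x0\<close> in the decomposition of \<open>X\<close>
    into \<open>M\<close> and the line through \<open>x0\<close>; both its uniqueness and its bound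
    by \<open>p\<close> come from \<open>pM\<close>.\<close>
  define u where "u = (\<lambda>f. THE c. \<exists>m\<in>M. f = m + sc c x0)"
  have uI: "u f = c" if "m \<in> M" "f = m + sc c x0" for f m c
    unfolding u_def
  proof (rule the_equality)
    show "\<exists>m\<in>M. f = m + sc c x0" using that by blast
  next
    fix d assume "\<exists>m\<in>M. f = m + sc d x0"
    then obtain m' where m': "m' \<in> M" "f = m' + sc d x0" by blast
    have "(m - m') + sc (c - d) x0 = 0" using that(2) m'(2)
      by (simp add: sc_eqs algebra_simps)
    then have "\<bar>c - d\<bar> \<le> p 0" using pM[OF Mdiff[OF that(1) m'(1)], of "c - d"] by simp
    then show "d = c" using seminorm_on_zero[OF p cfun.subspace_0[OF X]] by simp
  qed
  have "u (f + g) = u f + u g" if "f \<in> X" "g \<in> X" for f g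
  proof -
    obtain m m' c c' where mm: "m \<in> M" "f = m + sc c x0" "m' \<in> M" "g = m' + sc c' x0"
      using hyper \<open>f \<in> X\<close> \<open>g \<in> X\<close> by meson
    have "u (f + g) = c + c'"
      by (rule uI[of "m + m'"]) (use mm Madd in \<open>auto simp: sc_eqs\<close>)
    then show ?thesis using uI[OF mm(1,2)] uI[OF mm(3,4)] by simp
  qed
  moreover have "u (\<lambda>x. of_real d * f x) = d * u f" if "f \<in> X" for f d
  proof -
    obtain m c where mm: "m \<in> M" "f = m + sc c x0" using hyper \<open>f \<in> X\<close> by meson
    have "u (sc d f) = d * c"
      by (rule uI[of "sc d m"]) (use mm Msc in \<open>auto simp: sc_eqs\<close>)
    then show ?thesis using uI[OF mm] by (simp add: sc_def)
  qed
  moreover have "\<bar>u f\<bar> \<le> p f" if "f \<in> X" for f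
  proof -
    obtain m c where mm: "m \<in> M" "f = m + sc c x0" using hyper \<open>f \<in> X\<close> by meson
    then show ?thesis using uI[OF mm] pM[OF mm(1), of c] by simp
  qed
  moreover have "u f = 0" if "f \<in> J" for f
    by (rule uI[of f]) (use that MX in \<open>auto simp: sc_eqs\<close>)
  moreover have "u x0 = 1"
    by (rule uI[of 0]) (use M0 in \<open>auto simp: sc_eqs\<close>)
  ultimately show ?thesis by blast
qed

text \<open>A complex-linear functional is determined by its real part, and
  \<open>u f - \<i> * u (\<i> * f)\<close> is the one with real part \<open>u\<close>. It vanishes
  on \<open>J\<close> because \<open>J\<close> is stable under multiplication by \<i>; the factor 2
  comes from estimating the two parts separately.\<close>

lemma complex_separation:
  assumes p: "seminorm_on X p" and X: "cfun.subspace X" and J: "cfun.subspace J" "J \<subseteq> X"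
    and x0: "x0 \<in> X" "\<And>g. g \<in> J \<Longrightarrow> 1 \<le> p (x0 - g)"
  shows "\<exists>T. clinear_functional_on X T \<and> (\<forall>f\<in>X. cmod (T f) \<le> 2 * p f) \<and> (\<forall>f\<in>J. T f = 0) \<and> T x0 \<noteq> 0"
proof -
  obtain u :: "('a \<Rightarrow> complex) \<Rightarrow> real" where
    add: "\<And>f g. f \<in> X \<Longrightarrow> g \<in> X \<Longrightarrow> u (f + g) = u f + u g"
    and sc: "\<And>c f. f \<in> X \<Longrightarrow> u (\<lambda>x. of_real c * f x) = c * u f"
    and le: "\<And>f. f \<in> X \<Longrightarrow> \<bar>u f\<bar> \<le> p f" and uJ: "\<And>f. f \<in> J \<Longrightarrow> u f = 0" and u0: "u x0 = 1"
    using real_separation[OF p X J x0] by metis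
  define T where "T = (\<lambda>f. complex_of_real (u f) - \<i> * of_real (u (\<lambda>x. \<i> * f x)))"
  have iX: "(\<lambda>x. c * f x) \<in> X" if "f \<in> X" for f c
    using cfun.subspace_scale[OF X that] .
  have "T (f + g) = T f + T g" if "f \<in> X" "g \<in> X" for f g
  proof -
    have "(\<lambda>x. \<i> * (f + g) x) = (\<lambda>x. \<i> * f x) + (\<lambda>x. \<i> * g x)"
      by (auto simp: fun_eq_iff algebra_simps)
    then show ?thesis unfolding T_def using add that iX by (simp add: algebra_simps)
  qed
  moreover have "T (\<lambda>x. c * f x) = c * T f" if f: "f \<in> X" for c f
  proof -
    have 1: "(\<lambda>x. c * f x) = (\<lambda>x. of_real (Re c) * f x) + (\<lambda>x. of_real (Im c) * (\<i> * f x))"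
      using complex_eq[of c] by (auto simp: fun_eq_iff algebra_simps)
         (metis (no_types, lifting) distrib_right mult.commute mult.left_commute)
    have 2: "(\<lambda>x. \<i> * (c * f x)) = (\<lambda>x. of_real (Re c) * (\<i> * f x)) + (\<lambda>x. of_real (- Im c) * f x)"
    proof
      fix x
      have "c = of_real (Re c) + \<i> * of_real (Im c)" by (rule complex_eq)
      then have "\<i> * (c * f x) = \<i> * ((of_real (Re c) + \<i> * of_real (Im c)) * f x)" by simp
      then show "\<i> * (c * f x) = ((\<lambda>x. of_real (Re c) * (\<i> * f x)) + (\<lambda>x. of_real (- Im c) * f x)) x"
        by (simp add: algebra_simps)
    qed
    have "u (\<lambda>x. c * f x) = Re c * u f + Im c * u (\<lambda>x. \<i> * f x)"
      unfolding 1 using add sc f iX[OF f, of \<i>] iX[of "\<lambda>x. \<i> * f x" "of_real (Im c)"] iX[OF f] by metis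
    moreover have "u (\<lambda>x. \<i> * (c * f x)) = Re c * u (\<lambda>x. \<i> * f x) - Im c * u f"
      unfolding 2 using add[OF iX[OF iX[OF f, of \<i>]] iX[OF f], of "of_real (Re c)" "of_real (- Im c)"]
        sc[OF iX[OF f, of \<i>], of "Re c"] sc[OF f, of "- Im c"] by simp
    ultimately show ?thesis unfolding T_def
      by (simp add: complex_eq_iff)
  qed
  ultimately have "clinear_functional_on X T" unfolding clinear_functional_on_def by blast
  moreover have "cmod (T f) \<le> 2 * p f" if f: "f \<in> X" for f
  proof -
    have "p (\<lambda>x. \<i> * f x) = p f" using p f unfolding seminorm_on_def by simp
    then have "\<bar>u (\<lambda>x. \<i> * f x)\<bar> \<le> p f" using le[OF iX[OF f, of \<i>]] by simp
    moreover have "cmod (T f) \<le> \<bar>u f\<bar> + \<bar>u (\<lambda>x. \<i> * f x)\<bar>"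
      unfolding T_def by (rule order_trans[OF norm_triangle_ineq4]) (simp add: norm_mult)
    ultimately show ?thesis using le[OF f] by simp
  qed
  moreover have "T f = 0" if "f \<in> J" for f
    using uJ[OF that] uJ[OF cfun.subspace_scale[OF J(1) that, of \<i>]] by (simp add: T_def)
  moreover have "Re (T x0) = 1" by (simp add: T_def u0)
  then have "T x0 \<noteq> 0" by auto
  ultimately show ?thesis by blast
qed

lemma closed_subspace_separation:
  assumes Q: "\<And>q. q \<in> Q \<Longrightarrow> seminorm_on X q" and X: "cfun.subspace X" and ne: "Q \<noteq> {}"
    and J: "cfun.subspace J" "closedin (seminorm_topology X Q) J" and x0: "x0 \<in> X" "x0 \<notin> J"
  shows "\<exists>T F C. clinear_functional_on X T \<and> (\<forall>f\<in>J. T f = 0) \<and> T x0 \<noteq> 0 \<and>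
           finite F \<and> F \<subseteq> Q \<and> (\<forall>f\<in>X. cmod (T f) \<le> C * (\<Sum>q\<in>F. q f))"
proof -
  have ts: "topspace (seminorm_topology X Q) = X"
    using topspace_seminorm_topology[of X _ Q] Q ne cfun.subspace_0[OF X] by blast
  have JX: "J \<subseteq> X" using closedin_subset[OF J(2)] ts by simp
  have op: "openin (seminorm_topology X Q) (X - J)"
    using J(2) ts by (metis closedin_def)
  have "\<exists>F e. finite F \<and> F \<subseteq> Q \<and> 0 < e \<and>
      (\<forall>g\<in>X. (\<forall>q\<in>F. q (g - x0) < e) \<longrightarrow> g \<in> X - J)"
    by (rule seminorm_topology_nhds[OF _ X op]) (use x0 Q in auto)
  then obtain F e where F: "finite F" "F \<subseteq> Q" "0 < e"
      "\<forall>g\<in>X. (\<forall>q\<in>F. q (g - x0) < e) \<longrightarrow> g \<in> X - J"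
    by (elim exE conjE)
  have Fq: "\<And>q. q \<in> F \<Longrightarrow> seminorm_on X q" using F(2) Q by blast
  let ?p = "\<lambda>f. \<Sum>q\<in>F. q f"
  \<comment> \<open>The points within \<open>e\<close> of \<open>x0\<close> for all seminorms of
    \<open>F\<close> avoid \<open>J\<close>; dividing the sum by \<open>e\<close> turns this into
    distance at least 1 from \<open>J\<close>.\<close>
  define p where "p = (\<lambda>f. ?p f / e)"
  have p0: "seminorm_on X ?p" by (rule seminorm_on_sum[OF F(1) Fq])
  then have p: "seminorm_on X p" using F(3) unfolding p_def seminorm_on_def
    by (auto simp: divide_right_mono add_divide_distrib[symmetric])
  have ge: "1 \<le> p (x0 - g)" if g: "g \<in> J" for g
  proof -
    have gX: "g \<in> X" using g JX by blast
    obtain q where q: "q \<in> F" "e \<le> q (g - x0)" using F(4) gX g by (meson DiffD2 not_less)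
    have "q (g - x0) \<le> ?p (g - x0)"
      using seminorm_on_nonneg[OF Fq X cfun.subspace_diff[OF X gX x0(1)]] q(1) F(1)
      by (intro member_le_sum) auto
    also have "\<dots> = ?p (x0 - g)" by (rule seminorm_on_minus_commute[OF p0 X gX x0(1)])
    finally show ?thesis using q(2) F(3) by (simp add: p_def)
  qed
  obtain T where "clinear_functional_on X T" "\<forall>f\<in>X. cmod (T f) \<le> 2 * p f" "\<forall>f\<in>J. T f = 0" "T x0 \<noteq> 0"
    using complex_separation[OF p X J(1) JX x0(1) ge] by blast
  then show ?thesis using F
    by (intro exI[of _ T] exI[of _ F] exI[of _ "2 / e"]) (auto simp: p_def)
qed

section \<open>Entire functions of small type with rapid decay\<close>

lemma norm_sin_le_exp: "cmod (sin z) \<le> exp \<bar>Im z\<bar>"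
proof -
  have "sin z = (exp (\<i> * z) - exp (- (\<i> * z))) / (2 * \<i>)" by (simp add: sin_exp_eq)
  then have "cmod (sin z) = cmod (exp (\<i> * z) - exp (- (\<i> * z))) / 2"
    by (simp only: norm_divide norm_mult) simp
  also have "\<dots> \<le> (exp (- Im z) + exp (Im z)) / 2"
    by (rule divide_right_mono, rule order_trans[OF norm_triangle_ineq4]) (simp_all add: norm_exp_eq_Re)
  also have "\<dots> \<le> exp \<bar>Im z\<bar>" by (cases "Im z \<ge> 0") auto
  finally show ?thesis .
qed

lemma norm_cos_le_exp: "cmod (cos z) \<le> exp \<bar>Im z\<bar>"
proof -
  have "cos z = (exp (\<i> * z) + exp (- (\<i> * z))) / 2" by (simp add: cos_exp_eq)
  then have "cmod (cos z) = cmod (exp (\<i> * z) + exp (- (\<i> * z))) / 2"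
    by (simp only: norm_divide norm_mult) simp
  also have "\<dots> \<le> (exp (- Im z) + exp (Im z)) / 2"
    by (rule divide_right_mono, rule order_trans[OF norm_triangle_ineq]) (simp_all add: norm_exp_eq_Re)
  also have "\<dots> \<le> exp \<bar>Im z\<bar>" by (cases "Im z \<ge> 0") auto
  finally show ?thesis .
qed

lemma norm_exp_minus_one_le: "cmod (exp z - 1) \<le> exp (cmod z) - 1"
proof -
  have s: "(\<lambda>n. z ^ (n + 1) /\<^sub>R fact (n + 1)) sums (exp z - 1)"
    using sums_split_initial_segment[OF exp_converges[of z], of 1] by simp
  have s': "(\<lambda>n. cmod z ^ (n + 1) /\<^sub>R fact (n + 1)) sums (exp (cmod z) - 1)"
    using sums_split_initial_segment[OF exp_converges[of "cmod z"], of 1] by simp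
  have "cmod (\<Sum>n. z ^ (n + 1) /\<^sub>R fact (n + 1)) \<le> (\<Sum>n. cmod z ^ (n + 1) /\<^sub>R fact (n + 1))"
    by (rule order_trans[OF summable_norm])
       (use sums_summable[OF s'] in \<open>auto simp: norm_mult norm_power\<close>)
  then show ?thesis using sums_unique[OF s] sums_unique[OF s'] by simp
qed

text \<open>The mean of \<open>exp (-\<i> * z * t)\<close> over \<open>t\<close> between -1 and 1,
  hence an entire function of exponential type 1 that is bounded on the real axis.\<close>

definition csinc :: "complex \<Rightarrow> complex" where
  "csinc z = (if z = 0 then 1 else sin z / z)"

lemma csinc_0 [simp]: "csinc 0 = 1" by (simp add: csinc_def)

text \<open>The singularity at 0 is removable because \<open>sin z / z\<close> is the difference
  quotient of the sine there.\<close>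

lemma holomorphic_csinc [holomorphic_intros]:
  assumes "f holomorphic_on A"
  shows "(\<lambda>x. csinc (f x)) holomorphic_on A"
proof -
  have lim: "((\<lambda>z::complex. sin z / z) \<longlongrightarrow> 1) (at 0)"
    using DERIV_sin[of "0::complex"] by (simp add: DERIV_def)
  have "csinc holomorphic_on UNIV - {0}"
    by (rule holomorphic_transform[of "\<lambda>z. sin z / z"]) (auto intro!: holomorphic_intros simp: csinc_def)
  moreover have "isCont csinc w" for w
  proof (cases "w = 0")
    case True
    have "(csinc \<longlongrightarrow> 1) (at 0)"
      by (rule Lim_transform_eventually[OF lim]) (auto simp: eventually_at csinc_def intro: exI[of _ 1])
    then show ?thesis using True by (simp add: isCont_def)
  next
    case False
    have "csinc analytic_on {w}"
      using \<open>csinc holomorphic_on UNIV - {0}\<close> False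
      by (auto simp: analytic_at intro!: exI[of _ "UNIV - {0}"])
    then show ?thesis by (simp add: analytic_at_imp_isCont)
  qed
  then have "continuous_on UNIV csinc" by (simp add: continuous_at_imp_continuous_on)
  ultimately have "csinc holomorphic_on UNIV"
    by (intro no_isolated_singularity[of UNIV csinc "{0}"]) auto
  then show ?thesis using holomorphic_on_compose_gen[OF assms, of csinc UNIV] by (simp add: o_def)
qed

lemma norm_csinc_le: "cmod (csinc z) \<le> exp \<bar>Im z\<bar>"
proof (cases "z = 0")
  case False
  have "cmod (sin z - sin 0) \<le> exp \<bar>Im z\<bar> * cmod (z - 0)"
  proof (rule field_differentiable_bound[of "closed_segment 0 z"])
    fix w :: complex assume w: "w \<in> closed_segment 0 z"
    show "(sin has_field_derivative cos w) (at w within closed_segment 0 z)"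
      by (rule DERIV_subset[OF DERIV_sin]) simp
    obtain t where "0 \<le> t" "t \<le> 1" "w = of_real t * z"
      using w by (auto simp: in_segment scaleR_conv_of_real)
    then have "\<bar>Im w\<bar> \<le> \<bar>Im z\<bar>" by (simp add: abs_mult mult_left_le_one_le)
    then show "cmod (cos w) \<le> exp \<bar>Im z\<bar>" using norm_cos_le_exp[of w] by (meson exp_le_cancel_iff order_trans)
  qed auto
  then show ?thesis using False by (simp add: csinc_def norm_divide field_simps)
qed simp

lemma norm_csinc_le_inverse:
  assumes "0 < R" "R \<le> cmod z"
  shows "cmod (csinc z) \<le> exp \<bar>Im z\<bar> / R"
proof -
  have z: "z \<noteq> 0" using assms by auto
  have "cmod (csinc z) \<le> exp \<bar>Im z\<bar> / cmod z"
    using norm_sin_le_exp[of z] z by (simp add: csinc_def norm_divide divide_right_mono)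
  also have "\<dots> \<le> exp \<bar>Im z\<bar> / R" using assms by (intro divide_left_mono mult_pos_pos) auto
  finally show ?thesis .
qed

text \<open>Mean value inequality for \<open>sin w - w\<close>, whose derivative
  \<open>cos w - 1\<close> is controlled by the exponential series. The bound is given the shape
  \<open>exp x - 1\<close> because this shape survives products.\<close>

lemma norm_csinc_minus_one_le: "cmod (csinc z - 1) \<le> exp (cmod z) - 1"
proof (cases "z = 0")
  case False
  have "cmod ((sin z - z) - (sin 0 - 0)) \<le> (exp (cmod z) - 1) * cmod (z - 0)"
  proof (rule field_differentiable_bound[of "cball 0 (cmod z)"])
    fix w :: complex assume w: "w \<in> cball 0 (cmod z)"
    show "((\<lambda>w. sin w - w) has_field_derivative (cos w - 1)) (at w within cball 0 (cmod z))"
      by (auto intro!: derivative_eq_intros)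
    have "cos w - 1 = ((exp (\<i> * w) - 1) + (exp (- (\<i> * w)) - 1)) / 2" by (simp add: cos_exp_eq field_simps)
    then have "cmod (cos w - 1) = cmod ((exp (\<i> * w) - 1) + (exp (- (\<i> * w)) - 1)) / 2"
      by (simp only: norm_divide) simp
    also have "\<dots> \<le> (cmod (exp (\<i> * w) - 1) + cmod (exp (- (\<i> * w)) - 1)) / 2"
      by (rule divide_right_mono, rule norm_triangle_ineq) simp
    also have "\<dots> \<le> exp (cmod w) - 1"
      using norm_exp_minus_one_le[of "\<i> * w"] norm_exp_minus_one_le[of "- (\<i> * w)"] by (simp add: norm_mult)
    also have "\<dots> \<le> exp (cmod z) - 1" using w by simp
    finally show "cmod (cos w - 1) \<le> exp (cmod z) - 1" .
  qed auto
  then have "cmod (sin z - z) / cmod z \<le> exp (cmod z) - 1" using False by (simp add: divide_le_eq)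
  moreover have "csinc z - 1 = (sin z - z) / z" using False by (simp add: csinc_def diff_divide_distrib)
  ultimately show ?thesis by (simp only: norm_divide)
qed simp

text \<open>Write \<open>a * b - 1\<close> as \<open>(a - 1) * (b - 1) + (a - 1) + (b - 1)\<close>;
  the same identity holds for \<open>exp x\<close> and \<open>exp y\<close>.\<close>

lemma norm_mult_minus_one_le:
  fixes a b :: complex
  assumes "cmod (a - 1) \<le> exp x - 1" "cmod (b - 1) \<le> exp y - 1"
  shows "cmod (a * b - 1) \<le> exp (x + y) - 1"
proof -
  have "cmod (a * b - 1) = cmod ((a - 1) * (b - 1) + (a - 1) + (b - 1))" by (simp add: algebra_simps)
  also have "\<dots> \<le> cmod (a - 1) * cmod (b - 1) + cmod (a - 1) + cmod (b - 1)"
    using norm_triangle_ineq[of "(a - 1) * (b - 1) + (a - 1)" "b - 1"]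
      norm_triangle_ineq[of "(a - 1) * (b - 1)" "a - 1"] unfolding norm_mult by linarith
  also have "\<dots> \<le> (exp x - 1) * (exp y - 1) + (exp x - 1) + (exp y - 1)"
    by (intro add_mono mult_mono assms) (use assms(1) norm_ge_zero order_trans in blast)+
  also have "\<dots> = exp (x + y) - 1" by (simp add: exp_add algebra_simps)
  finally show ?thesis .
qed

lemma norm_power_minus_one_le:
  fixes a :: complex
  assumes "cmod (a - 1) \<le> exp x - 1"
  shows "cmod (a ^ m - 1) \<le> exp (real m * x) - 1"
proof (induction m)
  case (Suc m)
  from norm_mult_minus_one_le[OF assms Suc] show ?case by (simp add: algebra_simps)
qed simp

text \<open>
  The function is a product of factors \<open>csinc (e z / 2\<^sup>k) ^ m k\<close>.  For \<open>2\<^sup>k \<le> |z| < 2\<^sup>k\<^sup>+\<^sup>1\<close>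
  already the single factor with index \<open>k\<close> yields the decay \<open>exp (- m k) \<le> exp (- \<Omega> |z|)\<close>.
\<close>

lemma exists_entire_decay:
  fixes \<Omega> :: "real \<Rightarrow> real"
  assumes mono: "\<And>x y. 0 \<le> x \<Longrightarrow> x \<le> y \<Longrightarrow> \<Omega> x \<le> \<Omega> y"
    and summ: "summable (\<lambda>k. \<Omega> (2 ^ (k + 1)) / 2 ^ k)"
    and pos: "\<And>x. 0 \<le> x \<Longrightarrow> 0 \<le> \<Omega> x" and \<delta>: "0 < \<delta>"
  shows "\<exists>h. h holomorphic_on UNIV \<and> h 0 = 1 \<and>
      (\<forall>z. cmod (h z) \<le> exp (\<delta> * \<bar>Im z\<bar>)) \<and> (\<forall>z. cmod (h z - 1) \<le> exp (\<delta> * cmod z) - 1) \<and>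
      (\<exists>C. \<forall>z. cmod (h z) \<le> C * exp (\<delta> * \<bar>Im z\<bar> - \<Omega> (cmod z)))"
proof -
  \<comment> \<open>The exponent is taken from the outer radius of the dyadic shell, so that by
    monotonicity \<open>exp (- m k)\<close> is at most \<open>exp (- \<Omega> (cmod z))\<close> on
    the whole shell.\<close>
  define m where "m = (\<lambda>k::nat. nat \<lceil>\<Omega> (2 ^ (k + 1))\<rceil>)"
  have m: "\<Omega> (2 ^ (k + 1)) \<le> real (m k)" "real (m k) \<le> \<Omega> (2 ^ (k + 1)) + 1" for k
    using pos[of "2 ^ (k + 1)"] unfolding m_def by (auto intro: of_int_ceiling_le_add_one)
  \<comment> \<open>The exponential type of the k-th factor. The dilation by
    \<open>exp 1 / 2 ^ k\<close> makes the argument at least \<open>exp 1\<close> in modulus on the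
    k-th shell, so there each cardinal sine gains a factor \<open>exp (-1)\<close>.\<close>
  define d where "d = (\<lambda>k. real (m k) * (exp 1 / 2 ^ k))"
  have d0: "0 \<le> d k" for k by (simp add: d_def)
  have sd: "summable d"
  proof (rule summable_comparison_test')
    have "summable (\<lambda>k. exp 1 * (\<Omega> (2 ^ (k + 1)) / 2 ^ k) + exp 1 * (1 / 2) ^ k)"
      by (intro summable_add summable_mult summ summable_geometric) auto
    then show "summable (\<lambda>k. exp 1 * (\<Omega> (2 ^ (k + 1)) / 2 ^ k + (1 / 2) ^ k))"
      by (simp add: distrib_left)
    show "norm (d k) \<le> exp 1 * (\<Omega> (2 ^ (k + 1)) / 2 ^ k + (1 / 2) ^ k)" if "k \<ge> 0" for k
    proof -
      have "norm (d k) = exp 1 * (real (m k) / 2 ^ k)" by (simp add: d_def)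
      also have "\<dots> \<le> exp 1 * ((\<Omega> (2 ^ (k + 1)) + 1) / 2 ^ k)"
        using m(2)[of k] by (intro mult_left_mono divide_right_mono) auto
      finally show ?thesis by (simp add: add_divide_distrib power_divide)
    qed
  qed
  \<comment> \<open>The product starts only at index \<open>k0\<close>, so that the types of its
    factors add up to less than \<delta>.\<close>
  obtain k0 where k0: "(\<Sum>i. d (i + k0)) < \<delta>"
    using suminf_exist_split[OF \<delta> sd] d0 by (metis abs_of_nonneg dual_order.refl real_norm_def
        suminf_nonneg summable_iff_shift sd)
  have sd': "summable (\<lambda>i. d (i + k0))" using sd by (simp add: summable_iff_shift)
  define D where "D = (\<lambda>N. \<Sum>i<N. d (i + k0))"
  have D: "D N \<le> \<delta>" for N
    using sum_le_suminf[OF sd', of "{..<N}"] d0 k0 unfolding D_def by auto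
  define g where "g = (\<lambda>i z. csinc (of_real (exp 1 / 2 ^ (i + k0)) * z) ^ m (i + k0))"
  define H where "H = (\<lambda>N z. \<Prod>i<N. g i z)"
  have gle: "cmod (g i z) \<le> exp (d (i + k0) * \<bar>Im z\<bar>)" for i z
  proof -
    have "cmod (csinc (of_real (exp 1 / 2 ^ (i + k0)) * z)) \<le> exp (exp 1 / 2 ^ (i + k0) * \<bar>Im z\<bar>)"
      using norm_csinc_le[of "of_real (exp 1 / 2 ^ (i + k0)) * z"]
      by (simp add: times_complex.sel abs_mult)
    then have "cmod (g i z) \<le> exp (exp 1 / 2 ^ (i + k0) * \<bar>Im z\<bar>) ^ m (i + k0)"
      unfolding g_def norm_power by (rule power_mono) simp
    then show ?thesis by (simp add: d_def exp_of_nat_mult[symmetric] mult_ac)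
  qed
  have Hle: "cmod (H N z) \<le> exp (\<delta> * \<bar>Im z\<bar>)" for N z
  proof -
    have "cmod (H N z) \<le> (\<Prod>i<N. exp (d (i + k0) * \<bar>Im z\<bar>))"
      unfolding H_def prod_norm[symmetric] by (intro prod_mono) (use gle in auto)
    also have "\<dots> = exp (D N * \<bar>Im z\<bar>)" by (simp add: D_def exp_sum sum_distrib_right)
    also have "\<dots> \<le> exp (\<delta> * \<bar>Im z\<bar>)" using D[of N] by (simp add: mult_right_mono)
    finally show ?thesis .
  qed
  have H1: "cmod (H N z - 1) \<le> exp (\<delta> * cmod z) - 1" for N z
  proof -
    have "cmod (H N z - 1) \<le> exp (D N * cmod z) - 1"
    proof (induction N)
      case (Suc N)
      have "cmod (g N z - 1) \<le> exp (real (m (N + k0)) * (exp 1 / 2 ^ (N + k0) * cmod z)) - 1"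
        unfolding g_def
        using norm_csinc_minus_one_le[of "of_real (exp 1 / 2 ^ (N + k0)) * z"]
        by (intro norm_power_minus_one_le) (simp add: norm_mult norm_divide norm_power)
      then have "cmod (g N z - 1) \<le> exp (d (N + k0) * cmod z) - 1" by (simp add: d_def mult_ac)
      from norm_mult_minus_one_le[OF Suc this] show ?case
        by (simp add: H_def D_def algebra_simps)
    qed (simp add: H_def D_def)
    also have "\<dots> \<le> exp (\<delta> * cmod z) - 1" using D[of N] by (simp add: mult_right_mono)
    finally show ?thesis .
  qed
  \<comment> \<open>In the disc of radius \<open>2 ^ k0\<close> no factor supplies decay; this
    constant makes up for it.\<close>
  define C where "C = exp (\<Omega> (2 ^ k0))"
  have C1: "1 \<le> C" using pos by (simp add: C_def)
  have HC: "\<exists>M. \<forall>N\<ge>M. cmod (H N z) \<le> C * exp (\<delta> * \<bar>Im z\<bar> - \<Omega> (cmod z))" for z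
  proof (cases "cmod z < 2 ^ k0")
    case True
    then have "\<Omega> (cmod z) \<le> \<Omega> (2 ^ k0)" by (intro mono) auto
    then have "exp (\<delta> * \<bar>Im z\<bar>) \<le> C * exp (\<delta> * \<bar>Im z\<bar> - \<Omega> (cmod z))"
      by (simp add: C_def exp_add[symmetric])
    then show ?thesis using Hle order_trans by blast
  next
    case False
    define k where "k = nat \<lfloor>log 2 (cmod z)\<rfloor>"
    have z1: "1 \<le> cmod z" using False one_le_power[of "2::real" k0] by linarith
    have fl: "real k \<le> log 2 (cmod z)" "log 2 (cmod z) < real k + 1"
      using z1 zero_le_log_cancel_iff[of 2 "cmod z"] unfolding k_def by linarith+
    have k: "2 ^ k \<le> cmod z" "cmod z < 2 ^ (k + 1)"
    proof -
      have z0: "0 < cmod z" using z1 by linarith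
      show "2 ^ k \<le> cmod z" using fl(1) le_log_iff[of 2 "cmod z" "real k"] z0 by (simp add: powr_realpow)
      have "cmod z < 2 powr (real k + 1)" using fl(2) log_less_iff[of 2 "cmod z"] z0 by simp
      then show "cmod z < 2 ^ (k + 1)" by (simp add: powr_add powr_realpow)
    qed
    have "(2::real) ^ k0 < 2 ^ (k + 1)" using False k(2) by linarith
    then have kk: "k0 \<le> k" using power_strict_increasing_iff[of "2::real" k0 "k + 1"] by simp
    define j where "j = k - k0"
    have jk: "j + k0 = k" using kk by (simp add: j_def)
    have "cmod (csinc (of_real (exp 1 / 2 ^ k) * z)) \<le> exp \<bar>Im (of_real (exp 1 / 2 ^ k) * z)\<bar> / exp 1"
      by (rule norm_csinc_le_inverse) (use k in \<open>auto simp: norm_mult norm_divide norm_power field_simps\<close>)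
    also have "\<dots> = exp (exp 1 / 2 ^ k * \<bar>Im z\<bar> - 1)"
      by (simp add: times_complex.sel abs_mult exp_diff)
    finally have "cmod (csinc (of_real (exp 1 / 2 ^ k) * z)) ^ m k \<le> exp (exp 1 / 2 ^ k * \<bar>Im z\<bar> - 1) ^ m k"
      by (rule power_mono) simp
    then have gj: "cmod (g j z) \<le> exp (d (j + k0) * \<bar>Im z\<bar> - m k)"
      by (simp add: g_def jk norm_power d_def exp_of_nat_mult[symmetric] algebra_simps)
    show ?thesis
    proof (intro exI[of _ "Suc j"] allI impI)
      fix N assume N: "Suc j \<le> N"
      \<comment> \<open>The factor belonging to the shell of \<open>z\<close> is split off: it
        provides the decay, and for the others the type bound is enough.\<close>
      have "cmod (H N z) = cmod (g j z) * (\<Prod>i\<in>{..<N} - {j}. cmod (g i z))"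
        unfolding H_def prod_norm[symmetric] by (rule prod.remove) (use N in auto)
      also have "\<dots> \<le> exp (d (j + k0) * \<bar>Im z\<bar> - m k) * (\<Prod>i\<in>{..<N} - {j}. exp (d (i + k0) * \<bar>Im z\<bar>))"
        by (intro mult_mono prod_mono gj conjI gle prod_nonneg) auto
      also have "\<dots> = exp (- real (m k)) * (exp (d (j + k0) * \<bar>Im z\<bar>) * (\<Prod>i\<in>{..<N} - {j}. exp (d (i + k0) * \<bar>Im z\<bar>)))"
        by (simp add: exp_diff exp_minus divide_inverse)
      also have "exp (d (j + k0) * \<bar>Im z\<bar>) * (\<Prod>i\<in>{..<N} - {j}. exp (d (i + k0) * \<bar>Im z\<bar>)) =
          (\<Prod>i<N. exp (d (i + k0) * \<bar>Im z\<bar>))"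
        by (rule prod.remove[symmetric]) (use N in auto)
      also have "\<dots> = exp (D N * \<bar>Im z\<bar>)" by (simp add: D_def exp_sum sum_distrib_right)
      also have "exp (- real (m k)) * exp (D N * \<bar>Im z\<bar>) \<le> exp (- \<Omega> (cmod z)) * exp (\<delta> * \<bar>Im z\<bar>)"
      proof -
        have "\<Omega> (cmod z) \<le> \<Omega> (2 ^ (k + 1))" using k(2) by (intro mono) auto
        also have "\<dots> \<le> real (m k)" by (rule m)
        finally show ?thesis using D[of N] by (intro mult_mono) (auto simp: mult_right_mono)
      qed
      also have "\<dots> \<le> C * (exp (- \<Omega> (cmod z)) * exp (\<delta> * \<bar>Im z\<bar>))" using C1 by simp
      finally show "cmod (H N z) \<le> C * exp (\<delta> * \<bar>Im z\<bar> - \<Omega> (cmod z))"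
        by (simp add: exp_diff exp_minus divide_inverse mult_ac)
    qed
  qed
  have Hhol: "H N holomorphic_on UNIV" for N
    unfolding H_def g_def by (intro holomorphic_intros)
  have bd: "\<exists>B. \<forall>f\<in>range H. \<forall>z\<in>K. cmod (f z) \<le> B" if "compact K" for K
  proof -
    obtain b where b: "\<forall>z\<in>K. cmod z \<le> b"
      using compact_imp_bounded[OF \<open>compact K\<close>] unfolding bounded_iff by (elim exE)
    have "cmod (H N z) \<le> exp (\<delta> * b)" if "z \<in> K" for N z
    proof -
      have "\<delta> * \<bar>Im z\<bar> \<le> \<delta> * b"
        using bspec[OF b that] abs_Im_le_cmod[of z] \<delta> by (intro mult_left_mono) auto
      then show ?thesis using Hle[of N z] by (meson exp_le_cancel_iff order_trans)
    qed
    then show ?thesis by (intro exI[of _ "exp (\<delta> * b)"]) auto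
  qed
  \<comment> \<open>Montel's theorem replaces a convergence proof for the infinite product: at fixed
    \<open>z\<close> each bound holds for all large \<open>N\<close> and hence for the limit of a
    subsequence.\<close>
  obtain h r where h: "h holomorphic_on UNIV" "strict_mono (r :: nat \<Rightarrow> nat)"
      "\<And>x. x \<in> UNIV \<Longrightarrow> ((\<lambda>n. H (r n) x) \<longlongrightarrow> h x) sequentially"
  proof (rule Montel[of UNIV "range H" H])
    show "f holomorphic_on UNIV" if "f \<in> range H" for f using that Hhol by auto
  qed (use bd in simp_all)
  have lim: "(\<lambda>n. cmod (H (r n) z)) \<longlonglongrightarrow> cmod (h z)" for z by (intro tendsto_norm h(3)) simp
  have "h 0 = 1"
  proof -
    have "H n 0 = 1" for n by (simp add: H_def g_def)
    then show ?thesis using h(3)[of 0] LIMSEQ_unique[of "\<lambda>n. 1" "h 0" 1] by simp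
  qed
  moreover have "cmod (h z) \<le> exp (\<delta> * \<bar>Im z\<bar>)" for z
    by (rule LIMSEQ_le_const2[OF lim]) (use Hle in blast)
  moreover have "cmod (h z - 1) \<le> exp (\<delta> * cmod z) - 1" for z
  proof (rule LIMSEQ_le_const2)
    show "(\<lambda>n. cmod (H (r n) z - 1)) \<longlonglongrightarrow> cmod (h z - 1)" by (intro tendsto_intros h(3)) simp
  qed (use H1 in blast)
  moreover have "cmod (h z) \<le> C * exp (\<delta> * \<bar>Im z\<bar> - \<Omega> (cmod z))" for z
  proof -
    obtain M where M: "\<And>N. N \<ge> M \<Longrightarrow> cmod (H N z) \<le> C * exp (\<delta> * \<bar>Im z\<bar> - \<Omega> (cmod z))"
      using HC by blast
    have "cmod (H (r n) z) \<le> C * exp (\<delta> * \<bar>Im z\<bar> - \<Omega> (cmod z))" if "n \<ge> M" for n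
      using M seq_suble[OF h(2), of n] that by simp
    then show ?thesis by (intro LIMSEQ_le_const2[OF lim]) blast
  qed
  ultimately show ?thesis using h(1) by blast
qed


section \<open>Interpolation at the zeros of the sine\<close>

lemma norm_sin_ge_on_circle:
  assumes w: "cmod w = (real N + 1 / 2) * pi"
  shows "exp \<bar>Im w\<bar> / 8 \<le> cmod (sin w)"
proof (cases "\<bar>Im w\<bar> < 1")
  case True
  define R where "R = (real N + 1 / 2) * pi"
  have R1: "1 \<le> R"
  proof -
    have "1 / 2 * 2 \<le> (real N + 1 / 2) * pi" using pi_ge_two by (intro mult_mono) auto
    then show ?thesis by (simp add: R_def)
  qed
  have sq: "R\<^sup>2 = \<bar>Re w\<bar>\<^sup>2 + \<bar>Im w\<bar>\<^sup>2" using w cmod_power2[of w] by (simp add: R_def)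
  \<comment> \<open>The amount by which \<open>\<bar>Re w\<bar>\<close> falls short of the radius.
    From \<open>t * (R + \<bar>Re w\<bar>) = \<bar>Im w\<bar>\<^sup>2\<close> and
    \<open>R \<ge> 1\<close> it is at most 1, so
    \<open>\<bar>sin (Re w)\<bar> = \<bar>cos t\<bar>\<close> is at least
    \<open>cos (pi / 3)\<close>.\<close>
  define t where "t = R - \<bar>Re w\<bar>"
  have t0: "0 \<le> t" using w abs_Re_le_cmod[of w] by (simp add: t_def R_def)
  have "t * (R + \<bar>Re w\<bar>) = \<bar>Im w\<bar>\<^sup>2" using sq by (simp add: t_def power2_eq_square algebra_simps)
  then have "t * (R + \<bar>Re w\<bar>) \<le> 1" using True by (simp add: abs_square_le_1)
  moreover have "t * 1 \<le> t * (R + \<bar>Re w\<bar>)" using R1 t0 by (intro mult_left_mono) auto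
  ultimately have t1: "t \<le> 1" by simp
  have "\<bar>sin (Re w)\<bar> = \<bar>sin \<bar>Re w\<bar>\<bar>" by (cases "Re w \<ge> 0") auto
  also have "\<bar>Re w\<bar> = (pi / 2 - t) + pi * real N" by (simp add: t_def R_def algebra_simps)
  also have "\<bar>sin ((pi / 2 - t) + pi * real N)\<bar> = \<bar>cos t\<bar>"
    by (simp only: sin_add cos_sin_eq[of t]) (simp add: abs_mult)
  finally have "\<bar>sin (Re w)\<bar> = \<bar>cos t\<bar>" .
  moreover have "1 / 2 \<le> cos t"
  proof -
    have "t \<le> pi / 3" using t1 pi_gt3 by simp
    then have "cos (pi / 3) \<le> cos t" using t0 by (intro cos_monotone_0_pi_le) auto
    then show ?thesis by (simp add: cos_60)
  qed
  moreover have "\<bar>sin (Re w)\<bar> \<le> cmod (sin w)"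
  proof -
    have r: "Re (sin w) = sin (Re w) * ((exp (Im w) + exp (- Im w)) / 2)" by (simp add: Re_sin)
    have "1 \<le> (exp (Im w) + exp (- Im w)) / 2"
      using add_mono[OF exp_ge_add_one_self[of "Im w"] exp_ge_add_one_self[of "- Im w"]] by simp
    then have "\<bar>sin (Re w)\<bar> * 1 \<le> \<bar>sin (Re w)\<bar> * \<bar>(exp (Im w) + exp (- Im w)) / 2\<bar>"
      by (intro mult_left_mono) auto
    then have "\<bar>sin (Re w)\<bar> \<le> \<bar>Re (sin w)\<bar>" unfolding r abs_mult by simp
    then show ?thesis using abs_Re_le_cmod[of "sin w"] by simp
  qed
  moreover have "exp \<bar>Im w\<bar> \<le> 3" using True exp_le by (smt (verit) exp_le_cancel_iff)
  ultimately show ?thesis by linarith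
next
  case False
  have gen: "exp x / 8 \<le> (exp x - exp (- x)) / 2" if "1 \<le> x" for x :: real
  proof -
    have "exp (-x) \<le> 1" using that by simp
    moreover have "2 \<le> exp x" by (rule order_trans[OF _ exp_ge_add_one_self]) (use that in simp)
    moreover have "B / 8 \<le> (B - A) / 2" if "A \<le> 1" "2 \<le> B" for A B :: real
    proof -
      have "(B - A) / 2 - B / 8 = (3 * B - 4 * A) / 8" by (simp add: field_simps)
      moreover have "0 \<le> (3 * B - 4 * A) / 8" using that by simp
      ultimately show ?thesis by linarith
    qed
    ultimately show ?thesis by blast
  qed
  have eq: "sin w = (exp (\<i> * w) - exp (- (\<i> * w))) / (2 * \<i>)" by (simp add: sin_exp_eq)
  have n: "cmod (sin w) = cmod (exp (\<i> * w) - exp (- (\<i> * w))) / 2"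
    unfolding eq by (simp only: norm_divide norm_mult) simp
  have "\<bar>exp (- Im w) - exp (Im w)\<bar> \<le> cmod (exp (\<i> * w) - exp (- (\<i> * w)))"
    using norm_triangle_ineq3[of "exp (\<i> * w)" "exp (- (\<i> * w))"] by (simp add: norm_exp_eq_Re)
  moreover have "exp \<bar>Im w\<bar> / 8 \<le> \<bar>exp (- Im w) - exp (Im w)\<bar> / 2"
    using gen[of "Im w"] gen[of "- Im w"] False by (cases "Im w \<ge> 0") auto
  ultimately show ?thesis using n by simp
qed

lemma cos_int_pi_square: "cos (of_real (of_int n * pi)) * cos (of_real (of_int n * pi)) = (1 :: complex)"
proof -
  have "sin (of_real (of_int n * pi) :: complex) = 0" by (auto simp: sin_eq_0)
  then show ?thesis using sin_cos_squared_add[of "of_real (of_int n * pi) :: complex"]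
    by (simp add: power2_eq_square)
qed

text \<open>Residue theorem for \<open>\<psi> w / ((w - z) * sin w)\<close> on circles that cross
  the real axis half way between zeros of the sine. On them the sine cancels the growth
  \<open>exp \<bar>Im w\<bar>\<close> of \<psi>, and the two remaining denominators outweigh the
  length of the circle.\<close>

lemma unit_lattice_interpolation:
  assumes hol: "\<psi> holomorphic_on UNIV"
    and bound: "\<And>w. cmod (\<psi> w) \<le> C * exp \<bar>Im w\<bar> / (1 + cmod w)"
    and z: "sin z \<noteq> 0"
  shows "(\<lambda>N::nat. \<Sum>n\<in>{- int N..int N}. cos (of_real (of_int n * pi)) * \<psi> (of_real (of_int n * pi)) /
            (of_real (of_int n * pi) - z)) \<longlonglongrightarrow> - \<psi> z / sin z"
proof -
  define p :: "int \<Rightarrow> complex" where "p = (\<lambda>n. of_real (of_int n * pi))"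
  define f where "f = (\<lambda>w. \<psi> w / ((w - z) * sin w))"
  have injp: "inj p" by (auto simp: inj_def p_def)
  have zp: "z \<noteq> p n" for n using z by (auto simp: p_def sin_eq_0)
  have C0: "0 \<le> C" using order_trans[OF norm_ge_zero bound[of 0]] by simp
  define S where "S = (\<lambda>N::nat. \<Sum>n\<in>{- int N..int N}. cos (p n) * \<psi> (p n) / (p n - z))"
  define R where "R = (\<lambda>N::nat. (real N + 1 / 2) * pi)"
  have main: "cmod (S N + \<psi> z / sin z) \<le> 8 * C / (R N - cmod z)" if N: "cmod z < R N" for N
  proof -
    define A where "A = p ` {- int N..int N}"
    \<comment> \<open>The open ball reaches up to the first lattice points outside the contour and
      excludes them, so it contains no further poles of \<open>f\<close>.\<close>
    define B where "B = ball (0::complex) ((real N + 1) * pi)"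
    have Rp: "0 < R N" by (simp add: R_def add_nonneg_pos)
    have sinB: "w \<in> A" if "w \<in> B" "sin w = 0" for w
    proof -
      obtain n :: int where n: "w = p n" using \<open>sin w = 0\<close> by (auto simp: sin_eq_0 p_def)
      have "\<bar>real_of_int n\<bar> * pi < (real N + 1) * pi"
        using \<open>w \<in> B\<close> by (simp add: n B_def p_def abs_mult norm_mult)
      then have "\<bar>n\<bar> < int N + 1" by simp
      then show ?thesis unfolding A_def n by (intro imageI) auto
    qed
    have fhol: "f holomorphic_on B - (insert z A)"
      unfolding f_def using sinB by (intro holomorphic_intros holomorphic_on_subset[OF hol]) auto
    have inR: "cmod w < R N" if "w \<in> insert z A" for w
    proof -
      have "cmod (p n) < R N" if "n \<in> {- int N..int N}" for n
      proof -
        have "\<bar>real_of_int n\<bar> \<le> real N" using that by auto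
        then have "\<bar>real_of_int n\<bar> * pi < (real N + 1 / 2) * pi" by simp
        then show ?thesis by (simp add: p_def R_def norm_mult abs_mult)
      qed
      then show ?thesis using that N by (auto simp: A_def)
    qed
    have RB: "R N < (real N + 1) * pi" by (simp add: R_def)
    have int: "contour_integral (circlepath 0 (R N)) f =
        2 * pi * \<i> * (\<Sum>q\<in>insert z A. winding_number (circlepath 0 (R N)) q * residue f q)"
    proof (rule Residue_theorem[of B])
      show "open B" "connected B" by (auto simp: B_def)
      show "finite (insert z A)" by (simp add: A_def)
      show "path_image (circlepath 0 (R N)) \<subseteq> B - insert z A"
        using inR RB Rp by (auto simp: path_image_circlepath B_def sphere_def dest!: inR)
      show "\<forall>w. w \<notin> B \<longrightarrow> winding_number (circlepath 0 (R N)) w = 0"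
        using RB Rp by (auto simp: B_def intro!: winding_number_zero_outside[of _ "cball 0 (R N)"])
    qed (use fhol in auto)
    have wn: "winding_number (circlepath 0 (R N)) q = 1" if "q \<in> insert z A" for q
      using inR[OF that] by (intro winding_number_circlepath) simp
    have zA: "z \<notin> A" using zp by (auto simp: A_def)
    have resz: "residue f z = \<psi> z / sin z"
    proof (rule residue_simple'[of "- range p"])
      have rp: "range p = {w. sin w = 0}" by (auto simp: p_def sin_eq_0)
      show "open (- range p)" unfolding rp
        by (intro open_Compl closed_Collect_eq continuous_intros)
      show "z \<in> - range p" using zp by auto
      show "f holomorphic_on - range p - {z}"
        unfolding f_def rp by (intro holomorphic_intros holomorphic_on_subset[OF hol]) auto
      have "((\<lambda>w. \<psi> w / sin w) \<longlongrightarrow> \<psi> z / sin z) (at z)"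
        using holomorphic_on_imp_continuous_on[OF hol] z
        by (intro tendsto_intros) (auto simp: continuous_on_eq_continuous_at isCont_def)
      then show "((\<lambda>w. f w * (w - z)) \<longlongrightarrow> \<psi> z / sin z) (at z)"
        by (rule Lim_transform_eventually) (auto simp: f_def eventually_at intro!: exI[of _ 1])
    qed
    have resp: "residue f (p n) = cos (p n) * \<psi> (p n) / (p n - z)" if n: "n \<in> {- int N..int N}" for n
    proof (rule residue_simple'[of "B - (insert z A - {p n})"])
      show "open (B - (insert z A - {p n}))" unfolding B_def
        by (intro open_Diff finite_imp_closed) (auto simp: A_def)
      show "p n \<in> B - (insert z A - {p n})"
        using inR[of "p n"] n RB by (auto simp: B_def A_def)
      show "f holomorphic_on B - (insert z A - {p n}) - {p n}"
        by (rule holomorphic_on_subset[OF fhol]) auto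
      have cc: "cos (p n) * cos (p n) = 1" unfolding p_def by (rule cos_int_pi_square)
      then have c0: "cos (p n) \<noteq> 0" by auto
      have s0: "sin (p n) = 0" by (auto simp: p_def sin_eq_0)
      have "((\<lambda>w. sin w / (w - p n)) \<longlongrightarrow> cos (p n)) (at (p n))"
        using DERIV_sin[of "p n"] s0 by (simp add: has_field_derivative_iff)
      then have "((\<lambda>w. \<psi> w / (w - z) / (sin w / (w - p n))) \<longlongrightarrow> \<psi> (p n) / (p n - z) / cos (p n)) (at (p n))"
        using holomorphic_on_imp_continuous_on[OF hol] zp[of n] c0
        by (intro tendsto_intros) (auto simp: continuous_on_eq_continuous_at isCont_def)
      \<comment> \<open>The cosine is 1 or -1 at a lattice point, so the residue can be written
        without a quotient.\<close>
      moreover have "1 / cos (p n) = cos (p n)" using cc c0 by (simp add: field_simps)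
      ultimately have "((\<lambda>w. \<psi> w / (w - z) / (sin w / (w - p n))) \<longlongrightarrow> cos (p n) * \<psi> (p n) / (p n - z)) (at (p n))"
        by (simp add: divide_inverse mult_ac)
      then show "((\<lambda>w. f w * (w - p n)) \<longlongrightarrow> cos (p n) * \<psi> (p n) / (p n - z)) (at (p n))"
        by (rule Lim_transform_eventually) (auto simp: f_def)
    qed
    have "(\<Sum>q\<in>insert z A. winding_number (circlepath 0 (R N)) q * residue f q) = (\<Sum>q\<in>insert z A. residue f q)"
      by (intro sum.cong refl) (simp only: wn mult_1)
    also have "\<dots> = \<psi> z / sin z + (\<Sum>q\<in>A. residue f q)"
      using zA by (simp add: A_def resz)
    also have "(\<Sum>q\<in>A. residue f q) = S N"
      unfolding A_def S_def using resp inj_on_subset[OF injp] by (subst sum.reindex) (auto simp: inj_on_subset[OF injp])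
    finally have I: "contour_integral (circlepath 0 (R N)) f = 2 * pi * \<i> * (\<psi> z / sin z + S N)"
      using int by simp
    have "cmod (contour_integral (circlepath 0 (R N)) f) \<le> (8 * C / (R N * (R N - cmod z))) * (2 * pi * R N)"
    proof (rule has_contour_integral_bound_circlepath)
      have "f contour_integrable_on circlepath 0 (R N)"
      proof (rule contour_integrable_holomorphic_simple[of _ "B - insert z A"])
        show "open (B - insert z A)" unfolding B_def by (intro open_Diff finite_imp_closed) (auto simp: A_def)
        show "path_image (circlepath 0 (R N)) \<subseteq> B - insert z A"
          using inR RB Rp by (auto simp: path_image_circlepath B_def sphere_def dest!: inR)
      qed (use fhol in auto)
      then show "(f has_contour_integral contour_integral (circlepath 0 (R N)) f) (circlepath 0 (R N))"
        by (rule has_contour_integral_integral)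
      show "0 \<le> 8 * C / (R N * (R N - cmod z))" using C0 N Rp by simp
      show "0 < R N" by (rule Rp)
      fix w assume "cmod (w - 0) = R N"
      then have w: "cmod w = R N" by simp
      have s: "exp \<bar>Im w\<bar> / 8 \<le> cmod (sin w)" using norm_sin_ge_on_circle[of w N] w by (simp add: R_def)
      have d: "R N - cmod z \<le> cmod (w - z)" using norm_triangle_ineq2[of w z] w by simp
      have "cmod (\<psi> w) \<le> C * exp \<bar>Im w\<bar> / R N"
        using order_trans[OF bound[of w], of "C * exp \<bar>Im w\<bar> / R N"] C0 Rp w
        by (simp add: divide_left_mono)
      then have "cmod (f w) \<le> (C * exp \<bar>Im w\<bar> / R N) / ((R N - cmod z) * (exp \<bar>Im w\<bar> / 8))"
        unfolding f_def norm_divide norm_mult using s d N C0 Rp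
        by (intro frac_le mult_mono mult_pos_pos) auto
      also have "\<dots> = 8 * C / (R N * (R N - cmod z))" by simp
      finally show "cmod (f w) \<le> 8 * C / (R N * (R N - cmod z))" .
    qed
    also have "\<dots> = 2 * pi * (8 * C / (R N - cmod z))" using Rp by simp
    finally have "2 * pi * cmod (\<psi> z / sin z + S N) \<le> 2 * pi * (8 * C / (R N - cmod z))"
      unfolding I by (simp add: norm_mult)
    then have "cmod (\<psi> z / sin z + S N) \<le> 8 * C / (R N - cmod z)"
      by (rule mult_left_le_imp_le) simp
    then show ?thesis by (simp add: add.commute)
  qed
  have Rlim: "filterlim R at_top sequentially"
    unfolding R_def by real_asymp
  have "(\<lambda>N. S N + \<psi> z / sin z) \<longlonglongrightarrow> 0"
  proof (rule Lim_null_comparison)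
    show "\<forall>\<^sub>F N in sequentially. cmod (S N + \<psi> z / sin z) \<le> 8 * C / (R N - cmod z)"
      using filterlim_at_top_dense[THEN iffD1, OF Rlim, rule_format, of "cmod z"]
      by eventually_elim (rule main)
    show "(\<lambda>N. 8 * C / (R N - cmod z)) \<longlonglongrightarrow> 0"
      unfolding R_def by real_asymp
  qed
  then have "(\<lambda>N. (S N + \<psi> z / sin z) - \<psi> z / sin z) \<longlonglongrightarrow> 0 - \<psi> z / sin z"
    by (intro tendsto_diff tendsto_const)
  then show ?thesis by (simp add: S_def p_def)
qed

section \<open>Lattice sums, sampling and Fourier series\<close>

lemma tendsto_symmetric_int_sums:
  assumes "(f has_sum s) (UNIV :: int set)"
  shows "(\<lambda>N::nat. \<Sum>n\<in>{- int N..int N}. f n) \<longlonglongrightarrow> s"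
proof -
  have "filterlim (\<lambda>N::nat. {- int N..int N}) (finite_subsets_at_top UNIV) sequentially"
    unfolding filterlim_finite_subsets_at_top
  proof (intro allI impI)
    fix X :: "int set" assume "finite X \<and> X \<subseteq> UNIV"
    then obtain b where b: "\<And>x. x \<in> X \<Longrightarrow> \<bar>x\<bar> \<le> b"
      using bdd_above_finite[of "abs ` X"] by (auto simp: bdd_above_def)
    show "\<forall>\<^sub>F N in sequentially. finite {- int N..int N} \<and> X \<subseteq> {- int N..int N} \<and> {- int N..int N} \<subseteq> UNIV"
      using eventually_ge_at_top[of "nat \<bar>b\<bar>"]
    proof eventually_elim
      case (elim N)
      have "x \<in> {- int N..int N}" if "x \<in> X" for x using b[OF that] elim by auto
      then show ?case by auto
    qed
  qed
  from filterlim_compose[OF assms[unfolded has_sum_def] this] show ?thesis by (simp add: o_def)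
qed

text \<open>Residues and Fourier series only yield limits of symmetric partial sums; absolute
  summability upgrades them to unconditional sums, which may be split and compared freely.\<close>

lemma has_sum_symmetric_limit:
  fixes f :: "int \<Rightarrow> 'a :: banach"
  assumes "(\<lambda>n. norm (f n)) summable_on UNIV" and "(\<lambda>N::nat. \<Sum>n\<in>{- int N..int N}. f n) \<longlonglongrightarrow> s"
  shows "(f has_sum s) UNIV"
proof -
  have f: "(f has_sum infsum f UNIV) UNIV"
    by (rule has_sum_infsum[OF abs_summable_summable[OF assms(1)]])
  then show ?thesis using LIMSEQ_unique[OF assms(2) tendsto_symmetric_int_sums[OF f]] by simp
qed

lemma abs_summable_on_int:
  fixes g :: "nat \<Rightarrow> real" and f :: "int \<Rightarrow> 'a :: real_normed_vector"
  assumes g: "summable g" and le: "\<And>n. norm (f n) \<le> g (nat \<bar>n\<bar>)"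
  shows "(\<lambda>n. norm (f n)) summable_on UNIV"
proof -
  have g0: "0 \<le> g n" for n using order_trans[OF norm_ge_zero le[of "int n"]] by simp
  have gs: "g summable_on UNIV" using g g0 by (simp add: summable_on_UNIV_nonneg_real_iff)
  have "(\<lambda>n. norm (f n)) summable_on range int"
    unfolding summable_on_reindex[OF inj_of_nat] o_def
    by (rule summable_on_comparison_test[OF gs]) (use le[of "int _"] in auto)
  moreover have "(\<lambda>n. norm (f n)) summable_on range (\<lambda>n. - int n)"
    unfolding summable_on_reindex[of "\<lambda>n. - int n" UNIV, unfolded inj_on_def, simplified] o_def
    by (rule summable_on_comparison_test[OF gs]) (use le[of "- int _"] in auto)
  ultimately have "(\<lambda>n. norm (f n)) summable_on (range int \<union> range (\<lambda>n. - int n))"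
    by (rule summable_on_union)
  moreover have "range int \<union> range (\<lambda>n. - int n) = UNIV"
    by (auto simp: image_iff) (metis int_cases4)
  ultimately show ?thesis by simp
qed

text \<open>These numbers are the frequencies of period \<open>2 * L\<close> and also the zeros of
  \<open>sin (L * z)\<close>; the first role serves Fourier series, the second the sampling of
  entire functions of type \<open>L\<close>.\<close>

definition lat :: "real \<Rightarrow> int \<Rightarrow> real" where "lat L n = of_int n * pi / L"

lemma abs_lat: "0 < L \<Longrightarrow> \<bar>lat L n\<bar> = real (nat \<bar>n\<bar>) * (pi / L)"
  by (simp add: lat_def abs_mult)

lemma abs_summable_on_lat:
  fixes f :: "int \<Rightarrow> 'a :: real_normed_vector"
  assumes L: "0 < L" and le: "\<And>n. norm (f n) \<le> C / (1 + \<bar>lat L n\<bar>)\<^sup>2"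
  shows "(\<lambda>n. norm (f n)) summable_on UNIV"
proof (rule abs_summable_on_int)
  have O: "(\<lambda>n. C / (1 + real n * (pi / L))\<^sup>2) \<in> O(\<lambda>n. inverse (real n ^ 2))"
    using L by real_asymp
  have "summable (\<lambda>n. norm (inverse (real n ^ 2)))"
    using inverse_power_summable[of 2, where 'a=real] by simp
  from this O show "summable (\<lambda>n. C / (1 + real n * (pi / L))\<^sup>2)"
    by (rule summable_comparison_test_bigo)
  show "norm (f n) \<le> C / (1 + real (nat \<bar>n\<bar>) * (pi / L))\<^sup>2" for n
    using le[of n] abs_lat[OF L] by simp
qed

lemma sin_int_pi: "sin (of_real (of_int n * pi)) = (0 :: complex)"
  by (auto simp: sin_eq_0)

lemma norm_cos_int_pi: "cmod (cos (of_real (of_int n * pi))) = 1"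
proof -
  have "cmod (cos (of_real (of_int n * pi))) ^ 2 = 1"
    unfolding power2_eq_square norm_mult[symmetric] cos_int_pi_square by simp
  then show ?thesis by (simp add: power2_eq_1_iff)
     (metis norm_ge_zero not_one_le_zero neg_0_le_iff_le order_trans zero_le_one)
qed

text \<open>Interpolation at the point 1 for \<open>(u - 1) * G (u / L)\<close>, which vanishes
  there: the factor \<open>u - 1\<close> cancels the denominators of the series. It costs one power,
  whence the quadratic decay of \<open>G\<close>. The result makes the periodic bump of the cut-off
  construction vanish away from its centres.\<close>

lemma alternating_lattice_sum_zero:
  assumes hol: "G holomorphic_on UNIV" and L: "0 < L"
    and bound: "\<And>w. cmod (G w) \<le> C * exp (L * \<bar>Im w\<bar>) / (1 + cmod w)\<^sup>2"
  shows "((\<lambda>n. cos (of_real (of_int n * pi)) * G (of_real (lat L n))) has_sum 0) UNIV"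
proof -
  define \<psi> where "\<psi> = (\<lambda>u. (u - 1) * G (u / of_real L))"
  \<comment> \<open>The square stems from
    \<open>(1 + cmod u) / max 1 L \<le> 1 + cmod u / L\<close>.\<close>
  define D where "D = C * (max 1 L)\<^sup>2"
  have C0: "0 \<le> C" using order_trans[OF norm_ge_zero bound[of 0]] by simp
  have bd: "cmod (\<psi> u) \<le> D * exp \<bar>Im u\<bar> / (1 + cmod u)" for u
  proof -
    have "cmod (G (u / of_real L)) \<le> C * exp \<bar>Im u\<bar> / (1 + cmod u / L)\<^sup>2"
      using bound[of "u / of_real L"] L by (simp add: norm_divide Im_divide_of_real abs_div)
    also have "\<dots> \<le> C * exp \<bar>Im u\<bar> / ((1 + cmod u) / max 1 L)\<^sup>2"
    proof (rule divide_left_mono)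
      have "(1 + cmod u) / max 1 L \<le> 1 + cmod u / L"
      proof -
        have "1 / max 1 L \<le> 1" "cmod u / max 1 L \<le> cmod u / L"
          using L by (auto intro!: divide_left_mono mult_pos_pos)
        from add_mono[OF this] show ?thesis by (simp only: add_divide_distrib)
      qed
      then show "((1 + cmod u) / max 1 L)\<^sup>2 \<le> (1 + cmod u / L)\<^sup>2" by (intro power_mono) auto
      show "0 < (1 + cmod u / L)\<^sup>2 * ((1 + cmod u) / max 1 L)\<^sup>2"
        using L by (intro mult_pos_pos zero_less_power divide_pos_pos add_pos_nonneg) auto
    qed (use C0 in auto)
    also have "\<dots> = D * exp \<bar>Im u\<bar> / (1 + cmod u)\<^sup>2" by (simp add: D_def power_divide)
    finally have "cmod (\<psi> u) \<le> (1 + cmod u) * (D * exp \<bar>Im u\<bar> / (1 + cmod u)\<^sup>2)"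
      unfolding \<psi>_def norm_mult using norm_triangle_ineq4[of u 1]
      by (intro mult_mono) (auto simp: add.commute)
    also have "\<dots> = D * exp \<bar>Im u\<bar> / (1 + cmod u)"
      by (simp add: power2_eq_square add_nonneg_eq_0_iff)
    finally show ?thesis .
  qed
  have s1: "sin (1::complex) \<noteq> 0"
  proof
    assume "sin (1::complex) = 0"
    then have "sin (complex_of_real 1) = of_real 0" by simp
    then have "sin (1::real) = 0" unfolding sin_of_real by (simp only: of_real_eq_iff)
    then show False using sin_gt_zero[of 1] pi_gt3 by simp
  qed
  have nz: "(of_real (of_int n * pi) :: complex) - 1 \<noteq> 0" for n
    using s1 sin_int_pi[of n] by auto
  have \<psi>hol: "\<psi> holomorphic_on UNIV"
    unfolding \<psi>_def
    by (intro holomorphic_intros holomorphic_on_compose_gen[OF _ hol, unfolded o_def]) (use L in auto)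
  have eq: "cos (of_real (of_int n * pi)) * \<psi> (of_real (of_int n * pi)) / (of_real (of_int n * pi) - 1)
     = cos (of_real (of_int n * pi)) * G (of_real (lat L n))" for n
    unfolding \<psi>_def lat_def of_real_divide using nz[of n]
    by (simp del: of_real_mult)
  have "(\<lambda>N::nat. \<Sum>n\<in>{- int N..int N}. cos (of_real (of_int n * pi)) * G (of_real (lat L n))) \<longlonglongrightarrow> 0"
    using unit_lattice_interpolation[OF \<psi>hol bd s1] unfolding eq by (simp add: \<psi>_def)
  moreover have "(\<lambda>n. cmod (cos (of_real (of_int n * pi)) * G (of_real (lat L n)))) summable_on UNIV"
  proof (rule abs_summable_on_lat[OF L])
    show "cmod (cos (of_real (of_int n * pi)) * G (of_real (lat L n))) \<le> C / (1 + \<bar>lat L n\<bar>)\<^sup>2" for n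
      using bound[of "of_real (lat L n)"] by (simp add: norm_mult norm_cos_int_pi del: of_real_mult)
  qed
  ultimately show ?thesis by (intro has_sum_symmetric_limit)
qed

lemma csinc_int_pi:
  assumes "n \<noteq> 0" shows "csinc (of_real (of_int n * pi)) = 0"
  using assms sin_int_pi[of n] by (simp add: csinc_def)

text \<open>The cardinal series of Whittaker and Shannon. Off the lattice it is the interpolation
  formula times \<open>- sin (L * z)\<close>, since
  \<open>sin (L * z - n * pi) = sin (L * z) * cos (n * pi)\<close>; at a lattice point a single term
  survives.\<close>

lemma sampling:
  assumes hol: "\<psi> holomorphic_on UNIV" and L: "0 < L"
    and bound: "\<And>w. cmod (\<psi> w) \<le> C * exp (L * \<bar>Im w\<bar>) / (1 + cmod w)\<^sup>2"
  shows "((\<lambda>n. \<psi> (of_real (lat L n)) * csinc (of_real L * (z - of_real (lat L n)))) has_sum \<psi> z) UNIV"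
proof (cases "\<exists>m. z = of_real (lat L m)")
  case True
  then obtain m where m: "z = of_real (lat L m)" by blast
  have arg: "of_real L * (z - of_real (lat L n)) = of_real (of_int (m - n) * pi)" for n
    using L by (simp add: m lat_def field_simps)
  have "((\<lambda>n. \<psi> (of_real (lat L n)) * csinc (of_real L * (z - of_real (lat L n)))) has_sum \<psi> z) {m}"
    by (rule has_sum_finiteI) (simp_all add: m)
  also have "?this \<longleftrightarrow> ?thesis"
    by (rule has_sum_cong_neutral) (auto simp: arg csinc_int_pi simp del: of_real_mult of_int_diff)
  finally show ?thesis .
next
  case False
  define \<phi> where "\<phi> = (\<lambda>u. \<psi> (u / of_real L))"
  define D where "D = C * max 1 L"
  have C0: "0 \<le> C" using order_trans[OF norm_ge_zero bound[of 0]] by simp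
  have bd: "cmod (\<phi> u) \<le> D * exp \<bar>Im u\<bar> / (1 + cmod u)" for u
  proof -
    have "cmod (\<phi> u) \<le> C * exp \<bar>Im u\<bar> / (1 + cmod u / L)\<^sup>2"
      using bound[of "u / of_real L"] L by (simp add: \<phi>_def norm_divide Im_divide_of_real abs_div)
    also have "\<dots> \<le> C * exp \<bar>Im u\<bar> / ((1 + cmod u) / max 1 L)"
    proof (rule divide_left_mono)
      have "(1 + cmod u) / max 1 L \<le> 1 + cmod u / L"
      proof -
        have "1 / max 1 L \<le> 1" "cmod u / max 1 L \<le> cmod u / L"
          using L by (auto intro!: divide_left_mono mult_pos_pos)
        from add_mono[OF this] show ?thesis by (simp only: add_divide_distrib)
      qed
      also have "\<dots> \<le> (1 + cmod u / L)\<^sup>2"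
        using L by (intro self_le_power) auto
      finally show "(1 + cmod u) / max 1 L \<le> (1 + cmod u / L)\<^sup>2" .
      show "0 < (1 + cmod u / L)\<^sup>2 * ((1 + cmod u) / max 1 L)"
        using L by (intro mult_pos_pos zero_less_power divide_pos_pos add_pos_nonneg) auto
    qed (use C0 in auto)
    also have "\<dots> = D * exp \<bar>Im u\<bar> / (1 + cmod u)" by (simp add: D_def)
    finally show ?thesis .
  qed
  have s: "sin (of_real L * z) \<noteq> 0"
  proof
    assume "sin (of_real L * z) = 0"
    then obtain m :: int where "of_real L * z = of_real (of_int m * pi)" by (auto simp: sin_eq_0)
    then have "z = of_real (lat L m)" using L by (simp add: lat_def field_simps)
    then show False using False by blast
  qed
  have \<phi>hol: "\<phi> holomorphic_on UNIV"
    unfolding \<phi>_def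
    by (intro holomorphic_intros holomorphic_on_compose_gen[OF _ hol, unfolded o_def]) (use L in auto)
  have "(\<lambda>N::nat. - sin (of_real L * z) * (\<Sum>n\<in>{- int N..int N}. cos (of_real (of_int n * pi)) * \<phi> (of_real (of_int n * pi)) /
            (of_real (of_int n * pi) - of_real L * z))) \<longlonglongrightarrow> - sin (of_real L * z) * (- \<phi> (of_real L * z) / sin (of_real L * z))"
    by (intro tendsto_mult tendsto_const unit_lattice_interpolation[OF \<phi>hol bd s])
  also have "- sin (of_real L * z) * (- \<phi> (of_real L * z) / sin (of_real L * z)) = \<psi> z"
    using s L by (simp add: \<phi>_def)
  also have "(\<lambda>N::nat. - sin (of_real L * z) * (\<Sum>n\<in>{- int N..int N}. cos (of_real (of_int n * pi)) * \<phi> (of_real (of_int n * pi)) /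
            (of_real (of_int n * pi) - of_real L * z))) =
       (\<lambda>N::nat. \<Sum>n\<in>{- int N..int N}. \<psi> (of_real (lat L n)) * csinc (of_real L * (z - of_real (lat L n))))"
    unfolding sum_distrib_left
  proof (intro ext sum.cong refl)
    fix n
    have arg: "of_real L * (z - of_real (lat L n)) = of_real L * z - of_real (of_int n * pi)"
      using L by (simp add: lat_def field_simps)
    have ne: "of_real L * z - of_real (of_int n * pi) \<noteq> 0"
    proof
      assume "of_real L * z - of_real (of_int n * pi) = 0"
      then have "of_real L * z = of_real (of_int n * pi)" by simp
      then have "sin (of_real L * z) = 0" using sin_int_pi[of n] by (simp only:)
      then show False using s by simp
    qed
    have "sin (of_real L * z - of_real (of_int n * pi)) = sin (of_real L * z) * cos (of_real (of_int n * pi))"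
      unfolding sin_diff sin_int_pi by simp
    then have "csinc (of_real L * (z - of_real (lat L n))) =
        sin (of_real L * z) * cos (of_real (of_int n * pi)) / (of_real L * z - of_real (of_int n * pi))"
      unfolding arg csinc_def using ne by (simp only: if_False)
    moreover have "\<phi> (of_real (of_int n * pi)) = \<psi> (of_real (lat L n))" by (simp add: \<phi>_def lat_def)
    moreover have "- S * (c * p / (x - y)) = p * (S * c / (y - x))" if "y - x \<noteq> 0" for S c p x y :: complex
      using that by (simp add: divide_simps) (simp add: algebra_simps)
    ultimately show "- sin (of_real L * z) * (cos (of_real (of_int n * pi)) * \<phi> (of_real (of_int n * pi)) /
            (of_real (of_int n * pi) - of_real L * z)) = \<psi> (of_real (lat L n)) * csinc (of_real L * (z - of_real (lat L n)))"
      using ne by (simp only:)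
  qed
  finally have lim: "(\<lambda>N::nat. \<Sum>n\<in>{- int N..int N}. \<psi> (of_real (lat L n)) * csinc (of_real L * (z - of_real (lat L n)))) \<longlonglongrightarrow> \<psi> z" .
  have "(\<lambda>n. cmod (\<psi> (of_real (lat L n)) * csinc (of_real L * (z - of_real (lat L n))))) summable_on UNIV"
  proof (rule abs_summable_on_lat[OF L])
    fix n
    have "cmod (csinc (of_real L * (z - of_real (lat L n)))) \<le> exp (L * \<bar>Im z\<bar>)"
      using norm_csinc_le[of "of_real L * (z - of_real (lat L n))"] L by (simp add: abs_mult)
    moreover have "cmod (\<psi> (of_real (lat L n))) \<le> C / (1 + \<bar>lat L n\<bar>)\<^sup>2"
      using bound[of "of_real (lat L n)"] by simp
    ultimately show "cmod (\<psi> (of_real (lat L n)) * csinc (of_real L * (z - of_real (lat L n)))) \<le> (C * exp (L * \<bar>Im z\<bar>)) / (1 + \<bar>lat L n\<bar>)\<^sup>2"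
      unfolding norm_mult using mult_mono[of _ "C / (1 + \<bar>lat L n\<bar>)\<^sup>2" _ "exp (L * \<bar>Im z\<bar>)"]
      by (metis (no_types, lifting) C0 divide_nonneg_nonneg norm_ge_zero times_divide_eq_left zero_le_power2)
  qed
  from this lim show ?thesis by (rule has_sum_symmetric_limit)
qed

section \<open>Fourier series at a point of differentiability\<close>

lemma has_vector_derivative_quotient:
  fixes g :: "real \<Rightarrow> complex"
  assumes "(g has_vector_derivative d) (at x)"
  shows "((\<lambda>t. (g t - g x) / of_real (t - x)) \<longlongrightarrow> d) (at x)"
proof -
  have "((\<lambda>t. norm (g t - g x - (t - x) *\<^sub>R d) / norm (t - x)) \<longlongrightarrow> 0) (at x)"
    using assms unfolding has_vector_derivative_def has_derivative_iff_norm by blast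
  then have "((\<lambda>t. norm ((g t - g x) / of_real (t - x) - d)) \<longlongrightarrow> 0) (at x)"
  proof (rule Lim_transform_eventually)
    have "norm (g t - g x - (t - x) *\<^sub>R d) / norm (t - x) = norm ((g t - g x) / of_real (t - x) - d)"
      if "t \<noteq> x" for t
    proof -
      have "(g t - g x) / of_real (t - x) - d = (g t - g x - (t - x) *\<^sub>R d) / of_real (t - x)"
        using that by (simp add: field_simps scaleR_conv_of_real)
      then show ?thesis by (simp add: norm_divide del: of_real_diff)
    qed
    then show "\<forall>\<^sub>F t in at x. norm (g t - g x - (t - x) *\<^sub>R d) / norm (t - x) = norm ((g t - g x) / of_real (t - x) - d)"
      by (auto simp: eventually_at intro!: exI[of _ 1])
  qed
  then show ?thesis using tendsto_norm_zero_iff LIM_zero_iff by blast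
qed

text \<open>The passage from Taylor bounds to derivatives: series of exponentials, and functionals
  evaluated at exponentials, are differentiated through it.\<close>

lemma has_vector_derivative_quadratic:
  fixes g :: "real \<Rightarrow> complex"
  assumes e: "0 < e" and le: "\<And>t. \<bar>t - x\<bar> < e \<Longrightarrow> cmod (g t - g x - of_real (t - x) * d) \<le> B * \<bar>t - x\<bar>\<^sup>2"
  shows "(g has_vector_derivative d) (at x)"
  unfolding has_vector_derivative_def has_derivative_iff_norm
proof
  show "bounded_linear (\<lambda>h. h *\<^sub>R d)" by (rule bounded_linear_scaleR_left)
  show "((\<lambda>t. norm (g t - g x - (t - x) *\<^sub>R d) / norm (t - x)) \<longlongrightarrow> 0) (at x)"
  proof (rule Lim_null_comparison)
    have "norm (norm (g t - g x - (t - x) *\<^sub>R d) / norm (t - x)) \<le> B * \<bar>t - x\<bar>" if "t \<noteq> x" "\<bar>t - x\<bar> < e" for t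
      using le[OF that(2)] that(1) by (simp add: scaleR_conv_of_real power2_eq_square divide_le_eq mult.assoc del: of_real_diff)
    then show "\<forall>\<^sub>F t in at x. norm (norm (g t - g x - (t - x) *\<^sub>R d) / norm (t - x)) \<le> B * \<bar>t - x\<bar>"
      using e by (auto simp: eventually_at dist_real_def intro!: exI[of _ e])
    show "((\<lambda>t. B * \<bar>t - x\<bar>) \<longlongrightarrow> 0) (at x)"
      by (rule tendsto_eq_intros | simp)+
  qed
qed

definition chr :: "real \<Rightarrow> int \<Rightarrow> real \<Rightarrow> complex" where
  "chr L n t = exp (\<i> * of_real (lat L n * t))"

lemma chr_0 [simp]: "chr L 0 t = 1" by (simp add: chr_def lat_def)

lemma chr_mult: "chr L m t * chr L n t = chr L (m + n) t"
  by (simp add: chr_def lat_def exp_add[symmetric] ring_distribs add_divide_distrib)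

lemma chr_add: "chr L n (s + t) = chr L n s * chr L n t"
  by (simp add: chr_def exp_add[symmetric] algebra_simps)

lemma chr_minus: "chr L n (- t) = chr L (- n) t"
  by (simp add: chr_def lat_def)

lemma cnj_chr: "cnj (chr L n t) = chr L (- n) t"
  by (simp add: chr_def lat_def exp_cnj)

lemma norm_chr [simp]: "cmod (chr L n t) = 1"
  by (simp add: chr_def norm_exp_eq_Re)

lemma continuous_on_chr [continuous_intros]: 
  "continuous_on A f \<Longrightarrow> continuous_on A (\<lambda>x. chr L n (f x))"
  unfolding chr_def by (intro continuous_intros)

lemma chr_period: 
  assumes "L \<noteq> 0"
  shows "chr L n (t + 2 * L) = chr L n t"
proof -
  have "\<i> * complex_of_real (lat L n * (t + 2 * L)) = \<i> * of_real (lat L n * t) + \<i> * (of_int n * (of_real pi * 2))"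
    using assms by (simp add: lat_def field_simps)
  then show ?thesis unfolding chr_def by (simp only: exp_plus_2pin)
qed

lemma chr_has_vector_derivative:
  "(chr L n has_vector_derivative \<i> * of_real (lat L n) * chr L n t) (at t within A)"
proof -
  have "((\<lambda>z. exp (\<i> * (of_real (lat L n) * z))) has_field_derivative
      exp (\<i> * (of_real (lat L n) * of_real t)) * (\<i> * of_real (lat L n))) (at (of_real t))"
    by (auto intro!: derivative_eq_intros)
  from has_vector_derivative_real_field[OF this]
  show ?thesis by (auto simp: chr_def[abs_def] mult_ac intro: has_vector_derivative_at_within)
qed

lemma integral_chr:
  assumes "0 < L"
  shows "integral {-L..L} (chr L n) = (if n = 0 then 2 * of_real L else 0)"
proof (cases "n = 0")
  case True
  have "chr L 0 = (\<lambda>t. 1)" by (auto simp: fun_eq_iff)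
  then show ?thesis using True assms by (simp add: scaleR_conv_of_real)
next
  case False
  define c where "c = \<i> * complex_of_real (lat L n)"
  have c: "c \<noteq> 0" using False assms by (simp add: c_def lat_def)
  have "((\<lambda>t. c * chr L n t / c) has_integral chr L n L / c - chr L n (-L) / c) {-L..L}"
    by (rule fundamental_theorem_of_calculus, use assms in simp)
      (simp only: c_def has_vector_derivative_divide[OF chr_has_vector_derivative])
  moreover have "chr L n L = chr L n (-L)" using chr_period[of L n "-L"] assms by simp
  ultimately have "(chr L n has_integral 0) {-L..L}" using c by simp
  then show ?thesis using False by (simp add: integral_unique)
qed

text \<open>Bessel's inequality: expand the nonnegative integral of the squared modulus of
  \<open>k - p / (2 * L)\<close>, where \<open>p / (2 * L)\<close> is the orthogonal projection of
  \<open>k\<close> onto the span of the characters \<open>chr L (- n)\<close> with \<open>n\<close>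
  in \<open>A\<close>.\<close>

lemma bessel_sum:
  fixes k :: "real \<Rightarrow> complex"
  assumes L: "0 < L" and k: "continuous_on {-L..L} k" and A: "finite A"
  defines "d \<equiv> \<lambda>n. integral {-L..L} (\<lambda>t. k t * chr L n t)"
  shows "(\<Sum>n\<in>A. (cmod (d n))\<^sup>2) \<le> 2 * L * cmod (integral {-L..L} (\<lambda>t. k t * cnj (k t)))"
proof -
  let ?I = "integral {-L..L}"
  define p where "p = (\<lambda>t. \<Sum>n\<in>A. d n * chr L (-n) t)"
  have pc: "continuous_on {-L..L} p" unfolding p_def by (intro continuous_intros)
  have int: "f integrable_on {-L..L}" if "continuous_on {-L..L} f" for f :: "real \<Rightarrow> complex"
    using that by (rule integrable_continuous_interval)
  define Q where "Q = (\<Sum>n\<in>A. (cmod (d n))\<^sup>2)"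
  have cp: "cnj (p t) = (\<Sum>n\<in>A. cnj (d n) * chr L n t)" for t
    by (simp add: p_def cnj_chr)
  have kp: "?I (\<lambda>t. k t * cnj (p t)) = of_real Q"
  proof -
    have "?I (\<lambda>t. k t * cnj (p t)) = ?I (\<lambda>t. \<Sum>n\<in>A. cnj (d n) * (k t * chr L n t))"
      unfolding cp sum_distrib_left by (simp add: mult_ac)
    also have "\<dots> = (\<Sum>n\<in>A. ?I (\<lambda>t. cnj (d n) * (k t * chr L n t)))"
      by (rule integral_sum[OF A]) (intro int continuous_intros k)
    also have "\<dots> = (\<Sum>n\<in>A. cnj (d n) * d n)" by (simp add: d_def)
    also have "\<dots> = of_real Q" unfolding Q_def of_real_sum
      unfolding complex_norm_square by (intro sum.cong refl mult.commute)
    finally show ?thesis .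
  qed
  have pk: "?I (\<lambda>t. p t * cnj (k t)) = of_real Q"
  proof -
    have "?I (\<lambda>t. p t * cnj (k t)) = ?I (\<lambda>t. cnj (k t * cnj (p t)))" by (simp add: mult.commute)
    also have "\<dots> = cnj (?I (\<lambda>t. k t * cnj (p t)))"
      by (simp only: integral_cnj)
    finally show ?thesis by (simp add: kp)
  qed
  have pchr: "?I (\<lambda>t. p t * chr L n t) = 2 * of_real L * d n" if n: "n \<in> A" for n
  proof -
    have "?I (\<lambda>t. p t * chr L n t) = ?I (\<lambda>t. \<Sum>m\<in>A. d m * chr L (n - m) t)"
      unfolding p_def sum_distrib_right mult.assoc chr_mult by simp
    also have "\<dots> = (\<Sum>m\<in>A. ?I (\<lambda>t. d m * chr L (n - m) t))"
      by (rule integral_sum[OF A]) (intro int continuous_intros)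
    also have "\<dots> = (\<Sum>m\<in>A. d m * ?I (chr L (n - m)))" by simp
    also have "\<dots> = (\<Sum>m\<in>A. if m = n then 2 * of_real L * d n else 0)"
      using integral_chr[OF L] by (intro sum.cong refl) simp
    finally show ?thesis using n A by simp
  qed
  have pp: "?I (\<lambda>t. p t * cnj (p t)) = of_real (2 * L * Q)"
  proof -
    have "?I (\<lambda>t. p t * cnj (p t)) = ?I (\<lambda>t. \<Sum>n\<in>A. cnj (d n) * (p t * chr L n t))"
      unfolding cp sum_distrib_left by (simp add: mult_ac)
    also have "\<dots> = (\<Sum>n\<in>A. ?I (\<lambda>t. cnj (d n) * (p t * chr L n t)))"
      by (rule integral_sum[OF A]) (intro int continuous_intros pc)
    also have "\<dots> = (\<Sum>n\<in>A. cnj (d n) * (2 * of_real L * d n))" by (simp add: pchr)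
    also have "\<dots> = 2 * of_real L * (\<Sum>n\<in>A. of_real ((cmod (d n))\<^sup>2))"
      unfolding sum_distrib_left complex_norm_square
      by (intro sum.cong refl) (simp add: mult_ac)
    finally show ?thesis by (simp add: Q_def)
  qed
  \<comment> \<open>Each character has squared norm \<open>2 * L\<close> on the interval.\<close>
  define s where "s = 1 / (2 * L)"
  define q where "q = (\<lambda>t. k t - of_real s * p t)"
  have "(\<lambda>t. q t * cnj (q t)) = (\<lambda>t. k t * cnj (k t) - of_real s * (k t * cnj (p t)) - of_real s * (p t * cnj (k t))
      + of_real (s * s) * (p t * cnj (p t)))"
    by (simp add: q_def fun_eq_iff algebra_simps)
  then have "?I (\<lambda>t. q t * cnj (q t)) = ?I (\<lambda>t. k t * cnj (k t)) - of_real s * of_real Q - of_real s * of_real Q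
      + of_real (s * s) * of_real (2 * L * Q)"
    using k pc by (simp add: integral_add integral_diff int continuous_intros kp pk pp del: of_real_mult)
  also have "\<dots> = ?I (\<lambda>t. k t * cnj (k t)) - of_real (s * Q)"
    using L by (simp add: s_def field_simps)
  finally have eq: "?I (\<lambda>t. q t * cnj (q t)) = ?I (\<lambda>t. k t * cnj (k t)) - of_real (s * Q)" .
  have "?I (\<lambda>t. q t * cnj (q t)) = of_real (?I (\<lambda>t. (cmod (q t))\<^sup>2))"
  proof -
    have "(\<lambda>t. q t * cnj (q t)) = (\<lambda>t. of_real ((cmod (q t))\<^sup>2))" by (simp only: complex_norm_square)
    moreover have "(\<lambda>t. (cmod (q t))\<^sup>2) integrable_on {-L..L}"
      unfolding q_def by (intro integrable_continuous_interval continuous_intros k pc)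
    moreover from calculation(2) have "?I (of_real \<circ> (\<lambda>t. (cmod (q t))\<^sup>2)) = complex_of_real (?I (\<lambda>t. (cmod (q t))\<^sup>2))"
      by (rule integral_linear) (rule bounded_linear_of_real)
    ultimately show ?thesis by (simp only: o_def)
  qed
  moreover have "0 \<le> ?I (\<lambda>t. (cmod (q t))\<^sup>2)" by (rule integral_nonneg)
      (auto intro!: integrable_continuous_interval continuous_intros k pc simp: q_def)
  ultimately have "0 \<le> Re (?I (\<lambda>t. q t * cnj (q t)))" by simp
  then have "s * Q \<le> Re (?I (\<lambda>t. k t * cnj (k t)))" unfolding eq by simp
  also have "\<dots> \<le> cmod (?I (\<lambda>t. k t * cnj (k t)))" by (rule complex_Re_le_cmod)
  finally show ?thesis using L by (simp add: s_def Q_def field_simps)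
qed

text \<open>By Bessel's inequality the squares are summable along any injective sequence of indices.
  The two sequences singled out are the ends of the telescoping sum in
  \<open>fourier_series_pointwise\<close>.\<close>

lemma fourier_coefficients_tendsto_zero:
  fixes k :: "real \<Rightarrow> complex"
  assumes L: "0 < L" and k: "continuous_on {-L..L} k"
  defines "d \<equiv> \<lambda>n. integral {-L..L} (\<lambda>t. k t * chr L n t)"
  shows "(\<lambda>N. d (int N + 1)) \<longlonglongrightarrow> 0" "(\<lambda>N. d (- int N)) \<longlonglongrightarrow> 0"
proof -
  have gen: "(\<lambda>N. d (s N)) \<longlonglongrightarrow> 0" if s: "inj s" for s :: "nat \<Rightarrow> int"
  proof -
    have "summable (\<lambda>N. (cmod (d (s N)))\<^sup>2)"
    proof (rule bounded_imp_summable)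
      fix n
      have "(\<Sum>N\<in>{..n}. (cmod (d (s N)))\<^sup>2) = (\<Sum>m\<in>s ` {..n}. (cmod (d m))\<^sup>2)"
        using inj_on_subset[OF s] by (subst sum.reindex) auto
      also have "\<dots> \<le> 2 * L * cmod (integral {-L..L} (\<lambda>t. k t * cnj (k t)))"
        unfolding d_def by (rule bessel_sum[OF L k]) simp
      finally show "(\<Sum>N\<le>n. (cmod (d (s N)))\<^sup>2) \<le> 2 * L * cmod (integral {-L..L} (\<lambda>t. k t * cnj (k t)))" .
    qed simp
    from summable_LIMSEQ_zero[OF this] have "(\<lambda>N. sqrt ((cmod (d (s N)))\<^sup>2)) \<longlonglongrightarrow> sqrt 0"
      by (intro tendsto_intros)
    then show ?thesis by (intro tendsto_norm_zero_cancel[of "\<lambda>N. d (s N)"]) simp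
  qed
  show "(\<lambda>N. d (int N + 1)) \<longlonglongrightarrow> 0" "(\<lambda>N. d (- int N)) \<longlonglongrightarrow> 0"
    by (rule gen; simp add: inj_def)+
qed

text \<open>Chernoff's argument: dividing \<open>g - g x\<close> by \<open>chr L 1 (t - x) - 1\<close> makes the partial
  sums telescope.\<close>

lemma fourier_series_pointwise:
  fixes g :: "real \<Rightarrow> complex"
  assumes L: "0 < L" and g: "continuous_on {-L..L} g" and x: "\<bar>x\<bar> < L"
    and d: "(g has_vector_derivative d) (at x)"
  shows "(\<lambda>N::nat. \<Sum>n\<in>{- int N..int N}. integral {-L..L} (\<lambda>t. g t * chr L n t) / (2 * of_real L) * chr L (-n) x) \<longlonglongrightarrow> g x"
proof -
  let ?I = "integral {-L..L}"
  define e where "e = (\<lambda>t. chr L 1 (t - x) - 1)"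
  have ex: "e x = 0" by (simp add: e_def chr_def)
  \<comment> \<open>The value at \<open>x\<close> is the limit of the quotient, the derivative of
    \<open>e\<close> at \<open>x\<close> being \<open>\<i> * pi / L\<close>; so \<open>k\<close> is
    continuous and its coefficients tend to 0.\<close>
  define k where "k = (\<lambda>t. if t = x then d * of_real L / (\<i> * of_real pi) else (g t - g x) / e t)"
  \<comment> \<open>The zeros of \<open>e\<close> are spaced by \<open>2 * L\<close>, and
    \<open>x\<close> is an interior point of the interval, so no other zero lies in it.\<close>
  have e0: "e t \<noteq> 0" if "t \<in> {-L..L}" "t \<noteq> x" for t
  proof
    assume "e t = 0"
    then have "exp (\<i> * complex_of_real (pi * (t - x) / L)) = 1" by (simp add: e_def chr_def lat_def)
    then obtain m :: int where m: "pi * (t - x) / L = of_int (2 * m) * pi"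
      unfolding exp_eq_1 by auto
    then have "pi * (t - x) = pi * (of_int (2 * m) * L)" using L by (simp add: divide_eq_eq mult_ac)
    then have tx: "t - x = of_int (2 * m) * L" by (simp only: mult_cancel_left) simp
    have "\<bar>t - x\<bar> < 2 * L" using that x by auto
    then have "\<bar>of_int (2 * m) * L\<bar> < 2 * L" unfolding tx .
    then have "\<bar>real_of_int m\<bar> < 1" using L by (simp add: abs_mult)
    then have "m = 0" by linarith
    then show False using tx that by simp
  qed
  have gk: "g t = g x + e t * k t" if "t \<in> {-L..L}" for t
    using e0[OF that] by (cases "t = x") (simp_all add: k_def ex)
  have kc: "continuous_on {-L..L} k"
  proof -
    have "(k \<longlongrightarrow> k t) (at t within {-L..L})" if t: "t \<in> {-L..L}" for t
    proof (cases "t = x")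
      case True
      have "((\<lambda>t. chr L 1 (t - x)) has_vector_derivative \<i> * of_real (lat L 1) * chr L 1 (x - x)) (at x)"
      proof -
        have "((chr L 1 \<circ> (\<lambda>t. t - x)) has_vector_derivative (1 *\<^sub>R (\<i> * of_real (lat L 1) * chr L 1 (x - x)))) (at x)"
          by (rule vector_diff_chain_at) (auto intro!: derivative_eq_intros chr_has_vector_derivative)
        then show ?thesis by (simp add: o_def)
      qed
      from has_vector_derivative_quotient[OF this]
      have 1: "((\<lambda>t. e t / of_real (t - x)) \<longlongrightarrow> \<i> * of_real (pi / L)) (at x)"
        by (simp add: e_def lat_def chr_def[of _ _ 0])
      have "((\<lambda>t. ((g t - g x) / of_real (t - x)) / (e t / of_real (t - x))) \<longlongrightarrow> d / (\<i> * of_real (pi / L))) (at x)"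
        by (rule tendsto_divide[OF has_vector_derivative_quotient[OF d] 1]) (use L in auto)
      then have "(k \<longlongrightarrow> d / (\<i> * of_real (pi / L))) (at x)"
        by (rule Lim_transform_eventually) (auto simp: k_def eventually_at intro!: exI[of _ 1])
      moreover have "d / (\<i> * of_real (pi / L)) = k x" by (simp add: k_def)
      ultimately show ?thesis using True by (metis tendsto_within_subset subset_UNIV)
    next
      case False
      have "((\<lambda>t. (g t - g x) / e t) \<longlongrightarrow> (g t - g x) / e t) (at t within {-L..L})"
        using g t e0[OF t False] by (intro tendsto_intros)
          (auto simp: continuous_on_def e_def chr_def intro!: tendsto_intros)
      then have "(k \<longlongrightarrow> (g t - g x) / e t) (at t within {-L..L})"
        by (rule Lim_transform_eventually)
           (use False in \<open>auto simp: k_def eventually_at dist_real_def intro!: exI[of _ "\<bar>t - x\<bar>"]\<close>)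
      then show ?thesis using False by (simp add: k_def)
    qed
    then show ?thesis by (simp add: continuous_on_def)
  qed
  define D where "D = (\<lambda>n. ?I (\<lambda>t. k t * chr L n t))"
  have int: "f integrable_on {-L..L}" if "continuous_on {-L..L} f" for f :: "real \<Rightarrow> complex"
    using that by (rule integrable_continuous_interval)
  \<comment> \<open>Multiplication by the character of index 1 shifts Fourier coefficients, so
    \<open>g = g x + e * k\<close> makes each term a difference of neighbours; the constant
    \<open>g x\<close> only enters at \<open>n = 0\<close>.\<close>
  have coef: "?I (\<lambda>t. g t * chr L n t) / (2 * of_real L) * chr L (-n) x =
      (if n = 0 then g x else 0) + (D (n + 1) * chr L (- (n + 1)) x - D n * chr L (- n) x) / (2 * of_real L)" for n
  proof -
    have "?I (\<lambda>t. g t * chr L n t) = ?I (\<lambda>t. g x * chr L n t +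
        (chr L (-1) x * (k t * chr L (n + 1) t) - k t * chr L n t))"
    proof (rule integral_cong)
      fix t assume "t \<in> {-L..L}"
      have "chr L 1 t * chr L (-1) x = e t + 1"
        using chr_add[of L 1 t "-x"] by (simp add: e_def chr_minus)
      moreover have "chr L (-1) x * (k t * chr L (n + 1) t) = (chr L 1 t * chr L (-1) x) * (k t * chr L n t)"
        by (simp add: chr_mult[symmetric])
      ultimately have "chr L (-1) x * (k t * chr L (n + 1) t) = (e t + 1) * (k t * chr L n t)" by simp
      then show "g t * chr L n t = g x * chr L n t +
        (chr L (-1) x * (k t * chr L (n + 1) t) - k t * chr L n t)"
        unfolding gk[OF \<open>t \<in> {-L..L}\<close>] by (simp add: algebra_simps)
    qed
    also have "\<dots> = g x * ?I (chr L n) + (chr L (-1) x * D (n + 1) - D n)"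
      unfolding D_def by (simp add: integral_add integral_diff int continuous_intros kc)
    also have "g x * ?I (chr L n) = (if n = 0 then 2 * of_real L * g x else 0)"
      by (simp add: integral_chr[OF L])
    finally have I: "?I (\<lambda>t. g t * chr L n t) =
        (if n = 0 then 2 * of_real L * g x else 0) + (chr L (-1) x * D (n + 1) - D n)" .
    have "chr L (-1) x * chr L (-n) x = chr L (-(n+1)) x" by (simp add: chr_mult algebra_simps)
    then show ?thesis unfolding I using L by (auto simp: field_simps)
  qed
  define F where "F = (\<lambda>n. D n * chr L (- n) x / (2 * of_real L))"
  have tel: "(\<Sum>n\<in>{- int N..int N}. F (n + 1) - F n) = F (int N + 1) - F (- int N)" for N
  proof (induction N)
    case (Suc N)
    have "{- int (Suc N)..int (Suc N)} = insert (- int (Suc N)) (insert (int (Suc N)) {- int N..int N})"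
      by auto
    then show ?case using Suc by (simp add: add.commute)
  qed simp
  have part: "(\<Sum>n\<in>{- int N..int N}. ?I (\<lambda>t. g t * chr L n t) / (2 * of_real L) * chr L (-n) x) =
      g x + (F (int N + 1) - F (- int N))" for N :: nat
    unfolding coef sum.distrib tel[symmetric] by (simp add: F_def diff_divide_distrib)
  have zero: "(\<lambda>N. F (s N)) \<longlonglongrightarrow> 0" if "(\<lambda>N. D (s N)) \<longlonglongrightarrow> 0" for s :: "nat \<Rightarrow> int"
  proof -
    have "(\<lambda>N. cmod (D (s N)) / (2 * L)) \<longlonglongrightarrow> 0 / (2 * L)"
      using that L by (intro tendsto_intros tendsto_norm_zero) auto
    moreover have "cmod (F n) = cmod (D n) / (2 * L)" for n
      using L by (simp add: F_def norm_mult norm_divide)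
    ultimately show ?thesis using tendsto_norm_zero_iff by fastforce
  qed
  have "(\<lambda>N. g x + (F (int N + 1) - F (- int N))) \<longlonglongrightarrow> g x + (0 - 0)"
    using fourier_coefficients_tendsto_zero[OF L kc]
    by (intro tendsto_add tendsto_const tendsto_diff zero) (simp_all add: D_def)
  then show ?thesis unfolding part by simp
qed

section \<open>The conjugate weight\<close>

text \<open>With \<open>y = exp t\<close> this is the supremum of
  \<open>y ^ j * exp (- q * \<omega> y)\<close> over \<open>y \<ge> 1\<close>, the weight sequence
  of the class; \<open>wM_ge\<close> and \<open>wM_le\<close> are the two halves of that
  description.\<close>

definition wM :: "(real \<Rightarrow> real) \<Rightarrow> real \<Rightarrow> nat \<Rightarrow> real" where
  "wM \<omega> q j = exp (q * young_conj \<omega> (real j / q))"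

lemma wM_pos: "0 < wM \<omega> q j" by (simp add: wM_def)

context
  fixes \<omega> :: "real \<Rightarrow> real"
  assumes w: "weight \<omega>"
begin

lemma weight_nonneg: "0 \<le> x \<Longrightarrow> 0 \<le> \<omega> x"
  using w unfolding weight_def by blast

lemma weight_mono: "0 \<le> x \<Longrightarrow> x \<le> y \<Longrightarrow> \<omega> x \<le> \<omega> y"
  using w unfolding weight_def by (auto elim!: mono_onD)

text \<open>As \<open>ln\<close> is of smaller order than \<omega>, a power is paid for by an
  arbitrarily small multiple of \<omega>. Polynomial losses are absorbed in this way at the price of
  a small change of \<open>q\<close>.\<close>

lemma weight_beats_power:
  assumes e: "0 < e"
  shows "\<exists>C>0. \<forall>y\<ge>0. (1 + y) ^ n * exp (- e * \<omega> y) \<le> C"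
proof -
  have o: "ln \<in> o[at_top](\<omega>)" using w unfolding weight_def by blast
  \<comment> \<open>The summand 1 covers \<open>n = 0\<close>.\<close>
  have c: "0 < e / (real n + 1)" using e by simp
  obtain Y where Y: "\<And>y. y \<ge> Y \<Longrightarrow> norm (ln y) \<le> e / (real n + 1) * norm (\<omega> y)"
    using landau_o.smallD[OF o c] unfolding eventually_at_top_linorder by blast
  define Z where "Z = max Y 1"
  have "(1 + y) ^ n * exp (- e * \<omega> y) \<le> max (2 ^ n) ((1 + Z) ^ n)" if y: "0 \<le> y" for y
  proof (cases "Z \<le> y")
    case True
    then have y1: "1 \<le> y" "Y \<le> y" by (auto simp: Z_def)
    have "ln y \<le> e / (real n + 1) * \<omega> y" using Y[OF y1(2)] weight_nonneg[OF y] y1 by simp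
    then have "(real n + 1) * ln y \<le> e * \<omega> y" by (simp add: field_simps)
    moreover have "real n * ln y \<le> (real n + 1) * ln y" using y1 by (intro mult_right_mono) auto
    ultimately have le: "real n * ln y \<le> e * \<omega> y" by linarith
    have "(1 + y) ^ n \<le> (2 * y) ^ n" using y1 by (intro power_mono) auto
    also have "\<dots> = 2 ^ n * exp (real n * ln y)" using y1 by (simp add: power_mult_distrib exp_of_nat_mult)
    also have "\<dots> \<le> 2 ^ n * exp (e * \<omega> y)" using le by simp
    finally have "(1 + y) ^ n * exp (- e * \<omega> y) \<le> 2 ^ n * exp (e * \<omega> y) * exp (- e * \<omega> y)"
      by (intro mult_right_mono) auto
    also have "\<dots> = 2 ^ n" by (simp add: mult.assoc exp_add[symmetric])
    finally show ?thesis by simp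
  next
    case False
    have "(1 + y) ^ n * exp (- e * \<omega> y) \<le> (1 + Z) ^ n * 1"
      using False y e weight_nonneg[OF y] by (intro mult_mono power_mono) auto
    then show ?thesis by simp
  qed
  moreover have "0 < max (2 ^ n) ((1 + Z) ^ n)" by (simp add: less_max_iff_disj)
  ultimately show ?thesis by blast
qed

text \<open>A real supremum says something only about a bounded set. Here powers of
  \<open>exp t\<close> are beaten by \<open>exp (\<omega> (exp t))\<close>.\<close>

lemma young_conj_bdd: "bdd_above ((\<lambda>t. s * t - \<omega> (exp t)) ` {0..})"
proof -
  obtain C where C: "0 < C" "\<And>y. y \<ge> 0 \<Longrightarrow> (1 + y) ^ (nat \<lceil>\<bar>s\<bar>\<rceil>) * exp (- 1 * \<omega> y) \<le> C"
    using weight_beats_power[of 1 "nat \<lceil>\<bar>s\<bar>\<rceil>"] by auto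
  have "s * t - \<omega> (exp t) \<le> ln C" if t: "0 \<le> t" for t
  proof -
    have "s * t \<le> real (nat \<lceil>\<bar>s\<bar>\<rceil>) * t" using t by (intro mult_right_mono) (auto, linarith)
    then have "exp (s * t - \<omega> (exp t)) \<le> exp (real (nat \<lceil>\<bar>s\<bar>\<rceil>) * t - \<omega> (exp t))" by simp
    also have "\<dots> = exp t ^ nat \<lceil>\<bar>s\<bar>\<rceil> * exp (- 1 * \<omega> (exp t))"
      unfolding exp_diff exp_of_nat_mult by (simp add: exp_minus divide_inverse)
    also have "\<dots> \<le> (1 + exp t) ^ nat \<lceil>\<bar>s\<bar>\<rceil> * exp (- 1 * \<omega> (exp t))"
      by (intro mult_right_mono power_mono) auto
    also have "\<dots> \<le> C" by (rule C(2)) simp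
    finally show ?thesis using C(1) by (simp add: ln_ge_iff)
  qed
  then show ?thesis by (auto simp: bdd_above_def)
qed

lemma wM_ge:
  assumes q: "0 < q" and y: "1 \<le> y"
  shows "y ^ j * exp (- q * \<omega> y) \<le> wM \<omega> q j"
proof -
  have "real j / q * ln y - \<omega> (exp (ln y)) \<le> young_conj \<omega> (real j / q)"
    unfolding young_conj_def by (rule cSUP_upper[OF _ young_conj_bdd]) (use y in simp)
  then have "q * (real j / q * ln y - \<omega> y) \<le> q * young_conj \<omega> (real j / q)"
    using q y by (intro mult_left_mono) auto
  then have "real j * ln y - q * \<omega> y \<le> q * young_conj \<omega> (real j / q)" using q by (simp add: algebra_simps)
  then have "exp (real j * ln y - q * \<omega> y) \<le> wM \<omega> q j" unfolding wM_def by simp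
  moreover have "exp (real j * ln y - q * \<omega> y) = y ^ j * exp (- q * \<omega> y)"
    using y by (simp add: exp_diff exp_of_nat_mult exp_minus divide_inverse)
  ultimately show ?thesis by simp
qed

lemma wM_le:
  assumes q: "0 < q" and le: "\<And>y. 1 \<le> y \<Longrightarrow> y ^ j * exp (- q * \<omega> y) \<le> B"
  shows "wM \<omega> q j \<le> B"
proof -
  have B: "0 < B" using less_le_trans[OF exp_gt_zero, of "- q * \<omega> 1" B] le[of 1] by simp
  have "young_conj \<omega> (real j / q) \<le> ln B / q"
    unfolding young_conj_def
  proof (rule cSUP_least)
    fix t :: real assume "t \<in> {0..}"
    then have "exp t ^ j * exp (- q * \<omega> (exp t)) \<le> B" by (intro le) auto
    then have "exp (real j * t - q * \<omega> (exp t)) \<le> B"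
      by (simp add: exp_diff exp_of_nat_mult exp_minus divide_inverse)
    then have "real j * t - q * \<omega> (exp t) \<le> ln B" using B by (simp add: ln_ge_iff)
    then have "(real j * t - q * \<omega> (exp t)) / q \<le> ln B / q" using q by (intro divide_right_mono) auto
    then show "real j / q * t - \<omega> (exp t) \<le> ln B / q" using q by (simp add: diff_divide_distrib)
  qed auto
  then have "q * young_conj \<omega> (real j / q) \<le> ln B" using q by (simp add: field_simps)
  then show ?thesis unfolding wM_def using B by (simp add: ln_ge_iff)
qed

text \<open>For \<open>y < 1\<close> the left side is at most 1, while the supremum
  \<open>wM \<omega> q j\<close> is at least its entry \<open>exp (- q * \<omega> 1)\<close> at
  \<open>y = 1\<close>; this explains the constant.\<close>

lemma wM_ge_all:
  assumes q: "0 < q" and y: "0 \<le> y"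
  shows "y ^ j * exp (- q * \<omega> y) \<le> exp (q * \<omega> 1) * wM \<omega> q j"
proof (cases "1 \<le> y")
  case True
  have "1 \<le> exp (q * \<omega> 1)" using q weight_nonneg by simp
  then have "wM \<omega> q j \<le> exp (q * \<omega> 1) * wM \<omega> q j" using wM_pos[of \<omega> q j] by simp
  then show ?thesis using wM_ge[OF q True, of j] by linarith
next
  case False
  have "y ^ j * exp (- q * \<omega> y) \<le> 1 * 1"
    using False y q weight_nonneg[OF y] by (intro mult_mono power_le_one) auto
  also have "1 * 1 = exp (q * \<omega> 1) * (1 ^ j * exp (- q * \<omega> 1))" by (simp add: exp_add[symmetric])
  also have "\<dots> \<le> exp (q * \<omega> 1) * wM \<omega> q j" by (intro mult_left_mono wM_ge q) auto
  finally show ?thesis .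
qed

lemma wM_antimono:
  assumes "0 < q" "q \<le> q'"
  shows "wM \<omega> q' j \<le> wM \<omega> q j"
proof (rule wM_le)
  fix y :: real assume y: "1 \<le> y"
  have "exp (- q' * \<omega> y) \<le> exp (- q * \<omega> y)" using assms weight_nonneg[of y] y by (simp add: mult_right_mono)
  then have "y ^ j * exp (- q' * \<omega> y) \<le> y ^ j * exp (- q * \<omega> y)" using y by (intro mult_left_mono) auto
  also have "\<dots> \<le> wM \<omega> q j" by (rule wM_ge) (use assms y in auto)
  finally show "y ^ j * exp (- q' * \<omega> y) \<le> wM \<omega> q j" .
qed (use assms in auto)

text \<open>The additional factor \<open>y\<close> is absorbed by
  \<open>exp (- (q' - q) * \<omega> y)\<close>. This gives the continuity of
  \<open>Dop\<close>.\<close>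

lemma wM_shift:
  assumes "0 < q" "q < q'"
  shows "\<exists>C>0. \<forall>j. wM \<omega> q' (Suc j) \<le> C * wM \<omega> q j"
proof -
  obtain C where C: "0 < C" "\<And>y. y \<ge> 0 \<Longrightarrow> (1 + y) ^ 1 * exp (- (q' - q) * \<omega> y) \<le> C"
    using weight_beats_power[of "q' - q" 1] assms by auto
  have "wM \<omega> q' (Suc j) \<le> C * wM \<omega> q j" for j
  proof (rule wM_le)
    fix y :: real assume y: "1 \<le> y"
    have "y ^ Suc j * exp (- q' * \<omega> y) = (y * exp (- (q' - q) * \<omega> y)) * (y ^ j * exp (- q * \<omega> y))"
      by (simp add: exp_add[symmetric] algebra_simps)
    also have "\<dots> \<le> C * wM \<omega> q j"
    proof (intro mult_mono wM_ge)
      have "y * exp (- (q' - q) * \<omega> y) \<le> (1 + y) ^ 1 * exp (- (q' - q) * \<omega> y)"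
        by (intro mult_right_mono) auto
      then show "y * exp (- (q' - q) * \<omega> y) \<le> C" using C(2)[of y] y by linarith
    qed (use assms y C in auto)
    finally show "y ^ Suc j * exp (- q' * \<omega> y) \<le> C * wM \<omega> q j" .
  qed (use assms in auto)
  then show ?thesis using C(1) by blast
qed

text \<open>The estimate behind Leibniz' rule. One term of the binomial theorem is at most
  \<open>(x + y) ^ j\<close>, and the near subadditivity of \<omega> with factor
  \<open>q2 / q1\<close> handles the exponentials; the suprema over \<open>y\<close> and
  \<open>x\<close> are then taken one after the other.\<close>

lemma wM_binomial:
  assumes q: "0 < q1" "q1 < q2"
  shows "\<exists>C>0. \<forall>j. \<forall>i\<le>j. real (j choose i) * (wM \<omega> q2 i * wM \<omega> q2 (j - i)) \<le> C * wM \<omega> q1 j"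
proof -
  have "1 < q2 / q1" using q by simp
  then obtain K where K: "K > 0" "\<And>x y. 0 \<le> x \<Longrightarrow> 0 \<le> y \<Longrightarrow> \<omega> (x + y) \<le> q2 / q1 * (\<omega> x + \<omega> y) + K"
    using w unfolding weight_def by meson
  define C where "C = exp (q1 * K)"
  have "real (j choose i) * (wM \<omega> q2 i * wM \<omega> q2 (j - i)) \<le> C * wM \<omega> q1 j" if ij: "i \<le> j" for i j
  proof -
    define b where "b = real (j choose i)"
    have b: "0 < b" using ij by (simp add: b_def)
    have base: "b * ((x ^ i * exp (- q2 * \<omega> x)) * (y ^ (j - i) * exp (- q2 * \<omega> y))) \<le> C * wM \<omega> q1 j"
      if xy: "1 \<le> x" "1 \<le> y" for x y
    proof -
      have "b * (x ^ i * y ^ (j - i)) \<le> (x + y) ^ j"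
      proof -
        have "b * x ^ i * y ^ (j - i) \<le> (\<Sum>k\<le>j. real (j choose k) * x ^ k * y ^ (j - k))"
          unfolding b_def using ij xy by (intro member_le_sum) auto
        then show ?thesis by (simp add: binomial_ring mult.assoc)
      qed
      moreover have "exp (- q2 * (\<omega> x + \<omega> y)) \<le> C * exp (- q1 * \<omega> (x + y))"
      proof -
        have "q1 * \<omega> (x + y) \<le> q1 * (q2 / q1 * (\<omega> x + \<omega> y) + K)"
          using K(2)[of x y] xy q by (intro mult_left_mono) auto
        also have "\<dots> = q2 * (\<omega> x + \<omega> y) + q1 * K" using q by (simp add: field_simps)
        finally show ?thesis unfolding C_def by (simp add: exp_add[symmetric])
      qed
      ultimately have "(b * (x ^ i * y ^ (j - i))) * exp (- q2 * (\<omega> x + \<omega> y)) \<le> (x + y) ^ j * (C * exp (- q1 * \<omega> (x + y)))"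
        using xy by (intro mult_mono) auto
      also have "\<dots> = C * ((x + y) ^ j * exp (- q1 * \<omega> (x + y)))" by simp
      also have "\<dots> \<le> C * wM \<omega> q1 j"
        by (intro mult_left_mono wM_ge) (use xy q in \<open>auto simp: C_def\<close>)
      finally show ?thesis by (simp add: distrib_left exp_diff exp_minus divide_inverse mult_ac)
    qed
    have step: "b * ((x ^ i * exp (- q2 * \<omega> x)) * wM \<omega> q2 (j - i)) \<le> C * wM \<omega> q1 j" if x: "1 \<le> x" for x
    proof -
      define A where "A = b * (x ^ i * exp (- q2 * \<omega> x))"
      have A: "0 < A" using b x by (simp add: A_def)
      have "wM \<omega> q2 (j - i) \<le> C * wM \<omega> q1 j / A"
        by (rule wM_le) (use base[OF x] A q in \<open>auto simp: A_def field_simps\<close>)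
      then show ?thesis using A by (simp add: A_def field_simps)
    qed
    define A where "A = b * wM \<omega> q2 (j - i)"
    have A: "0 < A" using b wM_pos by (simp add: A_def)
    have "wM \<omega> q2 i \<le> C * wM \<omega> q1 j / A"
      by (rule wM_le) (use step A q in \<open>auto simp: A_def field_simps\<close>)
    then show ?thesis using A by (simp add: A_def b_def field_simps)
  qed
  moreover have "0 < C" by (simp add: C_def)
  ultimately show ?thesis by blast
qed

text \<open>The index \<open>j\<close> is the integer part of a slope of \<open>q \<omega>(e\<^sup>t)\<close> at \<open>t = ln y\<close>; rounding costs
  the factor \<open>y\<close>.\<close>

lemma wM_optimal:
  assumes q: "0 < q" and y: "1 \<le> y"
  shows "\<exists>j. wM \<omega> q j \<le> y ^ Suc j * exp (- q * \<omega> y)"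
\<comment> \<open>At \<open>y = 1\<close> the point \<open>ln y\<close> is the endpoint of the
  domain of convexity; there \<open>j = 0\<close> works because \<omega> is increasing.\<close>
proof (cases "y = 1")
  case True
  have "wM \<omega> q 0 \<le> exp (- q * \<omega> 1)"
    by (rule wM_le) (use q weight_mono in \<open>auto intro!: mult_left_mono\<close>)
  then show ?thesis using True by (intro exI[of _ 0]) simp
next
  case False
  define t where "t = ln y"
  have t: "0 < t" "exp t = y" using y False by (auto simp: t_def)
  define \<phi> where "\<phi> = (\<lambda>t. \<omega> (exp t))"
  \<comment> \<open>The right-hand slope of \<phi> at \<open>t\<close>: the line with this slope
    through the graph point supports \<phi> from below.\<close>
  define s where "s = Inf ((\<lambda>u. (\<phi> t - \<phi> u) / (t - u)) ` ({t<..} \<inter> {0..}))"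
  have conv: "convex_on {0..} \<phi>" using w unfolding weight_def \<phi>_def by blast
  have sub: "\<phi> u \<ge> \<phi> t + s * (u - t)" if "0 \<le> u" for u
    unfolding s_def
    by (rule convex_le_Inf_differential[OF conv]) (use t that in auto)
  have s0: "0 \<le> s"
    unfolding s_def
  proof (rule cINF_greatest)
    show "{t<..} \<inter> {0..} \<noteq> {}" using t by (metis IntI atLeast_iff empty_iff greaterThan_iff less_add_one less_imp_le order_less_trans)
    fix u assume "u \<in> {t<..} \<inter> {0..}"
    then have "\<phi> t \<le> \<phi> u" "t < u" by (auto simp: \<phi>_def intro!: weight_mono)
    then show "0 \<le> (\<phi> t - \<phi> u) / (t - u)" by (intro divide_nonpos_neg) auto
  qed
  \<comment> \<open>Rounding down makes \<open>(q * s - j) * u\<close> nonnegative, so it may be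
    dropped; replacing \<open>q * s\<close> by \<open>j + 1\<close> afterwards costs the factor
    \<open>y\<close>.\<close>
  define j where "j = nat \<lfloor>q * s\<rfloor>"
  have j: "real j \<le> q * s" "q * s \<le> real j + 1"
    using s0 q by (auto simp: j_def)
  have "wM \<omega> q j \<le> y ^ Suc j * exp (- q * \<omega> y)"
  proof (rule wM_le[OF q])
    fix x :: real assume x: "1 \<le> x"
    define u where "u = ln x"
    have u: "0 \<le> u" "exp u = x" using x by (auto simp: u_def)
    have "q * (\<phi> t + s * (u - t)) \<le> q * \<phi> u" using sub[OF u(1)] q by simp
    then have "real j * u - q * \<phi> u \<le> (q * s) * t - q * \<phi> t - (q * s - real j) * u"
      by (simp add: algebra_simps)
    also have "\<dots> \<le> (q * s) * t - q * \<phi> t" using j u by simp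
    also have "\<dots> \<le> (real j + 1) * t - q * \<phi> t" using mult_right_mono[OF j(2), of t] t by simp
    finally have "exp (real j * u - q * \<phi> u) \<le> exp (real (Suc j) * t - q * \<phi> t)"
      by (simp add: algebra_simps)
    then show "x ^ j * exp (- q * \<omega> x) \<le> y ^ Suc j * exp (- q * \<omega> y)"
      unfolding exp_diff exp_of_nat_mult \<phi>_def u(2) t(2) by (simp add: exp_minus divide_inverse)
  qed
  then show ?thesis by blast
qed

text \<open>Between \<open>2 ^ n\<close> and \<open>2 ^ (n + 1)\<close> the integrand is at least
  \<open>\<omega> (2 ^ n) / 4 ^ (n + 1)\<close>, and this interval has length \<open>2 ^ n\<close>;
  hence the denominators \<open>2 ^ (n + 2)\<close>.\<close>

lemma summable_weight_dyadic: "summable (\<lambda>k. \<omega> (2 ^ k) / 2 ^ k)"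
proof -
  define f where "f = (\<lambda>x. \<omega> x / x\<^sup>2)"
  have si: "set_integrable lborel {1..} f" using w unfolding weight_def f_def by blast
  have int: "f integrable_on {1..}" using set_borel_integral_eq_integral(1)[OF si] .
  have f0: "0 \<le> f x" if "1 \<le> x" for x using weight_nonneg[of x] that by (simp add: f_def)
  have sub: "f integrable_on {x..y}" if "1 \<le> x" for x y
    by (rule integrable_on_subinterval[OF int]) (use that in auto)
  have one: "(1::real) \<le> 2 ^ k" for k by simp
  have le: "(\<Sum>k<n. \<omega> (2 ^ k) / 2 ^ (k + 2)) \<le> integral {1..2 ^ n} f" for n
  proof (induction n)
    case (Suc n)
    have "\<omega> (2 ^ n) / 2 ^ (n + 2) = integral {2 ^ n..2 ^ Suc n :: real} (\<lambda>x. \<omega> (2 ^ n) / (2 ^ Suc n)\<^sup>2)"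
      by (simp add: power2_eq_square power_add)
    also have "\<dots> \<le> integral {2 ^ n..2 ^ Suc n} f"
    proof (rule integral_le)
      fix x :: real assume x: "x \<in> {2 ^ n..2 ^ Suc n}"
      have x1: "1 \<le> x" using order_trans[OF one[of n], of x] x by simp
      show "\<omega> (2 ^ n) / (2 ^ Suc n)\<^sup>2 \<le> f x" unfolding f_def
        using x x1 weight_mono[of "2 ^ n" x] weight_nonneg[of x]
        by (intro frac_le power_mono) auto
    qed (use sub one in auto)
    finally have "(\<Sum>k<Suc n. \<omega> (2 ^ k) / 2 ^ (k + 2)) \<le> integral {1..2 ^ n} f + integral {2 ^ n..2 ^ Suc n} f"
      using Suc by simp
    also have "\<dots> = integral {1..2 ^ Suc n} f"
      by (rule Henstock_Kurzweil_Integration.integral_combine) (use sub one in auto)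
    finally show ?case .
  qed simp
  have "summable (\<lambda>k. \<omega> (2 ^ k) / 2 ^ (k + 2))"
  proof (rule bounded_imp_summable)
    show "0 \<le> \<omega> (2 ^ k) / 2 ^ (k + 2)" for k using weight_nonneg[of "2 ^ k"] by simp
    fix n
    have "(\<Sum>k\<le>n. \<omega> (2 ^ k) / 2 ^ (k + 2)) \<le> integral {1..2 ^ Suc n} f"
      using le[of "Suc n"] by (simp add: lessThan_Suc_atMost)
    also have "\<dots> \<le> integral {1..} f"
      by (rule integral_subset_le) (use sub int f0 in auto)
    finally show "(\<Sum>k\<le>n. \<omega> (2 ^ k) / 2 ^ (k + 2)) \<le> integral {1..} f" .
  qed
  from summable_mult[OF this, of 4] show ?thesis by (simp add: power_add)
qed

text \<open>The form of the decay is fitted to two uses. Besides the cut-off, the density proof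
  needs two copies of the weight: one outweighs the growth of an element of \<open>P\<close> on the
  real axis, the other leaves summable samples.\<close>

lemma exists_entire_weight_decay:
  assumes \<delta>: "0 < \<delta>"
  shows "\<exists>h. h holomorphic_on UNIV \<and> h 0 = 1 \<and>
      (\<forall>z. cmod (h z) \<le> exp (\<delta> * \<bar>Im z\<bar>)) \<and> (\<forall>z. cmod (h z - 1) \<le> exp (\<delta> * cmod z) - 1) \<and>
      (\<exists>C. \<forall>z. cmod (h z) \<le> C * exp (\<delta> * \<bar>Im z\<bar> - 2 * \<omega> (2 * cmod z)))"
proof (rule exists_entire_decay[where \<Omega>="\<lambda>x. 2 * \<omega> (2 * x)"])
  have "summable (\<lambda>k. \<omega> (2 ^ (k + 2)) / 2 ^ (k + 2))"
    using summable_weight_dyadic by (simp only: summable_iff_shift[of "\<lambda>k. \<omega> (2 ^ k) / 2 ^ k" 2])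
  \<comment> \<open>The 8 is the factor 2 of the weight times \<open>2 ^ 2\<close> from the shift of
    the index.\<close>
  from summable_mult[OF this, of 8] show "summable (\<lambda>k. 2 * \<omega> (2 * 2 ^ (k + 1)) / 2 ^ k)"
    by (simp add: power_add)
qed (use \<delta> in \<open>auto intro!: weight_mono weight_nonneg\<close>)

lemma summable_exp_weight_lat:
  assumes "0 < L" "0 < e"
  shows "(\<lambda>n. exp (- e * \<omega> \<bar>lat L n\<bar>)) summable_on UNIV"
proof -
  obtain C where C: "0 < C" "\<And>y. y \<ge> 0 \<Longrightarrow> (1 + y) ^ 2 * exp (- e * \<omega> y) \<le> C"
    using weight_beats_power[of e 2] assms by auto
  have "(\<lambda>n. norm (exp (- e * \<omega> \<bar>lat L n\<bar>))) summable_on UNIV"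
  proof (rule abs_summable_on_lat[OF assms(1), of _ C])
    fix n
    have "0 < (1 + \<bar>lat L n\<bar>)\<^sup>2" by (intro zero_less_power add_pos_nonneg) auto
    then show "norm (exp (- e * \<omega> \<bar>lat L n\<bar>)) \<le> C / (1 + \<bar>lat L n\<bar>)\<^sup>2"
      using C(2)[of "\<bar>lat L n\<bar>"] by (simp add: le_divide_eq mult.commute)
  qed
  then show ?thesis by simp
qed

end

section \<open>The two function spaces and the Fourier-Laplace transform\<close>

lemma seminorm_continuous_imp_bound:
  assumes N: "seminorm_on X N" and X: "cfun.subspace X" and q: "seminorm_on X q"
    and cont: "continuous_map (seminorm_topology X {N}) euclideanreal q"
  shows "\<exists>C\<ge>0. \<forall>f\<in>X. q f \<le> C * N f"
proof -
  have ts: "topspace (seminorm_topology X {N}) = X"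
    using topspace_seminorm_topology[OF N, of "{N}"] cfun.subspace_0[OF X] by simp
  have op: "openin (seminorm_topology X {N}) {f\<in>X. q f \<in> {..<1}}"
    using openin_continuous_map_preimage[OF cont, of "{..<1}"] ts by simp
  have 0: "0 \<in> {f\<in>X. q f \<in> {..<1}}"
    using seminorm_on_zero[OF q] cfun.subspace_0[OF X] by simp
  have "\<exists>F e. finite F \<and> F \<subseteq> {N} \<and> 0 < e \<and> (\<forall>g\<in>X. (\<forall>p\<in>F. p (g - 0) < e) \<longrightarrow> g \<in> {f\<in>X. q f \<in> {..<1}})"
    by (rule seminorm_topology_nhds[OF _ X op 0]) (use N in simp)
  then obtain F e where F: "F \<subseteq> {N}" "0 < e" "\<forall>g\<in>X. (\<forall>p\<in>F. p (g - 0) < e) \<longrightarrow> g \<in> {f\<in>X. q f \<in> {..<1}}"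
    by (elim exE conjE)
  have small: "q g < 1" if "g \<in> X" "N g < e" for g
    using F that by auto
  have scale: "N (\<lambda>x. of_real t * f x) = t * N f" "q (\<lambda>x. of_real t * f x) = t * q f"
    "(\<lambda>x. of_real t * f x) \<in> X" if "f \<in> X" "0 < t" for f t
    using conjunct2[OF N[unfolded seminorm_on_def], rule_format, OF that(1), of "of_real t"]
      conjunct2[OF q[unfolded seminorm_on_def], rule_format, OF that(1), of "of_real t"]
      cfun.subspace_scale[OF X that(1), of "of_real t"] that(2) by auto
  have "q f \<le> (2 / e) * N f" if f: "f \<in> X" for f
  proof (cases "N f = 0")
    case True
    have "t * q f < 1" if "0 < t" for t
      using small[OF scale(3)[OF f that]] scale(1,2)[OF f that] True F(2) by simp
    from this[of "2 / q f"] have "q f \<le> 0" by (cases "0 < q f") auto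
    then show ?thesis using True by simp
  next
    case False
    then have pos: "N f > 0" using seminorm_on_nonneg[OF N X f] by simp
    have t: "0 < e / (2 * N f)" using pos F(2) by simp
    have "e / (2 * N f) * N f < e" using pos F(2) by simp
    then have "e / (2 * N f) * q f < 1" using small[OF scale(3)[OF f t]] scale(1,2)[OF f t] by simp
    then show ?thesis using pos F(2) by (simp add: field_simps)
  qed
  then show ?thesis using F(2) by (intro exI[of _ "2/e"]) simp
qed

lemma seminorm_bound_imp_continuous:
  assumes N: "seminorm_on X N" and X: "cfun.subspace X" and q: "seminorm_on X q"
    and le: "\<And>f. f \<in> X \<Longrightarrow> q f \<le> C * N f"
  shows "continuous_map (seminorm_topology X {N}) euclideanreal q"
proof -
  have ts: "topspace (seminorm_topology X {N}) = X"
    using topspace_seminorm_topology[OF N, of "{N}"] cfun.subspace_0[OF X] by simp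
  define K where "K = \<bar>C\<bar> + 1"
  have K: "0 < K" by (simp add: K_def)
  have leK: "q f \<le> K * N f" if "f \<in> X" for f
    by (rule order_trans[OF le[OF that] mult_right_mono])
       (use seminorm_on_nonneg[OF N X that] in \<open>auto simp: K_def\<close>)
  have tri: "\<bar>q g - q f\<bar> \<le> q (g - f)" if "f \<in> X" "g \<in> X" for f g
  proof -
    have d: "g - f \<in> X" "f - g \<in> X" using X that cfun.subspace_diff by blast+
    have "q (f + (g - f)) \<le> q f + q (g - f)" "q (g + (f - g)) \<le> q g + q (f - g)"
      using q(1) d that unfolding seminorm_on_def by blast+
    then show ?thesis
      using seminorm_on_minus_commute[OF q(1) X that] by (simp add: algebra_simps)
  qed
  have "openin (seminorm_topology X {N}) {x\<in>X. q x \<in> U}" if U: "open U" for U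
  proof (subst openin_subopen, intro ballI)
    fix f assume f: "f \<in> {x\<in>X. q x \<in> U}"
    then obtain e where e: "0 < e" "ball (q f) e \<subseteq> U" using U openE by blast
    let ?B = "{g\<in>X. N (g - f) < e / K}"
    have "openin (seminorm_topology X {N}) ?B"
      unfolding seminorm_topology_def
      by (rule topology_generated_by_Basis) (use f e K in \<open>auto intro!: exI[of _ f] exI[of _ "e / K"]\<close>)
    moreover have "f \<in> ?B"
      using f e(1) K seminorm_on_zero[OF N cfun.subspace_0[OF X]] by simp
    moreover have "g \<in> {x\<in>X. q x \<in> U}" if g: "g \<in> ?B" for g
    proof -
      have gX: "g \<in> X" and Ng: "N (g - f) < e / K" using g by blast+
      have gf: "g - f \<in> X" using cfun.subspace_diff[OF X gX] f by blast
      have "K * N (g - f) < e" using Ng K by (simp add: field_simps)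
      then have "q (g - f) < e" using leK[OF gf] by linarith
      then have "\<bar>q g - q f\<bar> < e" using tri[of f g] gX f by simp
      then show ?thesis using e(2) gX by (auto simp: dist_real_def abs_minus_commute)
    qed
    ultimately show "\<exists>T. openin (seminorm_topology X {N}) T \<and> f \<in> T \<and> T \<subseteq> {x\<in>X. q x \<in> U}" by blast
  qed
  then show ?thesis unfolding continuous_map_def ts by simp
qed

section \<open>Iterated derivatives of functions extended by zero\<close>

lemma Dop_outside: "\<not> ereal \<bar>x\<bar> < a \<Longrightarrow> Dop a f x = 0"
  by (simp add: Dop_def)

lemma open_interval_ereal: "open {t. ereal \<bar>t\<bar> < a}"
  by (intro open_Collect_less continuous_intros)

lemma smooth_fun_has_vector_derivative:
  assumes "f \<in> smooth_fun a" "ereal \<bar>x\<bar> < a"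
  shows "((Dop a ^^ j) f has_vector_derivative (Dop a ^^ Suc j) f x) (at x)"
proof -
  have "(Dop a ^^ j) f differentiable (at x)" using assms by (simp add: smooth_fun_def)
  then have "((Dop a ^^ j) f has_vector_derivative vector_derivative ((Dop a ^^ j) f) (at x)) (at x)"
    by (simp add: vector_derivative_works)
  then show ?thesis using assms(2) by (simp add: Dop_def)
qed

text \<open>Iterates of \<open>Dop\<close> are recognised by exhibiting all derivatives at once. The
  algebraic rules, the exponential monomials and the representing function of a functional on
  \<open>P\<close> are handled in this way.\<close>

lemma Dop_family:
  assumes z: "\<And>j x. \<not> ereal \<bar>x\<bar> < a \<Longrightarrow> F j x = 0"
    and d: "\<And>j x. ereal \<bar>x\<bar> < a \<Longrightarrow> (F j has_vector_derivative F (Suc j) x) (at x)"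
  shows "(Dop a ^^ j) (F 0) = F j" "F 0 \<in> smooth_fun a"
proof -
  have D: "Dop a (F j) = F (Suc j)" for j
  proof
    fix x show "Dop a (F j) x = F (Suc j) x"
      by (cases "ereal \<bar>x\<bar> < a") (auto simp: Dop_def z vector_derivative_at[OF d])
  qed
  have 1: "(Dop a ^^ j) (F 0) = F j" for j by (induction j) (auto simp: D)
  then show "(Dop a ^^ j) (F 0) = F j" .
  show "F 0 \<in> smooth_fun a"
    unfolding smooth_fun_def using z differentiableI_vector[OF d] 1 by simp
qed

lemma smooth_fun_outside: "f \<in> smooth_fun a \<Longrightarrow> \<not> ereal \<bar>x\<bar> < a \<Longrightarrow> (Dop a ^^ j) f x = 0"
  by (cases j) (auto simp: smooth_fun_def Dop_outside)

lemma Dop_smooth_add: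
  assumes "f \<in> smooth_fun a" "g \<in> smooth_fun a"
  shows "(Dop a ^^ j) (f + g) = (Dop a ^^ j) f + (Dop a ^^ j) g" "f + g \<in> smooth_fun a"
proof -
  let ?F = "\<lambda>j x. (Dop a ^^ j) f x + (Dop a ^^ j) g x"
  have z: "?F j x = 0" if "\<not> ereal \<bar>x\<bar> < a" for j x
    using smooth_fun_outside[OF assms(1) that] smooth_fun_outside[OF assms(2) that] by simp
  have d: "(?F j has_vector_derivative ?F (Suc j) x) (at x)" if "ereal \<bar>x\<bar> < a" for j x
    by (intro has_vector_derivative_add smooth_fun_has_vector_derivative assms that)
  have 0: "?F 0 = f + g" by (auto simp: fun_eq_iff)
  show "(Dop a ^^ j) (f + g) = (Dop a ^^ j) f + (Dop a ^^ j) g"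
    using Dop_family(1)[of a ?F j, OF z d] unfolding 0 by (auto simp: fun_eq_iff)
  show "f + g \<in> smooth_fun a" using Dop_family(2)[of a ?F, OF z d] unfolding 0 .
qed

lemma Dop_smooth_scale:
  assumes "f \<in> smooth_fun a"
  shows "(Dop a ^^ j) (\<lambda>x. k * f x) = (\<lambda>x. k * (Dop a ^^ j) f x)" "(\<lambda>x. k * f x) \<in> smooth_fun a"
proof -
  let ?F = "\<lambda>j x. k * (Dop a ^^ j) f x"
  have z: "?F j x = 0" if "\<not> ereal \<bar>x\<bar> < a" for j x
    using smooth_fun_outside[OF assms(1) that] by simp
  have d: "(?F j has_vector_derivative ?F (Suc j) x) (at x)" if "ereal \<bar>x\<bar> < a" for j x
    by (intro has_vector_derivative_mult_right smooth_fun_has_vector_derivative assms that)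
  have 0: "?F 0 = (\<lambda>x. k * f x)" by (auto simp: fun_eq_iff)
  show "(Dop a ^^ j) (\<lambda>x. k * f x) = (\<lambda>x. k * (Dop a ^^ j) f x)"
    using Dop_family(1)[of a ?F j, OF z d] unfolding 0 .
  show "(\<lambda>x. k * f x) \<in> smooth_fun a" using Dop_family(2)[of a ?F, OF z d] unfolding 0 .
qed

lemma Dop_smooth_diff:
  assumes "f \<in> smooth_fun a" "g \<in> smooth_fun a"
  shows "(Dop a ^^ j) (f - g) = (Dop a ^^ j) f - (Dop a ^^ j) g"
proof -
  have "f - g = f + (\<lambda>x. (-1) * g x)" by (auto simp: fun_eq_iff)
  then show ?thesis
    by (simp only: Dop_smooth_add(1)[OF assms(1) Dop_smooth_scale(2)[OF assms(2)]]
        Dop_smooth_scale(1)[OF assms(2)]) (auto simp: fun_eq_iff)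
qed

lemma Dop_smooth: 
  assumes "f \<in> smooth_fun a" shows "Dop a f \<in> smooth_fun a"
proof -
  have "(Dop a ^^ Suc j) f differentiable (at x)" if "ereal \<bar>x\<bar> < a" for j x
    using assms that unfolding smooth_fun_def by blast
  then have "(Dop a ^^ j) (Dop a f) differentiable (at x)" if "ereal \<bar>x\<bar> < a" for j x
    using that by (simp add: funpow_swap1)
  then show ?thesis using Dop_outside by (simp add: smooth_fun_def)
qed

lemma smooth_fun_0: "0 \<in> smooth_fun a"
  using Dop_family(2)[of a "\<lambda>_ _. 0"] by (simp add: zero_fun_def)

text \<open>Turns the power series of a transform into its holomorphy and its derivatives, with no
  differentiation under the functional.\<close>

lemma has_fps_shift_deriv:
  fixes \<phi> :: "complex \<Rightarrow> complex"
  assumes "\<And>h. (\<lambda>j. b j * h ^ j) sums \<phi> (\<mu> + h)"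
  shows "(deriv ^^ j) \<phi> \<mu> = fact j * b j" "\<phi> holomorphic_on UNIV"
proof -
  have "(\<lambda>h. \<phi> (\<mu> + h)) has_fps_expansion Abs_fps b"
    by (rule has_fps_expansionI) (use assms in simp)
  from fps_nth_fps_expansion[OF this, of j]
  have "b j = (deriv ^^ j) (\<lambda>h. \<phi> (\<mu> + h)) 0 / fact j" by simp
  then show "(deriv ^^ j) \<phi> \<mu> = fact j * b j"
    using higher_deriv_shift_0[of j \<phi> \<mu>] by (simp add: o_def)
  have "\<phi> holomorphic_on ball \<mu> (real n)" for n
    by (rule power_series_holomorphic[of _ _ b]) (use assms[of "_ - \<mu>"] in simp)
  then have "\<phi> holomorphic_on (\<Union>n. ball \<mu> (real n))"
    by (intro holomorphic_on_UN_open) auto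
  moreover have "(\<Union>n. ball \<mu> (real n)) = UNIV" using reals_Archimedean2 by auto
  ultimately show "\<phi> holomorphic_on UNIV" by simp
qed

text \<open>\<open>mono_deriv \<mu> i j\<close> is the \<open>i\<close>-th derivative of \<open>(-\<i> t)\<^sup>j exp (-\<i> \<mu> t)\<close>.\<close>

fun mono_deriv :: "complex \<Rightarrow> nat \<Rightarrow> nat \<Rightarrow> real \<Rightarrow> complex" where
  "mono_deriv \<mu> 0 j t = (- \<i> * of_real t) ^ j * exp (- \<i> * \<mu> * of_real t)"
| "mono_deriv \<mu> (Suc i) j t = - \<i> * \<mu> * mono_deriv \<mu> i j t - \<i> * of_nat j * mono_deriv \<mu> i (j - 1) t"

lemma mono_deriv_has_vector_derivative:
  "(mono_deriv \<mu> i j has_vector_derivative mono_deriv \<mu> (Suc i) j t) (at t)"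
proof (induction i arbitrary: j)
  case 0
  have "((\<lambda>z. (- \<i> * z) ^ j * exp (- \<i> * \<mu> * z)) has_field_derivative
     (of_nat j * (- \<i> * of_real t) ^ (j - 1) * (- \<i>)) * exp (- \<i> * \<mu> * of_real t)
     + (- \<i> * of_real t) ^ j * (exp (- \<i> * \<mu> * of_real t) * (- \<i> * \<mu>))) (at (of_real t))"
    by (auto intro!: derivative_eq_intros)
  from has_vector_derivative_real_field[OF this]
  have "((\<lambda>t. (- \<i> * of_real t) ^ j * exp (- \<i> * \<mu> * of_real t)) has_vector_derivative
     (of_nat j * (- \<i> * of_real t) ^ (j - 1) * (- \<i>)) * exp (- \<i> * \<mu> * of_real t)
     + (- \<i> * of_real t) ^ j * (exp (- \<i> * \<mu> * of_real t) * (- \<i> * \<mu>))) (at t)" .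
  moreover have "mono_deriv \<mu> 0 j = (\<lambda>t. (- \<i> * of_real t) ^ j * exp (- \<i> * \<mu> * of_real t))"
    by (auto simp: fun_eq_iff)
  ultimately show ?case by (simp add: algebra_simps)
next
  case (Suc i)
  have "mono_deriv \<mu> (Suc i) j = (\<lambda>t. - \<i> * \<mu> * mono_deriv \<mu> i j t - \<i> * of_nat j * mono_deriv \<mu> i (j - 1) t)"
    by (auto simp: fun_eq_iff)
  moreover have "((\<lambda>t. - \<i> * \<mu> * mono_deriv \<mu> i j t - \<i> * of_nat j * mono_deriv \<mu> i (j - 1) t) has_vector_derivative
     - \<i> * \<mu> * mono_deriv \<mu> (Suc i) j t - \<i> * of_nat j * mono_deriv \<mu> (Suc i) (j - 1) t) (at t)"
    by (intro has_vector_derivative_diff has_vector_derivative_mult_right Suc)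
  ultimately show ?case by simp
qed

text \<open>Shaped like a Cauchy estimate: with \<open>R\<close> free, the factor
  \<open>fact j / R ^ j\<close> lets power series in the parameter converge for all increments below
  \<open>R\<close>. In the induction the second part of the recursion contributes \<open>R\<close>,
  because \<open>j * fact (j - 1) / R ^ (j - 1) = R * fact j / R ^ j\<close> for
  \<open>j > 0\<close>.\<close>

lemma norm_mono_deriv_le:
  assumes R: "0 < R"
  shows "cmod (mono_deriv \<mu> i j t) \<le> fact j / R ^ j * (R + cmod \<mu>) ^ i * exp ((R + cmod \<mu>) * \<bar>t\<bar>)"
proof (induction i arbitrary: j)
  case 0
  have "(R * \<bar>t\<bar>) ^ j /\<^sub>R fact j \<le> exp (R * \<bar>t\<bar>)"
  proof -
    have s: "(\<lambda>n. (R * \<bar>t\<bar>) ^ n /\<^sub>R fact n) sums exp (R * \<bar>t\<bar>)" by (rule exp_converges)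
    have "(\<Sum>n\<in>{j}. (R * \<bar>t\<bar>) ^ n /\<^sub>R fact n) \<le> (\<Sum>n. (R * \<bar>t\<bar>) ^ n /\<^sub>R fact n)"
      by (rule sum_le_suminf[OF sums_summable[OF s]]) (use R in auto)
    then show ?thesis using sums_unique[OF s] by simp
  qed
  then have "\<bar>t\<bar> ^ j \<le> fact j / R ^ j * exp (R * \<bar>t\<bar>)"
    using R by (simp add: power_mult_distrib field_simps)
  moreover have "cmod (exp (- \<i> * \<mu> * of_real t)) \<le> exp (cmod \<mu> * \<bar>t\<bar>)"
    using norm_exp[of "- \<i> * \<mu> * of_real t"] by (simp add: norm_mult)
  ultimately have "\<bar>t\<bar> ^ j * cmod (exp (- \<i> * \<mu> * of_real t)) \<le> fact j / R ^ j * exp (R * \<bar>t\<bar>) * exp (cmod \<mu> * \<bar>t\<bar>)"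
    using R by (intro mult_mono) auto
  then show ?case by (simp add: norm_mult norm_power distrib_right exp_add)
next
  case (Suc i)
  define X E where "X = R + cmod \<mu>" and "E = exp ((R + cmod \<mu>) * \<bar>t\<bar>)"
  have X: "0 \<le> X" "0 \<le> E" using R by (auto simp: X_def E_def)
  have 1: "cmod (- \<i> * \<mu> * mono_deriv \<mu> i j t) \<le> cmod \<mu> * (fact j / R ^ j * X ^ i * E)"
    using mult_left_mono[OF Suc[of j], of "cmod \<mu>"] by (simp add: norm_mult X_def E_def)
  have 2: "cmod (\<i> * of_nat j * mono_deriv \<mu> i (j - 1) t) \<le> R * (fact j / R ^ j * X ^ i * E)"
  proof (cases j)
    case (Suc l)
    have "cmod (\<i> * of_nat j * mono_deriv \<mu> i (j - 1) t) \<le> real (Suc l) * (fact l / R ^ l * X ^ i * E)"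
      using mult_left_mono[OF Suc.IH[of l], of "real (Suc l)"] unfolding Suc by (simp add: norm_mult X_def E_def del: of_nat_Suc)
    also have "\<dots> = R * (fact j / R ^ j * X ^ i * E)" using R by (simp add: Suc field_simps)
    finally show ?thesis .
  qed (use R X in simp)
  have "cmod (mono_deriv \<mu> (Suc i) j t) \<le> cmod \<mu> * (fact j / R ^ j * X ^ i * E) + R * (fact j / R ^ j * X ^ i * E)"
    using norm_triangle_ineq4[of "- \<i> * \<mu> * mono_deriv \<mu> i j t" "\<i> * of_nat j * mono_deriv \<mu> i (j - 1) t"] 1 2
    by simp
  also have "\<dots> = fact j / R ^ j * X ^ Suc i * E" by (simp add: X_def algebra_simps)
  finally show ?case by (simp add: X_def E_def)
qed

text \<open>Taylor expansion in the parameter of the i-th derivative in \<open>t\<close> of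
  \<open>exp (-\<i> * (\<mu> + h) * t)\<close>. In the induction step the second part of the
  recursion is the same series with its index shifted by one, that is, multiplied by
  \<open>h\<close>.\<close>

lemma mono_deriv_sums:
  "(\<lambda>j. h ^ j / fact j * mono_deriv \<mu> i j t) sums ((- \<i> * (\<mu> + h)) ^ i * exp (- \<i> * (\<mu> + h) * of_real t))"
proof (induction i)
  case 0
  have "(\<lambda>j. (- \<i> * h * of_real t) ^ j /\<^sub>R fact j * exp (- \<i> * \<mu> * of_real t)) sums
     (exp (- \<i> * h * of_real t) * exp (- \<i> * \<mu> * of_real t))"
    by (intro sums_mult2 exp_converges)
  moreover have "(- \<i> * h * of_real t) ^ j /\<^sub>R fact j * exp (- \<i> * \<mu> * of_real t) = h ^ j / fact j * mono_deriv \<mu> 0 j t" for j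
  proof -
    have "(- \<i> * h * of_real t) ^ j = h ^ j * (- \<i> * of_real t) ^ j"
      unfolding power_mult_distrib[symmetric] by (simp add: mult_ac)
    then show ?thesis by (simp add: scaleR_conv_of_real divide_inverse mult_ac)
  qed
  ultimately show ?case by (simp add: exp_add[symmetric] algebra_simps)
next
  case (Suc i)
  define s where "s = (- \<i> * (\<mu> + h)) ^ i * exp (- \<i> * (\<mu> + h) * of_real t)"
  have "(\<lambda>j. h ^ Suc j / fact (Suc j) * (of_nat (Suc j) * mono_deriv \<mu> i j t)) sums (h * s)"
  proof -
    have "h ^ Suc j / fact (Suc j) * (of_nat (Suc j) * mono_deriv \<mu> i j t) = h * (h ^ j / fact j * mono_deriv \<mu> i j t)" for j
    proof -
      have n0: "(of_nat (Suc j) :: complex) \<noteq> 0" by (simp only: of_nat_eq_0_iff)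
      have "h * H / (n * F) * (n * m) = h * (H / F * m)" if "n \<noteq> 0" for H n F m :: complex
        using that by simp
      from this[OF n0] show ?thesis unfolding fact_Suc power_Suc .
    qed
    then show ?thesis using sums_mult[OF Suc, of h] by (simp add: s_def)
  qed
  from sums_Suc[where f="\<lambda>j. h ^ j / fact j * (of_nat j * mono_deriv \<mu> i (j - 1) t)" and l="h * s"] this
  have A: "(\<lambda>j. h ^ j / fact j * (of_nat j * mono_deriv \<mu> i (j - 1) t)) sums (h * s)" by simp
  have "(\<lambda>j. (- \<i> * \<mu>) * (h ^ j / fact j * mono_deriv \<mu> i j t) - \<i> * (h ^ j / fact j * (of_nat j * mono_deriv \<mu> i (j - 1) t)))
     sums ((- \<i> * \<mu>) * s - \<i> * (h * s))"
    by (intro sums_diff sums_mult A) (use Suc in \<open>simp add: s_def\<close>)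
  moreover have "(- \<i> * \<mu>) * s - \<i> * (h * s) = (- \<i> * (\<mu> + h)) ^ Suc i * exp (- \<i> * (\<mu> + h) * of_real t)"
    by (simp add: s_def algebra_simps)
  moreover have "(\<lambda>j. (- \<i> * \<mu>) * (h ^ j / fact j * mono_deriv \<mu> i j t) - \<i> * (h ^ j / fact j * (of_nat j * mono_deriv \<mu> i (j - 1) t)))
     = (\<lambda>j. h ^ j / fact j * mono_deriv \<mu> (Suc i) j t)"
    by (rule ext) (simp add: algebra_simps)
  ultimately show ?case by (simp only:)
qed

section \<open>The space of ultradifferentiable functions and its dual\<close>

locale ultra =
  fixes \<omega> :: "real \<Rightarrow> real" and a :: ereal and c r :: "nat \<Rightarrow> real"
  assumes weight: "weight \<omega>"
    and c_mono: "incseq c" and c_pos: "\<And>k. 0 < c k" and c_less: "\<And>k. ereal (c k) < a"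
    and c_lim: "(\<lambda>k. ereal (c k)) \<longlonglongrightarrow> a"
    and r_mono: "incseq r" and r_pos: "\<And>k. 0 < r k" and r_less: "\<And>k. r k < 1" and r_lim: "r \<longlonglongrightarrow> 1"
begin

abbreviation U where "U \<equiv> U_space a \<omega> c"
abbreviation NU where "NU \<equiv> u_norm a \<omega> c"
abbreviation M where "M \<equiv> wM \<omega>"
abbreviation D where "D j \<equiv> Dop a ^^ j"
abbreviation P where "P \<equiv> P_space \<omega> c r"
abbreviation Pk where "Pk \<equiv> P_step \<omega> c r"
abbreviation PN where "PN \<equiv> p_norm \<omega> c r"

lemmas \<omega>_nonneg = weight_nonneg[OF weight]

lemma c_le: "\<bar>x\<bar> \<le> c k \<Longrightarrow> ereal \<bar>x\<bar> < a"
  using c_less[of k] by (meson ereal_less_eq(3) le_less_trans)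

lemma ex_c: "ereal x < a \<Longrightarrow> \<exists>k. x < c k"
proof -
  assume "ereal x < a"
  then have "\<forall>\<^sub>F k in sequentially. ereal x < ereal (c k)" using order_tendstoD(1)[OF c_lim] by blast
  then show ?thesis by (auto simp: eventually_sequentially)
qed

lemma ex_c_ge: "\<exists>m\<ge>k. c k < c m"
proof -
  obtain m where "c k < c m" using ex_c[OF c_less] by blast
  moreover have "k \<le> m" using calculation incseqD[OF c_mono, of m k] by (cases "k \<le> m") auto
  ultimately show ?thesis by blast
qed

lemma ex_r: "x < 1 \<Longrightarrow> \<exists>k. x < r k"
proof -
  assume "x < 1"
  then have "\<forall>\<^sub>F k in sequentially. x < r k" using order_tendstoD(1)[OF r_lim] by blast
  then show ?thesis by (auto simp: eventually_sequentially)
qed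

lemma u_weighted_eq: "u_weighted a \<omega> q f (j, x) = cmod (D j f x) / M q j"
  by (simp add: u_weighted_def wM_def exp_minus divide_inverse)

lemma U_smooth: "f \<in> U \<Longrightarrow> f \<in> smooth_fun a"
  by (simp add: U_space_def)

lemma u_norm_ge:
  assumes "f \<in> U" "0 < q" "q < 1" "\<bar>x\<bar> \<le> c k"
  shows "cmod (D j f x) \<le> NU q k f * M q j"
proof -
  have "bdd_above (u_weighted a \<omega> q f ` (UNIV \<times> {- c k..c k}))"
    using assms unfolding U_space_def by simp
  moreover have "(j, x) \<in> UNIV \<times> {- c k..c k}" using assms(4) by auto
  ultimately have "u_weighted a \<omega> q f (j, x) \<le> NU q k f"
    unfolding u_norm_def by (rule cSUP_upper2[OF _ _ order_refl])
  then show ?thesis unfolding u_weighted_eq using wM_pos[of \<omega> q j] by (simp add: divide_le_eq)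
qed

lemma u_norm_le:
  assumes "\<And>j x. \<bar>x\<bar> \<le> c k \<Longrightarrow> cmod (D j f x) \<le> B * M q j"
  shows "NU q k f \<le> B"
  unfolding u_norm_def
proof (rule cSUP_least)
  show "UNIV \<times> {- c k..c k} \<noteq> {}" using c_pos[of k] by (auto simp: less_imp_le)
  fix p assume "p \<in> (UNIV :: nat set) \<times> {- c k..c k}"
  then obtain j x where p: "p = (j, x)" "\<bar>x\<bar> \<le> c k" by force
  show "u_weighted a \<omega> q f p \<le> B"
    unfolding p(1) u_weighted_eq using assms[OF p(2), of j] wM_pos[of \<omega> q j] by (simp add: divide_le_eq)
qed

lemma U_I:
  assumes "f \<in> smooth_fun a"
    and B: "\<And>q k. 0 < q \<Longrightarrow> q < 1 \<Longrightarrow> \<exists>B. \<forall>j x. \<bar>x\<bar> \<le> c k \<longrightarrow> cmod (D j f x) \<le> B * M q j"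
  shows "f \<in> U"
proof -
  have "bdd_above (u_weighted a \<omega> q f ` (UNIV \<times> {- c k..c k}))" if q: "0 < q" "q < 1" for q k
  proof -
    obtain B where B: "\<And>j x. \<bar>x\<bar> \<le> c k \<Longrightarrow> cmod (D j f x) \<le> B * M q j" using B[OF q, of k] by blast
    have "u_weighted a \<omega> q f (j, x) \<le> B" if "\<bar>x\<bar> \<le> c k" for j x
      unfolding u_weighted_eq using B[OF that, of j] wM_pos[of \<omega> q j] by (simp add: divide_le_eq)
    then show ?thesis by (intro bdd_aboveI2[of _ _ B]) (auto simp: abs_le_iff)
  qed
  then show ?thesis using assms(1) unfolding U_space_def by simp
qed

lemma NU_nonneg: "f \<in> U \<Longrightarrow> 0 < q \<Longrightarrow> q < 1 \<Longrightarrow> 0 \<le> NU q k f"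
  using u_norm_ge[of f q 0 k 0] c_pos[of k] wM_pos[of \<omega> q 0]
  by (metis abs_zero less_imp_le norm_ge_zero order_trans zero_le_mult_iff not_le)

lemma U_subspace: "cfun.subspace U"
  unfolding cfun.subspace_def
proof (intro conjI ballI allI)
  have 0: "D j (\<lambda>_. 0) = (\<lambda>_. 0)" for j
    using Dop_family(1)[of a "\<lambda>_ _. 0"] by simp
  show "0 \<in> U"
    by (rule U_I[OF smooth_fun_0]) (auto simp: zero_fun_def 0 intro!: exI[of _ 0])
next
  fix f g assume fg: "f \<in> U" "g \<in> U"
  show "f + g \<in> U"
  proof (rule U_I)
    show "f + g \<in> smooth_fun a" using fg by (intro Dop_smooth_add U_smooth)
    fix q :: real and k assume q: "0 < q" "q < 1"
    have "cmod (D j (f + g) x) \<le> (NU q k f + NU q k g) * M q j" if x: "\<bar>x\<bar> \<le> c k" for j x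
      using norm_triangle_ineq[of "D j f x" "D j g x"] u_norm_ge[OF fg(1) q x, of j] u_norm_ge[OF fg(2) q x, of j]
      by (simp add: Dop_smooth_add[OF U_smooth U_smooth] fg distrib_right)
    then show "\<exists>B. \<forall>j x. \<bar>x\<bar> \<le> c k \<longrightarrow> cmod (D j (f + g) x) \<le> B * M q j" by blast
  qed
next
  fix f assume f: "f \<in> U" fix b :: complex
  show "(\<lambda>x. b * f x) \<in> U"
  proof (rule U_I)
    show "(\<lambda>x. b * f x) \<in> smooth_fun a" using f by (intro Dop_smooth_scale U_smooth)
    fix q :: real and k assume q: "0 < q" "q < 1"
    have "cmod (D j (\<lambda>x. b * f x) x) \<le> (cmod b * NU q k f) * M q j" if x: "\<bar>x\<bar> \<le> c k" for j x
      using mult_left_mono[OF u_norm_ge[OF f q x, of j], of "cmod b"]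
      by (simp add: Dop_smooth_scale[OF U_smooth] f norm_mult mult.assoc)
    then show "\<exists>B. \<forall>j x. \<bar>x\<bar> \<le> c k \<longrightarrow> cmod (D j (\<lambda>x. b * f x) x) \<le> B * M q j" by blast
  qed
qed

lemma NU_seminorm: 
  assumes q: "0 < q" "q < 1"
  shows "seminorm_on U (NU q k)"
  unfolding seminorm_on_def
proof (intro conjI ballI allI)
  fix f g assume fg: "f \<in> U" "g \<in> U"
  show "NU q k (f + g) \<le> NU q k f + NU q k g"
  proof (rule u_norm_le)
    show "cmod (D j (f + g) x) \<le> (NU q k f + NU q k g) * M q j" if x: "\<bar>x\<bar> \<le> c k" for j x
      using norm_triangle_ineq[of "D j f x" "D j g x"] u_norm_ge[OF fg(1) q x, of j] u_norm_ge[OF fg(2) q x, of j]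
      by (simp add: Dop_smooth_add[OF U_smooth U_smooth] fg distrib_right)
  qed
next
  fix b :: complex and f assume f: "f \<in> U"
  have le: "NU q k (\<lambda>x. b * f x) \<le> cmod b * NU q k f" if "f \<in> U" for b f
  proof (rule u_norm_le)
    show "cmod (D j (\<lambda>x. b * f x) x) \<le> (cmod b * NU q k f) * M q j" if x: "\<bar>x\<bar> \<le> c k" for j x
      using mult_left_mono[OF u_norm_ge[OF \<open>f \<in> U\<close> q x, of j], of "cmod b"]
      by (simp add: Dop_smooth_scale[OF U_smooth] \<open>f \<in> U\<close> norm_mult mult.assoc)
  qed
  have bf: "(\<lambda>x. b * f x) \<in> U" using cfun.subspace_scale[OF U_subspace f] .
  show "NU q k (\<lambda>x. b * f x) = cmod b * NU q k f"
  proof (cases "b = 0")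
    case True
    have "NU q k (\<lambda>x. b * f x) \<le> 0" using le[OF f, of b] True by simp
    then show ?thesis using NU_nonneg[OF bf q, of k] True by simp
  next
    case False
    have "(\<lambda>x. inverse b * (b * f x)) = f" using False by (simp add: fun_eq_iff)
    then have "NU q k f \<le> cmod (inverse b) * NU q k (\<lambda>x. b * f x)" using le[OF bf, of "inverse b"] by simp
    from mult_left_mono[OF this norm_ge_zero[of b]]
    have "cmod b * NU q k f \<le> NU q k (\<lambda>x. b * f x)" using False by (simp only: norm_inverse mult.assoc[symmetric]) simp
    then show ?thesis using le[OF f, of b] by simp
  qed
qed

lemma NU_mono:
  assumes "f \<in> U" "0 < q" "q \<le> q'" "q' < 1" "k \<le> k'"
  shows "NU q k f \<le> NU q' k' f"
proof (rule u_norm_le)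
  fix j x assume "\<bar>x\<bar> \<le> c k"
  then have x: "\<bar>x\<bar> \<le> c k'" using incseqD[OF c_mono assms(5)] by simp
  have "cmod (D j f x) \<le> NU q' k' f * M q' j" by (rule u_norm_ge) (use assms x in auto)
  also have "\<dots> \<le> NU q' k' f * M q j"
    by (intro mult_left_mono wM_antimono[OF weight] NU_nonneg) (use assms in auto)
  finally show "cmod (D j f x) \<le> NU q' k' f * M q j" .
qed

lemma U_Dop:
  assumes "f \<in> U" shows "Dop a f \<in> U"
    and "0 < q \<Longrightarrow> q < q' \<Longrightarrow> q' < 1 \<Longrightarrow> \<exists>C>0. \<forall>f\<in>U. NU q k (Dop a f) \<le> C * NU q' k f"
proof -
  have main: "\<exists>C>0. \<forall>f\<in>U. \<forall>j x. \<bar>x\<bar> \<le> c k \<longrightarrow> cmod (D j (Dop a f) x) \<le> (C * NU q' k f) * M q j"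
    if q: "0 < q" "q < q'" "q' < 1" for q q' k
  proof -
    obtain C where C: "C > 0" "\<And>j. M q' (Suc j) \<le> C * M q j" using wM_shift[OF weight q(1,2)] by blast
    have "cmod (D j (Dop a f) x) \<le> (C * NU q' k f) * M q j" if "f \<in> U" "\<bar>x\<bar> \<le> c k" for f j x
    proof -
      have "cmod (D (Suc j) f x) \<le> NU q' k f * M q' (Suc j)" by (rule u_norm_ge) (use that q in auto)
      also have "\<dots> \<le> NU q' k f * (C * M q j)"
        by (intro mult_left_mono C NU_nonneg) (use that q in auto)
      finally show ?thesis by (simp add: funpow_swap1 mult_ac)
    qed
    then show ?thesis using C(1) by blast
  qed
  show "Dop a f \<in> U"
  proof (rule U_I[OF Dop_smooth[OF U_smooth[OF assms]]])
    fix q :: real and k assume q: "0 < q" "q < 1"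
    show "\<exists>B. \<forall>j x. \<bar>x\<bar> \<le> c k \<longrightarrow> cmod (D j (Dop a f) x) \<le> B * M q j"
      using main[of q "(q + 1) / 2" k] q assms by force
  qed
  show "\<exists>C>0. \<forall>f\<in>U. NU q k (Dop a f) \<le> C * NU q' k f" if q: "0 < q" "q < q'" "q' < 1"
  proof -
    obtain C where C: "C > 0" "\<forall>f\<in>U. \<forall>j x. \<bar>x\<bar> \<le> c k \<longrightarrow> cmod (D j (Dop a f) x) \<le> (C * NU q' k f) * M q j"
      using main[OF q, of k] by blast
    have "NU q k (Dop a f) \<le> C * NU q' k f" if "f \<in> U" for f
      by (rule u_norm_le) (use C(2) that in blast)
    then show ?thesis using C(1) by blast
  qed
qed

text \<open>Normalised so that a functional applied to \<open>expo \<mu> j\<close> is exactly the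
  j-th derivative of its transform at \<mu>.\<close>

definition expo :: "complex \<Rightarrow> nat \<Rightarrow> real \<Rightarrow> complex" where
  "expo \<mu> j = (\<lambda>t. if ereal \<bar>t\<bar> < a then mono_deriv \<mu> 0 j t else 0)"

lemma expo_eq: "expo \<mu> j = (\<lambda>t. (- \<i>) ^ j * exp_monomial a j \<mu> t)"
  by (auto simp: expo_def exp_monomial_def fun_eq_iff power_mult_distrib[symmetric])

lemma exp_monomial_eq: "exp_monomial a j \<mu> = (\<lambda>t. \<i> ^ j * expo \<mu> j t)"
  by (auto simp: expo_eq fun_eq_iff mult.assoc[symmetric] power_mult_distrib[symmetric])

lemma expo_0: "expo \<mu> 0 = exp_monomial a 0 \<mu>" by (simp add: expo_eq)

lemma D_expo: "D i (expo \<mu> j) = (\<lambda>t. if ereal \<bar>t\<bar> < a then mono_deriv \<mu> i j t else 0)"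
  and expo_smooth: "expo \<mu> j \<in> smooth_fun a"
proof -
  let ?F = "\<lambda>i t. if ereal \<bar>t\<bar> < a then mono_deriv \<mu> i j t else 0"
  have z: "?F i x = 0" if "\<not> ereal \<bar>x\<bar> < a" for i x using that by simp
  have d: "(?F i has_vector_derivative ?F (Suc i) x) (at x)" if "ereal \<bar>x\<bar> < a" for i x
  proof -
    have "(mono_deriv \<mu> i j has_vector_derivative ?F (Suc i) x) (at x)"
      using mono_deriv_has_vector_derivative[of \<mu> i j x] that by simp
    then show ?thesis
      by (rule has_vector_derivative_transform_within_open[OF _ open_interval_ereal[of a]]) (use that in auto)
  qed
  show "D i (expo \<mu> j) = ?F i" using Dop_family(1)[of a ?F i, OF z d] by (simp add: expo_def)
  show "expo \<mu> j \<in> smooth_fun a" using Dop_family(2)[of a ?F, OF z d] by (simp add: expo_def)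
qed

text \<open>The power \<open>(R + cmod \<mu>) ^ i\<close> of \<open>norm_mono_deriv_le\<close> is
  traded for \<open>M q i\<close> by \<open>wM_ge_all\<close>; what remains does not depend on
  \<open>i\<close>.\<close>

lemma norm_D_expo:
  assumes "0 < R" "\<bar>x\<bar> \<le> c k" "0 < q"
  shows "cmod (D i (expo \<mu> j) x) \<le>
    fact j / R ^ j * exp ((R + cmod \<mu>) * c k + q * \<omega> 1 + q * \<omega> (R + cmod \<mu>)) * M q i"
proof -
  define X where "X = R + cmod \<mu>"
  have X: "0 \<le> X" using assms by (simp add: X_def)
  have "X ^ i * exp (- q * \<omega> X) \<le> exp (q * \<omega> 1) * M q i" by (rule wM_ge_all[OF weight assms(3) X])
  from mult_right_mono[OF this exp_ge_zero[of "q * \<omega> X"]]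
  have Xi: "X ^ i \<le> exp (q * \<omega> 1 + q * \<omega> X) * M q i"
    unfolding mult.assoc exp_add[symmetric] by (simp add: exp_add mult_ac)
  have "cmod (D i (expo \<mu> j) x) \<le> fact j / R ^ j * X ^ i * exp (X * \<bar>x\<bar>)"
    using norm_mono_deriv_le[OF assms(1), of \<mu> i j x] c_le[OF assms(2)] by (simp add: D_expo X_def)
  also have "\<dots> \<le> fact j / R ^ j * (exp (q * \<omega> 1 + q * \<omega> X) * M q i) * exp (X * c k)"
    using assms X Xi wM_pos[of \<omega> q i]
    by (intro mult_mono mult_left_mono) (auto simp: mult_left_mono intro!: divide_nonneg_nonneg mult_nonneg_nonneg less_imp_le)
  also have "\<dots> = fact j / R ^ j * exp (X * c k + q * \<omega> 1 + q * \<omega> X) * M q i"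
    by (simp add: exp_add mult_ac)
  finally show ?thesis by (simp add: X_def)
qed

lemma expo_U: "expo \<mu> j \<in> U"
proof (rule U_I[OF expo_smooth])
  fix q :: real and k assume "0 < q"
  then show "\<exists>B. \<forall>i x. \<bar>x\<bar> \<le> c k \<longrightarrow> cmod (D i (expo \<mu> j) x) \<le> B * M q i"
    using norm_D_expo[of 1 _ k q _ \<mu> j] by (intro exI allI impI) (rule norm_D_expo[of 1], auto)
qed

lemma exp_monomial_U: "exp_monomial a j \<mu> \<in> U"
  unfolding exp_monomial_eq using cfun.subspace_scale[OF U_subspace expo_U] .

lemma mono_deriv_0: "mono_deriv z i 0 t = (- \<i> * z) ^ i * exp (- \<i> * z * of_real t)"
  by (induction i) auto

lemma D_exp: "ereal \<bar>x\<bar> < a \<Longrightarrow> D i (exp_monomial a 0 z) x = (- \<i> * z) ^ i * exp (- \<i> * z * of_real x)"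
  using D_expo[of i z 0] unfolding expo_0 by (simp only: mono_deriv_0 if_True)

text \<open>The power \<open>cmod z ^ i\<close> costs \<open>exp (q * \<omega> (cmod z))\<close>,
  and the exponential itself costs \<open>exp (c k * \<bar>Im z\<bar>)\<close>: here the growth
  condition of \<open>P\<close> originates.\<close>

lemma NU_exp:
  assumes q: "0 < q"
  shows "NU q k (exp_monomial a 0 z) \<le> exp (q * \<omega> 1) * exp (q * \<omega> (cmod z) + c k * \<bar>Im z\<bar>)"
proof (rule u_norm_le)
  fix i x assume x: "\<bar>x\<bar> \<le> c k"
  have "cmod z ^ i * exp (- q * \<omega> (cmod z)) \<le> exp (q * \<omega> 1) * M q i" by (rule wM_ge_all[OF weight q]) simp
  then have "cmod z ^ i * exp (- q * \<omega> (cmod z)) * exp (q * \<omega> (cmod z)) \<le> exp (q * \<omega> 1) * M q i * exp (q * \<omega> (cmod z))"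
    by (intro mult_right_mono) auto
  then have zi: "cmod z ^ i \<le> exp (q * \<omega> 1) * M q i * exp (q * \<omega> (cmod z))"
    by (simp add: mult.assoc exp_add[symmetric])
  have "Im z * x \<le> \<bar>Im z\<bar> * \<bar>x\<bar>" by (metis abs_ge_self abs_mult)
  also have "\<dots> \<le> \<bar>Im z\<bar> * c k" using x by (intro mult_left_mono) auto
  finally have "cmod (exp (- \<i> * z * of_real x)) \<le> exp (c k * \<bar>Im z\<bar>)"
    by (simp add: norm_exp_eq_Re mult.commute)
  then have "cmod (D i (exp_monomial a 0 z) x) \<le> (exp (q * \<omega> 1) * M q i * exp (q * \<omega> (cmod z))) * exp (c k * \<bar>Im z\<bar>)"
    unfolding D_exp[OF c_le[OF x]] norm_mult norm_power
    by (intro mult_mono) (use zi wM_pos[of \<omega> q i] in \<open>auto simp: less_imp_le\<close>)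
  also have "\<dots> = exp (q * \<omega> 1) * exp (q * \<omega> (cmod z) + c k * \<bar>Im z\<bar>) * M q i"
    by (simp add: exp_add mult_ac)
  finally show "cmod (D i (exp_monomial a 0 z) x) \<le> exp (q * \<omega> 1) * exp (q * \<omega> (cmod z) + c k * \<bar>Im z\<bar>) * M q i" .
qed

text \<open>The seminorms increase in both indices, so a finite family of them is dominated by a
  single one.\<close>

lemma U_dual_bound:
  assumes "S \<in> U_dual a \<omega> c"
  shows "\<exists>q k C. 0 < q \<and> q < 1 \<and> 0 \<le> C \<and> (\<forall>f\<in>U. cmod (S f) \<le> C * NU q k f)"
proof -
  let ?Q = "{NU q k | q k. 0 < q \<and> q < 1}"
  have Q: "\<And>p. p \<in> ?Q \<Longrightarrow> seminorm_on U p" using NU_seminorm by blast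
  have ne: "?Q \<noteq> {}" by (auto intro!: exI[of _ "1/2"])
  have S: "clinear_functional_on U S" "continuous_map (seminorm_topology U ?Q) euclidean S"
    using assms unfolding U_dual_def U_topology_def by auto
  have "\<exists>F C. finite F \<and> F \<subseteq> ?Q \<and> 0 \<le> C \<and> (\<forall>f\<in>U. cmod (S f) \<le> C * (\<Sum>p\<in>F. p f))"
    by (rule continuous_functional_imp_bound[OF _ U_subspace ne S]) (rule Q)
  then obtain F C where F: "finite F" "F \<subseteq> ?Q" "0 \<le> C" "\<forall>f\<in>U. cmod (S f) \<le> C * (\<Sum>p\<in>F. p f)"
    by (elim exE conjE)
  have "\<exists>q k. 0 < q \<and> q < 1 \<and> (\<forall>p\<in>F. \<forall>f\<in>U. p f \<le> NU q k f)"
    using F(1,2)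
  proof (induction F)
    case empty then show ?case by (auto intro!: exI[of _ "1/2"])
  next
    case (insert p F)
    then obtain q k where qk: "0 < q" "q < 1" "\<forall>p\<in>F. \<forall>f\<in>U. p f \<le> NU q k f" by auto
    obtain q' k' where p: "p = NU q' k'" "0 < q'" "q' < 1" using insert.prems by auto
    have 1: "NU q k f \<le> NU (max q q') (max k k') f" if "f \<in> U" for f
      by (rule NU_mono) (use that qk p in auto)
    have 2: "NU q' k' f \<le> NU (max q q') (max k k') f" if "f \<in> U" for f
      by (rule NU_mono) (use that qk p in auto)
    show ?case
    proof (intro exI conjI ballI)
      show "0 < max q q'" "max q q' < 1" using qk p by auto
      show "p' f \<le> NU (max q q') (max k k') f" if "p' \<in> insert p F" "f \<in> U" for p' f
      proof (cases "p' = p")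
        case True
        then show ?thesis using 2[OF that(2)] p(1) by simp
      next
        case False
        then have "p' f \<le> NU q k f" using qk(3) that by simp
        then show ?thesis using 1[OF that(2)] by (rule order_trans)
      qed
    qed
  qed
  then obtain q k where qk: "0 < q" "q < 1" "\<forall>p\<in>F. \<forall>f\<in>U. p f \<le> NU q k f" by blast
  have "cmod (S f) \<le> (C * real (card F)) * NU q k f" if f: "f \<in> U" for f
  proof -
    have "cmod (S f) \<le> C * (\<Sum>p\<in>F. p f)" using F(4) f by blast
    also have "\<dots> \<le> C * (\<Sum>p\<in>F. NU q k f)" using qk(3) f F(3) by (intro mult_left_mono sum_mono) auto
    finally show ?thesis by simp
  qed
  moreover have "0 \<le> C * real (card F)" using F(3) by simp
  ultimately show ?thesis using qk(1,2) by blast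
qed

lemma U_dual_I:
  assumes "clinear_functional_on U S" "0 < q" "q < 1" "\<And>f. f \<in> U \<Longrightarrow> cmod (S f) \<le> C * NU q k f"
  shows "restrict S U \<in> U_dual a \<omega> c"
proof -
  let ?Q = "{NU q k | q k. 0 < q \<and> q < 1}"
  have Q: "\<And>p. p \<in> ?Q \<Longrightarrow> seminorm_on U p" using NU_seminorm by blast
  have ne: "?Q \<noteq> {}" by (auto intro!: exI[of _ "1/2"])
  have lin: "clinear_functional_on U (restrict S U)"
    using assms(1) cfun.subspace_add[OF U_subspace] cfun.subspace_scale[OF U_subspace]
    unfolding clinear_functional_on_def by (simp del: plus_fun_apply)
  have "continuous_map (seminorm_topology U ?Q) euclidean (restrict S U)"
  proof (rule bound_imp_continuous_functional[OF _ U_subspace ne lin, of "{NU q k}" C])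
    show "\<And>p. p \<in> ?Q \<Longrightarrow> seminorm_on U p" by (rule Q)
  qed (use assms in auto)
  then show ?thesis using lin unfolding U_dual_def U_topology_def by simp
qed

lemma U_dual_linear: "S \<in> U_dual a \<omega> c \<Longrightarrow> clinear_functional_on U S"
  by (simp add: U_dual_def)

section \<open>The inductive limit of spaces of entire functions\<close>

lemma p_weighted_eq: "p_weighted \<omega> c r k \<phi> z = cmod (\<phi> z) / exp (r k * \<omega> (cmod z) + c k * \<bar>Im z\<bar>)"
  by (simp add: p_weighted_def exp_minus[symmetric] divide_inverse)

lemma p_norm_ge:
  assumes "\<phi> \<in> Pk k"
  shows "cmod (\<phi> z) \<le> PN k \<phi> * exp (r k * \<omega> (cmod z) + c k * \<bar>Im z\<bar>)"
proof -
  have "p_weighted \<omega> c r k \<phi> z \<le> PN k \<phi>"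
    unfolding p_norm_def using assms by (intro cSUP_upper) (auto simp: P_step_def)
  then show ?thesis unfolding p_weighted_eq by (simp add: divide_le_eq)
qed

lemma p_norm_le:
  assumes "\<And>z. cmod (\<phi> z) \<le> B * exp (r k * \<omega> (cmod z) + c k * \<bar>Im z\<bar>)"
  shows "PN k \<phi> \<le> B"
  unfolding p_norm_def by (rule cSUP_least) (use assms in \<open>auto simp: p_weighted_eq divide_le_eq\<close>)

lemma P_step_I:
  assumes "\<phi> holomorphic_on UNIV" "\<And>z. cmod (\<phi> z) \<le> B * exp (r k * \<omega> (cmod z) + c k * \<bar>Im z\<bar>)"
  shows "\<phi> \<in> Pk k"
  unfolding P_step_def using assms
  by (auto intro!: bdd_aboveI2[of _ _ B] simp: p_weighted_eq divide_le_eq)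

lemma P_step_holomorphic: "\<phi> \<in> Pk k \<Longrightarrow> \<phi> holomorphic_on UNIV"
  by (simp add: P_step_def)

lemma PN_nonneg: "\<phi> \<in> Pk k \<Longrightarrow> 0 \<le> PN k \<phi>"
  using p_norm_ge[of \<phi> k 0] order_trans[OF norm_ge_zero] zero_le_mult_iff exp_gt_zero
  by (metis exp_ge_zero not_le mult_neg_pos)

lemma P_step_add:
  assumes "\<phi> \<in> Pk k" "\<psi> \<in> Pk k"
  shows "\<phi> + \<psi> \<in> Pk k" "PN k (\<phi> + \<psi>) \<le> PN k \<phi> + PN k \<psi>"
proof -
  have le: "cmod ((\<phi> + \<psi>) z) \<le> (PN k \<phi> + PN k \<psi>) * exp (r k * \<omega> (cmod z) + c k * \<bar>Im z\<bar>)" for z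
    using norm_triangle_ineq[of "\<phi> z" "\<psi> z"] p_norm_ge[OF assms(1), of z] p_norm_ge[OF assms(2), of z]
    by (simp add: distrib_right)
  have "(\<phi> + \<psi>) holomorphic_on UNIV"
    using holomorphic_on_add[OF P_step_holomorphic[OF assms(1)] P_step_holomorphic[OF assms(2)]]
    by (simp add: plus_fun_def)
  then show "\<phi> + \<psi> \<in> Pk k" using le by (rule P_step_I)
  show "PN k (\<phi> + \<psi>) \<le> PN k \<phi> + PN k \<psi>" using le by (rule p_norm_le)
qed

lemma P_step_scale:
  assumes "\<phi> \<in> Pk k"
  shows "(\<lambda>z. b * \<phi> z) \<in> Pk k" "PN k (\<lambda>z. b * \<phi> z) = cmod b * PN k \<phi>"
proof -
  have le: "cmod (b * \<phi> z) \<le> (cmod b * PN k \<phi>) * exp (r k * \<omega> (cmod z) + c k * \<bar>Im z\<bar>)"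
    if "\<phi> \<in> Pk k" for b z \<phi>
    using mult_left_mono[OF p_norm_ge[OF that, of z], of "cmod b"] by (simp add: norm_mult mult.assoc)
  have mem: "(\<lambda>z. b * \<phi> z) \<in> Pk k" if "\<phi> \<in> Pk k" for b \<phi>
    by (rule P_step_I[OF _ le[OF that]]) (intro holomorphic_intros P_step_holomorphic[OF that])
  show "(\<lambda>z. b * \<phi> z) \<in> Pk k" by (rule mem[OF assms])
  have le': "PN k (\<lambda>z. b * \<phi> z) \<le> cmod b * PN k \<phi>" if "\<phi> \<in> Pk k" for b \<phi>
    by (rule p_norm_le) (rule le[OF that])
  show "PN k (\<lambda>z. b * \<phi> z) = cmod b * PN k \<phi>"
  proof (cases "b = 0")
    case True
    have "PN k (\<lambda>z. b * \<phi> z) \<le> 0" using le'[OF assms, of b] True by simp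
    then show ?thesis using PN_nonneg[OF mem[OF assms, of b]] True by simp
  next
    case False
    have "(\<lambda>z. inverse b * (b * \<phi> z)) = \<phi>" using False by (simp add: fun_eq_iff)
    then have "PN k \<phi> \<le> cmod (inverse b) * PN k (\<lambda>z. b * \<phi> z)" using le'[OF mem[OF assms, of b], of "inverse b"] by simp
    from mult_left_mono[OF this norm_ge_zero[of b]]
    have "cmod b * PN k \<phi> \<le> PN k (\<lambda>z. b * \<phi> z)" using False by (simp only: norm_inverse mult.assoc[symmetric]) simp
    then show ?thesis using le'[OF assms, of b] by simp
  qed
qed

lemma P_step_subspace: "cfun.subspace (Pk k)"
  unfolding cfun.subspace_def
proof (intro conjI ballI allI)
  show "0 \<in> Pk k" by (rule P_step_I[of _ 0]) (auto simp: zero_fun_def)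
qed (auto intro: P_step_add P_step_scale)

lemma PN_seminorm: "seminorm_on (Pk k) (PN k)"
  unfolding seminorm_on_def using P_step_add P_step_scale by blast

lemma P_step_mono:
  assumes "k \<le> m" "\<phi> \<in> Pk k"
  shows "\<phi> \<in> Pk m" "PN m \<phi> \<le> PN k \<phi>"
proof -
  have le: "cmod (\<phi> z) \<le> PN k \<phi> * exp (r m * \<omega> (cmod z) + c m * \<bar>Im z\<bar>)" for z
  proof -
    have "exp (r k * \<omega> (cmod z) + c k * \<bar>Im z\<bar>) \<le> exp (r m * \<omega> (cmod z) + c m * \<bar>Im z\<bar>)"
      using incseqD[OF c_mono assms(1)] incseqD[OF r_mono assms(1)] \<omega>_nonneg[of "cmod z"]
      by (simp add: add_mono mult_right_mono)
    then show ?thesis using p_norm_ge[OF assms(2), of z] PN_nonneg[OF assms(2)]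
      by (meson mult_left_mono order_trans)
  qed
  show "\<phi> \<in> Pk m" using P_step_holomorphic[OF assms(2)] le by (rule P_step_I)
  show "PN m \<phi> \<le> PN k \<phi>" using le by (rule p_norm_le)
qed

lemma P_space_subspace: "cfun.subspace P"
  unfolding cfun.subspace_def
proof (intro conjI ballI allI)
  show "0 \<in> P" using cfun.subspace_0[OF P_step_subspace] unfolding P_space_def by blast
  fix \<phi> \<psi> assume "\<phi> \<in> P" "\<psi> \<in> P"
  then obtain k m where "\<phi> \<in> Pk k" "\<psi> \<in> Pk m" unfolding P_space_def by blast
  then have "\<phi> \<in> Pk (max k m)" "\<psi> \<in> Pk (max k m)" using P_step_mono by (meson max.cobounded1 max.cobounded2)+
  then show "\<phi> + \<psi> \<in> P" using P_step_add unfolding P_space_def by blast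
next
  fix b \<phi> assume "\<phi> \<in> P"
  then show "(\<lambda>x. b * \<phi> x) \<in> P" using P_step_scale unfolding P_space_def by blast
qed

definition PQ :: "((complex \<Rightarrow> complex) \<Rightarrow> real) set" where
  "PQ = {q. seminorm_on P q \<and> (\<forall>k. continuous_map (seminorm_topology (Pk k) {PN k}) euclideanreal q)}"

lemma P_topology_eq: "P_topology \<omega> c r = seminorm_topology P PQ"
  by (simp add: P_topology_def inductive_limit_topology_def P_space_def PQ_def)

lemma PQ_iff: "q \<in> PQ \<longleftrightarrow> seminorm_on P q \<and> (\<forall>k. \<exists>C\<ge>0. \<forall>\<phi>\<in>Pk k. q \<phi> \<le> C * PN k \<phi>)"
proof -
  have sub: "seminorm_on (Pk k) q" if "seminorm_on P q" for k
    using that unfolding seminorm_on_def P_space_def by blast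
  show ?thesis unfolding PQ_def
    using seminorm_continuous_imp_bound[OF PN_seminorm P_step_subspace sub]
      seminorm_bound_imp_continuous[OF PN_seminorm P_step_subspace sub] by blast
qed

lemma PQ_nonempty: "PQ \<noteq> {}"
proof -
  have "(\<lambda>_. 0) \<in> PQ" unfolding PQ_iff by (auto simp: seminorm_on_def intro!: exI[of _ 0])
  then show ?thesis by blast
qed

lemma topspace_P: "topspace (P_topology \<omega> c r) = P"
proof -
  obtain q where "q \<in> PQ" using PQ_nonempty by blast
  then show ?thesis unfolding P_topology_eq
    using topspace_seminorm_topology[of P q PQ] cfun.subspace_0[OF P_space_subspace] by (auto simp: PQ_iff)
qed

lemma topspace_U: "topspace (U_topology a \<omega> c) = U"
  unfolding U_topology_def
  by (rule topspace_seminorm_topology[OF NU_seminorm[of "1/2" 0]])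
    (use cfun.subspace_0[OF U_subspace] in \<open>auto intro!: exI[of _ "1/2 :: real"]\<close>)

section \<open>The transform of a functional and its derivatives\<close>

abbreviation U' where "U' \<equiv> U_dual a \<omega> c"
abbreviation FL where "FL \<equiv> fourier_laplace a"

lemma FL_bound:
  assumes "0 < q" "\<And>f. f \<in> U \<Longrightarrow> cmod (S f) \<le> C * NU q k f" "0 \<le> C"
  shows "cmod (FL S z) \<le> C * exp (q * \<omega> 1) * exp (q * \<omega> (cmod z) + c k * \<bar>Im z\<bar>)"
proof -
  have "cmod (FL S z) \<le> C * NU q k (exp_monomial a 0 z)"
    unfolding fourier_laplace_def by (rule assms(2)[OF exp_monomial_U])
  also have "\<dots> \<le> C * (exp (q * \<omega> 1) * exp (q * \<omega> (cmod z) + c k * \<bar>Im z\<bar>))"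
    by (intro mult_left_mono NU_exp assms)
  finally show ?thesis by (simp add: mult.assoc)
qed

text \<open>The functional is applied term by term to the expansion of
  \<open>exp_monomial a 0 (\<mu> + h)\<close> in powers of \<open>h\<close>. This is legitimate
  because the remainders tend to 0 geometrically in the very seminorm that bounds \<open>S\<close>,
  uniformly in the order of differentiation.\<close>

lemma FL_sums:
  assumes S: "S \<in> U'"
  shows "(\<lambda>j. S (expo \<mu> j) / fact j * h ^ j) sums FL S (\<mu> + h)"
proof -
  obtain q k C where q: "0 < q" "q < 1" and C: "0 \<le> C" "\<And>f. f \<in> U \<Longrightarrow> cmod (S f) \<le> C * NU q k f"
    using U_dual_bound[OF S] by blast
  note lin = U_dual_linear[OF S]
  \<comment> \<open>A radius beyond \<open>cmod h\<close>, so that the ratio \<rho> of the geometric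
    majorant is below 1.\<close>
  define R where "R = cmod h + 1"
  define K where "K = exp ((R + cmod \<mu>) * c k + q * \<omega> 1 + q * \<omega> (R + cmod \<mu>))"
  define \<rho> where "\<rho> = cmod h / R"
  have R: "0 < R" by (simp add: R_def add_nonneg_pos)
  have \<rho>: "0 \<le> \<rho>" "\<rho> < 1" using R by (auto simp: \<rho>_def R_def)
  have tail: "cmod (FL S (\<mu> + h) - (\<Sum>j<N. S (expo \<mu> j) / fact j * h ^ j)) \<le> C * (K * (\<rho> ^ N / (1 - \<rho>)))" for N
  proof -
    let ?s = "\<lambda>x. \<Sum>j<N. (h ^ j / fact j) * expo \<mu> j x"
    have s: "?s \<in> U" "S ?s = (\<Sum>j<N. (h ^ j / fact j) * S (expo \<mu> j))"
      using clinear_functional_on_sum[OF lin U_subspace, of "{..<N}" "expo \<mu>" "\<lambda>j. h ^ j / fact j"] expo_U by auto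
    have d: "exp_monomial a 0 (\<mu> + h) - ?s \<in> U"
      by (rule cfun.subspace_diff[OF U_subspace exp_monomial_U s(1)])
    have Ds: "D i ?s = (\<lambda>x. \<Sum>j<N. (h ^ j / fact j) * D i (expo \<mu> j) x)" for i
    proof (induction N)
      case 0
      have "D i (\<lambda>_. 0) = (\<lambda>_. 0)" for i using Dop_family(1)[of a "\<lambda>_ _. 0"] by simp
      then show ?case by simp
    next
      case (Suc N)
      have "(\<lambda>x. \<Sum>j<N. (h ^ j / fact j) * expo \<mu> j x) \<in> U"
        using clinear_functional_on_sum(2)[OF lin U_subspace, of "{..<N}" "expo \<mu>" "\<lambda>j. h ^ j / fact j"] expo_U by auto
      note 1 = U_smooth[OF this] and 2 = Dop_smooth_scale[where k="h ^ N / fact N", OF expo_smooth[of \<mu> N]]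
      have split: "(\<lambda>x. \<Sum>j<Suc N. (h ^ j / fact j) * expo \<mu> j x) =
         (\<lambda>x. \<Sum>j<N. (h ^ j / fact j) * expo \<mu> j x) + (\<lambda>x. (h ^ N / fact N) * expo \<mu> N x)"
        by (auto simp: fun_eq_iff)
      show ?case unfolding split Dop_smooth_add(1)[OF 1 2(2), of i] 2(1)[of i] Suc
        by (auto simp: fun_eq_iff)
    qed
    have "NU q k (exp_monomial a 0 (\<mu> + h) - ?s) \<le> K * (\<rho> ^ N / (1 - \<rho>))"
    proof (rule u_norm_le)
      fix i x assume x: "\<bar>x\<bar> \<le> c k"
      define b where "b = (\<lambda>j. h ^ j / fact j * mono_deriv \<mu> i j x)"
      have xa: "ereal \<bar>x\<bar> < a" by (rule c_le[OF x])
      have sums: "b sums D i (exp_monomial a 0 (\<mu> + h)) x"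
        unfolding b_def D_exp[OF xa] by (rule mono_deriv_sums)
      have bb: "norm (b j) \<le> K * M q i * \<rho> ^ j" for j
      proof -
        have "cmod (mono_deriv \<mu> i j x) \<le> fact j / R ^ j * K * M q i"
          using norm_D_expo[OF R x q(1), of i \<mu> j] xa by (simp add: D_expo K_def)
        from mult_left_mono[OF this, of "cmod h ^ j / fact j"]
        have "norm (b j) \<le> cmod h ^ j / fact j * (fact j / R ^ j * K * M q i)"
          unfolding b_def by (simp add: norm_mult norm_divide norm_power)
        also have "\<dots> = K * M q i * \<rho> ^ j" by (simp add: \<rho>_def power_divide)
        finally show ?thesis .
      qed
      have "D i (exp_monomial a 0 (\<mu> + h) - ?s) x = D i (exp_monomial a 0 (\<mu> + h)) x - (\<Sum>j<N. b j)"
      proof -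
        have "D i (exp_monomial a 0 (\<mu> + h) - ?s) = D i (exp_monomial a 0 (\<mu> + h)) - D i ?s"
          by (rule Dop_smooth_diff[OF U_smooth[OF exp_monomial_U] U_smooth[OF s(1)]])
        then show ?thesis unfolding Ds b_def using xa by (simp add: D_expo)
      qed
      also have "\<dots> = (\<Sum>j. b (j + N))"
        using sums_split_initial_segment[OF sums, of N] by (simp add: sums_iff)
      also have "cmod \<dots> \<le> (\<Sum>j. K * M q i * \<rho> ^ N * \<rho> ^ j)"
      proof (rule norm_suminf_le)
        show "norm (b (j + N)) \<le> K * M q i * \<rho> ^ N * \<rho> ^ j" for j
          using bb[of "j + N"] by (simp add: power_add mult_ac)
        show "summable (\<lambda>j. K * M q i * \<rho> ^ N * \<rho> ^ j)" using \<rho> by (intro summable_mult summable_geometric) simp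
      qed
      also have "\<dots> = K * (\<rho> ^ N / (1 - \<rho>)) * M q i"
        using \<rho> by (simp add: suminf_mult suminf_geometric summable_geometric)
      finally show "cmod (D i (exp_monomial a 0 (\<mu> + h) - ?s) x) \<le> K * (\<rho> ^ N / (1 - \<rho>)) * M q i" .
    qed
    then have "cmod (S (exp_monomial a 0 (\<mu> + h) - ?s)) \<le> C * (K * (\<rho> ^ N / (1 - \<rho>)))"
      using C(2)[OF d] C(1) by (meson mult_left_mono order_trans)
    moreover have "S (exp_monomial a 0 (\<mu> + h) - ?s) = FL S (\<mu> + h) - (\<Sum>j<N. S (expo \<mu> j) / fact j * h ^ j)"
      using clinear_functional_on_diff[OF lin U_subspace exp_monomial_U s(1)] s(2)
      by (simp add: fourier_laplace_def mult_ac)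
    ultimately show ?thesis by simp
  qed
  have "(\<lambda>N. \<rho> ^ N) \<longlonglongrightarrow> 0" using \<rho> by (intro LIMSEQ_power_zero) simp
  then have lim: "(\<lambda>N. C * (K * (\<rho> ^ N / (1 - \<rho>)))) \<longlonglongrightarrow> C * (K * (0 / (1 - \<rho>)))"
    using \<rho> by (intro tendsto_intros) auto
  have "(\<lambda>N. FL S (\<mu> + h) - (\<Sum>j<N. S (expo \<mu> j) / fact j * h ^ j)) \<longlonglongrightarrow> 0"
    by (rule Lim_null_comparison[OF always_eventually]) (use tail lim in auto)
  then have "(\<lambda>N. FL S (\<mu> + h) - (FL S (\<mu> + h) - (\<Sum>j<N. S (expo \<mu> j) / fact j * h ^ j))) \<longlonglongrightarrow> FL S (\<mu> + h) - 0"
    by (intro tendsto_intros)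
  then show ?thesis unfolding sums_def by simp
qed

lemma FL_holomorphic: "S \<in> U' \<Longrightarrow> FL S holomorphic_on UNIV"
  using has_fps_shift_deriv(2)[OF FL_sums[of S 0]] by simp

lemma FL_higher_deriv: "S \<in> U' \<Longrightarrow> (deriv ^^ j) (FL S) \<mu> = S (expo \<mu> j)"
  using has_fps_shift_deriv(1)[OF FL_sums[of S \<mu>], of j] by simp

lemma FL_in_P:
  assumes "S \<in> U'" shows "FL S \<in> P"
proof -
  obtain q k C where q: "0 < q" "q < 1" and C: "0 \<le> C" "\<And>f. f \<in> U \<Longrightarrow> cmod (S f) \<le> C * NU q k f"
    using U_dual_bound[OF assms] by blast
  obtain m where m: "q < r m" using ex_r[OF q(2)] by blast
  define n where "n = max k m"
  have n: "q \<le> r n" "c k \<le> c n"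
    using m incseqD[OF r_mono, of m n] incseqD[OF c_mono, of k n] by (auto simp: n_def)
  have "FL S \<in> Pk n"
  proof (rule P_step_I[OF FL_holomorphic[OF assms]])
    fix z
    have "exp (q * \<omega> (cmod z) + c k * \<bar>Im z\<bar>) \<le> exp (r n * \<omega> (cmod z) + c n * \<bar>Im z\<bar>)"
      using n \<omega>_nonneg[of "cmod z"] by (simp add: add_mono mult_right_mono)
    then show "cmod (FL S z) \<le> (C * exp (q * \<omega> 1)) * exp (r n * \<omega> (cmod z) + c n * \<bar>Im z\<bar>)"
      using FL_bound[OF q(1) C(2,1), where z=z] C(1)
      by (meson exp_ge_zero mult_left_mono mult_nonneg_nonneg order_trans)
  qed
  then show ?thesis unfolding P_space_def by blast
qed

end

section \<open>Cut-off functions and exponential expansions\<close>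

lemma has_sum_diff:
  fixes f g :: "'a \<Rightarrow> 'b :: real_normed_vector"
  assumes "(f has_sum a) A" "(g has_sum b) A"
  shows "((\<lambda>x. f x - g x) has_sum (a - b)) A"
  using has_sum_add[OF assms(1), of "\<lambda>x. - g x" "- b"] assms(2) by (simp add: has_sum_uminus)

text \<open>The second-order remainders of the exponentials, each at most
  \<open>(\<bar>lat L n\<bar> * \<bar>t - x\<bar>)\<^sup>2\<close>, are summed. First moments are
  summable because \<open>v \<le> 1 + v\<^sup>2\<close>.\<close>

lemma chr_series_has_vector_derivative:
  assumes s0: "(\<lambda>n. cmod (\<alpha> n)) summable_on UNIV"
    and s2: "(\<lambda>n. cmod (\<alpha> n) * \<bar>lat L n\<bar>\<^sup>2) summable_on UNIV"
  shows "((\<lambda>t. \<Sum>\<^sub>\<infinity>n. \<alpha> n * chr L n t) has_vector_derivative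
           (\<Sum>\<^sub>\<infinity>n. \<alpha> n * (\<i> * of_real (lat L n)) * chr L n x)) (at x)"
proof (rule has_vector_derivative_quadratic[of 1])
  have s1: "(\<lambda>n. cmod (\<alpha> n) * \<bar>lat L n\<bar>) summable_on UNIV"
  proof (rule summable_on_comparison_test[OF summable_on_add[OF s0 s2]])
    fix n :: int
    have "\<bar>lat L n\<bar> \<le> 1 + \<bar>lat L n\<bar>\<^sup>2"
      using zero_le_power2[of "\<bar>lat L n\<bar> - 1"] unfolding power2_diff
      by (simp only: mult_1_right power_one)
    from mult_left_mono[OF this norm_ge_zero[of "\<alpha> n"]]
    show "cmod (\<alpha> n) * \<bar>lat L n\<bar> \<le> cmod (\<alpha> n) + cmod (\<alpha> n) * \<bar>lat L n\<bar>\<^sup>2" by (simp add: distrib_left)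
  qed simp
  fix t :: real
  let ?a = "\<lambda>t n. \<alpha> n * chr L n t" and ?d = "\<lambda>n. \<alpha> n * (\<i> * of_real (lat L n)) * chr L n x"
  let ?e = "\<lambda>n. \<alpha> n * (chr L n t - chr L n x - of_real (t - x) * (\<i> * of_real (lat L n)) * chr L n x)"
  have a: "(\<lambda>n. ?a t n) summable_on UNIV" for t
    by (rule abs_summable_summable) (use s0 in \<open>simp add: norm_mult\<close>)
  have d: "?d summable_on UNIV"
    by (rule abs_summable_summable) (use s1 in \<open>simp add: norm_mult\<close>)
  have "((\<lambda>n. ?a t n - ?a x n - of_real (t - x) * ?d n) has_sum
      ((\<Sum>\<^sub>\<infinity>n. ?a t n) - (\<Sum>\<^sub>\<infinity>n. ?a x n) - of_real (t - x) * (\<Sum>\<^sub>\<infinity>n. ?d n))) UNIV"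
    by (intro has_sum_diff has_sum_cmult_right has_sum_infsum a d)
  moreover have "?a t n - ?a x n - of_real (t - x) * ?d n = ?e n" for n by (simp add: algebra_simps)
  ultimately have hs: "(?e has_sum
      ((\<Sum>\<^sub>\<infinity>n. ?a t n) - (\<Sum>\<^sub>\<infinity>n. ?a x n) - of_real (t - x) * (\<Sum>\<^sub>\<infinity>n. ?d n))) UNIV" by (simp only:)
  have "cmod ((\<Sum>\<^sub>\<infinity>n. ?a t n) - (\<Sum>\<^sub>\<infinity>n. ?a x n) - of_real (t - x) * (\<Sum>\<^sub>\<infinity>n. ?d n))
      \<le> (\<Sum>\<^sub>\<infinity>n. cmod (\<alpha> n) * \<bar>lat L n\<bar>\<^sup>2 * \<bar>t - x\<bar>\<^sup>2)"
  proof (rule norm_infsum_le[OF hs has_sum_infsum])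
    have e: "cmod (?e n) \<le> cmod (\<alpha> n) * \<bar>lat L n\<bar>\<^sup>2 * \<bar>t - x\<bar>\<^sup>2" for n
    proof -
      define u where "u = \<i> * complex_of_real (lat L n * (t - x))"
      have "chr L n t = chr L n (t - x) * chr L n x" using chr_add[of L n "t - x" x] by simp
      then have eq: "?e n = \<alpha> n * chr L n x * (exp u - (\<Sum>k\<le>1. u ^ k / fact k))"
        by (simp add: u_def chr_def algebra_simps)
      have "cmod (exp u - (\<Sum>k\<le>1. u ^ k / fact k)) \<le> exp \<bar>Re u\<bar> * cmod u ^ Suc 1 / fact 1"
        by (rule Taylor_exp)
      moreover have "Re u = 0" by (simp add: u_def)
      moreover have "cmod u = \<bar>lat L n\<bar> * \<bar>t - x\<bar>"
        unfolding u_def norm_mult norm_of_real abs_mult by simp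
      ultimately have "cmod (exp u - (\<Sum>k\<le>1. u ^ k / fact k)) \<le> (\<bar>lat L n\<bar> * \<bar>t - x\<bar>) ^ 2"
        by (simp only: abs_zero exp_zero mult_1 fact_1 div_by_1 Suc_1 One_nat_def[symmetric])
      from mult_left_mono[OF this norm_ge_zero[of "\<alpha> n"]]
      have "cmod (?e n) \<le> cmod (\<alpha> n) * (\<bar>lat L n\<bar> * \<bar>t - x\<bar>) ^ 2"
        unfolding eq by (simp only: norm_mult norm_chr mult_1_right)
      then show ?thesis by (simp add: power_mult_distrib mult.assoc)
    qed
    show s: "(\<lambda>n. cmod (\<alpha> n) * \<bar>lat L n\<bar>\<^sup>2 * \<bar>t - x\<bar>\<^sup>2) summable_on UNIV"
      by (rule summable_on_cmult_left[OF s2])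
    show "\<And>n. n \<in> UNIV \<Longrightarrow> cmod (?e n) \<le> cmod (\<alpha> n) * \<bar>lat L n\<bar>\<^sup>2 * \<bar>t - x\<bar>\<^sup>2" using e by blast
  qed
  also have "\<dots> = (\<Sum>\<^sub>\<infinity>n. cmod (\<alpha> n) * \<bar>lat L n\<bar>\<^sup>2) * \<bar>t - x\<bar>\<^sup>2"
    by (rule infsum_cmult_left) (use s2 in simp)
  finally show "cmod ((\<Sum>\<^sub>\<infinity>n. ?a t n) - (\<Sum>\<^sub>\<infinity>n. ?a x n) - of_real (t - x) * (\<Sum>\<^sub>\<infinity>n. ?d n))
     \<le> (\<Sum>\<^sub>\<infinity>n. cmod (\<alpha> n) * \<bar>lat L n\<bar>\<^sup>2) * \<bar>t - x\<bar>\<^sup>2" .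
qed simp

text \<open>At \<open>s = L\<close> a character is the sign \<open>cos (n * pi)\<close>. Splitting
  it off brings a series of characters into the form of \<open>alternating_lattice_sum_zero\<close>,
  the remaining exponential having type \<open>\<bar>s - L\<bar>\<close>.\<close>

lemma chr_shift_half:
  assumes "L \<noteq> 0"
  shows "chr L n s = cos (of_real (of_int n * pi)) * exp (\<i> * of_real (lat L n) * of_real (s - L))"
proof -
  have "exp (\<i> * complex_of_real (of_int n * pi)) = cos (of_real (of_int n * pi))"
    unfolding exp_Euler sin_int_pi by simp
  moreover have "\<i> * complex_of_real (lat L n * s) = \<i> * complex_of_real (of_int n * pi) + \<i> * of_real (lat L n) * of_real (s - L)"
    using assms by (simp add: lat_def field_simps)
  ultimately show ?thesis unfolding chr_def by (simp only: exp_add)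
qed

lemma wM_mono_index:
  assumes w: "weight \<omega>" and q: "0 < q"
  shows "wM \<omega> q j \<le> wM \<omega> q (Suc j)"
proof (rule wM_le[OF w q])
  fix y :: real assume y: "1 \<le> y"
  have "y ^ j * exp (- q * \<omega> y) \<le> y ^ Suc j * exp (- q * \<omega> y)"
    using y by (intro mult_right_mono power_increasing) auto
  also have "\<dots> \<le> wM \<omega> q (Suc j)" by (rule wM_ge[OF w q y])
  finally show "y ^ j * exp (- q * \<omega> y) \<le> wM \<omega> q (Suc j)" .
qed

text \<open>The cut-off function is \<open>PP (t + b0) - PP (t - b0)\<close>, where \<open>PP\<close> is a smooth primitive of a
  \<open>2 L\<close>-periodic bump \<open>\<rho> 0\<close> concentrated near \<open>2 L \<int>\<close>, whose Fourier coefficients are the values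
  of the rapidly decreasing entire function \<open>h\<close>.\<close>

lemma exists_cutoff:
  assumes w: "weight \<omega>" and b: "0 < b" "b < L"
  shows "\<exists>\<eta> :: nat \<Rightarrow> real \<Rightarrow> complex. \<exists>C>0.
    (\<forall>i t. (\<eta> i has_vector_derivative \<eta> (Suc i) t) (at t)) \<and>
    (\<forall>t. \<bar>t\<bar> \<le> b \<longrightarrow> \<eta> 0 t = 1 \<and> (\<forall>i. \<eta> (Suc i) t = 0)) \<and>
    (\<forall>i. \<eta> i L = 0 \<and> \<eta> i (- L) = 0) \<and>
    (\<forall>i t. cmod (\<eta> i t) \<le> C / 2 ^ i * wM \<omega> 1 i)"
proof -
  have L: "0 < L" using b by simp
  \<comment> \<open>The bump has half-width \<delta> and the edges of the cut-off sit at distance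
    \<open>b0\<close> from 0, with \<open>b + \<delta> = b0\<close> and
    \<open>b0 + \<delta> = L\<close>.\<close>
  define \<delta> where "\<delta> = (L - b) / 2"
  define b0 where "b0 = (b + L) / 2"
  have \<delta>: "0 < \<delta>" using b by (simp add: \<delta>_def)
  obtain h C0 where h: "h holomorphic_on UNIV" "h 0 = 1" 
    and hC: "\<And>z. cmod (h z) \<le> C0 * exp (\<delta> * \<bar>Im z\<bar> - 2 * \<omega> (2 * cmod z))"
    using exists_entire_weight_decay[OF w \<delta>] by blast
  note wn = weight_nonneg[OF w] and wm = weight_mono[OF w]
  have C0: "0 \<le> C0"
    using order_trans[OF norm_ge_zero hC[of 0]] by (simp add: zero_le_mult_iff)
  define H where "H = (\<lambda>n. h (of_real (lat L n)))"
  define W where "W = (\<lambda>n. \<bar>lat L n\<bar>)"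
  have Hle: "cmod (H n) \<le> C0 * (exp (- 1 * \<omega> (2 * W n)) * exp (- 1 * \<omega> (2 * W n)))" for n
    using hC[of "of_real (lat L n)"] by (simp add: H_def W_def exp_add[symmetric])
  have e2: "exp (- 1 * \<omega> (2 * W n)) \<le> exp (- 1 * \<omega> (W n))" for n
    by (simp add: W_def wm)
  define Stot where "Stot = (\<Sum>\<^sub>\<infinity>n. exp (- 1 * \<omega> \<bar>lat L n\<bar>))"
  have sumE: "(\<lambda>n. exp (- 1 * \<omega> (W n))) summable_on UNIV"
    unfolding W_def by (rule summable_exp_weight_lat[OF w L]) simp
  have Stot0: "0 \<le> Stot" unfolding Stot_def by (rule infsum_nonneg) simp
  define K where "K = C0 * exp (1 * \<omega> 1)"
  have K0: "0 \<le> K" using C0 by (simp add: K_def)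
  \<comment> \<open>One factor \<open>exp (- \<omega> (2 * W n))\<close> turns the power into
    \<open>wM \<omega> 1 i / 2 ^ i\<close>; the other is kept for the summation over
    \<open>n\<close>.\<close>
  have HW: "cmod (H n) * W n ^ i \<le> (K / 2 ^ i * wM \<omega> 1 i) * exp (- 1 * \<omega> (W n))" for n i
  proof -
    have "(2 * W n) ^ i * exp (- 1 * \<omega> (2 * W n)) \<le> exp (1 * \<omega> 1) * wM \<omega> 1 i"
      by (rule wM_ge_all[OF w]) (auto simp: W_def)
    then have 1: "W n ^ i * exp (- 1 * \<omega> (2 * W n)) \<le> exp (1 * \<omega> 1) * wM \<omega> 1 i / 2 ^ i"
      by (simp add: power_mult_distrib field_simps)
    have "cmod (H n) * W n ^ i \<le> C0 * (exp (- 1 * \<omega> (2 * W n)) * exp (- 1 * \<omega> (2 * W n))) * W n ^ i"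
      by (intro mult_right_mono Hle) (simp add: W_def)
    also have "\<dots> = C0 * ((W n ^ i * exp (- 1 * \<omega> (2 * W n))) * exp (- 1 * \<omega> (2 * W n)))" by simp
    also have "\<dots> \<le> C0 * ((exp (1 * \<omega> 1) * wM \<omega> 1 i / 2 ^ i) * exp (- 1 * \<omega> (W n)))"
      by (intro mult_left_mono mult_mono 1 e2 C0) (auto simp: less_imp_le[OF wM_pos])
    finally show ?thesis by (simp add: K_def mult_ac)
  qed
  have sH: "(\<lambda>n. cmod (H n) * W n ^ i) summable_on UNIV" for i
    by (rule summable_on_comparison_test[OF summable_on_cmult_right[OF sumE, of "K / 2 ^ i * wM \<omega> 1 i"]])
      (use HW in \<open>auto simp: W_def\<close>)
  define \<iota> where "\<iota> = (\<lambda>n. \<i> * complex_of_real (lat L n))"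
  have n\<iota>: "cmod (\<iota> n) = W n" for n by (simp add: \<iota>_def W_def norm_mult)
  define \<rho> where "\<rho> = (\<lambda>i t. (1 / (2 * of_real L)) * (\<Sum>\<^sub>\<infinity>n. H n * \<iota> n ^ i * chr L n t))"
  have \<rho>d: "(\<rho> i has_vector_derivative \<rho> (Suc i) t) (at t)" for i t
  proof -
    have "((\<lambda>t. \<Sum>\<^sub>\<infinity>n. (H n * \<iota> n ^ i) * chr L n t) has_vector_derivative
           (\<Sum>\<^sub>\<infinity>n. (H n * \<iota> n ^ i) * (\<i> * of_real (lat L n)) * chr L n t)) (at t)"
    proof (rule chr_series_has_vector_derivative)
      show "(\<lambda>n. cmod (H n * \<iota> n ^ i)) summable_on UNIV" using sH[of i] by (simp add: norm_mult norm_power n\<iota>)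
      have "cmod (H n * \<iota> n ^ i) * \<bar>lat L n\<bar>\<^sup>2 = cmod (H n) * W n ^ (i + 2)" for n
        by (simp only: norm_mult norm_power n\<iota> W_def power_add mult.assoc)
      then show "(\<lambda>n. cmod (H n * \<iota> n ^ i) * \<bar>lat L n\<bar>\<^sup>2) summable_on UNIV" using sH[of "i + 2"] by (simp only:)
    qed
    from has_vector_derivative_mult_right[OF this, of "1 / (2 * of_real L)"]
    show ?thesis unfolding \<rho>_def by (simp add: \<iota>_def mult_ac)
  qed
  have \<rho>le: "cmod (\<rho> i t) \<le> (1 / (2 * L)) * ((K / 2 ^ i * wM \<omega> 1 i) * Stot)" for i t
  proof -
    have "cmod (\<Sum>\<^sub>\<infinity>n. H n * \<iota> n ^ i * chr L n t) \<le> (\<Sum>\<^sub>\<infinity>n. (K / 2 ^ i * wM \<omega> 1 i) * exp (- 1 * \<omega> (W n)))"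
    proof (rule norm_infsum_le[OF has_sum_infsum has_sum_infsum])
      show "(\<lambda>n. H n * \<iota> n ^ i * chr L n t) summable_on UNIV"
        by (rule abs_summable_summable) (use sH[of i] in \<open>simp add: norm_mult norm_power n\<iota>\<close>)
      show "(\<lambda>n. K / 2 ^ i * wM \<omega> 1 i * exp (- 1 * \<omega> (W n))) summable_on UNIV"
        by (rule summable_on_cmult_right[OF sumE])
      show "\<And>n. n \<in> UNIV \<Longrightarrow> cmod (H n * \<iota> n ^ i * chr L n t) \<le> K / 2 ^ i * wM \<omega> 1 i * exp (- 1 * \<omega> (W n))"
        using HW by (simp add: norm_mult norm_power n\<iota>)
    qed
    also have "\<dots> = (K / 2 ^ i * wM \<omega> 1 i) * Stot"
      unfolding Stot_def W_def by (rule infsum_cmult_right) (use sumE in \<open>simp add: W_def\<close>)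
    finally have "(1 / (2 * L)) * cmod (\<Sum>\<^sub>\<infinity>n. H n * \<iota> n ^ i * chr L n t) \<le> (1 / (2 * L)) * ((K / 2 ^ i * wM \<omega> 1 i) * Stot)"
      using L by (intro mult_left_mono) auto
    then show ?thesis unfolding \<rho>_def using L by (simp only: norm_mult norm_divide) simp
  qed
  \<comment> \<open>The series is the alternating lattice sum of \<open>G\<close>, whose type is at
    most \<open>\<delta> + \<bar>s - L\<bar>\<close>; on this range of \<open>s\<close> that does
    not exceed \<open>L\<close>, so the sum is 0.\<close>
  have \<rho>0: "\<rho> i s = 0" if s: "\<delta> \<le> s" "s \<le> 2 * L - \<delta>" for i s
  proof -
    define G where "G = (\<lambda>z. h z * (\<i> * z) ^ i * exp (\<i> * z * of_real (s - L)))"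
    obtain C1 where C1: "0 < C1" "\<And>y. y \<ge> 0 \<Longrightarrow> (1 + y) ^ (i + 2) * exp (- 2 * \<omega> y) \<le> C1"
      using weight_beats_power[OF w, of 2 "i + 2"] by auto
    have bd: "cmod (G z) \<le> (C0 * C1) * exp (L * \<bar>Im z\<bar>) / (1 + cmod z)\<^sup>2" for z
    proof -
      have p: "0 < (1 + cmod z)\<^sup>2" by (intro zero_less_power add_pos_nonneg) auto
      have "cmod z ^ i \<le> (1 + cmod z) ^ i" by (intro power_mono) auto
      then have "cmod z ^ i * exp (- 2 * \<omega> (2 * cmod z)) * (1 + cmod z)\<^sup>2
          \<le> (1 + cmod z) ^ i * exp (- 2 * \<omega> (cmod z)) * (1 + cmod z)\<^sup>2"
        using wm[of "cmod z" "2 * cmod z"] by (intro mult_right_mono mult_mono) auto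
      also have "\<dots> \<le> C1" using C1(2)[of "cmod z"] by (simp add: power_add power2_eq_square mult_ac)
      finally have 1: "cmod z ^ i * exp (- 2 * \<omega> (2 * cmod z)) \<le> C1 / (1 + cmod z)\<^sup>2"
        using p by (simp add: field_simps)
      have "- Im z * (s - L) \<le> \<bar>Im z\<bar> * \<bar>s - L\<bar>"
        using abs_ge_self[of "- Im z * (s - L)"] by (simp only: abs_mult abs_minus_cancel)
      moreover have "\<delta> * \<bar>Im z\<bar> + \<bar>Im z\<bar> * \<bar>s - L\<bar> \<le> L * \<bar>Im z\<bar>"
      proof -
        have "\<delta> + \<bar>s - L\<bar> \<le> L" using s by auto
        from mult_right_mono[OF this, of "\<bar>Im z\<bar>"] show ?thesis by (simp add: algebra_simps)
      qed
      ultimately have 2: "exp (\<delta> * \<bar>Im z\<bar>) * cmod (exp (\<i> * z * of_real (s - L))) \<le> exp (L * \<bar>Im z\<bar>)"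
        by (simp add: norm_exp_eq_Re exp_add[symmetric] del: of_real_diff)
      have "cmod (G z) = cmod (h z) * cmod z ^ i * cmod (exp (\<i> * z * of_real (s - L)))"
        by (simp add: G_def norm_mult norm_power)
      also have "\<dots> \<le> C0 * exp (\<delta> * \<bar>Im z\<bar> - 2 * \<omega> (2 * cmod z)) * cmod z ^ i * cmod (exp (\<i> * z * of_real (s - L)))"
        by (intro mult_right_mono hC) auto
      also have "\<dots> = C0 * ((cmod z ^ i * exp (- 2 * \<omega> (2 * cmod z))) * (exp (\<delta> * \<bar>Im z\<bar>) * cmod (exp (\<i> * z * of_real (s - L)))))"
        by (simp add: exp_diff exp_minus divide_inverse mult_ac)
      also have "\<dots> \<le> C0 * ((C1 / (1 + cmod z)\<^sup>2) * exp (L * \<bar>Im z\<bar>))"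
        by (intro mult_left_mono mult_mono 1 2 C0) (use C1 in auto)
      finally show ?thesis by simp
    qed
    have Ghol: "G holomorphic_on UNIV" unfolding G_def by (intro holomorphic_intros h)
    have "((\<lambda>n. cos (of_real (of_int n * pi)) * G (of_real (lat L n))) has_sum 0) UNIV"
      by (rule alternating_lattice_sum_zero[OF Ghol L bd])
    moreover have "cos (of_real (of_int n * pi)) * G (of_real (lat L n)) = H n * \<iota> n ^ i * chr L n s" for n
      using chr_shift_half[of L n s] L by (simp add: G_def H_def \<iota>_def mult_ac)
    ultimately have "((\<lambda>n. H n * \<iota> n ^ i * chr L n s) has_sum 0) UNIV" by simp
    then show ?thesis unfolding \<rho>_def by (simp add: infsumI)
  qed
  have \<rho>per: "\<rho> i (t + 2 * L) = \<rho> i t" for i t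
    unfolding \<rho>_def using L by (simp add: chr_period)
  \<comment> \<open>The term at \<open>n = 0\<close> is 0 by the convention for division by 0; the
    constant mode \<open>H 0 = 1\<close> is integrated to \<open>of_real t\<close> instead.\<close>
  define PP where "PP = (\<lambda>t. (1 / (2 * of_real L)) * (of_real t + (\<Sum>\<^sub>\<infinity>n. (H n / \<iota> n) * chr L n t)))"
  have invW: "cmod (H n / \<iota> n) \<le> (L / pi) * cmod (H n)" for n
  proof (cases "n = 0")
    case True then show ?thesis using L by (simp add: \<iota>_def lat_def)
  next
    case False
    have "1 \<le> \<bar>real_of_int n\<bar>" using False by simp
    then have "pi / L \<le> W n" using L by (simp add: W_def lat_def abs_mult divide_right_mono)
    moreover have "0 < pi / L" using L by simp
    ultimately have "1 / W n \<le> 1 / (pi / L)" by (intro divide_left_mono mult_pos_pos) linarith+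
    from mult_left_mono[OF this norm_ge_zero[of "H n"]]
    show ?thesis by (simp add: norm_divide n\<iota> mult.commute)
  qed
  have sP: "(\<lambda>n. cmod (H n / \<iota> n)) summable_on UNIV"
    by (rule summable_on_comparison_test[OF summable_on_cmult_right[OF sH[of 0], of "L / pi"]])
      (use invW in auto)
  have PPd: "(PP has_vector_derivative \<rho> 0 t) (at t)" for t
  proof -
    have s2: "(\<lambda>n. cmod (H n / \<iota> n) * \<bar>lat L n\<bar>\<^sup>2) summable_on UNIV"
    proof (rule summable_on_comparison_test[OF sH[of 1]])
      show "cmod (H n / \<iota> n) * \<bar>lat L n\<bar>\<^sup>2 \<le> cmod (H n) * W n ^ 1" for n
      proof -
        have "A / v * v ^ 2 \<le> A * v ^ 1" for A v :: real by (cases "v = 0") (simp_all add: power2_eq_square)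
        then show ?thesis unfolding norm_divide n\<iota> W_def .
      qed
    qed simp
    have 1: "((\<lambda>t. \<Sum>\<^sub>\<infinity>n. (H n / \<iota> n) * chr L n t) has_vector_derivative
           (\<Sum>\<^sub>\<infinity>n. (H n / \<iota> n) * (\<i> * of_real (lat L n)) * chr L n t)) (at t)"
      by (rule chr_series_has_vector_derivative[OF sP s2])
    have "((\<lambda>n. H n * chr L n t) has_sum (\<Sum>\<^sub>\<infinity>n. H n * chr L n t)) UNIV"
      by (rule has_sum_infsum, rule abs_summable_summable) (use sH[of 0] in \<open>simp add: norm_mult\<close>)
    moreover have "((\<lambda>n::int. if n = 0 then 1 else 0 :: complex) has_sum 1) UNIV"
    proof -
      have "((\<lambda>n::int. if n = 0 then 1 else 0 :: complex) has_sum 1) {0}" by (rule has_sum_finiteI) auto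
      also have "?this \<longleftrightarrow> ?thesis" by (rule has_sum_cong_neutral) auto
      finally show ?thesis .
    qed
    ultimately have "((\<lambda>n. H n * chr L n t - (if n = 0 then 1 else 0)) has_sum ((\<Sum>\<^sub>\<infinity>n. H n * chr L n t) - 1)) UNIV"
      by (rule has_sum_diff)
    moreover have "H n * chr L n t - (if n = 0 then 1 else 0) = (H n / \<iota> n) * (\<i> * of_real (lat L n)) * chr L n t" for n
    proof (cases "n = 0")
      case True then show ?thesis by (simp add: H_def lat_def h(2))
    next
      case False
      then have "\<iota> n \<noteq> 0" using L by (simp add: \<iota>_def lat_def)
      then show ?thesis using False by (simp add: \<iota>_def)
    qed
    ultimately have "(\<Sum>\<^sub>\<infinity>n. (H n / \<iota> n) * (\<i> * of_real (lat L n)) * chr L n t) = (\<Sum>\<^sub>\<infinity>n. H n * chr L n t) - 1"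
      by (simp add: infsumI)
    with 1 have "((\<lambda>t. \<Sum>\<^sub>\<infinity>n. (H n / \<iota> n) * chr L n t) has_vector_derivative
           (\<Sum>\<^sub>\<infinity>n. H n * chr L n t) - 1) (at t)" by (simp only:)
    moreover have "((\<lambda>t. complex_of_real t) has_vector_derivative of_real 1) (at t)"
      by (intro has_vector_derivative_of_real) simp
    ultimately have "((\<lambda>t. of_real t + (\<Sum>\<^sub>\<infinity>n. (H n / \<iota> n) * chr L n t)) has_vector_derivative
           of_real 1 + ((\<Sum>\<^sub>\<infinity>n. H n * chr L n t) - 1)) (at t)" by (intro has_vector_derivative_add)
    from has_vector_derivative_mult_right[OF this, of "1 / (2 * of_real L)"]
    show ?thesis by (simp add: PP_def \<rho>_def)
  qed
  \<comment> \<open>The bump has integral 1 over a period, so \<open>PP\<close> is a smooth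
    staircase that gains 1 per period and is flat between its steps.\<close>
  have PPper: "PP (t + 2 * L) = PP t + 1" for t
  proof -
    have "chr L n (t + 2 * L) = chr L n t" for n using L by (intro chr_period) simp
    then show ?thesis unfolding PP_def using L by (simp add: distrib_left)
  qed
  obtain \<kappa> where \<kappa>: "\<And>s. \<delta> \<le> s \<Longrightarrow> s \<le> 2 * L - \<delta> \<Longrightarrow> PP s = \<kappa>"
  proof -
    have "\<exists>\<kappa>. \<forall>s\<in>{\<delta>..2 * L - \<delta>}. PP s = \<kappa>"
    proof (rule has_vector_derivative_zero_constant)
      show "convex {\<delta>..2 * L - \<delta>}" by (rule convex_real_interval)
      show "(PP has_vector_derivative 0) (at s within {\<delta>..2 * L - \<delta>})" if "s \<in> {\<delta>..2 * L - \<delta>}" for s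
        using PPd[of s] \<rho>0[of s 0] that by (auto intro: has_vector_derivative_at_within)
    qed auto
    then show ?thesis using that by auto
  qed
  have PPle: "cmod (PP (t + b0) - PP (t - b0)) \<le> 1 + (1 / L) * ((L / pi) * ((K * wM \<omega> 1 0) * Stot))" for t
  proof -
    define Q where "Q = (\<lambda>t. \<Sum>\<^sub>\<infinity>n. (H n / \<iota> n) * chr L n t)"
    have Q: "cmod (Q t) \<le> (L / pi) * ((K * wM \<omega> 1 0) * Stot)" for t
    proof -
      have "cmod (Q t) \<le> (\<Sum>\<^sub>\<infinity>n. ((L / pi) * (K * wM \<omega> 1 0)) * exp (- 1 * \<omega> (W n)))"
        unfolding Q_def
      proof (rule norm_infsum_le[OF has_sum_infsum has_sum_infsum])
        show "(\<lambda>n. H n / \<iota> n * chr L n t) summable_on UNIV"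
          by (rule abs_summable_summable) (use sP in \<open>simp only: norm_mult norm_chr mult_1_right\<close>)
        show "(\<lambda>n. ((L / pi) * (K * wM \<omega> 1 0)) * exp (- 1 * \<omega> (W n))) summable_on UNIV"
          by (rule summable_on_cmult_right[OF sumE])
        fix n
        have "cmod (H n) \<le> K * wM \<omega> 1 0 * exp (- 1 * \<omega> (W n))" using HW[of n 0] by simp
        then have "(L / pi) * cmod (H n) \<le> (L / pi) * (K * wM \<omega> 1 0 * exp (- 1 * \<omega> (W n)))"
          using L by (intro mult_left_mono) auto
        then show "cmod (H n / \<iota> n * chr L n t) \<le> ((L / pi) * (K * wM \<omega> 1 0)) * exp (- 1 * \<omega> (W n))"
          using invW[of n] by (simp only: norm_mult norm_chr mult.assoc)
      qed
      also have "\<dots> = ((L / pi) * (K * wM \<omega> 1 0)) * Stot"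
        unfolding Stot_def W_def by (rule infsum_cmult_right) (use sumE in \<open>simp add: W_def\<close>)
      finally show ?thesis by (simp add: mult.assoc)
    qed
    have "PP (t + b0) - PP (t - b0) = (1 / (2 * of_real L)) * (of_real (2 * b0) + Q (t + b0) - Q (t - b0))"
      unfolding PP_def Q_def right_diff_distrib[symmetric] by (intro arg_cong2[of _ _ _ _ "(*)"] refl) simp
    then have "cmod (PP (t + b0) - PP (t - b0)) = (1 / (2 * L)) * cmod (of_real (2 * b0) + Q (t + b0) - Q (t - b0))"
      using L by (simp add: norm_mult norm_divide)
    also have "\<dots> \<le> (1 / (2 * L)) * (2 * b0 + 2 * ((L / pi) * ((K * wM \<omega> 1 0) * Stot)))"
    proof (rule mult_left_mono)
      have 1: "cmod (of_real (2 * b0) + Q (t + b0) - Q (t - b0)) \<le> cmod (of_real (2 * b0)) + cmod (Q (t + b0)) + cmod (Q (t - b0))"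
        by (meson add_right_mono norm_triangle_ineq norm_triangle_ineq4 order_trans)
      have 2: "cmod (of_real (2 * b0)) = 2 * b0" unfolding norm_of_real using b by (simp add: b0_def)
      have "A \<le> u + v + w \<Longrightarrow> u = B \<Longrightarrow> v \<le> X \<Longrightarrow> w \<le> X \<Longrightarrow> A \<le> B + 2 * X" for A B u v w X :: real
        by linarith
      from this[OF 1 2 Q Q]
      show "cmod (of_real (2 * b0) + Q (t + b0) - Q (t - b0)) \<le> 2 * b0 + 2 * ((L / pi) * ((K * wM \<omega> 1 0) * Stot))" .
    qed (use L in simp)
    also have "\<dots> = b0 / L + (1 / L) * ((L / pi) * ((K * wM \<omega> 1 0) * Stot))"
      using L by (simp add: field_simps)
    also have "b0 / L \<le> 1" using b L by (simp add: b0_def)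
    finally show ?thesis by simp
  qed
  \<comment> \<open>Difference of two shifted staircases: the step of the first at
    \<open>- b0\<close> raises it to 1, and the step of the second at \<open>b0\<close> brings it
    back to 0.\<close>
  define \<eta> where "\<eta> = (\<lambda>i t. case i of 0 \<Rightarrow> PP (t + b0) - PP (t - b0) | Suc i \<Rightarrow> \<rho> i (t + b0) - \<rho> i (t - b0))"
  have \<eta>d: "(\<eta> i has_vector_derivative \<eta> (Suc i) t) (at t)" for i t
  proof -
    have sh: "((\<lambda>t. F (t + d)) has_vector_derivative F' (t + d)) (at t)"
      if "\<And>t. (F has_vector_derivative F' t) (at t)" for F F' :: "real \<Rightarrow> complex" and d t
    proof -
      have "((F \<circ> (\<lambda>t. t + d)) has_vector_derivative (1 *\<^sub>R F' (t + d))) (at t)"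
        by (rule vector_diff_chain_at) (auto intro!: derivative_eq_intros that)
      then show ?thesis by (simp add: o_def)
    qed
    have 1: "((\<lambda>t. PP (t + b0) - PP (t - b0)) has_vector_derivative \<rho> 0 (t + b0) - \<rho> 0 (t - b0)) (at t)"
      using has_vector_derivative_diff[OF sh[OF PPd, where d=b0] sh[OF PPd, where d="-b0"]] by simp
    have 2: "((\<lambda>t. \<rho> j (t + b0) - \<rho> j (t - b0)) has_vector_derivative \<rho> (Suc j) (t + b0) - \<rho> (Suc j) (t - b0)) (at t)" for j
      using has_vector_derivative_diff[OF sh[OF \<rho>d, where d=b0] sh[OF \<rho>d, where d="-b0"]] by simp
    show ?thesis using 1 2 by (cases i) (simp_all add: \<eta>_def)
  qed
  \<comment> \<open>For these \<open>t\<close> the point \<open>t + b0\<close> lies on the plateau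
    behind the step at 0, and \<open>t - b0\<close> on the one before it, which one period moves to
    the former.\<close>
  have in1: "\<delta> \<le> t + b0" "t + b0 \<le> 2 * L - \<delta>" "\<delta> \<le> t - b0 + 2 * L" "t - b0 + 2 * L \<le> 2 * L - \<delta>" if "\<bar>t\<bar> \<le> b" for t
    using that b by (auto simp: \<delta>_def b0_def field_simps abs_le_iff)
  have one: "\<eta> 0 t = 1 \<and> (\<forall>i. \<eta> (Suc i) t = 0)" if "\<bar>t\<bar> \<le> b" for t
  proof -
    have "PP (t - b0) = \<kappa> - 1" using PPper[of "t - b0"] \<kappa>[OF in1(3,4)[OF that]] by (simp add: eq_diff_eq)
    then show ?thesis
      using \<kappa>[OF in1(1,2)[OF that]] \<rho>0[OF in1(1,2)[OF that]] \<rho>0[OF in1(3,4)[OF that]] \<rho>per[of _ "t - b0"]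
      by (simp add: \<eta>_def)
  qed
  have in2: "\<delta> \<le> L + b0" "L + b0 \<le> 2 * L - \<delta>" "\<delta> \<le> L - b0" "L - b0 \<le> 2 * L - \<delta>"
    using b by (auto simp: \<delta>_def b0_def field_simps)
  have zeroL: "\<eta> i L = 0" for i
    using \<kappa>[OF in2(1,2)] \<kappa>[OF in2(3,4)] \<rho>0[OF in2(1,2)] \<rho>0[OF in2(3,4)] by (cases i) (simp_all add: \<eta>_def)
  have zeroL': "\<eta> i (- L) = 0" for i
  proof -
    have "- L + b0 + 2 * L = L + b0" "- L - b0 + 2 * L = L - b0" by simp_all
    then have "PP (- L + b0) = PP (L + b0) - 1" "PP (- L - b0) = PP (L - b0) - 1"
      "\<And>i. \<rho> i (- L + b0) = \<rho> i (L + b0)" "\<And>i. \<rho> i (- L - b0) = \<rho> i (L - b0)"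
      using PPper[of "- L + b0"] PPper[of "- L - b0"] \<rho>per[of _ "- L + b0"] \<rho>per[of _ "- L - b0"] by simp_all
    then show ?thesis
      using \<kappa>[OF in2(1,2)] \<kappa>[OF in2(3,4)] \<rho>0[OF in2(1,2)] \<rho>0[OF in2(3,4)] by (cases i) (simp_all add: \<eta>_def)
  qed
  define B0 where "B0 = (1 + (1 / L) * ((L / pi) * ((K * wM \<omega> 1 0) * Stot))) / wM \<omega> 1 0"
  \<comment> \<open>\<open>\<eta> (Suc j)\<close> is built from \<open>\<rho> j\<close>, whose gain
    is only \<open>2 ^ j\<close>; the factor 2 restores the missing power.\<close>
  define B1 where "B1 = (2 / L) * (K * Stot)"
  have B1: "0 \<le> B1" using L K0 Stot0 by (simp add: B1_def)
  have B0: "0 < B0" unfolding B0_def using L K0 Stot0 wM_pos[of \<omega> 1 0]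
    by (intro divide_pos_pos add_pos_nonneg mult_nonneg_nonneg) (auto simp: less_imp_le)
  have \<eta>le: "cmod (\<eta> i t) \<le> (B0 + B1) / 2 ^ i * wM \<omega> 1 i" for i t
  proof (cases i)
    case 0
    have "cmod (\<eta> i t) \<le> B0 * wM \<omega> 1 0" using PPle[of t] wM_pos[of \<omega> 1 0] by (simp add: 0 \<eta>_def B0_def)
    also have "\<dots> \<le> (B0 + B1) * wM \<omega> 1 0" using B1 wM_pos[of \<omega> 1 0] by (intro mult_right_mono) auto
    finally show ?thesis by (simp add: 0)
  next
    case (Suc j)
    have "cmod (\<eta> i t) \<le> cmod (\<rho> j (t + b0)) + cmod (\<rho> j (t - b0))"
      unfolding Suc \<eta>_def by (simp add: norm_triangle_ineq4)
    also have "\<dots> \<le> 2 * ((1 / (2 * L)) * ((K / 2 ^ j * wM \<omega> 1 j) * Stot))"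
      using \<rho>le[of j "t + b0"] \<rho>le[of j "t - b0"] by linarith
    also have "\<dots> = B1 / 2 ^ i * wM \<omega> 1 j" by (simp add: Suc B1_def field_simps)
    also have "\<dots> \<le> (B0 + B1) / 2 ^ i * wM \<omega> 1 i"
      using B0 B1 wM_mono_index[OF w, of 1 j] less_imp_le[OF wM_pos[of \<omega> 1 j]]
      by (intro mult_mono divide_right_mono) (auto simp: Suc)
    finally show ?thesis .
  qed
  show ?thesis
    using \<eta>d one zeroL zeroL' \<eta>le B0 B1 by (intro exI[of _ \<eta>] exI[of _ "B0 + B1"]) auto
qed

text \<open>Pascal's rule, arranged for differentiating a Leibniz sum.\<close>

lemma leibniz_sum_Suc:
  fixes A B :: "nat \<Rightarrow> complex"
  shows "(\<Sum>i\<le>j. of_nat (j choose i) * (A (Suc i) * B (j - i) + A i * B (Suc (j - i)))) =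
         (\<Sum>i\<le>Suc j. of_nat (Suc j choose i) * (A i * B (Suc j - i)))"
proof -
  define X where "X = (\<lambda>i. A i * B (Suc j - i))"
  have 1: "(\<Sum>i\<le>j. of_nat (j choose i) * X i) = X 0 + (\<Sum>i\<le>j. of_nat (j choose Suc i) * X (Suc i))"
  proof -
    have "(\<Sum>i\<le>j. of_nat (j choose i) * X i) = (\<Sum>i\<le>Suc j. of_nat (j choose i) * X i)" by simp
    also have "\<dots> = X 0 + (\<Sum>i\<le>j. of_nat (j choose Suc i) * X (Suc i))"
      by (subst sum.atMost_Suc_shift) simp
    finally show ?thesis .
  qed
  have "(\<Sum>i\<le>Suc j. of_nat (Suc j choose i) * X i) = X 0 + (\<Sum>i\<le>j. of_nat (Suc j choose Suc i) * X (Suc i))"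
    by (subst sum.atMost_Suc_shift) simp
  also have "\<dots> = (\<Sum>i\<le>j. of_nat (j choose i) * X (Suc i)) + (\<Sum>i\<le>j. of_nat (j choose i) * X i)"
    unfolding 1 by (simp add: distrib_right sum.distrib)
  also have "\<dots> = (\<Sum>i\<le>j. of_nat (j choose i) * (A (Suc i) * B (j - i) + A i * B (Suc (j - i))))"
    unfolding sum.distrib[symmetric] X_def
    by (intro sum.cong refl) (simp add: distrib_left Suc_diff_le)
  finally show ?thesis by (simp add: X_def)
qed


context ultra
begin

text \<open>Integration by parts has no boundary terms, so the j-th power of a frequency times its
  coefficient is at most a constant times \<open>M q1 j\<close>, for every \<open>j\<close>.
  Optimising \<open>j\<close> for each frequency merges these bounds into the exponential decay.
  Linearity and the uniform constant are recorded because the coefficients will serve to define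
  functionals.\<close>

lemma expansion:
  assumes q: "0 < q" "q < 1"
  shows "\<exists>L coef q' m' C. 0 < L \<and> 0 < q' \<and> q' < 1 \<and> 0 \<le> C \<and>
    (\<forall>f\<in>U. \<forall>g\<in>U. \<forall>n. coef (f + g) n = coef f n + coef g n) \<and>
    (\<forall>b. \<forall>f\<in>U. \<forall>n. coef (\<lambda>x. b * f x) n = b * coef f n) \<and>
    (\<forall>f\<in>U. \<forall>n. cmod (coef f n) \<le> C * NU q' m' f * exp (- q * \<omega> \<bar>lat L n\<bar>)) \<and>
    (\<forall>f\<in>U. \<forall>j x. \<bar>x\<bar> \<le> c m \<longrightarrow>
      ((\<lambda>n. coef f n * (- \<i> * of_real (lat L n)) ^ j * chr L (- n) x) has_sum D j f x) UNIV)"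
proof -
  obtain m' where m': "c m < c m'" using ex_c_ge by blast
  define L where "L = c m'"
  have L: "0 < L" "c m < L" using c_pos m' by (auto simp: L_def)
  \<comment> \<open>Room for two losses: from \<open>q2\<close> to \<open>q1\<close> in the Leibniz
    sum, and from \<open>q1\<close> to \<open>q\<close> for the extra factor in
    \<open>wM_optimal\<close>.\<close>
  define q1 where "q1 = (q + 1) / 2"
  define q2 where "q2 = (q1 + 1) / 2"
  have qq: "0 < q1" "q < q1" "q1 < q2" "0 < q2" "q2 < 1" using q by (simp_all add: q1_def q2_def field_simps)
  obtain \<eta> :: "nat \<Rightarrow> real \<Rightarrow> complex" and C0 where C0: "0 < C0"
    and \<eta>d: "\<And>i t. (\<eta> i has_vector_derivative \<eta> (Suc i) t) (at t)"
    and \<eta>1: "\<And>t. \<bar>t\<bar> \<le> c m \<Longrightarrow> \<eta> 0 t = 1" "\<And>t i. \<bar>t\<bar> \<le> c m \<Longrightarrow> \<eta> (Suc i) t = 0"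
    and \<eta>0: "\<And>i. \<eta> i L = 0" "\<And>i. \<eta> i (- L) = 0"
    and \<eta>le: "\<And>i t. cmod (\<eta> i t) \<le> C0 / 2 ^ i * M 1 i"
    using exists_cutoff[OF weight c_pos L(2)] by blast
  obtain C1 where C1: "0 < C1"
    "\<And>j i. i \<le> j \<Longrightarrow> real (j choose i) * (M q2 i * M q2 (j - i)) \<le> C1 * M q1 j"
    using wM_binomial[OF weight qq(1,3)] by blast
  have inL: "\<bar>t\<bar> \<le> c m'" if "t \<in> {-L..L}" for t using that by (auto simp: L_def)
  \<comment> \<open>The j-th derivative of the product with the cut-off. The interval stays inside
    the domain of \<open>f\<close> because \<open>L = c m'\<close>.\<close>
  define g where "g = (\<lambda>f j t. \<Sum>i\<le>j. of_nat (j choose i) * (\<eta> i t * D (j - i) f t))"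
  have gd: "(g f j has_vector_derivative g f (Suc j) t) (at t)" if f: "f \<in> U" and t: "t \<in> {-L..L}" for f j t
  proof -
    have "((\<lambda>t. \<Sum>i\<le>j. of_nat (j choose i) * (\<eta> i t * D (j - i) f t)) has_vector_derivative
       (\<Sum>i\<le>j. of_nat (j choose i) * (\<eta> i t * D (Suc (j - i)) f t + \<eta> (Suc i) t * D (j - i) f t))) (at t)"
      by (intro has_vector_derivative_sum has_vector_derivative_mult_right has_vector_derivative_mult \<eta>d
          smooth_fun_has_vector_derivative[OF U_smooth[OF f] c_le[OF inL[OF t]]])
    moreover have "(\<Sum>i\<le>j. of_nat (j choose i) * (\<eta> i t * D (Suc (j - i)) f t + \<eta> (Suc i) t * D (j - i) f t))
       = g f (Suc j) t"
      unfolding g_def leibniz_sum_Suc[of j "\<lambda>i. \<eta> i t" "\<lambda>i. D i f t", symmetric]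
      by (simp only: add.commute)
    ultimately show ?thesis by (simp only: g_def[abs_def])
  qed
  have gc: "continuous_on {-L..L} (g f j)" if f: "f \<in> U" for f j
    by (meson continuous_at_imp_continuous_on gd[OF f] has_vector_derivative_continuous)
  have gle: "cmod (g f j t) \<le> (2 * C0 * C1) * NU q2 m' f * M q1 j" if f: "f \<in> U" and t: "t \<in> {-L..L}" for f j t
  proof -
    have N0: "0 \<le> NU q2 m' f" by (rule NU_nonneg[OF f qq(4,5)])
    \<comment> \<open>The gain of the cut-off gives a geometric series, so the bound does not grow
      with the number of terms.\<close>
    have "cmod (g f j t) \<le> (\<Sum>i\<le>j. (C0 * C1 * NU q2 m' f * M q1 j) * (1 / 2) ^ i)"
      unfolding g_def
    proof (rule sum_norm_le)
      fix i assume i: "i \<in> {..j}"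
      have "cmod (\<eta> i t) \<le> C0 / 2 ^ i * M q2 i"
        using \<eta>le[of i t] wM_antimono[OF weight qq(4), of 1 i] qq(5) C0
        by (meson divide_nonneg_nonneg less_imp_le mult_left_mono order_trans zero_le_numeral zero_le_power)
      moreover have "cmod (D (j - i) f t) \<le> NU q2 m' f * M q2 (j - i)"
        by (rule u_norm_ge[OF f qq(4,5) inL[OF t]])
      ultimately have "cmod (\<eta> i t) * cmod (D (j - i) f t) \<le> (C0 / 2 ^ i * M q2 i) * (NU q2 m' f * M q2 (j - i))"
        using C0 wM_pos[of \<omega> q2 i] by (intro mult_mono) auto
      then have "real (j choose i) * (cmod (\<eta> i t) * cmod (D (j - i) f t)) \<le>
          real (j choose i) * ((C0 / 2 ^ i * M q2 i) * (NU q2 m' f * M q2 (j - i)))"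
        by (rule mult_left_mono) simp
      also have "\<dots> = (C0 * NU q2 m' f * (1 / 2) ^ i) * (real (j choose i) * (M q2 i * M q2 (j - i)))"
        by (simp add: power_divide mult_ac)
      also have "\<dots> \<le> (C0 * NU q2 m' f * (1 / 2) ^ i) * (C1 * M q1 j)"
        using C1(2)[of i j] i C0 N0 by (intro mult_left_mono) auto
      finally show "cmod (of_nat (j choose i) * (\<eta> i t * D (j - i) f t)) \<le> (C0 * C1 * NU q2 m' f * M q1 j) * (1 / 2) ^ i"
        by (simp add: norm_mult mult_ac)
    qed
    also have "\<dots> = (C0 * C1 * NU q2 m' f * M q1 j) * (\<Sum>i\<le>j. (1 / 2) ^ i)" by (simp add: sum_distrib_left)
    also have "\<dots> \<le> (C0 * C1 * NU q2 m' f * M q1 j) * 2"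
    proof (rule mult_left_mono)
      have "(\<Sum>i\<le>j. (1 / 2) ^ i) \<le> (\<Sum>i. (1 / 2 :: real) ^ i)"
        by (rule sum_le_suminf) (auto intro: summable_geometric)
      then show "(\<Sum>i\<le>j. (1 / 2 :: real) ^ i) \<le> 2" by (simp add: suminf_geometric)
    qed (use C0 C1 N0 wM_pos[of \<omega> q1 j] in auto)
    finally show ?thesis by (simp add: mult_ac)
  qed
  define I where "I = (\<lambda>f j n. integral {-L..L} (\<lambda>t. g f j t * chr L n t) / (2 * of_real L))"
  have int: "(\<lambda>t. g f j t * chr L n t) integrable_on {-L..L}" if "f \<in> U" for f j n
    by (intro integrable_continuous_interval continuous_intros gc that continuous_on_id)
  \<comment> \<open>Integration by parts; the boundary terms vanish together with all derivatives of
    the cut-off at the endpoints.\<close>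
  have IS: "I f (Suc j) n = (- \<i> * of_real (lat L n)) * I f j n" if f: "f \<in> U" for f j n
  proof -
    have "((\<lambda>t. g f j t * (\<i> * of_real (lat L n) * chr L n t) + g f (Suc j) t * chr L n t) has_integral
        (g f j L * chr L n L - g f j (- L) * chr L n (- L))) {-L..L}"
    proof (rule fundamental_theorem_of_calculus)
      fix t assume t: "t \<in> {-L..L}"
      show "((\<lambda>t. g f j t * chr L n t) has_vector_derivative
          g f j t * (\<i> * of_real (lat L n) * chr L n t) + g f (Suc j) t * chr L n t) (at t within {-L..L})"
        by (intro has_vector_derivative_mult chr_has_vector_derivative has_vector_derivative_at_within[OF gd[OF f t]])
    qed (use L in simp)
    moreover have "g f j L = 0" "g f j (- L) = 0" by (simp_all add: g_def \<eta>0)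
    ultimately have "integral {-L..L} (\<lambda>t. (\<i> * of_real (lat L n)) * (g f j t * chr L n t) + g f (Suc j) t * chr L n t) = 0"
      by (simp add: integral_unique mult_ac)
    moreover have i1: "(\<lambda>t. (\<i> * of_real (lat L n)) * (g f j t * chr L n t)) integrable_on {-L..L}"
      by (intro integrable_continuous_interval continuous_intros gc f)
    ultimately have "(\<i> * of_real (lat L n)) * integral {-L..L} (\<lambda>t. g f j t * chr L n t)
        + integral {-L..L} (\<lambda>t. g f (Suc j) t * chr L n t) = 0"
      using integral_add[OF i1 int[OF f, of "Suc j" n]]
        integral_mult_right[of "{-L..L}" "\<i> * of_real (lat L n)" "\<lambda>t. g f j t * chr L n t"] by simp
    then have e: "integral {-L..L} (\<lambda>t. g f (Suc j) t * chr L n t) =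
        - ((\<i> * of_real (lat L n)) * integral {-L..L} (\<lambda>t. g f j t * chr L n t))"
      by (simp add: eq_neg_iff_add_eq_0 add.commute)
    show ?thesis unfolding I_def e by simp
  qed
  define coef where "coef = (\<lambda>f n. I f 0 n)"
  have Ij: "I f j n = (- \<i> * of_real (lat L n)) ^ j * coef f n" if "f \<in> U" for f j n
    by (induction j) (simp_all add: coef_def IS[OF that])
  have Ile: "cmod (I f j n) \<le> (2 * C0 * C1) * NU q2 m' f * M q1 j" if f: "f \<in> U" for f j n
  proof -
    have "cmod (integral {-L..L} (\<lambda>t. g f j t * chr L n t)) \<le> ((2 * C0 * C1) * NU q2 m' f * M q1 j) * (L - (- L))"
      by (rule integral_bound) (use L gle[OF f] in \<open>auto simp: norm_mult intro!: continuous_intros gc[OF f]\<close>)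
    then show ?thesis unfolding I_def using L by (simp add: norm_divide norm_mult divide_le_eq mult_ac)
  qed
  obtain C2 where C2: "0 < C2" "\<And>y. y \<ge> 0 \<Longrightarrow> (1 + y) ^ 1 * exp (- (q1 - q) * \<omega> y) \<le> C2"
    using weight_beats_power[OF weight, of "q1 - q" 1] qq by auto
  define C3 where "C3 = max C2 (M q1 0 * exp (q * \<omega> 1))"
  define C where "C = (2 * C0 * C1) * C3"
  have coefle: "cmod (coef f n) \<le> C * NU q2 m' f * exp (- q * \<omega> \<bar>lat L n\<bar>)" if f: "f \<in> U" for f n
  proof -
    define y where "y = \<bar>lat L n\<bar>"
    define A where "A = (2 * C0 * C1) * NU q2 m' f"
    have A: "0 \<le> A" using C0 C1 NU_nonneg[OF f qq(4,5), of m'] by (simp add: A_def)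
    have le: "y ^ j * cmod (coef f n) \<le> A * M q1 j" for j
      using Ile[OF f, of j n] unfolding Ij[OF f] by (simp add: norm_mult norm_power y_def A_def)
    have "cmod (coef f n) \<le> A * (C3 * exp (- q * \<omega> y))"
    proof (cases "1 \<le> y")
      case True
      \<comment> \<open>Up to the factor \<open>y\<close>, this index minimises
        \<open>M q1 j / y ^ j\<close>; that factor is absorbed because
        \<open>q < q1\<close>.\<close>
      obtain j where j: "M q1 j \<le> y ^ Suc j * exp (- q1 * \<omega> y)" using wM_optimal[OF weight qq(1) True] by blast
      have "y ^ j * cmod (coef f n) \<le> A * (y ^ Suc j * exp (- q1 * \<omega> y))"
        using le[of j] mult_left_mono[OF j A] by linarith
      also have "\<dots> = y ^ j * (A * (y * exp (- q1 * \<omega> y)))" by simp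
      finally have "cmod (coef f n) \<le> A * (y * exp (- q1 * \<omega> y))" using True by (simp add: mult_le_cancel_left)
      also have "\<dots> \<le> A * (C3 * exp (- q * \<omega> y))"
      proof (rule mult_left_mono[OF _ A])
        have "y * exp (- (q1 - q) * \<omega> y) \<le> (1 + y) ^ 1 * exp (- (q1 - q) * \<omega> y)" by (intro mult_right_mono) auto
        also have "\<dots> \<le> C3" using C2(2)[of y] True by (simp add: C3_def)
        finally have "y * exp (- (q1 - q) * \<omega> y) * exp (- q * \<omega> y) \<le> C3 * exp (- q * \<omega> y)"
          by (rule mult_right_mono) simp
        then show "y * exp (- q1 * \<omega> y) \<le> C3 * exp (- q * \<omega> y)"
          by (simp add: mult.assoc exp_add[symmetric] algebra_simps)
      qed
      finally show ?thesis .
    next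
      case False
      have y0: "0 \<le> y" by (simp add: y_def)
      have "\<omega> y \<le> \<omega> 1" using False y0 by (intro weight_mono[OF weight]) auto
      then have "1 \<le> exp (q * \<omega> 1) * exp (- q * \<omega> y)" using q by (simp add: exp_add[symmetric])
      then have "M q1 0 * 1 \<le> M q1 0 * (exp (q * \<omega> 1) * exp (- q * \<omega> y))"
        using wM_pos[of \<omega> q1 0] by (intro mult_left_mono) auto
      also have "\<dots> \<le> C3 * exp (- q * \<omega> y)" by (simp add: C3_def mult.assoc[symmetric])
      finally have "A * M q1 0 \<le> A * (C3 * exp (- q * \<omega> y))" using A by (intro mult_left_mono) auto
      then show ?thesis using le[of 0] by simp
    qed
    then show ?thesis by (simp add: A_def C_def y_def mult_ac)
  qed
  have C3: "0 \<le> C" using C0 C1 C2 by (simp add: C_def C3_def le_max_iff_disj)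
  have rep: "((\<lambda>n. coef f n * (- \<i> * of_real (lat L n)) ^ j * chr L (- n) x) has_sum D j f x) UNIV"
    if f: "f \<in> U" and x: "\<bar>x\<bar> \<le> c m" for f j x
  proof -
    have xL: "\<bar>x\<bar> < L" "x \<in> {-L..L}" using x L by auto
    have gx: "g f j x = D j f x"
    proof -
      have "g f j x = (\<Sum>i\<in>{0}. of_nat (j choose i) * (\<eta> i x * D (j - i) f x))"
        unfolding g_def
      proof (rule sum.mono_neutral_right)
        show "\<forall>i\<in>{..j} - {0}. of_nat (j choose i) * (\<eta> i x * D (j - i) f x) = 0"
        proof
          fix i assume "i \<in> {..j} - {0}"
          then obtain l where "i = Suc l" by (cases i) auto
          then show "of_nat (j choose i) * (\<eta> i x * D (j - i) f x) = 0" using \<eta>1(2)[OF x] by simp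
        qed
      qed auto
      then show ?thesis using \<eta>1(1)[OF x] by simp
    qed
    have "(\<lambda>N::nat. \<Sum>n\<in>{- int N..int N}. integral {-L..L} (\<lambda>t. g f j t * chr L n t) / (2 * of_real L) * chr L (-n) x) \<longlonglongrightarrow> g f j x"
      by (rule fourier_series_pointwise[OF L(1) gc[OF f] xL(1) gd[OF f xL(2)]])
    then have lim: "(\<lambda>N::nat. \<Sum>n\<in>{- int N..int N}. coef f n * (- \<i> * of_real (lat L n)) ^ j * chr L (- n) x) \<longlonglongrightarrow> D j f x"
      using Ij[OF f, of j] unfolding gx I_def by (simp only: mult.commute)
    \<comment> \<open>Half of the decay pays for the power of the frequency, the other half for
      absolute summability.\<close>
    obtain C4 where C4: "0 < C4" "\<And>y. y \<ge> 0 \<Longrightarrow> (1 + y) ^ j * exp (- (q / 2) * \<omega> y) \<le> C4"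
      using weight_beats_power[OF weight, of "q / 2" j] q by auto
    have "(\<lambda>n. cmod (coef f n * (- \<i> * of_real (lat L n)) ^ j * chr L (- n) x)) summable_on UNIV"
    proof (rule summable_on_comparison_test)
      show "(\<lambda>n. (C * NU q2 m' f * C4) * exp (- (q / 2) * \<omega> \<bar>lat L n\<bar>)) summable_on UNIV"
        by (rule summable_on_cmult_right, rule summable_exp_weight_lat[OF weight L(1)]) (use q in simp)
      fix n
      define y where "y = \<bar>lat L n\<bar>"
      have y0: "0 \<le> y" by (simp add: y_def)
      have N0: "0 \<le> NU q2 m' f" by (rule NU_nonneg[OF f qq(4,5)])
      have "cmod (coef f n * (- \<i> * of_real (lat L n)) ^ j * chr L (- n) x) = cmod (coef f n) * y ^ j"
        by (simp add: norm_mult norm_power y_def)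
      also have "\<dots> \<le> (C * NU q2 m' f * exp (- q * \<omega> y)) * (1 + y) ^ j"
        using coefle[OF f, of n] y0 by (intro mult_mono power_mono) (auto simp: y_def C3 N0)
      also have "\<dots> = (C * NU q2 m' f) * ((1 + y) ^ j * exp (- (q / 2) * \<omega> y)) * exp (- (q / 2) * \<omega> y)"
        by (simp add: mult.assoc mult.left_commute exp_add[symmetric])
      also have "\<dots> \<le> (C * NU q2 m' f) * C4 * exp (- (q / 2) * \<omega> y)"
        by (intro mult_right_mono mult_left_mono C4(2) y0) (use C3 N0 in auto)
      finally show "cmod (coef f n * (- \<i> * of_real (lat L n)) ^ j * chr L (- n) x)
        \<le> (C * NU q2 m' f * C4) * exp (- (q / 2) * \<omega> \<bar>lat L n\<bar>)" by (simp add: y_def)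
    qed simp
    from this lim show ?thesis by (rule has_sum_symmetric_limit)
  qed
  have g0: "g f 0 t = \<eta> 0 t * f t" for f t by (simp add: g_def)
  have add: "coef (f + h) n = coef f n + coef h n" if "f \<in> U" "h \<in> U" for f h n
  proof -
    have "integral {-L..L} (\<lambda>t. g (f + h) 0 t * chr L n t) = integral {-L..L} (\<lambda>t. g f 0 t * chr L n t + g h 0 t * chr L n t)"
      by (simp add: g0 algebra_simps)
    also have "\<dots> = integral {-L..L} (\<lambda>t. g f 0 t * chr L n t) + integral {-L..L} (\<lambda>t. g h 0 t * chr L n t)"
      by (rule integral_add[OF int[OF that(1)] int[OF that(2)]])
    finally show ?thesis unfolding coef_def I_def by (simp add: add_divide_distrib)
  qed
  have scale: "coef (\<lambda>x. b * f x) n = b * coef f n" for b f n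
  proof -
    have "integral {-L..L} (\<lambda>t. g (\<lambda>x. b * f x) 0 t * chr L n t) = integral {-L..L} (\<lambda>t. b * (g f 0 t * chr L n t))"
      by (simp add: g0 mult_ac)
    then show ?thesis unfolding coef_def I_def by simp
  qed
  show ?thesis
    by (rule exI[of _ L], rule exI[of _ coef], rule exI[of _ q2], rule exI[of _ m'], rule exI[of _ C])
       (use L qq C3 coefle rep add scale in blast)
qed

end

section \<open>The Fourier-Laplace transform is an isomorphism\<close>

text \<open>\<open>csinc (l * \<zeta>)\<close> is the mean of
  \<open>exp (-\<i> * \<zeta> * t)\<close> over \<open>t\<close> between \<open>- l\<close> and
  \<open>l\<close>. Instead of an integral, the increments of the exponential along the mesh are
  telescoped and compared with their linear parts; the error is explicit in \<zeta>, as
  approximation in a weighted norm on the whole plane requires.\<close>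

lemma csinc_riemann_sum:
  fixes N :: nat and \<zeta> :: complex
  assumes l: "0 < l" and N: "0 < N"
  defines "d \<equiv> 2 * l / real N"
  shows "cmod (csinc (of_real l * \<zeta>) - (\<Sum>j<N. exp (- \<i> * \<zeta> * of_real (- l + real j * d))) / of_nat N)
           \<le> d * cmod \<zeta> * exp ((l + d) * \<bar>Im \<zeta>\<bar>)"
proof (cases "\<zeta> = 0")
  case True then show ?thesis using N by simp
next
  case False
  have d: "0 < d" "real N * d = 2 * l" using l N by (auto simp: d_def)
  define F where "F = (\<lambda>t::real. exp (- \<i> * \<zeta> * of_real t))"
  define t where "t = (\<lambda>j. - l + real j * d)"
  define u where "u = - \<i> * \<zeta> * of_real d"
  have step: "F (t (Suc j)) - F (t j) = F (t j) * u + F (t j) * (exp u - (\<Sum>k\<le>1. u ^ k / fact k))" for j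
  proof -
    have "F (t (Suc j)) = F (t j) * exp u"
      by (simp add: F_def t_def u_def exp_add[symmetric] algebra_simps)
    then show ?thesis by (simp add: algebra_simps)
  qed
  have tj: "\<bar>t j\<bar> \<le> l" if "j < N" for j
  proof -
    have "real j * d \<le> real N * d" using that d by (intro mult_right_mono) auto
    then show ?thesis using d that by (auto simp: t_def abs_le_iff)
  qed
  have err: "cmod (F (t j) * (exp u - (\<Sum>k\<le>1. u ^ k / fact k))) \<le> exp ((l + d) * \<bar>Im \<zeta>\<bar>) * (cmod \<zeta> * d)\<^sup>2"
    if j: "j < N" for j
  proof -
    have "Im \<zeta> * t j \<le> \<bar>Im \<zeta>\<bar> * \<bar>t j\<bar>" using abs_ge_self[of "Im \<zeta> * t j"] by (simp only: abs_mult)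
    also have "\<dots> \<le> \<bar>Im \<zeta>\<bar> * l" by (intro mult_left_mono tj j) auto
    finally have 1: "cmod (F (t j)) \<le> exp (l * \<bar>Im \<zeta>\<bar>)" by (simp add: F_def norm_exp_eq_Re mult.commute)
    have "cmod (exp u - (\<Sum>k\<le>1. u ^ k / fact k)) \<le> exp \<bar>Re u\<bar> * cmod u ^ Suc 1 / fact 1"
      by (rule Taylor_exp)
    also have "\<bar>Re u\<bar> = d * \<bar>Im \<zeta>\<bar>" using d by (simp add: u_def abs_mult)
    also have "cmod u = cmod \<zeta> * d" using d by (simp add: u_def norm_mult)
    finally have "cmod (exp u - (\<Sum>k\<le>1. u ^ k / fact k)) \<le> exp (d * \<bar>Im \<zeta>\<bar>) * (cmod \<zeta> * d)\<^sup>2" 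
      by (simp add: power2_eq_square)
    then have "cmod (F (t j)) * cmod (exp u - (\<Sum>k\<le>1. u ^ k / fact k)) \<le> exp (l * \<bar>Im \<zeta>\<bar>) * (exp (d * \<bar>Im \<zeta>\<bar>) * (cmod \<zeta> * d)\<^sup>2)"
      by (intro mult_mono 1) auto
    then show ?thesis unfolding norm_mult distrib_right exp_add by (simp only: mult_ac)
  qed
  define S where "S = (\<Sum>j<N. F (t j))"
  define E where "E = (\<Sum>j<N. F (t j) * (exp u - (\<Sum>k\<le>1. u ^ k / fact k)))"
  have "F l - F (- l) = (\<Sum>j<N. F (t (Suc j)) - F (t j))"
    using sum_lessThan_telescope[of "\<lambda>j. F (t j)" N] d by (simp add: t_def)
  also have "\<dots> = S * u + E" unfolding step S_def E_def by (simp add: sum.distrib sum_distrib_right)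
  finally have tel: "F l - F (- l) = S * u + E" .
  have "csinc (of_real l * \<zeta>) = (F l - F (- l)) / (- 2 * \<i> * of_real l * \<zeta>)"
  proof -
    have "sin (of_real l * \<zeta>) = (exp (\<i> * (of_real l * \<zeta>)) - exp (- (\<i> * (of_real l * \<zeta>)))) / (2 * \<i>)"
      by (simp add: sin_exp_eq)
    also have "\<dots> = (F l - F (- l)) / (- 2 * \<i>)" by (simp add: F_def mult_ac divide_simps)
    finally have "sin (of_real l * \<zeta>) = (F l - F (- l)) / (- 2 * \<i>)" .
    moreover have "of_real l * \<zeta> \<noteq> 0" using False l by simp
    ultimately show ?thesis by (simp add: csinc_def mult_ac)
  qed
  also have "\<dots> = S / of_nat N + E / (- 2 * \<i> * of_real l * \<zeta>)"
  proof -
    have "u / (- 2 * \<i> * of_real l * \<zeta>) = of_real (d / (2 * l))" using False l by (simp add: u_def)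
    also have "d / (2 * l) = 1 / real N" using l by (simp add: d_def)
    finally have "S * u / (- 2 * \<i> * of_real l * \<zeta>) = S / of_nat N" by (metis (no_types, lifting) mult_1_right of_real_1 of_real_divide of_real_of_nat_eq times_divide_eq_right)
    then show ?thesis unfolding tel by (simp add: add_divide_distrib)
  qed
  finally have "csinc (of_real l * \<zeta>) - S / of_nat N = E / (- 2 * \<i> * of_real l * \<zeta>)" by simp
  then have "cmod (csinc (of_real l * \<zeta>) - S / of_nat N) = cmod E / (2 * l * cmod \<zeta>)"
    using l by (simp only: norm_divide norm_mult) simp
  also have "\<dots> \<le> (real N * (exp ((l + d) * \<bar>Im \<zeta>\<bar>) * (cmod \<zeta> * d)\<^sup>2)) / (2 * l * cmod \<zeta>)"
  proof (rule divide_right_mono)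
    have "cmod E \<le> (\<Sum>j<N. exp ((l + d) * \<bar>Im \<zeta>\<bar>) * (cmod \<zeta> * d)\<^sup>2)"
      unfolding E_def by (rule sum_norm_le) (use err in auto)
    then show "cmod E \<le> real N * (exp ((l + d) * \<bar>Im \<zeta>\<bar>) * (cmod \<zeta> * d)\<^sup>2)" by simp
  qed (use l in simp)
  also have "\<dots> = (real N * d) * d * cmod \<zeta> * exp ((l + d) * \<bar>Im \<zeta>\<bar>) / (2 * l)"
    using False by (simp add: power2_eq_square)
  also have "\<dots> = d * cmod \<zeta> * exp ((l + d) * \<bar>Im \<zeta>\<bar>)" unfolding d(2) using l by simp
  finally show ?thesis by (simp add: S_def F_def t_def)
qed

context ultra
begin

text \<open>Three errors of size \<open>\<epsilon> / 3\<close>: the function is multiplied by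
  \<open>h\<close>, the sampling series of the product is truncated, and each cardinal sine becomes
  a Riemann sum of exponentials.\<close>

lemma exponentials_dense:
  "\<exists>m\<ge>k. \<forall>\<phi>\<in>Pk k. \<forall>\<epsilon>>0. \<exists>N t b. (\<forall>i<N. \<bar>t i\<bar> \<le> c m) \<and>
     (\<forall>z. cmod (\<phi> z - (\<Sum>i<N::nat. b i * exp (- \<i> * z * of_real (t i :: real))))
        \<le> \<epsilon> * exp (r m * \<omega> (cmod z) + c m * \<bar>Im z\<bar>))"
proof -
  obtain m1 where m1: "r k < r m1" using ex_r[OF r_less] by blast
  obtain m2 where m2: "m2 \<ge> k" "c k < c m2" using ex_c_ge by blast
  define m where "m = max m1 m2"
  have rm: "r k < r m" using m1 incseqD[OF r_mono, of m1 m] by (simp add: m_def)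
  have cm: "c k < c m" using m2(2) incseqD[OF c_mono, of m2 m] by (simp add: m_def)
  have mk: "k \<le> m" using m2(1) by (simp add: m_def)
  \<comment> \<open>Strictly between the two types: below \<open>l\<close> there is room for the
    type of \<open>h\<close>, above it for the mesh of the Riemann sums.\<close>
  define l where "l = (c k + c m) / 2"
  have l: "0 < l" "l < c m" "c k < l" using cm c_pos[of k] c_pos[of m] by (auto simp: l_def)
  define e where "e = r m - r k"
  have e: "0 < e" using rm by (simp add: e_def)
  have "\<exists>N t b. (\<forall>i<N. \<bar>t i\<bar> \<le> c m) \<and>
     (\<forall>z. cmod (\<phi> z - (\<Sum>i<N::nat. b i * exp (- \<i> * z * of_real (t i :: real))))
        \<le> \<epsilon> * exp (r m * \<omega> (cmod z) + c m * \<bar>Im z\<bar>))"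
    if \<phi>: "\<phi> \<in> Pk k" and \<epsilon>: "0 < \<epsilon>" for \<phi> \<epsilon>
  proof -
    define A where "A = PN k \<phi> + 1"
    have A: "0 < A" using PN_nonneg[OF \<phi>] by (simp add: A_def)
    have \<phi>le: "cmod (\<phi> z) \<le> A * exp (r k * \<omega> (cmod z) + c k * \<bar>Im z\<bar>)" for z
      using p_norm_ge[OF \<phi>, of z] by (rule order_trans) (simp add: A_def)
    obtain C1 where C1: "0 < C1" "\<And>y. y \<ge> 0 \<Longrightarrow> (1 + y) ^ 1 * exp (- e * \<omega> y) \<le> C1"
      using weight_beats_power[OF weight e, of 1] by blast
    \<comment> \<open>Outside this radius the surplus \<open>e\<close> of the weight makes the crude
      bound \<open>2 * exp (\<delta> * \<bar>Im z\<bar>)\<close> for \<open>h z - 1\<close>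
      sufficient. The radius is fixed before \<delta>, which depends on it.\<close>
    define R where "R = max 1 (6 * A * C1 / \<epsilon>)"
    have R: "1 \<le> R" "6 * A * C1 / \<epsilon> \<le> R" by (auto simp: R_def)
    have far: "2 * A * exp (- e * \<omega> y) \<le> \<epsilon> / 3" if "R \<le> y" for y
    proof -
      have "exp (- e * \<omega> y) \<le> C1 / (1 + y)" using C1(2)[of y] that R by (simp add: field_simps)
      also have "\<dots> \<le> C1 / R" using that R C1 by (intro divide_left_mono) auto
      also have "\<dots> \<le> \<epsilon> / (6 * A)" using R A \<epsilon> C1 by (simp add: field_simps)
      finally show ?thesis using A by (simp add: field_simps)
    qed
    \<comment> \<open>The first entry keeps the type of the product at most \<open>l\<close>; the
      second makes \<open>h\<close> close to 1 on the disc of radius \<open>R\<close>.\<close>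
    define \<delta> where "\<delta> = min (l - c k) (ln (1 + \<epsilon> / (3 * A)) / R)"
    have \<delta>: "0 < \<delta>" "c k + \<delta> \<le> l" "\<delta> * R \<le> ln (1 + \<epsilon> / (3 * A))"
      using l R A \<epsilon> by (auto simp: \<delta>_def min_def field_simps)
    have near: "A * (exp (\<delta> * R) - 1) \<le> \<epsilon> / 3"
    proof -
      have "exp (\<delta> * R) \<le> 1 + \<epsilon> / (3 * A)" using \<delta>(3) A \<epsilon> by (simp add: ln_ge_iff[symmetric] add_pos_pos)
      then have "A * (exp (\<delta> * R) - 1) \<le> A * (\<epsilon> / (3 * A))" using A by (intro mult_left_mono) auto
      then show ?thesis using A by simp
    qed
    obtain h C2 where h: "h holomorphic_on UNIV" "\<And>z. cmod (h z) \<le> exp (\<delta> * \<bar>Im z\<bar>)"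
      "\<And>z. cmod (h z - 1) \<le> exp (\<delta> * cmod z) - 1"
      "\<And>z. cmod (h z) \<le> C2 * exp (\<delta> * \<bar>Im z\<bar> - 2 * \<omega> (2 * cmod z))"
      using exists_entire_weight_decay[OF weight \<delta>(1)] by blast
    define \<psi> where "\<psi> = (\<lambda>z. \<phi> z * h z)"
    have \<psi>hol: "\<psi> holomorphic_on UNIV" unfolding \<psi>_def by (intro holomorphic_intros P_step_holomorphic[OF \<phi>] h)
    have 1: "cmod (\<phi> z - \<psi> z) \<le> \<epsilon> / 3 * exp (r m * \<omega> (cmod z) + c m * \<bar>Im z\<bar>)" for z
    proof -
      have w0: "0 \<le> \<omega> (cmod z)" by (rule \<omega>_nonneg) simp
      have "cmod (\<phi> z - \<psi> z) = cmod (\<phi> z) * cmod (h z - 1)"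
        unfolding \<psi>_def norm_mult[symmetric] by (simp add: algebra_simps norm_minus_commute)
      also have "\<dots> \<le> (A * exp (r k * \<omega> (cmod z) + c k * \<bar>Im z\<bar>)) * cmod (h z - 1)"
        by (intro mult_right_mono \<phi>le) simp
      also have "\<dots> \<le> \<epsilon> / 3 * exp (r m * \<omega> (cmod z) + c m * \<bar>Im z\<bar>)"
      proof (cases "R \<le> cmod z")
        case True
        have "cmod (h z - 1) \<le> exp (\<delta> * \<bar>Im z\<bar>) + 1"
          using norm_triangle_ineq4[of "h z" 1] h(2)[of z] by simp
        also have "\<dots> \<le> 2 * exp (\<delta> * \<bar>Im z\<bar>)" using \<delta> by simp
        finally have "(A * exp (r k * \<omega> (cmod z) + c k * \<bar>Im z\<bar>)) * cmod (h z - 1) \<le>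
            (A * exp (r k * \<omega> (cmod z) + c k * \<bar>Im z\<bar>)) * (2 * exp (\<delta> * \<bar>Im z\<bar>))"
          using A by (intro mult_left_mono) auto
        also have "\<dots> = (2 * A * exp (- e * \<omega> (cmod z))) * exp (r m * \<omega> (cmod z) + (c k + \<delta>) * \<bar>Im z\<bar>)"
          by (simp add: e_def mult.assoc mult.left_commute exp_add[symmetric] algebra_simps)
        also have "\<dots> \<le> \<epsilon> / 3 * exp (r m * \<omega> (cmod z) + c m * \<bar>Im z\<bar>)"
          using far[OF True] \<delta> l \<epsilon> by (intro mult_mono) (auto intro: mult_right_mono)
        finally show ?thesis .
      next
        case False
        have "cmod (h z - 1) \<le> exp (\<delta> * R) - 1"
        proof -
          have "\<delta> * cmod z \<le> \<delta> * R" using False \<delta> by (intro mult_left_mono) auto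
          then show ?thesis using h(3)[of z] exp_le_cancel_iff[of "\<delta> * cmod z" "\<delta> * R"] by linarith
        qed
        then have "(A * exp (r k * \<omega> (cmod z) + c k * \<bar>Im z\<bar>)) * cmod (h z - 1) \<le>
          (A * exp (r k * \<omega> (cmod z) + c k * \<bar>Im z\<bar>)) * (exp (\<delta> * R) - 1)"
          using A by (intro mult_left_mono) auto
        also have "\<dots> = (A * (exp (\<delta> * R) - 1)) * exp (r k * \<omega> (cmod z) + c k * \<bar>Im z\<bar>)" by simp
        also have "\<dots> \<le> \<epsilon> / 3 * exp (r m * \<omega> (cmod z) + c m * \<bar>Im z\<bar>)"
          using near rm cm \<epsilon> w0 by (intro mult_mono) (auto intro!: add_mono mult_right_mono)
        finally show ?thesis .
      qed
      finally show ?thesis .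
    qed
    obtain C3 where C3: "0 < C3" "\<And>y. y \<ge> 0 \<Longrightarrow> (1 + y) ^ 2 * exp (- 1 * \<omega> y) \<le> C3"
      using weight_beats_power[OF weight, of 1 2] by auto
    have C2: "0 \<le> C2" using order_trans[OF norm_ge_zero h(4)[of 0]] by (simp add: zero_le_mult_iff)
    define B where "B = A * C2 * C3"
    have \<psi>le: "cmod (\<psi> z) \<le> B * exp (l * \<bar>Im z\<bar>) / (1 + cmod z)\<^sup>2" for z
    proof -
      have w0: "0 \<le> \<omega> (cmod z)" by (rule \<omega>_nonneg) simp
      have w2: "\<omega> (cmod z) \<le> \<omega> (2 * cmod z)" by (rule weight_mono[OF weight]) auto
      have rw: "r k * \<omega> (cmod z) \<le> 1 * \<omega> (cmod z)" using r_less[of k] w0 by (intro mult_right_mono) auto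
      have p: "0 < (1 + cmod z)\<^sup>2" by (intro zero_less_power add_pos_nonneg) auto
      have "cmod (\<psi> z) \<le> (A * exp (r k * \<omega> (cmod z) + c k * \<bar>Im z\<bar>)) * (C2 * exp (\<delta> * \<bar>Im z\<bar> - 2 * \<omega> (2 * cmod z)))"
        unfolding \<psi>_def norm_mult using A by (intro mult_mono \<phi>le h(4)) auto
      also have "\<dots> = A * C2 * exp (r k * \<omega> (cmod z) - 2 * \<omega> (2 * cmod z) + (c k + \<delta>) * \<bar>Im z\<bar>)"
        by (simp add: mult.assoc mult.left_commute exp_add[symmetric] algebra_simps)
      also have "\<dots> \<le> A * C2 * exp (- 1 * \<omega> (cmod z) + l * \<bar>Im z\<bar>)"
      proof (rule mult_left_mono)
        have "(c k + \<delta>) * \<bar>Im z\<bar> \<le> l * \<bar>Im z\<bar>" using \<delta>(2) by (intro mult_right_mono) auto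
        then show "exp (r k * \<omega> (cmod z) - 2 * \<omega> (2 * cmod z) + (c k + \<delta>) * \<bar>Im z\<bar>) \<le> exp (- 1 * \<omega> (cmod z) + l * \<bar>Im z\<bar>)"
          using rw w2 unfolding exp_le_cancel_iff by linarith
      qed (use A C2 in simp)
      also have "\<dots> = A * C2 * exp (- 1 * \<omega> (cmod z)) * exp (l * \<bar>Im z\<bar>)" by (simp add: exp_diff exp_minus divide_inverse)
      also have "\<dots> \<le> A * C2 * (C3 / (1 + cmod z)\<^sup>2) * exp (l * \<bar>Im z\<bar>)"
        using C3(2)[of "cmod z"] p A C2 by (intro mult_right_mono mult_left_mono) (auto simp: field_simps)
      finally show ?thesis by (simp add: B_def)
    qed
    define p where "p = (\<lambda>n. \<psi> (of_real (lat l n)))"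
    have sp: "(\<lambda>n. cmod (p n)) summable_on UNIV"
      by (rule abs_summable_on_lat[OF l(1), of _ B]) (use \<psi>le[of "of_real (lat l _)"] in \<open>simp add: p_def\<close>)
    \<comment> \<open>The samples are absolutely summable and each cardinal sine is at most
      \<open>exp (l * \<bar>Im z\<bar>)\<close>, so one truncation serves all
      \<open>z\<close>.\<close>
    obtain F where F: "finite F" "dist (\<Sum>n\<in>F. cmod (p n)) (\<Sum>\<^sub>\<infinity>n. cmod (p n)) \<le> \<epsilon> / 3"
      using has_sum_finite_approximation[OF has_sum_infsum[OF sp], of "\<epsilon> / 3"] \<epsilon> by auto
    have 2: "cmod (\<psi> z - (\<Sum>n\<in>F. p n * csinc (of_real l * (z - of_real (lat l n))))) \<le> \<epsilon> / 3 * exp (l * \<bar>Im z\<bar>)" for z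
    proof -
      let ?f = "\<lambda>n. p n * csinc (of_real l * (z - of_real (lat l n)))"
      have "(?f has_sum \<psi> z) UNIV" unfolding p_def by (rule sampling[OF \<psi>hol l(1) \<psi>le])
      then have d1: "(?f has_sum (\<psi> z - sum ?f F)) (UNIV - F)"
        by (rule has_sum_Diff) (use F in \<open>auto intro: has_sum_finite\<close>)
      have d2: "((\<lambda>n. cmod (p n)) has_sum ((\<Sum>\<^sub>\<infinity>n. cmod (p n)) - (\<Sum>n\<in>F. cmod (p n)))) (UNIV - F)"
        by (rule has_sum_Diff[OF has_sum_infsum[OF sp]]) (use F in \<open>auto intro: has_sum_finite\<close>)
      have "cmod (\<psi> z - sum ?f F) \<le> ((\<Sum>\<^sub>\<infinity>n. cmod (p n)) - (\<Sum>n\<in>F. cmod (p n))) * exp (l * \<bar>Im z\<bar>)"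
      proof (rule norm_infsum_le[OF d1 has_sum_cmult_left[OF d2]])
        fix n
        have "cmod (csinc (of_real l * (z - of_real (lat l n)))) \<le> exp (l * \<bar>Im z\<bar>)"
          using norm_csinc_le[of "of_real l * (z - of_real (lat l n))"] l by (simp add: abs_mult)
        then show "cmod (?f n) \<le> cmod (p n) * exp (l * \<bar>Im z\<bar>)" by (simp add: norm_mult mult_left_mono)
      qed
      also have "\<dots> \<le> \<epsilon> / 3 * exp (l * \<bar>Im z\<bar>)"
      proof (rule mult_right_mono)
        show "(\<Sum>\<^sub>\<infinity>n. cmod (p n)) - (\<Sum>n\<in>F. cmod (p n)) \<le> \<epsilon> / 3"
          using F(2) unfolding dist_real_def by linarith
      qed simp
      finally show ?thesis .
    qed
    obtain C5 where C5: "0 < C5" "\<And>y. y \<ge> 0 \<Longrightarrow> (1 + y) ^ 1 * exp (- r m * \<omega> y) \<le> C5"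
      using weight_beats_power[OF weight r_pos, of 1 m] by blast
    \<comment> \<open>Collects the Riemann errors of all retained nodes, where \<open>C5\<close> is
      the price of absorbing \<open>1 + cmod z\<close> into the weight; the summand 1 makes
      \<open>G\<close> positive.\<close>
    define G where "G = (\<Sum>n\<in>F. cmod (p n) * (C5 * (1 + \<bar>lat l n\<bar>))) + 1"
    have G: "0 < G" using C5 by (auto simp: G_def intro!: add_nonneg_pos sum_nonneg)
    define \<mu> where "\<mu> = min (c m - l) (\<epsilon> / (3 * G))"
    have \<mu>: "0 < \<mu>" using l \<epsilon> G by (simp add: \<mu>_def)
    obtain N :: nat where N': "2 * l / \<mu> < real N" using reals_Archimedean2 by blast
    moreover have "0 < 2 * l / \<mu>" using l \<mu> by simp
    ultimately have "0 < real N" by linarith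
    then have N: "0 < N" "2 * l / real N < \<mu>" using N' \<mu> by (auto simp: field_simps)
    define d where "d = 2 * l / real N"
    have d: "0 \<le> d" "d \<le> c m - l" "d * G \<le> \<epsilon> / 3" using N l G by (auto simp: d_def \<mu>_def field_simps)
    define t where "t = (\<lambda>j. - l + real j * d)"
    \<comment> \<open>Interchanging the sums over the nodes and over the mesh leaves these
      coefficients at the exponentials.\<close>
    define b where "b = (\<lambda>j. (\<Sum>n\<in>F. p n * exp (\<i> * of_real (lat l n) * of_real (t j))) / of_nat N)"
    have tj: "\<bar>t j\<bar> \<le> c m" if "j < N" for j
    proof -
      have "real j * d \<le> real N * d" using that d by (intro mult_right_mono) auto
      moreover have "real N * d = 2 * l" using N(1) by (simp add: d_def)
      moreover have "0 \<le> real j * d" using d by simp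
      ultimately have "\<bar>t j\<bar> \<le> l" unfolding t_def abs_le_iff by linarith
      then show ?thesis using l by simp
    qed
    have 3: "cmod ((\<Sum>n\<in>F. p n * csinc (of_real l * (z - of_real (lat l n)))) - (\<Sum>j<N. b j * exp (- \<i> * z * of_real (t j))))
        \<le> \<epsilon> / 3 * exp (r m * \<omega> (cmod z) + c m * \<bar>Im z\<bar>)" for z
    proof -
      define X where "X = (\<lambda>n. (\<Sum>j<N. exp (- \<i> * (z - of_real (lat l n)) * of_real (t j))) / of_nat N)"
      have "(\<Sum>j<N. b j * exp (- \<i> * z * of_real (t j))) =
         (\<Sum>j<N. \<Sum>n\<in>F. p n * (exp (- \<i> * (z - of_real (lat l n)) * of_real (t j)) / of_nat N))"
        unfolding b_def sum_divide_distrib sum_distrib_right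
        by (intro sum.cong refl) (simp add: algebra_simps exp_add exp_diff exp_minus divide_inverse)
      also have "\<dots> = (\<Sum>n\<in>F. p n * X n)"
        by (subst sum.swap) (simp add: X_def sum_distrib_left sum_divide_distrib)
      finally have eq: "(\<Sum>n\<in>F. p n * csinc (of_real l * (z - of_real (lat l n)))) - (\<Sum>j<N. b j * exp (- \<i> * z * of_real (t j)))
         = (\<Sum>n\<in>F. p n * (csinc (of_real l * (z - of_real (lat l n))) - X n))"
        by (simp add: sum_subtractf right_diff_distrib)
      have z1: "1 + cmod z \<le> C5 * exp (r m * \<omega> (cmod z))"
        using C5(2)[of "cmod z"] by (simp add: exp_minus field_simps)
      have "cmod (\<Sum>n\<in>F. p n * (csinc (of_real l * (z - of_real (lat l n))) - X n)) \<le>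
          (\<Sum>n\<in>F. (cmod (p n) * (C5 * (1 + \<bar>lat l n\<bar>))) * (d * exp (r m * \<omega> (cmod z) + c m * \<bar>Im z\<bar>)))"
      proof (rule sum_norm_le)
        fix n assume "n \<in> F"
        let ?\<zeta> = "z - of_real (lat l n)"
        have "cmod (csinc (of_real l * ?\<zeta>) - X n) \<le> d * cmod ?\<zeta> * exp ((l + d) * \<bar>Im ?\<zeta>\<bar>)"
          using csinc_riemann_sum[OF l(1) N(1), of ?\<zeta>] by (simp only: X_def d_def t_def)
        also have "\<dots> \<le> d * ((C5 * exp (r m * \<omega> (cmod z))) * (1 + \<bar>lat l n\<bar>)) * exp (c m * \<bar>Im z\<bar>)"
        proof (intro mult_mono)
          have "cmod ?\<zeta> \<le> cmod z + \<bar>lat l n\<bar>" using norm_triangle_ineq4[of z "of_real (lat l n)"] by simp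
          also have "\<dots> \<le> (1 + cmod z) * (1 + \<bar>lat l n\<bar>)" by (simp add: algebra_simps)
          also have "\<dots> \<le> (C5 * exp (r m * \<omega> (cmod z))) * (1 + \<bar>lat l n\<bar>)" by (intro mult_right_mono z1) simp
          finally show "cmod ?\<zeta> \<le> (C5 * exp (r m * \<omega> (cmod z))) * (1 + \<bar>lat l n\<bar>)" .
          show "exp ((l + d) * \<bar>Im ?\<zeta>\<bar>) \<le> exp (c m * \<bar>Im z\<bar>)" using d(2) by (simp add: mult_right_mono)
        qed (use d C5 in auto)
        also have "\<dots> = (C5 * (1 + \<bar>lat l n\<bar>)) * (d * exp (r m * \<omega> (cmod z) + c m * \<bar>Im z\<bar>))"
          by (simp add: exp_add mult_ac)
        finally have "cmod (p n) * cmod (csinc (of_real l * ?\<zeta>) - X n) \<le> cmod (p n) * ((C5 * (1 + \<bar>lat l n\<bar>)) * (d * exp (r m * \<omega> (cmod z) + c m * \<bar>Im z\<bar>)))"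
          by (rule mult_left_mono) simp
        then show "cmod (p n * (csinc (of_real l * ?\<zeta>) - X n)) \<le> (cmod (p n) * (C5 * (1 + \<bar>lat l n\<bar>))) * (d * exp (r m * \<omega> (cmod z) + c m * \<bar>Im z\<bar>))"
          by (simp only: norm_mult mult.assoc)
      qed
      also have "\<dots> = (\<Sum>n\<in>F. cmod (p n) * (C5 * (1 + \<bar>lat l n\<bar>))) * (d * exp (r m * \<omega> (cmod z) + c m * \<bar>Im z\<bar>))"
        by (simp only: sum_distrib_right)
      also have "\<dots> \<le> G * (d * exp (r m * \<omega> (cmod z) + c m * \<bar>Im z\<bar>))"
        using d by (intro mult_right_mono) (auto simp: G_def)
      also have "\<dots> = (d * G) * exp (r m * \<omega> (cmod z) + c m * \<bar>Im z\<bar>)" by simp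
      also have "\<dots> \<le> \<epsilon> / 3 * exp (r m * \<omega> (cmod z) + c m * \<bar>Im z\<bar>)" by (intro mult_right_mono d) simp
      finally show ?thesis unfolding eq .
    qed
    have "cmod (\<phi> z - (\<Sum>j<N. b j * exp (- \<i> * z * of_real (t j)))) \<le> \<epsilon> * exp (r m * \<omega> (cmod z) + c m * \<bar>Im z\<bar>)" for z
    proof -
      define W where "W = exp (r m * \<omega> (cmod z) + c m * \<bar>Im z\<bar>)"
      define s where "s = (\<Sum>n\<in>F. p n * csinc (of_real l * (z - of_real (lat l n))))"
      define v where "v = (\<Sum>j<N. b j * exp (- \<i> * z * of_real (t j)))"
      have "exp (l * \<bar>Im z\<bar>) \<le> W"
        using l \<omega>_nonneg[of "cmod z"] r_pos[of m] by (simp add: W_def add_increasing mult_right_mono)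
      then have "cmod (\<psi> z - s) \<le> \<epsilon> / 3 * W"
        using 2[of z] \<epsilon> mult_left_mono[of "exp (l * \<bar>Im z\<bar>)" W "\<epsilon> / 3"] unfolding s_def by linarith
      moreover have "cmod (\<phi> z - \<psi> z) \<le> \<epsilon> / 3 * W" using 1[of z] by (simp add: W_def)
      moreover have "cmod (s - v) \<le> \<epsilon> / 3 * W" using 3[of z] by (simp only: W_def s_def v_def)
      moreover have "cmod (\<phi> z - v) \<le> cmod (\<phi> z - \<psi> z) + cmod (\<psi> z - s) + cmod (s - v)"
        using norm_triangle_ineq[of "\<phi> z - \<psi> z" "\<psi> z - s"] norm_triangle_ineq[of "\<phi> z - s" "s - v"] by simp
      ultimately have "cmod (\<phi> z - v) \<le> \<epsilon> / 3 * W + \<epsilon> / 3 * W + \<epsilon> / 3 * W" by linarith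
      then show ?thesis by (simp add: W_def v_def)
    qed
    then show ?thesis using tj by blast
  qed
  then show ?thesis using mk by blast
qed

lemma chr_exp: "chr L (- n) x = exp (- \<i> * of_real (lat L n) * of_real x)"
  by (simp add: chr_def lat_def mult_ac)

text \<open>Decay with exponent \<open>q\<close>, against derivatives measured with
  \<open>q0 < q\<close>, leaves the summable factor
  \<open>exp (- (q - q0) * \<omega> \<bar>lat L n\<bar>)\<close> uniformly in the order of
  differentiation. So the expansion converges in the seminorm that bounds \<open>S\<close>, and
  \<open>S\<close> may be applied term by term.\<close>

lemma expansion_functional:
  assumes S: "S \<in> U'" "\<And>f. f \<in> U \<Longrightarrow> cmod (S f) \<le> K * NU q0 k f" and K: "0 \<le> K"
    and q: "0 < q0" "q0 < q" "q < 1" and L: "0 < L" and km: "k \<le> m" and f: "f \<in> U"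
    and cle: "\<And>n. cmod (coef n) \<le> C * exp (- q * \<omega> \<bar>lat L n\<bar>)"
    and rep: "\<And>j x. \<bar>x\<bar> \<le> c m \<Longrightarrow> ((\<lambda>n. coef n * (- \<i> * of_real (lat L n)) ^ j * chr L (- n) x) has_sum D j f x) UNIV"
  shows "((\<lambda>n. coef n * FL S (of_real (lat L n))) has_sum S f) UNIV"
proof -
  note lin = U_dual_linear[OF S(1)]
  define s where "s = (\<lambda>n. exp (- (q - q0) * \<omega> \<bar>lat L n\<bar>))"
  have ss: "s summable_on UNIV" unfolding s_def by (rule summable_exp_weight_lat[OF weight L]) (use q in simp)
  define E where "E = exp (q0 * \<omega> 1)"
  have C0: "0 \<le> C" using order_trans[OF norm_ge_zero cle[of 0]] by (simp add: zero_le_mult_iff)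
  have trm: "cmod (coef n * (- \<i> * of_real (lat L n)) ^ j * chr L (- n) x) \<le> (C * E * M q0 j) * s n" for n j x
  proof -
    define y where "y = \<bar>lat L n\<bar>"
    have "y ^ j * exp (- q0 * \<omega> y) \<le> E * M q0 j" unfolding E_def by (rule wM_ge_all[OF weight q(1)]) (simp add: y_def)
    then have "y ^ j * exp (- q0 * \<omega> y) * s n \<le> E * M q0 j * s n" by (rule mult_right_mono) (simp add: s_def)
    moreover have "exp (- q0 * \<omega> y) * s n = exp (- q * \<omega> y)"
      by (simp add: s_def y_def exp_add[symmetric] algebra_simps)
    then have "exp (- q * \<omega> y) * y ^ j = y ^ j * exp (- q0 * \<omega> y) * s n"
      unfolding mult.assoc by (simp only: mult.commute)
    ultimately have 1: "exp (- q * \<omega> y) * y ^ j \<le> E * M q0 j * s n" by (simp only:)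
    have "cmod (coef n * (- \<i> * of_real (lat L n)) ^ j * chr L (- n) x) = cmod (coef n) * y ^ j"
      by (simp add: norm_mult norm_power y_def)
    also have "\<dots> \<le> (C * exp (- q * \<omega> y)) * y ^ j"
      using cle[of n] by (intro mult_right_mono) (auto simp: y_def)
    also have "\<dots> = C * (exp (- q * \<omega> y) * y ^ j)" by simp
    also have "\<dots> \<le> C * (E * M q0 j * s n)" by (rule mult_left_mono[OF 1 C0])
    finally show ?thesis by (simp add: mult.assoc)
  qed
  let ?e = "\<lambda>n. exp_monomial a 0 (of_real (lat L n))"
  have tail: "cmod (S f - (\<Sum>n\<in>F. coef n * FL S (of_real (lat L n)))) \<le> K * (C * E * ((\<Sum>\<^sub>\<infinity>n. s n) - (\<Sum>n\<in>F. s n)))"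
    if F: "finite F" for F
  proof -
    let ?p = "\<lambda>x. \<Sum>n\<in>F. coef n * ?e n x"
    have p: "?p \<in> U" "S ?p = (\<Sum>n\<in>F. coef n * S (?e n))"
      using clinear_functional_on_sum[OF lin U_subspace, of F ?e coef] exp_monomial_U by auto
    have Dp: "D j ?p = (\<lambda>x. \<Sum>n\<in>F. coef n * D j (?e n) x)" for j
      using F
    proof (induction F)
      case empty
      have "D j (\<lambda>_. 0) = (\<lambda>_. 0)" using Dop_family(1)[of a "\<lambda>_ _. 0"] by simp
      then show ?case by simp
    next
      case (insert n F)
      have "(\<lambda>x. \<Sum>n\<in>F. coef n * ?e n x) \<in> U"
        using clinear_functional_on_sum(2)[OF lin U_subspace, of F ?e coef] exp_monomial_U by auto
      note 1 = U_smooth[OF this] and 2 = Dop_smooth_scale[OF U_smooth[OF exp_monomial_U[of 0 "of_real (lat L n)"]], where k="coef n"]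
      have split: "(\<lambda>x. \<Sum>n\<in>insert n F. coef n * ?e n x) = (\<lambda>x. coef n * ?e n x) + (\<lambda>x. \<Sum>n\<in>F. coef n * ?e n x)"
        using insert by (auto simp: fun_eq_iff)
      show ?case unfolding split Dop_smooth_add(1)[OF 2(2) 1, of j] 2(1)[of j] insert.IH
        using insert.hyps by (auto simp: fun_eq_iff)
    qed
    have dU: "f - ?p \<in> U" by (rule cfun.subspace_diff[OF U_subspace f p(1)])
    have "NU q0 k (f - ?p) \<le> C * E * ((\<Sum>\<^sub>\<infinity>n. s n) - (\<Sum>n\<in>F. s n))"
    proof (rule u_norm_le)
      fix j x assume x: "\<bar>x\<bar> \<le> c k"
      have xm: "\<bar>x\<bar> \<le> c m" using x incseqD[OF c_mono km] by simp
      have xa: "ereal \<bar>x\<bar> < a" by (rule c_le[OF x])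
      let ?g = "\<lambda>n. coef n * (- \<i> * of_real (lat L n)) ^ j * chr L (- n) x"
      have "D j (f - ?p) x = D j f x - sum ?g F"
      proof -
        have "D j (f - ?p) x = D j f x - (\<Sum>n\<in>F. coef n * D j (?e n) x)"
          unfolding Dop_smooth_diff[OF U_smooth[OF f] U_smooth[OF p(1)]] Dp by (simp only: minus_apply)
        then show ?thesis unfolding D_exp[OF xa] chr_exp by (simp only: mult.assoc)
      qed
      moreover have d1: "(?g has_sum (D j f x - sum ?g F)) (UNIV - F)"
        by (rule has_sum_Diff[OF rep[OF xm]]) (use F in \<open>auto intro: has_sum_finite\<close>)
      have d2: "(s has_sum ((\<Sum>\<^sub>\<infinity>n. s n) - (\<Sum>n\<in>F. s n))) (UNIV - F)"
        by (rule has_sum_Diff[OF has_sum_infsum[OF ss]]) (use F in \<open>auto intro: has_sum_finite\<close>)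
      have "cmod (D j f x - sum ?g F) \<le> (C * E * M q0 j) * ((\<Sum>\<^sub>\<infinity>n. s n) - (\<Sum>n\<in>F. s n))"
        by (rule norm_infsum_le[OF d1 has_sum_cmult_right[OF d2]]) (rule trm)
      ultimately show "cmod (D j (f - ?p) x) \<le> C * E * ((\<Sum>\<^sub>\<infinity>n. s n) - (\<Sum>n\<in>F. s n)) * M q0 j"
        by (simp add: mult_ac)
    qed
    from order_trans[OF S(2)[OF dU] mult_left_mono[OF this K]]
    have "cmod (S (f - ?p)) \<le> K * (C * E * ((\<Sum>\<^sub>\<infinity>n. s n) - (\<Sum>n\<in>F. s n)))" .
    then show ?thesis using clinear_functional_on_diff[OF lin U_subspace f p(1)] p(2) by (simp add: fourier_laplace_def)
  qed
  have lim: "((\<lambda>F. K * (C * E * ((\<Sum>\<^sub>\<infinity>n. s n) - (\<Sum>n\<in>F. s n)))) \<longlongrightarrow> K * (C * E * ((\<Sum>\<^sub>\<infinity>n. s n) - (\<Sum>\<^sub>\<infinity>n. s n)))) (finite_subsets_at_top UNIV)"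
    using has_sum_infsum[OF ss] unfolding has_sum_def by (intro tendsto_intros)
  have "((\<lambda>F. S f - (\<Sum>n\<in>F. coef n * FL S (of_real (lat L n)))) \<longlongrightarrow> 0) (finite_subsets_at_top UNIV)"
  proof (rule Lim_null_comparison)
    show "\<forall>\<^sub>F F in finite_subsets_at_top UNIV. cmod (S f - (\<Sum>n\<in>F. coef n * FL S (of_real (lat L n))))
        \<le> K * (C * E * ((\<Sum>\<^sub>\<infinity>n. s n) - (\<Sum>n\<in>F. s n)))"
      using tail by (auto simp: eventually_finite_subsets_at_top)
  qed (use lim in simp)
  then have "((\<lambda>F. S f - (S f - (\<Sum>n\<in>F. coef n * FL S (of_real (lat L n))))) \<longlongrightarrow> S f - 0) (finite_subsets_at_top UNIV)"
    by (intro tendsto_intros)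
  then show ?thesis unfolding has_sum_def by simp
qed

lemma FL_injective:
  assumes S: "S \<in> U'" "S' \<in> U'" and eq: "FL S = FL S'"
  shows "S = S'"
proof -
  obtain q1 k1 K1 where 1: "0 < q1" "q1 < 1" "0 \<le> K1" "\<And>f. f \<in> U \<Longrightarrow> cmod (S f) \<le> K1 * NU q1 k1 f"
    using U_dual_bound[OF S(1)] by blast
  obtain q2 k2 K2 where 2: "0 < q2" "q2 < 1" "0 \<le> K2" "\<And>f. f \<in> U \<Longrightarrow> cmod (S' f) \<le> K2 * NU q2 k2 f"
    using U_dual_bound[OF S(2)] by blast
  \<comment> \<open>With \<open>q\<close> and \<open>m\<close> above the data of both functionals,
    one expansion evaluates them both.\<close>
  define q where "q = (max q1 q2 + 1) / 2"
  define m where "m = max k1 k2"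
  have q: "0 < q" "q < 1" "q1 < q" "q2 < q" using 1 2 by (auto simp: q_def max_def field_simps)
  obtain L coef q' m' C where E0: "0 < L" "0 < q'" "q' < 1" "0 \<le> C"
    "\<forall>f\<in>U. \<forall>g\<in>U. \<forall>n. coef (f + g) n = coef f n + coef g n"
    "\<forall>b. \<forall>f\<in>U. \<forall>n. coef (\<lambda>x. b * f x) n = b * coef f n"
    "\<forall>f\<in>U. \<forall>n. cmod (coef f n) \<le> C * NU q' m' f * exp (- q * \<omega> \<bar>lat L n\<bar>)"
    "\<forall>f\<in>U. \<forall>j x. \<bar>x\<bar> \<le> c m \<longrightarrow>
      ((\<lambda>n. coef f n * (- \<i> * of_real (lat L n)) ^ j * chr L (- n) x) has_sum D j f x) UNIV"
    using expansion[OF q(1,2), of m] by (elim exE conjE)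
  note E = E0(1) E0(7)[rule_format] E0(8)[rule_format]
  have "S f = S' f" if f: "f \<in> U" for f
  proof -
    have "((\<lambda>n. coef f n * FL S (of_real (lat L n))) has_sum S f) UNIV"
      by (rule expansion_functional[OF S(1) 1(4,3,1) q(3,2) E(1) _ f E(2)[OF f] E(3)[OF f]]) (simp_all add: m_def)
    moreover have "((\<lambda>n. coef f n * FL S' (of_real (lat L n))) has_sum S' f) UNIV"
      by (rule expansion_functional[OF S(2) 2(4,3,1) q(4,2) E(1) _ f E(2)[OF f] E(3)[OF f]]) (simp_all add: m_def)
    ultimately show ?thesis unfolding eq by (rule has_sum_unique)
  qed
  moreover have "S \<in> extensional U" "S' \<in> extensional U" using S by (auto simp: U_dual_def)
  ultimately show ?thesis by (metis extensionalityI)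
qed

text \<open>Pairing the coefficients with an exponential sum gives a combination of point values;
  the points must lie within \<open>c m\<close>, where the expansion is valid.\<close>

lemma exp_sum_has_sum:
  assumes rep: "\<And>x. \<bar>x\<bar> \<le> c m \<Longrightarrow> ((\<lambda>n. coef n * chr L (- n) x) has_sum F x) UNIV"
    and t: "\<forall>i<N. \<bar>t i\<bar> \<le> c m"
  shows "((\<lambda>n. coef n * (\<Sum>i<N::nat. b i * exp (- \<i> * of_real (lat L n) * of_real (t i)))) has_sum
     (\<Sum>i<N. b i * F (t i))) UNIV"
proof -
  have "((\<lambda>n. \<Sum>i<N. b i * (coef n * chr L (- n) (t i))) has_sum (\<Sum>i<N. b i * F (t i))) UNIV"
    using t
  proof (induction N)
    case (Suc N)
    have "((\<lambda>n. (\<Sum>i<N. b i * (coef n * chr L (- n) (t i))) + b N * (coef n * chr L (- n) (t N))) has_sum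
       ((\<Sum>i<N. b i * F (t i)) + b N * F (t N))) UNIV"
      by (intro has_sum_add has_sum_cmult_right rep Suc.IH) (use Suc.prems in auto)
    then show ?case by simp
  qed simp
  then show ?thesis by (simp add: sum_distrib_left chr_exp mult_ac)
qed

text \<open>Continuity of the pairing in its second argument. Applied to the difference between an
  element of \<open>P\<close> and an exponential sum, it carries identities from the latter to the
  former.\<close>

lemma coef_sum_bound:
  assumes L: "0 < L" and q: "q0 < q" and B: "0 \<le> B"
    and cle: "\<And>n. cmod (coef n) \<le> B * exp (- q * \<omega> \<bar>lat L n\<bar>)"
    and \<phi>: "\<And>n. cmod (\<phi> (of_real (lat L n))) \<le> A * exp (q0 * \<omega> \<bar>lat L n\<bar>)"
  shows "(\<lambda>n. coef n * \<phi> (of_real (lat L n))) summable_on UNIV"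
    and "((\<lambda>n. coef n * \<phi> (of_real (lat L n))) has_sum v) UNIV \<Longrightarrow>
      cmod v \<le> B * A * (\<Sum>\<^sub>\<infinity>n. exp (- (q - q0) * \<omega> \<bar>lat L n\<bar>))"
proof -
  define s where "s = (\<lambda>n. exp (- (q - q0) * \<omega> \<bar>lat L n\<bar>))"
  have ss: "s summable_on UNIV" unfolding s_def by (rule summable_exp_weight_lat[OF weight L]) (use q in simp)
  have le: "cmod (coef n * \<phi> (of_real (lat L n))) \<le> B * A * s n" for n
  proof -
    have "cmod (coef n * \<phi> (of_real (lat L n))) \<le> (B * exp (- q * \<omega> \<bar>lat L n\<bar>)) * (A * exp (q0 * \<omega> \<bar>lat L n\<bar>))"
      unfolding norm_mult using B by (intro mult_mono cle \<phi>) auto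
    also have "\<dots> = B * A * s n"
      by (simp add: s_def mult.assoc mult.left_commute exp_add[symmetric] algebra_simps)
    finally show ?thesis .
  qed
  show "(\<lambda>n. coef n * \<phi> (of_real (lat L n))) summable_on UNIV"
    by (rule abs_summable_summable, rule summable_on_comparison_test[OF summable_on_cmult_right[OF ss, of "B * A"]])
       (use le in auto)
  show "cmod v \<le> B * A * (\<Sum>\<^sub>\<infinity>n. exp (- (q - q0) * \<omega> \<bar>lat L n\<bar>))"
    if "((\<lambda>n. coef n * \<phi> (of_real (lat L n))) has_sum v) UNIV"
    using norm_infsum_le[OF that has_sum_cmult_right[OF has_sum_infsum[OF ss], of "B * A"]] le by (simp add: s_def)
qed

lemma eq_if_le_mult_eps:
  fixes x y :: complex
  assumes "\<And>\<epsilon>. 0 < \<epsilon> \<Longrightarrow> cmod (x - y) \<le> \<epsilon> * K"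
  shows "x = y"
proof -
  have "cmod (x - y) \<le> \<epsilon>" if "0 < \<epsilon>" for \<epsilon>
  proof -
    have "cmod (x - y) \<le> \<epsilon> / (\<bar>K\<bar> + 1) * K" by (rule assms) (use that in simp)
    also have "\<dots> \<le> \<epsilon> / (\<bar>K\<bar> + 1) * (\<bar>K\<bar> + 1)" using that by (intro mult_left_mono) auto
    also have "\<dots> = \<epsilon>" by simp
    finally show ?thesis .
  qed
  then have "cmod (x - y) \<le> 0" by (rule field_le_epsilon) simp
  then show ?thesis by simp
qed

text \<open>The constants depend on the step only and the bound is linear in
  \<open>PN k \<phi>\<close>: beyond surjectivity this yields the continuity of the inverse
  transform on each step.\<close>

lemma FL_surjective:
  "\<exists>q' m' K. 0 < q' \<and> q' < 1 \<and> 0 \<le> K \<and> (\<forall>\<phi>\<in>Pk k. \<exists>S\<in>U'. FL S = \<phi> \<and>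
     (\<forall>f\<in>U. cmod (S f) \<le> K * PN k \<phi> * NU q' m' f))"
proof -
  obtain m where m: "m \<ge> k" and dense: "\<And>\<phi> \<epsilon>. \<phi> \<in> Pk k \<Longrightarrow> 0 < \<epsilon> \<Longrightarrow> \<exists>N t b. (\<forall>i<N. \<bar>t i\<bar> \<le> c m) \<and>
     (\<forall>z. cmod (\<phi> z - (\<Sum>i<N::nat. b i * exp (- \<i> * z * of_real (t i :: real))))
        \<le> \<epsilon> * exp (r m * \<omega> (cmod z) + c m * \<bar>Im z\<bar>))"
    using exponentials_dense[of k] by blast
  define q where "q = (r m + 1) / 2"
  have q: "0 < q" "q < 1" "r m < q" using r_pos[of m] r_less[of m] by (auto simp: q_def)
  obtain L coef q' m' C where E0: "0 < L" "0 < q'" "q' < 1" "0 \<le> C"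
    "\<forall>f\<in>U. \<forall>g\<in>U. \<forall>n. coef (f + g) n = coef f n + coef g n"
    "\<forall>b. \<forall>f\<in>U. \<forall>n. coef (\<lambda>x. b * f x) n = b * coef f n"
    "\<forall>f\<in>U. \<forall>n. cmod (coef f n) \<le> C * NU q' m' f * exp (- q * \<omega> \<bar>lat L n\<bar>)"
    "\<forall>f\<in>U. \<forall>j x. \<bar>x\<bar> \<le> c m \<longrightarrow>
      ((\<lambda>n. coef f n * (- \<i> * of_real (lat L n)) ^ j * chr L (- n) x) has_sum D j f x) UNIV"
    using expansion[OF q(1,2), of m] by (elim exE conjE)
  note L = E0(1) and q' = E0(2,3) and C = E0(4) and add = E0(5)[rule_format] and scale = E0(6)[rule_format]
    and cle = E0(7)[rule_format] and rep = E0(8)[rule_format]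
  define s where "s = (\<Sum>\<^sub>\<infinity>n. exp (- (q - r m) * \<omega> \<bar>lat L n\<bar>))"
  have s0: "0 \<le> s" unfolding s_def by (rule infsum_nonneg) simp
  have B0: "0 \<le> C * NU q' m' f" if "f \<in> U" for f using C NU_nonneg[OF that q'] by simp
  have "\<exists>S\<in>U'. FL S = \<phi> \<and> (\<forall>f\<in>U. cmod (S f) \<le> (C * s) * PN k \<phi> * NU q' m' f)" if \<phi>: "\<phi> \<in> Pk k" for \<phi>
  proof -
    define S where "S = (\<lambda>f. \<Sum>\<^sub>\<infinity>n. coef f n * \<phi> (of_real (lat L n)))"
    have \<phi>n: "cmod (\<phi> (of_real (lat L n))) \<le> PN k \<phi> * exp (r m * \<omega> \<bar>lat L n\<bar>)" for n
    proof -
      have "cmod (\<phi> (of_real (lat L n))) \<le> PN m \<phi> * exp (r m * \<omega> \<bar>lat L n\<bar>)"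
        using p_norm_ge[OF P_step_mono(1)[OF m \<phi>], of "of_real (lat L n)"] by simp
      also have "\<dots> \<le> PN k \<phi> * exp (r m * \<omega> \<bar>lat L n\<bar>)"
        using P_step_mono(2)[OF m \<phi>] by (intro mult_right_mono) auto
      finally show ?thesis .
    qed
    note bound = coef_sum_bound[where \<phi>=\<phi>, OF L q(3) B0 cle \<phi>n]
    have hs: "((\<lambda>n. coef f n * \<phi> (of_real (lat L n))) has_sum S f) UNIV" if "f \<in> U" for f
      unfolding S_def by (rule has_sum_infsum[OF bound(1)[OF that that]])
    have Sle: "cmod (S f) \<le> ((C * s) * PN k \<phi>) * NU q' m' f" if "f \<in> U" for f
      using bound(2)[OF that that hs[OF that]] by (simp add: s_def mult_ac)
    have lin: "clinear_functional_on U S"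
      unfolding clinear_functional_on_def
    proof (intro conjI ballI allI)
      fix f g assume fg: "f \<in> U" "g \<in> U"
      have "((\<lambda>n. coef (f + g) n * \<phi> (of_real (lat L n))) has_sum (S f + S g)) UNIV"
        unfolding add[OF fg] distrib_right by (intro has_sum_add hs fg)
      then show "S (f + g) = S f + S g"
        using hs[OF cfun.subspace_add[OF U_subspace fg]] has_sum_unique by blast
    next
      fix b f assume f: "f \<in> U"
      have "((\<lambda>n. coef (\<lambda>x. b * f x) n * \<phi> (of_real (lat L n))) has_sum (b * S f)) UNIV"
        unfolding scale[OF f] mult.assoc by (intro has_sum_cmult_right hs f)
      then show "S (\<lambda>x. b * f x) = b * S f"
        using hs[OF cfun.subspace_scale[OF U_subspace f]] has_sum_unique by blast
    qed
    define S' where "S' = restrict S U"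
    have S': "S' \<in> U'" unfolding S'_def by (rule U_dual_I[OF lin q' Sle])
    have "FL S' z = \<phi> z" for z
    proof -
      let ?e = "exp_monomial a 0 z"
      have eU: "?e \<in> U" by (rule exp_monomial_U)
      have FLz: "FL S' z = S ?e" by (simp add: fourier_laplace_def S'_def eU)
      define W where "W = exp (r m * \<omega> (cmod z) + c m * \<bar>Im z\<bar>)"
      \<comment> \<open>Both \<open>S ?e\<close> and \<open>\<phi> z\<close> are within a multiple
        of \<epsilon> of \<open>\<psi> z\<close>, since for the exponential sum \<psi> the series
        has exactly this value.\<close>
      have "cmod (S ?e - \<phi> z) \<le> \<epsilon> * (C * NU q' m' ?e * s + W)" if \<epsilon>: "0 < \<epsilon>" for \<epsilon>
      proof -
        obtain N t b where t: "\<forall>i<N. \<bar>t i\<bar> \<le> c m" and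
          ap: "\<And>z. cmod (\<phi> z - (\<Sum>i<N::nat. b i * exp (- \<i> * z * of_real (t i :: real))))
            \<le> \<epsilon> * exp (r m * \<omega> (cmod z) + c m * \<bar>Im z\<bar>)"
          using dense[OF \<phi> \<epsilon>] by blast
        define \<psi> where "\<psi> = (\<lambda>z. \<Sum>i<N. b i * exp (- \<i> * z * of_real (t i)))"
        have "((\<lambda>n. coef ?e n * \<psi> (of_real (lat L n))) has_sum (\<Sum>i<N. b i * ?e (t i))) UNIV"
          unfolding \<psi>_def by (rule exp_sum_has_sum[OF _ t]) (use rep[OF eU, of _ 0] in simp)
        moreover have "(\<Sum>i<N. b i * ?e (t i)) = \<psi> z"
        proof -
          have "?e (t i) = exp (- \<i> * z * of_real (t i))" if "i < N" for i
            using c_le[of "t i" m] t that by (simp add: exp_monomial_def)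
          then show ?thesis by (simp add: \<psi>_def)
        qed
        ultimately have h\<psi>: "((\<lambda>n. coef ?e n * \<psi> (of_real (lat L n))) has_sum \<psi> z) UNIV" by simp
        have "((\<lambda>n. coef ?e n * (\<phi> (of_real (lat L n)) - \<psi> (of_real (lat L n)))) has_sum (S ?e - \<psi> z)) UNIV"
          unfolding right_diff_distrib by (intro has_sum_diff hs eU h\<psi>)
        then have "cmod (S ?e - \<psi> z) \<le> C * NU q' m' ?e * \<epsilon> * s"
          unfolding s_def
          by (intro coef_sum_bound(2)[where \<phi>="\<lambda>z. \<phi> z - \<psi> z", OF L q(3) B0[OF eU] cle[OF eU]])
             (use ap[of "of_real (lat L _)"] in \<open>simp_all add: \<psi>_def\<close>)
        moreover have "cmod (\<psi> z - \<phi> z) \<le> \<epsilon> * W"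
          using ap[of z] by (simp add: \<psi>_def W_def norm_minus_commute)
        moreover have "cmod (S ?e - \<phi> z) \<le> cmod (S ?e - \<psi> z) + cmod (\<psi> z - \<phi> z)"
          using norm_triangle_ineq[of "S ?e - \<psi> z" "\<psi> z - \<phi> z"] by simp
        ultimately show ?thesis by (simp add: algebra_simps)
      qed
      then show ?thesis unfolding FLz by (rule eq_if_le_mult_eps)
    qed
    then have "FL S' = \<phi>" by blast
    moreover have "\<forall>f\<in>U. cmod (S' f) \<le> (C * s) * PN k \<phi> * NU q' m' f" using Sle by (simp add: S'_def)
    ultimately show ?thesis using S' by blast
  qed
  then show ?thesis using q' C s0 by (intro exI[of _ q'] exI[of _ m'] exI[of _ "C * s"]) auto
qed

lemma P_step_exp:
  assumes t: "\<bar>t\<bar> \<le> c k" and km: "k \<le> m"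
  shows "(\<lambda>z. (- \<i> * z) ^ j * exp (- \<i> * z * of_real t)) \<in> Pk m"
    "PN m (\<lambda>z. (- \<i> * z) ^ j * exp (- \<i> * z * of_real t)) \<le> exp (r m * \<omega> 1) * M (r m) j"
proof -
  have le: "cmod ((- \<i> * z) ^ j * exp (- \<i> * z * of_real t)) \<le> (exp (r m * \<omega> 1) * M (r m) j) * exp (r m * \<omega> (cmod z) + c m * \<bar>Im z\<bar>)" for z
  proof -
    have "cmod z ^ j * exp (- r m * \<omega> (cmod z)) \<le> exp (r m * \<omega> 1) * M (r m) j"
      by (rule wM_ge_all[OF weight r_pos]) simp
    from mult_right_mono[OF this exp_ge_zero[of "r m * \<omega> (cmod z)"]]
    have 1: "cmod z ^ j \<le> (exp (r m * \<omega> 1) * M (r m) j) * exp (r m * \<omega> (cmod z))"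
      unfolding mult.assoc exp_add[symmetric] by simp
    have "Im z * t \<le> \<bar>Im z\<bar> * \<bar>t\<bar>" using abs_ge_self[of "Im z * t"] by (simp only: abs_mult)
    also have "\<dots> \<le> \<bar>Im z\<bar> * c m" using t incseqD[OF c_mono km] by (intro mult_left_mono) auto
    finally have 2: "cmod (exp (- \<i> * z * of_real t)) \<le> exp (c m * \<bar>Im z\<bar>)"
      by (simp add: norm_exp_eq_Re mult.commute)
    have "cmod ((- \<i> * z) ^ j * exp (- \<i> * z * of_real t)) = cmod z ^ j * cmod (exp (- \<i> * z * of_real t))"
      by (simp add: norm_mult norm_power)
    also have "\<dots> \<le> ((exp (r m * \<omega> 1) * M (r m) j) * exp (r m * \<omega> (cmod z))) * exp (c m * \<bar>Im z\<bar>)"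
      by (intro mult_mono 1 2) (use wM_pos[of \<omega> "r m" j] in \<open>auto simp: less_imp_le\<close>)
    finally show ?thesis by (simp add: exp_add mult_ac)
  qed
  show "(\<lambda>z. (- \<i> * z) ^ j * exp (- \<i> * z * of_real t)) \<in> Pk m"
    by (rule P_step_I[OF _ le]) (intro holomorphic_intros)
  show "PN m (\<lambda>z. (- \<i> * z) ^ j * exp (- \<i> * z * of_real t)) \<le> exp (r m * \<omega> 1) * M (r m) j"
    by (rule p_norm_le[OF le])
qed

text \<open>The representing function is the value of \<open>T\<close> at
  \<open>exp (-\<i> * t * z)\<close>, as a function of \<open>t\<close>; its derivatives are the
  values of \<open>T\<close> at \<open>(-\<i> * z) ^ j * exp (-\<i> * t * z)\<close>. The identity
  is exact for exponential sums, and density extends it, since both sides are bounded with respect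
  to the growth of one step.\<close>

lemma P_dual_representation:
  assumes T: "clinear_functional_on P T" and bd: "\<And>k. \<exists>C\<ge>0. \<forall>\<phi>\<in>Pk k. cmod (T \<phi>) \<le> C * PN k \<phi>"
  shows "\<exists>f\<in>U. \<forall>S\<in>U'. T (FL S) = S f"
proof -
  have "\<exists>C. \<forall>k. 0 \<le> C k \<and> (\<forall>\<phi>\<in>Pk k. cmod (T \<phi>) \<le> C k * PN k \<phi>)" using bd by (intro choice) auto
  then obtain C where C: "\<And>k. 0 \<le> C k" "\<And>k \<phi>. \<phi> \<in> Pk k \<Longrightarrow> cmod (T \<phi>) \<le> C k * PN k \<phi>" by blast
  have PkP: "\<phi> \<in> P" if "\<phi> \<in> Pk k" for \<phi> k using that unfolding P_space_def by blast
  define E where "E = (\<lambda>j (t::real) z. (- \<i> * z) ^ j * exp (- \<i> * z * of_real t))"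
  have EP: "E j t \<in> Pk m" "PN m (E j t) \<le> exp (r m * \<omega> 1) * M (r m) j" if "\<bar>t\<bar> \<le> c k" "k \<le> m" for j t k m
    unfolding E_def using P_step_exp[OF that] by auto
  define F where "F = (\<lambda>j t. if ereal \<bar>t\<bar> < a then T (E j t) else 0)"
  have z: "F j t = 0" if "\<not> ereal \<bar>t\<bar> < a" for j t using that by (simp add: F_def)
  have d: "(F j has_vector_derivative F (Suc j) t) (at t)" if ta: "ereal \<bar>t\<bar> < a" for j t
  proof -
    obtain k where k: "\<bar>t\<bar> < c k" using ex_c[OF ta] by blast
    \<comment> \<open>Within this distance
      \<open>\<bar>t\<bar> + \<bar>s - t\<bar> \<le> c k\<close>, so the remainder stays in step
      \<open>k\<close> and one constant of \<open>T\<close> applies.\<close>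
    define e where "e = c k - \<bar>t\<bar>"
    show ?thesis
    proof (rule has_vector_derivative_quadratic)
      show "0 < e" using k by (simp add: e_def)
      fix s assume s: "\<bar>s - t\<bar> < e"
      have tk: "\<bar>t\<bar> \<le> c k" and sk: "\<bar>s\<bar> \<le> c k" using k s by (auto simp: e_def)
      define G where "G = E j s - E j t - (\<lambda>z. of_real (s - t) * E (Suc j) t z)"
      have mem: "E j s \<in> Pk k" "E j t \<in> Pk k" "(\<lambda>z. of_real (s - t) * E (Suc j) t z) \<in> Pk k"
        using EP[OF sk order_refl] EP[OF tk order_refl] P_step_scale(1) by auto
      have GP: "G \<in> Pk k" unfolding G_def by (intro cfun.subspace_diff[OF P_step_subspace] mem)
      have TG: "T G = F j s - F j t - of_real (s - t) * F (Suc j) t"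
      proof -
        have "T G = T (E j s) - T (E j t) - T (\<lambda>z. of_real (s - t) * E (Suc j) t z)"
          unfolding G_def
          by (simp only: clinear_functional_on_diff[OF T P_space_subspace] cfun.subspace_diff[OF P_space_subspace] PkP[OF mem(1)] PkP[OF mem(2)] PkP[OF mem(3)])
        moreover have "T (\<lambda>z. of_real (s - t) * E (Suc j) t z) = of_real (s - t) * T (E (Suc j) t)"
          by (rule clinear_functional_onD(2)[OF T PkP[OF EP(1)[OF tk order_refl]]])
        ultimately show ?thesis using c_le[OF sk] ta by (simp add: F_def)
      qed
      \<comment> \<open>The second-order remainder of the exponential costs two more powers of
        \<open>z\<close>, whence the index \<open>j + 2\<close>.\<close>
      have "PN k G \<le> \<bar>s - t\<bar>\<^sup>2 * (exp (r k * \<omega> 1) * M (r k) (j + 2))"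
      proof (rule p_norm_le)
        fix z
        define u where "u = - \<i> * z * of_real (s - t)"
        have "E j s z = E j t z * exp u" by (simp add: E_def u_def exp_add[symmetric] algebra_simps)
        moreover have "of_real (s - t) * E (Suc j) t z = E j t z * u" by (simp add: E_def u_def)
        ultimately have Gz: "G z = E j t z * (exp u - (\<Sum>i\<le>1. u ^ i / fact i))"
          by (simp add: G_def algebra_simps)
        have "cmod (exp u - (\<Sum>i\<le>1. u ^ i / fact i)) \<le> exp \<bar>Re u\<bar> * cmod u ^ Suc 1 / fact 1" by (rule Taylor_exp)
        also have "\<bar>Re u\<bar> = \<bar>Im z\<bar> * \<bar>s - t\<bar>" by (simp add: u_def abs_mult)
        also have "cmod u = cmod z * \<bar>s - t\<bar>" unfolding u_def norm_mult norm_of_real by simp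
        finally have 1: "cmod (exp u - (\<Sum>i\<le>1. u ^ i / fact i)) \<le> exp (\<bar>Im z\<bar> * \<bar>s - t\<bar>) * (cmod z * \<bar>s - t\<bar>)\<^sup>2"
          by (simp add: power2_eq_square)
        have "Im z * t \<le> \<bar>Im z\<bar> * \<bar>t\<bar>" using abs_ge_self[of "Im z * t"] by (simp only: abs_mult)
        then have 2: "cmod (E j t z) \<le> cmod z ^ j * exp (\<bar>Im z\<bar> * \<bar>t\<bar>)"
          by (simp add: E_def norm_mult norm_power norm_exp_eq_Re mult_left_mono)
        have "\<bar>Im z\<bar> * (\<bar>t\<bar> + \<bar>s - t\<bar>) \<le> \<bar>Im z\<bar> * c k" using s by (intro mult_left_mono) (auto simp: e_def)
        then have 3: "exp (\<bar>Im z\<bar> * \<bar>t\<bar>) * exp (\<bar>Im z\<bar> * \<bar>s - t\<bar>) \<le> exp (c k * \<bar>Im z\<bar>)"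
          by (simp add: exp_add[symmetric] distrib_left mult.commute)
        have "cmod z ^ (j + 2) * exp (- r k * \<omega> (cmod z)) \<le> exp (r k * \<omega> 1) * M (r k) (j + 2)"
          by (rule wM_ge_all[OF weight r_pos]) simp
        from mult_right_mono[OF this exp_ge_zero[of "r k * \<omega> (cmod z)"]]
        have 4: "cmod z ^ (j + 2) \<le> (exp (r k * \<omega> 1) * M (r k) (j + 2)) * exp (r k * \<omega> (cmod z))"
          unfolding mult.assoc exp_add[symmetric] by simp
        have "cmod (G z) \<le> (cmod z ^ j * exp (\<bar>Im z\<bar> * \<bar>t\<bar>)) * (exp (\<bar>Im z\<bar> * \<bar>s - t\<bar>) * (cmod z * \<bar>s - t\<bar>)\<^sup>2)"
          unfolding Gz norm_mult by (intro mult_mono 1 2) auto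
        also have "\<dots> = \<bar>s - t\<bar>\<^sup>2 * (cmod z ^ (j + 2) * (exp (\<bar>Im z\<bar> * \<bar>t\<bar>) * exp (\<bar>Im z\<bar> * \<bar>s - t\<bar>)))"
          unfolding power_mult_distrib power_add by (simp only: mult_ac)
        also have "\<dots> \<le> \<bar>s - t\<bar>\<^sup>2 * (((exp (r k * \<omega> 1) * M (r k) (j + 2)) * exp (r k * \<omega> (cmod z))) * exp (c k * \<bar>Im z\<bar>))"
          by (intro mult_left_mono mult_mono 3 4) (use wM_pos[of \<omega> "r k" "j + 2"] in \<open>auto simp: less_imp_le\<close>)
        finally show "cmod (G z) \<le> \<bar>s - t\<bar>\<^sup>2 * (exp (r k * \<omega> 1) * M (r k) (j + 2)) * exp (r k * \<omega> (cmod z) + c k * \<bar>Im z\<bar>)"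
          by (simp only: exp_add mult_ac)
      qed
      then have "C k * PN k G \<le> C k * (\<bar>s - t\<bar>\<^sup>2 * (exp (r k * \<omega> 1) * M (r k) (j + 2)))"
        by (rule mult_left_mono) (rule C(1))
      then show "cmod (F j s - F j t - of_real (s - t) * F (Suc j) t) \<le> (C k * (exp (r k * \<omega> 1) * M (r k) (j + 2))) * \<bar>s - t\<bar>\<^sup>2"
        using C(2)[OF GP] unfolding TG by (simp only: mult_ac)
    qed
  qed
  have DF: "D j (F 0) = F j" for j by (rule Dop_family(1)[of a F j, OF z d])
  have F0: "F 0 \<in> smooth_fun a" by (rule Dop_family(2)[of a F, OF z d])
  have fU: "F 0 \<in> U"
  proof (rule U_I[OF F0])
    fix q :: real and k assume q: "0 < q" "q < 1"
    obtain m0 where m0: "q < r m0" using ex_r[OF q(2)] by blast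
    \<comment> \<open>A step that admits the points of modulus at most \<open>c k\<close> and has
      \<open>r m \<ge> q\<close>, so that \<open>M (r m) j \<le> M q j\<close>.\<close>
    define m where "m = max m0 k"
    have rm: "q \<le> r m" using m0 incseqD[OF r_mono, of m0 m] by (simp add: m_def)
    have "cmod (D j (F 0) x) \<le> (C m * exp (r m * \<omega> 1)) * M q j" if x: "\<bar>x\<bar> \<le> c k" for j x
    proof -
      have "cmod (D j (F 0) x) = cmod (T (E j x))" unfolding DF using c_le[OF x] by (simp add: F_def)
      also have "\<dots> \<le> C m * PN m (E j x)" by (rule C(2)[OF EP(1)[OF x]]) (simp add: m_def)
      also have "\<dots> \<le> C m * (exp (r m * \<omega> 1) * M (r m) j)"
        by (intro mult_left_mono C(1) EP(2)[OF x]) (simp add: m_def)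
      also have "\<dots> \<le> C m * (exp (r m * \<omega> 1) * M q j)"
        by (intro mult_left_mono C(1) wM_antimono[OF weight q(1) rm]) simp
      finally show ?thesis by (simp add: mult.assoc)
    qed
    then show "\<exists>B. \<forall>j x. \<bar>x\<bar> \<le> c k \<longrightarrow> cmod (D j (F 0) x) \<le> B * M q j" by blast
  qed
  have "T (FL S) = S (F 0)" if S: "S \<in> U'" for S
  proof -
    obtain q0 k0 K where q0: "0 < q0" "q0 < 1" "0 \<le> K" "\<And>f. f \<in> U \<Longrightarrow> cmod (S f) \<le> K * NU q0 k0 f"
      using U_dual_bound[OF S] by blast
    obtain k1 where k1: "FL S \<in> Pk k1" using FL_in_P[OF S] unfolding P_space_def by blast
    obtain k2 where k2: "q0 < r k2" using ex_r[OF q0(2)] by blast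
    \<comment> \<open>This step contains the transform and dominates the index \<open>k0\<close> and
      the exponent \<open>q0\<close> of the seminorm that bounds \<open>S\<close>.\<close>
    define k where "k = max k0 (max k1 k2)"
    have \<phi>: "FL S \<in> Pk k" by (rule P_step_mono(1)[OF _ k1]) (simp add: k_def)
    obtain m where m: "m \<ge> k" and dense: "\<And>\<phi> \<epsilon>. \<phi> \<in> Pk k \<Longrightarrow> 0 < \<epsilon> \<Longrightarrow> \<exists>N t b. (\<forall>i<N. \<bar>t i\<bar> \<le> c m) \<and>
       (\<forall>z. cmod (\<phi> z - (\<Sum>i<N::nat. b i * exp (- \<i> * z * of_real (t i :: real))))
          \<le> \<epsilon> * exp (r m * \<omega> (cmod z) + c m * \<bar>Im z\<bar>))"
      using exponentials_dense[of k] by blast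
    define q where "q = (r m + 1) / 2"
    have "r k2 \<le> r m" using m by (intro incseqD[OF r_mono]) (simp add: k_def)
    then have q: "0 < q" "q < 1" "r m < q" "q0 < q" using r_pos[of m] r_less[of m] k2 by (auto simp: q_def)
    obtain L coef q' m' B where E0: "0 < L" "0 < q'" "q' < 1" "0 \<le> B"
    "\<forall>f\<in>U. \<forall>g\<in>U. \<forall>n. coef (f + g) n = coef f n + coef g n"
    "\<forall>b. \<forall>f\<in>U. \<forall>n. coef (\<lambda>x. b * f x) n = b * coef f n"
    "\<forall>f\<in>U. \<forall>n. cmod (coef f n) \<le> B * NU q' m' f * exp (- q * \<omega> \<bar>lat L n\<bar>)"
    "\<forall>f\<in>U. \<forall>j x. \<bar>x\<bar> \<le> c m \<longrightarrow>
      ((\<lambda>n. coef f n * (- \<i> * of_real (lat L n)) ^ j * chr L (- n) x) has_sum D j f x) UNIV"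
    using expansion[OF q(1,2), of m] by (elim exE conjE)
    note L = E0(1) and q' = E0(2,3) and B = E0(4)
      and cle = E0(7)[rule_format] and rep = E0(8)[rule_format]
    let ?f = "F 0"
    define s where "s = (\<Sum>\<^sub>\<infinity>n. exp (- (q - r m) * \<omega> \<bar>lat L n\<bar>))"
    have hs: "((\<lambda>n. coef ?f n * FL S (of_real (lat L n))) has_sum S ?f) UNIV"
      by (rule expansion_functional[OF S q0(4,3,1) q(4,2) L _ fU cle[OF fU] rep[OF fU]]) (use m in \<open>simp_all add: k_def\<close>)
    have B0: "0 \<le> B * NU q' m' ?f" using B NU_nonneg[OF fU q'] by simp
    have "cmod (T (FL S) - S ?f) \<le> \<epsilon> * (C m + B * NU q' m' ?f * s)" if \<epsilon>: "0 < \<epsilon>" for \<epsilon>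
    proof -
      obtain N t b where t: "\<forall>i<N. \<bar>t i\<bar> \<le> c m" and
        ap: "\<And>z. cmod (FL S z - (\<Sum>i<N::nat. b i * exp (- \<i> * z * of_real (t i :: real))))
          \<le> \<epsilon> * exp (r m * \<omega> (cmod z) + c m * \<bar>Im z\<bar>)"
        using dense[OF \<phi> \<epsilon>] by blast
      define \<psi> where "\<psi> = (\<lambda>z. \<Sum>i<N. b i * exp (- \<i> * z * of_real (t i)))"
      have Ei: "E 0 (t i) \<in> P" if "i \<in> {..<N}" for i
        using EP(1)[of "t i" m m 0] t that by (auto intro: PkP)
      have \<psi>E: "\<psi> = (\<lambda>z. \<Sum>i\<in>{..<N}. b i * E 0 (t i) z)" by (simp add: \<psi>_def E_def)
      have T\<psi>: "T \<psi> = (\<Sum>i<N. b i * ?f (t i))"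
      proof -
        have "T \<psi> = (\<Sum>i<N. b i * T (E 0 (t i)))"
          unfolding \<psi>E by (rule clinear_functional_on_sum(1)[OF T P_space_subspace Ei])
        also have "\<dots> = (\<Sum>i<N. b i * ?f (t i))"
        proof (intro sum.cong refl)
          fix i assume "i \<in> {..<N}"
          then have "ereal \<bar>t i\<bar> < a" using t c_le[of "t i" m] by simp
          then show "b i * T (E 0 (t i)) = b i * ?f (t i)" by (simp add: F_def)
        qed
        finally show ?thesis .
      qed
      have \<psi>P: "\<psi> \<in> P" unfolding \<psi>E by (rule clinear_functional_on_sum(2)[OF T P_space_subspace Ei])
      have h\<psi>: "((\<lambda>n. coef ?f n * \<psi> (of_real (lat L n))) has_sum T \<psi>) UNIV"
        unfolding T\<psi> unfolding \<psi>_def by (rule exp_sum_has_sum[OF _ t]) (use rep[OF fU, of _ 0] in simp)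
      have "((\<lambda>n. coef ?f n * (FL S (of_real (lat L n)) - \<psi> (of_real (lat L n)))) has_sum (S ?f - T \<psi>)) UNIV"
        unfolding right_diff_distrib by (intro has_sum_diff hs h\<psi>)
      then have 1: "cmod (S ?f - T \<psi>) \<le> B * NU q' m' ?f * \<epsilon> * s"
        unfolding s_def
        by (intro coef_sum_bound(2)[where \<phi>="\<lambda>z. FL S z - \<psi> z", OF L q(3) B0 cle[OF fU]])
           (use ap[of "of_real (lat L _)"] in \<open>simp_all add: \<psi>_def\<close>)
      have hol: "(FL S - \<psi>) holomorphic_on UNIV"
        unfolding fun_diff_def \<psi>_def by (intro holomorphic_intros FL_holomorphic S)
      have "cmod ((FL S - \<psi>) z) \<le> \<epsilon> * exp (r m * \<omega> (cmod z) + c m * \<bar>Im z\<bar>)" for z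
        using ap[of z] by (simp add: \<psi>_def)
      from P_step_I[OF hol this] p_norm_le[OF this]
      have pk: "FL S - \<psi> \<in> Pk m" "PN m (FL S - \<psi>) \<le> \<epsilon>" .
      from order_trans[OF C(2)[OF pk(1)] mult_left_mono[OF pk(2) C(1)]]
      have "cmod (T (FL S - \<psi>)) \<le> C m * \<epsilon>" .
      then have 2: "cmod (T (FL S) - T \<psi>) \<le> C m * \<epsilon>"
        using clinear_functional_on_diff[OF T P_space_subspace FL_in_P[OF S] \<psi>P] by simp
      have "cmod (T (FL S) - S ?f) \<le> cmod (T (FL S) - T \<psi>) + cmod (S ?f - T \<psi>)"
        using norm_triangle_ineq4[of "T (FL S) - T \<psi>" "S ?f - T \<psi>"] by simp
      then show ?thesis using 1 2 by (simp add: algebra_simps)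
    qed
    then show ?thesis by (rule eq_if_le_mult_eps)
  qed
  then show ?thesis using fU by blast
qed

end

section \<open>Annihilators and submodules\<close>

context ultra
begin

abbreviation Ann where "Ann \<equiv> annihilator a \<omega> c"

section \<open>Linear structure and multiplication by z under the transform\<close>

lemma U_Dop_add: "f \<in> U \<Longrightarrow> g \<in> U \<Longrightarrow> Dop a (f + g) = Dop a f + Dop a g"
  using Dop_smooth_add(1)[OF U_smooth U_smooth, of f g 1] by simp

lemma U_Dop_scale: "f \<in> U \<Longrightarrow> Dop a (\<lambda>x. b * f x) = (\<lambda>x. b * Dop a f x)"
  using Dop_smooth_scale(1)[OF U_smooth, of f 1 b] by simp

lemma U_dual_bound_mono:
  assumes "f \<in> U" "cmod (S f) \<le> C * NU q k f" "0 \<le> C" "0 < q" "q \<le> q'" "q' < 1" "k \<le> k'"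
  shows "cmod (S f) \<le> C * NU q' k' f"
  using assms(2) mult_left_mono[OF NU_mono[OF assms(1,4-7)] assms(3)] by (rule order_trans)

lemma U_dual_add:
  assumes "S \<in> U'" "S' \<in> U'"
  shows "restrict (\<lambda>f. S f + S' f) U \<in> U'"
proof -
  obtain q k C where 1: "0 < q" "q < 1" "0 \<le> C" "\<And>f. f \<in> U \<Longrightarrow> cmod (S f) \<le> C * NU q k f"
    using U_dual_bound[OF assms(1)] by blast
  obtain q' k' C' where 2: "0 < q'" "q' < 1" "0 \<le> C'" "\<And>f. f \<in> U \<Longrightarrow> cmod (S' f) \<le> C' * NU q' k' f"
    using U_dual_bound[OF assms(2)] by blast
  have "cmod (S f + S' f) \<le> (C + C') * NU (max q q') (max k k') f" if f: "f \<in> U" for f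
  proof -
    have "cmod (S f) \<le> C * NU (max q q') (max k k') f"
      by (rule U_dual_bound_mono[where S=S, OF f 1(4)[OF f]]) (use 1 2 in auto)
    moreover have "cmod (S' f) \<le> C' * NU (max q q') (max k k') f"
      by (rule U_dual_bound_mono[where S=S', OF f 2(4)[OF f]]) (use 1 2 in auto)
    ultimately show ?thesis using norm_triangle_ineq[of "S f" "S' f"] by (simp add: distrib_right)
  qed
  moreover have "clinear_functional_on U (\<lambda>f. S f + S' f)"
    unfolding clinear_functional_on_def
    by (intro conjI ballI allI; simp only: clinear_functional_onD[OF U_dual_linear[OF assms(1)]]
        clinear_functional_onD[OF U_dual_linear[OF assms(2)]]; simp add: algebra_simps)
  ultimately show ?thesis using 1 2 by (intro U_dual_I[of _ "max q q'"]) auto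
qed

lemma U_dual_scale:
  assumes "S \<in> U'"
  shows "restrict (\<lambda>f. b * S f) U \<in> U'"
proof -
  obtain q k C where 1: "0 < q" "q < 1" "0 \<le> C" "\<And>f. f \<in> U \<Longrightarrow> cmod (S f) \<le> C * NU q k f"
    using U_dual_bound[OF assms(1)] by blast
  have "cmod (b * S f) \<le> (cmod b * C) * NU q k f" if "f \<in> U" for f
    using mult_left_mono[OF 1(4)[OF that], of "cmod b"] by (simp add: norm_mult mult.assoc)
  moreover have "clinear_functional_on U (\<lambda>f. b * S f)"
    unfolding clinear_functional_on_def
    by (intro conjI ballI allI; simp only: clinear_functional_onD[OF U_dual_linear[OF assms(1)]]; simp add: algebra_simps)
  ultimately show ?thesis using 1 by (intro U_dual_I[of _ q]) auto
qed

text \<open>The adjoint of \<i> times the derivation. As exponentials are eigenfunctions of the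
  derivation, it corresponds to multiplication of the transform by \<open>z\<close>; see
  \<open>FL_Dop\<close>.\<close>

lemma U_dual_Dop:
  assumes "S \<in> U'"
  shows "restrict (\<lambda>f. \<i> * S (Dop a f)) U \<in> U'"
proof -
  obtain q k C where 1: "0 < q" "q < 1" "0 \<le> C" "\<And>f. f \<in> U \<Longrightarrow> cmod (S f) \<le> C * NU q k f"
    using U_dual_bound[OF assms(1)] by blast
  define q' where "q' = (q + 1) / 2"
  have q': "q < q'" "q' < 1" "0 < q'" using 1 by (auto simp: q'_def field_simps)
  have "\<exists>B>0. \<forall>f\<in>U. NU q k (Dop a f) \<le> B * NU q' k f"
    \<comment> \<open>The membership premise shared by both claims of \<open>U_Dop\<close> is
      discharged with the zero function.\<close>
    by (rule U_Dop(2)[OF cfun.subspace_0[OF U_subspace] 1(1) q'(1,2)])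
  then obtain B where B: "0 < B" "\<And>f. f \<in> U \<Longrightarrow> NU q k (Dop a f) \<le> B * NU q' k f" by blast
  have "cmod (\<i> * S (Dop a f)) \<le> (C * B) * NU q' k f" if "f \<in> U" for f
    using order_trans[OF 1(4)[OF U_Dop(1)[OF that]] mult_left_mono[OF B(2)[OF that] 1(3)]]
    by (simp add: norm_mult mult.assoc)
  moreover have "clinear_functional_on U (\<lambda>f. \<i> * S (Dop a f))"
    unfolding clinear_functional_on_def
    by (simp add: U_Dop_add U_Dop_scale U_Dop(1) clinear_functional_onD[OF U_dual_linear[OF assms(1)]] algebra_simps)
  ultimately show ?thesis using q' by (intro U_dual_I[of _ q']) auto
qed

lemma FL_add: "FL (restrict (\<lambda>f. S f + S' f) U) = FL S + FL S'"
  and FL_scale: "FL (restrict (\<lambda>f. b * S f) U) = (\<lambda>z. b * FL S z)"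
  by (auto simp: fourier_laplace_def fun_eq_iff exp_monomial_U)

lemma Dop_exp: "Dop a (exp_monomial a 0 z) = (\<lambda>x. (- \<i> * z) * exp_monomial a 0 z x)"
proof
  fix x
  show "Dop a (exp_monomial a 0 z) x = (- \<i> * z) * exp_monomial a 0 z x"
    using D_exp[of x 1 z] by (cases "ereal \<bar>x\<bar> < a") (auto simp: exp_monomial_def Dop_def)
qed

lemma FL_Dop:
  assumes "S \<in> U'"
  shows "FL (restrict (\<lambda>f. \<i> * S (Dop a f)) U) = (\<lambda>z. z * FL S z)"
proof
  fix z
  have "FL (restrict (\<lambda>f. \<i> * S (Dop a f)) U) z = \<i> * S (\<lambda>x. (- \<i> * z) * exp_monomial a 0 z x)"
    by (simp only: fourier_laplace_def restrict_apply exp_monomial_U if_True Dop_exp)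
  also have "\<dots> = \<i> * ((- \<i> * z) * S (exp_monomial a 0 z))"
    by (simp only: clinear_functional_onD(2)[OF U_dual_linear[OF assms] exp_monomial_U])
  also have "\<dots> = z * S (exp_monomial a 0 z)" by (simp flip: mult.assoc)
  finally show "FL (restrict (\<lambda>f. \<i> * S (Dop a f)) U) z = z * FL S z"
    by (simp only: fourier_laplace_def)
qed

text \<open>For fixed \<open>f\<close> in \<open>U\<close>, the value \<open>FL_inv \<phi> f\<close>
  as a function of \<phi> is the pairing of \<open>P\<close> with \<open>U\<close>.\<close>

definition FL_inv :: "(complex \<Rightarrow> complex) \<Rightarrow> (real \<Rightarrow> complex) \<Rightarrow> complex" where
  "FL_inv \<phi> = (THE S. S \<in> U' \<and> FL S = \<phi>)"

lemma FL_inv_FL: "S \<in> U' \<Longrightarrow> FL_inv (FL S) = S"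
  unfolding FL_inv_def by (rule the_equality) (auto intro: FL_injective)

lemma FL_inv:
  assumes "\<phi> \<in> P" shows "FL_inv \<phi> \<in> U'" "FL (FL_inv \<phi>) = \<phi>"
proof -
  obtain k where "\<phi> \<in> Pk k" using assms unfolding P_space_def by blast
  then obtain S where "S \<in> U'" "FL S = \<phi>" using FL_surjective[of k] by blast
  then show "FL_inv \<phi> \<in> U'" "FL (FL_inv \<phi>) = \<phi>" using FL_inv_FL by auto
qed

lemma FL_inv_linear:
  assumes f: "f \<in> U"
  shows "clinear_functional_on P (\<lambda>\<phi>. FL_inv \<phi> f)"
  unfolding clinear_functional_on_def
proof (intro conjI ballI allI)
  fix \<phi> \<psi> assume p: "\<phi> \<in> P" "\<psi> \<in> P"
  have "FL_inv (\<phi> + \<psi>) = restrict (\<lambda>f. FL_inv \<phi> f + FL_inv \<psi> f) U"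
    using FL_inv_FL[OF U_dual_add[OF FL_inv(1)[OF p(1)] FL_inv(1)[OF p(2)]]] FL_inv(2)[OF p(1)] FL_inv(2)[OF p(2)]
    by (simp only: FL_add)
  then show "FL_inv (\<phi> + \<psi>) f = FL_inv \<phi> f + FL_inv \<psi> f" using f by (simp only: restrict_apply if_True)
next
  fix b \<phi> assume p: "\<phi> \<in> P"
  have "FL_inv (\<lambda>z. b * \<phi> z) = restrict (\<lambda>f. b * FL_inv \<phi> f) U"
    using FL_inv_FL[OF U_dual_scale[OF FL_inv(1)[OF p], of b]] FL_inv(2)[OF p] by (simp only: FL_scale)
  then show "FL_inv (\<lambda>x. b * \<phi> x) f = b * FL_inv \<phi> f" using f by (simp only: restrict_apply if_True)
qed

text \<open>By the uniform bound of \<open>FL_surjective\<close> on each step, the modulus of this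
  evaluation is itself one of the seminorms defining the inductive limit. It makes transforms of
  annihilators closed.\<close>

lemma FL_inv_continuous:
  assumes f: "f \<in> U"
  shows "continuous_map (P_topology \<omega> c r) euclidean (\<lambda>\<phi>. FL_inv \<phi> f)"
proof -
  let ?q = "\<lambda>\<phi>. cmod (FL_inv \<phi> f)"
  have "seminorm_on P ?q"
    unfolding seminorm_on_def using clinear_functional_onD[OF FL_inv_linear[OF f]]
    by (simp add: norm_triangle_ineq norm_mult)
  moreover have "\<exists>C\<ge>0. \<forall>\<phi>\<in>Pk k. ?q \<phi> \<le> C * PN k \<phi>" for k
  proof -
    obtain q m K where K: "0 < q" "q < 1" "0 \<le> K"
      "\<And>\<phi>. \<phi> \<in> Pk k \<Longrightarrow> \<exists>S\<in>U'. FL S = \<phi> \<and> (\<forall>f\<in>U. cmod (S f) \<le> K * PN k \<phi> * NU q m f)"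
      using FL_surjective[of k] by blast
    have "?q \<phi> \<le> (K * NU q m f) * PN k \<phi>" if \<phi>: "\<phi> \<in> Pk k" for \<phi>
    proof -
      obtain S where S: "S \<in> U'" "FL S = \<phi>" "\<forall>f\<in>U. cmod (S f) \<le> K * PN k \<phi> * NU q m f" using K(4)[OF \<phi>] by blast
      have "FL_inv \<phi> = S" using FL_inv_FL[OF S(1)] S(2) by simp
      then show ?thesis using S(3) f by (simp add: mult_ac)
    qed
    moreover have "0 \<le> K * NU q m f" using K NU_nonneg[OF f K(1,2)] by simp
    ultimately show ?thesis by blast
  qed
  ultimately have "?q \<in> PQ" by (simp add: PQ_iff)
  then show ?thesis unfolding P_topology_eq
    by (intro bound_imp_continuous_functional[OF _ P_space_subspace PQ_nonempty FL_inv_linear[OF f], of "{?q}" 1])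
       (auto simp: PQ_iff)
qed

lemma mult_poly_mem:
  assumes J: "cfun.subspace J" and z: "\<And>\<phi>. \<phi> \<in> J \<Longrightarrow> (\<lambda>z. z * \<phi> z) \<in> J" and \<phi>: "\<phi> \<in> J"
  shows "(\<lambda>z. poly p z * \<phi> z) \<in> J"
proof (induction p)
  case 0
  then show ?case using cfun.subspace_0[OF J] by (simp add: zero_fun_def)
next
  case (pCons b p)
  have "(\<lambda>z. b * \<phi> z) + (\<lambda>z. z * (poly p z * \<phi> z)) \<in> J"
    by (intro cfun.subspace_add[OF J] cfun.subspace_scale[OF J] z \<phi> pCons)
  moreover have "(\<lambda>z. b * \<phi> z) + (\<lambda>z. z * (poly p z * \<phi> z)) = (\<lambda>z. poly (pCons b p) z * \<phi> z)"
    by (auto simp: fun_eq_iff algebra_simps)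
  ultimately show ?case by simp
qed

section \<open>Annihilators, bipolars and zero sets\<close>

lemma D_invariantD:
  assumes "D_invariant_subspace a \<omega> c W"
  shows "W \<subseteq> U" "cfun.subspace W" "closedin (U_topology a \<omega> c) W" "\<And>f. f \<in> W \<Longrightarrow> Dop a f \<in> W"
  using assms unfolding D_invariant_subspace_def by auto

lemma FL_annihilator_eq:
  assumes "W \<subseteq> U"
  shows "FL ` Ann W = {\<phi> \<in> P. \<forall>f\<in>W. FL_inv \<phi> f = 0}"
proof
  show "FL ` Ann W \<subseteq> {\<phi> \<in> P. \<forall>f\<in>W. FL_inv \<phi> f = 0}"
    using FL_in_P FL_inv_FL by (auto simp: annihilator_def)
  show "{\<phi> \<in> P. \<forall>f\<in>W. FL_inv \<phi> f = 0} \<subseteq> FL ` Ann W"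
  proof
    fix \<phi> assume "\<phi> \<in> {\<phi> \<in> P. \<forall>f\<in>W. FL_inv \<phi> f = 0}"
    then have "FL_inv \<phi> \<in> Ann W" "\<phi> = FL (FL_inv \<phi>)" using FL_inv by (auto simp: annihilator_def)
    then show "\<phi> \<in> FL ` Ann W" by blast
  qed
qed

text \<open>An intersection of kernels of continuous evaluations is closed. Stability under
  multiplication by \<open>z\<close>, and hence by polynomials, is the invariance of
  \<open>W\<close> read through the adjoint of the derivation.\<close>

lemma closed_submodule_FL_annihilator:
  assumes W: "D_invariant_subspace a \<omega> c W"
  shows "closed_submodule \<omega> c r (FL ` Ann W)"
proof -
  note Wd = D_invariantD[OF W]
  let ?J = "{\<phi> \<in> P. \<forall>f\<in>W. FL_inv \<phi> f = 0}"
  have sub: "cfun.subspace ?J"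
    unfolding cfun.subspace_def
  proof (intro conjI ballI allI)
    have "FL_inv 0 f = 0" if "f \<in> U" for f
      using clinear_functional_on_zero[OF FL_inv_linear[OF that] P_space_subspace] .
    then show "0 \<in> ?J" using cfun.subspace_0[OF P_space_subspace] Wd(1) by blast
    show "\<phi> + \<psi> \<in> ?J" if "\<phi> \<in> ?J" "\<psi> \<in> ?J" for \<phi> \<psi>
    proof -
      have "FL_inv (\<phi> + \<psi>) f = 0" if "f \<in> W" for f
        using clinear_functional_onD(1)[OF FL_inv_linear, of f \<phi> \<psi>] \<open>\<phi> \<in> ?J\<close> \<open>\<psi> \<in> ?J\<close> that Wd(1) by auto
      then show ?thesis using that cfun.subspace_add[OF P_space_subspace] by blast
    qed
    show "(\<lambda>z. b * \<phi> z) \<in> ?J" if "\<phi> \<in> ?J" for b \<phi>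
    proof -
      have "FL_inv (\<lambda>z. b * \<phi> z) f = 0" if "f \<in> W" for f
        using clinear_functional_onD(2)[OF FL_inv_linear, of f \<phi> b] \<open>\<phi> \<in> ?J\<close> that Wd(1) by auto
      then show ?thesis using that cfun.subspace_scale[OF P_space_subspace] by blast
    qed
  qed
  have z: "(\<lambda>z. z * \<phi> z) \<in> FL ` Ann W" if \<phi>: "\<phi> \<in> FL ` Ann W" for \<phi>
  proof -
    obtain S where S: "S \<in> U'" "\<forall>f\<in>W. S f = 0" "\<phi> = FL S" using \<phi> by (auto simp: annihilator_def)
    have "restrict (\<lambda>f. \<i> * S (Dop a f)) U \<in> Ann W"
      using U_dual_Dop[OF S(1)] S(2) Wd(1,4) by (auto simp: annihilator_def)
    then have "FL (restrict (\<lambda>f. \<i> * S (Dop a f)) U) \<in> FL ` Ann W" by (rule imageI)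
    then show ?thesis unfolding FL_Dop[OF S(1)] S(3) .
  qed
  have "closedin (P_topology \<omega> c r) (\<Inter>f\<in>W. {\<phi> \<in> P. FL_inv \<phi> f = 0})"
  proof (rule closedin_Inter)
    show "(\<lambda>f. {\<phi> \<in> P. FL_inv \<phi> f = 0}) ` W \<noteq> {}" using cfun.subspace_0[OF Wd(2)] by blast
    fix K assume "K \<in> (\<lambda>f. {\<phi> \<in> P. FL_inv \<phi> f = 0}) ` W"
    then obtain f where "f \<in> U" "K = {\<phi> \<in> P. FL_inv \<phi> f = 0}" using Wd(1) by blast
    then show "closedin (P_topology \<omega> c r) K"
      using closedin_kernel[OF FL_inv_continuous, of f] by (simp add: topspace_P)
  qed
  moreover have "(\<Inter>f\<in>W. {\<phi> \<in> P. FL_inv \<phi> f = 0}) = ?J" using cfun.subspace_0[OF Wd(2)] by blast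
  ultimately have "closedin (P_topology \<omega> c r) ?J" by simp
  then show ?thesis
    using sub mult_poly_mem[OF _ z] unfolding closed_submodule_def FL_annihilator_eq[OF Wd(1)] by blast
qed

text \<open>A point outside \<open>W\<close> would be separated from it by a functional dominated by
  finitely many of the seminorms. Restricting it to \<open>U\<close> yields an element of
  \<open>U'\<close>, whose members are extensional.\<close>

lemma bipolar_U:
  assumes W: "D_invariant_subspace a \<omega> c W" and f: "f \<in> U" "\<And>S. S \<in> Ann W \<Longrightarrow> S f = 0"
  shows "f \<in> W"
proof (rule ccontr)
  assume nf: "f \<notin> W"
  note Wd = D_invariantD[OF W]
  let ?Q = "{NU q k | q k. 0 < q \<and> q < 1}"
  have Q: "\<And>p. p \<in> ?Q \<Longrightarrow> seminorm_on U p" using NU_seminorm by blast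
  have ne: "?Q \<noteq> {}" by (auto intro!: exI[of _ "1/2 :: real"])
  have cl: "closedin (seminorm_topology U ?Q) W" using Wd(3) by (simp add: U_topology_def)
  have "\<exists>T F C. clinear_functional_on U T \<and> (\<forall>f\<in>W. T f = 0) \<and> T f \<noteq> 0 \<and>
           finite F \<and> F \<subseteq> ?Q \<and> (\<forall>f\<in>U. cmod (T f) \<le> C * (\<Sum>q\<in>F. q f))"
    by (rule closed_subspace_separation[OF _ U_subspace ne Wd(2) cl f(1) nf]) (rule Q)
  then obtain T F C where T: "clinear_functional_on U T" "\<forall>f\<in>W. T f = 0" "T f \<noteq> 0"
    "finite F" "F \<subseteq> ?Q" "\<forall>f\<in>U. cmod (T f) \<le> C * (\<Sum>q\<in>F. q f)" by (elim exE conjE)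
  have lin: "clinear_functional_on U (restrict T U)"
    unfolding clinear_functional_on_def using clinear_functional_onD[OF T(1)]
      cfun.subspace_add[OF U_subspace] cfun.subspace_scale[OF U_subspace]
    by (simp del: plus_fun_apply)
  have "continuous_map (seminorm_topology U ?Q) euclidean (restrict T U)"
  proof (rule bound_imp_continuous_functional[OF _ U_subspace ne lin T(4,5)])
    show "\<And>p. p \<in> ?Q \<Longrightarrow> seminorm_on U p" by (rule Q)
    show "cmod (restrict T U g) \<le> C * (\<Sum>q\<in>F. q g)" if "g \<in> U" for g using T(6) that by simp
  qed
  then have "restrict T U \<in> Ann W"
    using lin T(2) Wd(1) by (auto simp: annihilator_def U_dual_def U_topology_def)
  from f(2)[OF this] show False using T(3) f(1) by simp
qed

lemma closedin_U_kernel: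
  assumes "S \<in> U'"
  shows "closedin (U_topology a \<omega> c) {f \<in> U. S f = 0}"
  using closedin_kernel[of "U_topology a \<omega> c" S] assms by (simp add: topspace_U U_dual_def)

text \<open>\<open>W\<close> is the common kernel of the functionals with transform in
  \<open>J\<close>. If \<open>S\<close> annihilates \<open>W\<close> but its transform lies outside
  \<open>J\<close>, a functional on \<open>P\<close> separates the two. It is represented by some
  \<open>f\<close>, which lies in \<open>W\<close> because the functional vanishes on
  \<open>J\<close>; then \<open>S f \<noteq> 0\<close> is a contradiction.\<close>

lemma submodule_preimage:
  assumes J: "closed_submodule \<omega> c r J"
  shows "\<exists>W. D_invariant_subspace a \<omega> c W \<and> FL ` Ann W = J"
proof -
  have JP: "J \<subseteq> P" and sub: "cfun.subspace J" and cl: "closedin (P_topology \<omega> c r) J"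
    and pol: "\<And>p \<phi>. \<phi> \<in> J \<Longrightarrow> (\<lambda>z. poly p z * \<phi> z) \<in> J"
    using J unfolding closed_submodule_def by auto
  define \<S> where "\<S> = {S \<in> U'. FL S \<in> J}"
  define W where "W = {f \<in> U. \<forall>S\<in>\<S>. S f = 0}"
  \<comment> \<open>An intersection of closed sets is closed here only for a nonempty family; the
    preimage of the zero function provides a member.\<close>
  have \<S>ne: "FL_inv 0 \<in> \<S>"
    using FL_inv[of 0] cfun.subspace_0[OF sub] JP by (auto simp: \<S>_def)
  have Wsub: "cfun.subspace W"
    unfolding cfun.subspace_def
  proof (intro conjI ballI allI)
    show "0 \<in> W"
      using cfun.subspace_0[OF U_subspace] clinear_functional_on_zero[OF U_dual_linear U_subspace]
      by (auto simp: W_def \<S>_def)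
    show "f + g \<in> W" if fg: "f \<in> W" "g \<in> W" for f g
    proof -
      have fgU: "f \<in> U" "g \<in> U" using fg by (auto simp: W_def)
      have "S (f + g) = 0" if S: "S \<in> \<S>" for S
      proof -
        have "S f = 0" "S g = 0" using fg S unfolding W_def by blast+
        then show ?thesis
          using clinear_functional_onD(1)[OF U_dual_linear fgU, of S] S by (simp add: \<S>_def)
      qed
      then show ?thesis using cfun.subspace_add[OF U_subspace fgU] unfolding W_def by blast
    qed
    show "(\<lambda>x. b * f x) \<in> W" if f: "f \<in> W" for b f
    proof -
      have fU: "f \<in> U" using f by (auto simp: W_def)
      have "S (\<lambda>x. b * f x) = 0" if S: "S \<in> \<S>" for S
      proof -
        have "S f = 0" using f S unfolding W_def by blast
        then show ?thesis
          using clinear_functional_onD(2)[OF U_dual_linear fU, of S b] S by (simp add: \<S>_def)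
      qed
      then show ?thesis using cfun.subspace_scale[OF U_subspace fU] unfolding W_def by blast
    qed
  qed
  have "closedin (U_topology a \<omega> c) (\<Inter>S\<in>\<S>. {f \<in> U. S f = 0})"
    by (rule closedin_Inter) (use \<S>ne closedin_U_kernel in \<open>auto simp: \<S>_def\<close>)
  moreover have "(\<Inter>S\<in>\<S>. {f \<in> U. S f = 0}) = W" using \<S>ne unfolding W_def by blast
  ultimately have Wcl: "closedin (U_topology a \<omega> c) W" by simp
  have WD: "Dop a f \<in> W" if f: "f \<in> W" for f
  proof -
    have fU: "f \<in> U" using f by (simp add: W_def)
    have "S (Dop a f) = 0" if S: "S \<in> \<S>" for S
    proof -
      have S': "S \<in> U'" "FL S \<in> J" using S by (auto simp: \<S>_def)
      have "restrict (\<lambda>f. \<i> * S (Dop a f)) U \<in> \<S>"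
        using U_dual_Dop[OF S'(1)] FL_Dop[OF S'(1)] pol[OF S'(2), of "[:0, 1:]"] by (simp add: \<S>_def)
      then have "restrict (\<lambda>f. \<i> * S (Dop a f)) U f = 0" using f unfolding W_def by blast
      then show ?thesis using fU by simp
    qed
    then show ?thesis using U_Dop(1)[OF fU] by (simp add: W_def)
  qed
  have WU: "W \<subseteq> U" by (auto simp: W_def)
  have Winv: "D_invariant_subspace a \<omega> c W"
    unfolding D_invariant_subspace_def using WU Wsub Wcl WD by blast
  have "J \<subseteq> FL ` Ann W"
  proof
    fix \<phi> assume \<phi>: "\<phi> \<in> J"
    then have S: "FL_inv \<phi> \<in> U'" "FL (FL_inv \<phi>) = \<phi>" using JP FL_inv by blast+
    then have "FL_inv \<phi> \<in> Ann W" using \<phi> by (auto simp: annihilator_def W_def \<S>_def)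
    then show "\<phi> \<in> FL ` Ann W" using S(2) by (metis image_eqI)
  qed
  moreover have "FL ` Ann W \<subseteq> J"
  proof (rule ccontr)
    assume "\<not> FL ` Ann W \<subseteq> J"
    then obtain S where S: "S \<in> U'" "\<forall>f\<in>W. S f = 0" "FL S \<notin> J" by (auto simp: annihilator_def)
    have cl': "closedin (seminorm_topology P PQ) J" using cl by (simp add: P_topology_eq)
    have "\<exists>T F C. clinear_functional_on P T \<and> (\<forall>f\<in>J. T f = 0) \<and> T (FL S) \<noteq> 0 \<and>
           finite F \<and> F \<subseteq> PQ \<and> (\<forall>f\<in>P. cmod (T f) \<le> C * (\<Sum>q\<in>F. q f))"
      by (rule closed_subspace_separation[OF _ P_space_subspace PQ_nonempty sub cl' FL_in_P[OF S(1)] S(3)])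
         (simp add: PQ_iff)
    then obtain T F C where T: "clinear_functional_on P T" "\<forall>f\<in>J. T f = 0" "T (FL S) \<noteq> 0"
      "finite F" "F \<subseteq> PQ" "\<forall>f\<in>P. cmod (T f) \<le> C * (\<Sum>q\<in>F. q f)" by (elim exE conjE)
    have bd: "\<exists>B\<ge>0. \<forall>\<phi>\<in>Pk k. cmod (T \<phi>) \<le> B * PN k \<phi>" for k
    proof -
      have "\<exists>b. \<forall>q\<in>F. 0 \<le> b q \<and> (\<forall>\<phi>\<in>Pk k. q \<phi> \<le> b q * PN k \<phi>)"
        using T(5) by (intro bchoice) (auto simp: PQ_iff)
      then obtain b where b: "\<And>q. q \<in> F \<Longrightarrow> 0 \<le> b q" "\<And>q \<phi>. q \<in> F \<Longrightarrow> \<phi> \<in> Pk k \<Longrightarrow> q \<phi> \<le> b q * PN k \<phi>" by blast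
      have "cmod (T \<phi>) \<le> (\<bar>C\<bar> * (\<Sum>q\<in>F. b q)) * PN k \<phi>" if \<phi>: "\<phi> \<in> Pk k" for \<phi>
      proof -
        have \<phi>P: "\<phi> \<in> P" using \<phi> unfolding P_space_def by blast
        have s0: "0 \<le> (\<Sum>q\<in>F. q \<phi>)"
          using T(5) seminorm_on_nonneg[OF _ P_space_subspace \<phi>P] by (intro sum_nonneg) (auto simp: PQ_iff)
        have "cmod (T \<phi>) \<le> C * (\<Sum>q\<in>F. q \<phi>)" using T(6) \<phi>P by blast
        also have "\<dots> \<le> \<bar>C\<bar> * (\<Sum>q\<in>F. q \<phi>)" using s0 by (intro mult_right_mono) auto
        also have "\<dots> \<le> \<bar>C\<bar> * (\<Sum>q\<in>F. b q * PN k \<phi>)" by (intro mult_left_mono sum_mono b \<phi>) auto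
        finally show ?thesis by (simp add: sum_distrib_right mult.assoc)
      qed
      moreover have "0 \<le> \<bar>C\<bar> * (\<Sum>q\<in>F. b q)" using b by (intro mult_nonneg_nonneg sum_nonneg) auto
      ultimately show ?thesis by blast
    qed
    obtain f where f: "f \<in> U" "\<forall>S\<in>U'. T (FL S) = S f" using P_dual_representation[OF T(1) bd] by blast
    have "f \<in> W" unfolding W_def \<S>_def using f T(2) by force
    then show False using S f(2) T(3) by auto
  qed
  ultimately show ?thesis using Winv by blast
qed

lemma exp_monomial_downward:
  assumes W: "D_invariant_subspace a \<omega> c W" and j: "exp_monomial a j \<mu> \<in> W" and ij: "i \<le> j"
  shows "exp_monomial a i \<mu> \<in> W"
proof -
  note Wd = D_invariantD[OF W]
  have "exp_monomial a n \<mu> \<in> W" if n: "exp_monomial a (Suc n) \<mu> \<in> W" for n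
  proof -
    have "(\<lambda>x. (1 / of_nat (Suc n)) * (Dop a (exp_monomial a (Suc n) \<mu>)
        - (\<lambda>x. (- \<i> * \<mu>) * exp_monomial a (Suc n) \<mu> x)) x) \<in> W"
      by (intro cfun.subspace_scale[OF Wd(2)] cfun.subspace_diff[OF Wd(2)] Wd(4) n)
    also have "(\<lambda>x. (1 / of_nat (Suc n)) * (Dop a (exp_monomial a (Suc n) \<mu>)
        - (\<lambda>x. (- \<i> * \<mu>) * exp_monomial a (Suc n) \<mu> x)) x) = exp_monomial a n \<mu>"
      unfolding Dop_exp_monomial by (auto simp: fun_eq_iff simp del: of_nat_Suc)
    finally show ?thesis .
  qed
  with ij j show ?thesis by (induction rule: inc_induct) auto
qed

text \<open>By \<open>bipolar_U\<close> membership is tested on the annihilator, and the value of a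
  functional at the monomial is, up to a power of \<i>, the j-th derivative of its
  transform.\<close>

lemma exp_monomial_mem_iff:
  assumes W: "D_invariant_subspace a \<omega> c W"
  shows "exp_monomial a j \<mu> \<in> W \<longleftrightarrow> (\<forall>\<phi>\<in>FL ` Ann W. (deriv ^^ j) \<phi> \<mu> = 0)"
proof -
  have eq: "(deriv ^^ j) (FL S) \<mu> = (- \<i>) ^ j * S (exp_monomial a j \<mu>)" if "S \<in> U'" for S
    using FL_higher_deriv[OF that, of j \<mu>] clinear_functional_onD(2)[OF U_dual_linear[OF that] exp_monomial_U]
    by (simp add: expo_eq)
  have "exp_monomial a j \<mu> \<in> W \<longleftrightarrow> (\<forall>S\<in>Ann W. S (exp_monomial a j \<mu>) = 0)"
    using bipolar_U[OF W exp_monomial_U] by (auto simp: annihilator_def)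
  also have "\<dots> \<longleftrightarrow> (\<forall>\<phi>\<in>FL ` Ann W. (deriv ^^ j) \<phi> \<mu> = 0)"
    using eq by (auto simp: annihilator_def)
  finally show ?thesis .
qed

lemma le_zero_mult_iff: "n \<le> zero_mult \<phi> \<mu> \<longleftrightarrow> (\<forall>j. enat j < n \<longrightarrow> (deriv ^^ j) \<phi> \<mu> = 0)"
  unfolding zero_mult_def le_INF_iff by (auto simp: not_less[symmetric])

lemma zero_mult_eqI:
  assumes "(deriv ^^ n) \<phi> \<mu> \<noteq> 0" "\<And>j. j < n \<Longrightarrow> (deriv ^^ j) \<phi> \<mu> = 0"
  shows "zero_mult \<phi> \<mu> = enat n"
proof (rule antisym)
  show "zero_mult \<phi> \<mu> \<le> enat n" unfolding zero_mult_def using assms(1) by (intro INF_lower) simp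
  show "enat n \<le> zero_mult \<phi> \<mu>" unfolding le_zero_mult_iff using assms(2) by simp
qed

lemma zero_mult_eqD:
  assumes "zero_mult \<phi> \<mu> = enat n" shows "(deriv ^^ n) \<phi> \<mu> \<noteq> 0"
proof
  assume "(deriv ^^ n) \<phi> \<mu> = 0"
  moreover have "(deriv ^^ j) \<phi> \<mu> = 0" if "j < n" for j
    using assms le_zero_mult_iff[of "enat n" \<phi> \<mu>] that by simp
  ultimately have "enat (Suc n) \<le> zero_mult \<phi> \<mu>"
    unfolding le_zero_mult_iff by (auto simp: less_Suc_eq)
  then show False using assms by simp
qed

text \<open>The degrees \<open>j\<close> of the monomials in \<open>W\<close> form an initial
  segment, which ends at the first order at which some derivative of an element of the submodule is
  nonzero. That element has the exact multiplicity; if the segment is infinite, any element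
  does.\<close>

lemma spectrum_eq_zero_set:
  assumes W: "D_invariant_subspace a \<omega> c W"
  shows "spectrum a W = zero_set (FL ` Ann W)"
proof -
  let ?J = "FL ` Ann W"
  have ne: "\<exists>\<phi>. \<phi> \<in> ?J"
  proof -
    have "cfun.subspace ?J" using closed_submodule_FL_annihilator[OF W] unfolding closed_submodule_def by blast
    then show ?thesis using cfun.subspace_0 by blast
  qed
  note mem = exp_monomial_mem_iff[OF W]
  have "(\<mu>, m) \<in> spectrum a W \<longleftrightarrow> (\<mu>, m) \<in> zero_set ?J" for \<mu> m
  proof
    assume "(\<mu>, m) \<in> spectrum a W"
    then have m: "1 \<le> m" "\<And>j. exp_monomial a j \<mu> \<in> W \<longleftrightarrow> enat j < m" by (auto simp: spectrum_def)
    have le: "\<forall>\<psi>\<in>?J. m \<le> zero_mult \<psi> \<mu>" unfolding le_zero_mult_iff using m(2) mem by blast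
    moreover have "\<exists>\<phi>\<in>?J. zero_mult \<phi> \<mu> = m"
    proof (cases m)
      case (enat n)
      then have "exp_monomial a n \<mu> \<notin> W" using m(2) by simp
      then obtain \<phi> where \<phi>: "\<phi> \<in> ?J" "(deriv ^^ n) \<phi> \<mu> \<noteq> 0" using mem by blast
      have "(deriv ^^ j) \<phi> \<mu> = 0" if "j < n" for j
      proof -
        have "exp_monomial a j \<mu> \<in> W" using m(2) that enat by simp
        then show ?thesis using mem \<phi>(1) by blast
      qed
      then show ?thesis using zero_mult_eqI[OF \<phi>(2)] \<phi>(1) enat by blast
    next
      case infinity
      obtain \<phi> where "\<phi> \<in> ?J" using ne by blast
      then show ?thesis using le infinity by (intro bexI[of _ \<phi>]) auto
    qed
    ultimately show "(\<mu>, m) \<in> zero_set ?J" using m(1) by (simp add: zero_set_def)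
  next
    assume "(\<mu>, m) \<in> zero_set ?J"
    then have m: "1 \<le> m" "\<forall>\<psi>\<in>?J. m \<le> zero_mult \<psi> \<mu>" "\<exists>\<phi>\<in>?J. zero_mult \<phi> \<mu> = m"
      by (auto simp: zero_set_def)
    have 1: "exp_monomial a j \<mu> \<in> W" if "enat j < m" for j
      unfolding mem using m(2) that unfolding le_zero_mult_iff by blast
    have 2: "enat j < m" if j: "exp_monomial a j \<mu> \<in> W" for j
    proof (rule ccontr)
      assume "\<not> enat j < m"
      then obtain n where n: "m = enat n" "n \<le> j" by (cases m) auto
      obtain \<phi> where "\<phi> \<in> ?J" "zero_mult \<phi> \<mu> = enat n" using m(3) n(1) by blast
      then have "exp_monomial a n \<mu> \<notin> W" using zero_mult_eqD mem by blast
      then show False using exp_monomial_downward[OF W j n(2)] by blast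
    qed
    show "(\<mu>, m) \<in> spectrum a W" using m(1) 1 2 by (auto simp: spectrum_def)
  qed
  then show ?thesis by auto
qed

text \<open>Injectivity: an invariant subspace is the common kernel of its annihilator, and
  \<open>FL_injective\<close> recovers the annihilator from its transform.\<close>

lemma correspondence:
  "bij_betw (\<lambda>W. FL ` Ann W) {W. D_invariant_subspace a \<omega> c W} {J. closed_submodule \<omega> c r J}"
  unfolding bij_betw_def
proof
  show "inj_on (\<lambda>W. FL ` Ann W) {W. D_invariant_subspace a \<omega> c W}"
  proof (rule inj_onI)
    fix W V assume WV: "W \<in> {W. D_invariant_subspace a \<omega> c W}" "V \<in> {W. D_invariant_subspace a \<omega> c W}"
      and eq: "FL ` Ann W = FL ` Ann V"
    have ss: "Ann W \<subseteq> U'" "Ann V \<subseteq> U'" by (auto simp: annihilator_def)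
    have "inj_on FL U'" by (rule inj_onI) (rule FL_injective)
    then have "Ann W = Ann V" using inj_on_image_eq_iff[OF _ ss] eq by blast
    moreover have "X = {f \<in> U. \<forall>S\<in>Ann X. S f = 0}" if "X \<in> {W. D_invariant_subspace a \<omega> c W}" for X
      using bipolar_U[of X] D_invariantD(1)[of X] that by (auto simp: annihilator_def)
    from this[OF WV(1)] this[OF WV(2)] have "W = {f \<in> U. \<forall>S\<in>Ann W. S f = 0}"
      "V = {f \<in> U. \<forall>S\<in>Ann V. S f = 0}" .
    ultimately show "W = V" by (simp only:)
  qed
  show "(\<lambda>W. FL ` Ann W) ` {W. D_invariant_subspace a \<omega> c W} = {J. closed_submodule \<omega> c r J}"
    using closed_submodule_FL_annihilator submodule_preimage by blast
qed

end

theorem proposition2p2: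
  fixes \<omega> :: "real \<Rightarrow> real" and a :: ereal and c r :: "nat \<Rightarrow> real"
  assumes "weight \<omega>"
    and "0 < a"
    and "incseq c" and "\<And>k. 0 < c k" and "\<And>k. ereal (c k) < a"
    and "(\<lambda>k. ereal (c k)) \<longlonglongrightarrow> a"
    and "incseq r" and "\<And>k. 0 < r k" and "\<And>k. r k < 1" and "r \<longlonglongrightarrow> 1"
  shows "bij_betw (\<lambda>W. fourier_laplace a ` annihilator a \<omega> c W)
           {W. D_invariant_subspace a \<omega> c W} {J. closed_submodule \<omega> c r J} \<and>
         (\<forall>W J. D_invariant_subspace a \<omega> c W \<and> closed_submodule \<omega> c r J \<and>
            J = fourier_laplace a ` annihilator a \<omega> c W \<longrightarrow> spectrum a W = zero_set J)"
proof -
  interpret ultra \<omega> a c r by unfold_locales (fact assms)+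
  show ?thesis
  proof (intro conjI allI impI)
    show "bij_betw (\<lambda>W. fourier_laplace a ` annihilator a \<omega> c W)
           {W. D_invariant_subspace a \<omega> c W} {J. closed_submodule \<omega> c r J}"
      by (rule correspondence)
    fix W J
    assume "D_invariant_subspace a \<omega> c W \<and> closed_submodule \<omega> c r J \<and>
            J = fourier_laplace a ` annihilator a \<omega> c W"
    then show "spectrum a W = zero_set J" using spectrum_eq_zero_set by simp
  qed
qed

end
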